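(* Let $G$ be an infinite non-soluble FC-group with at most eleven automorphism orbits. Then $G$ is central-by-finite.
   Context: A group $G$ is an FC-group if every element of $G$ has only finitely many conjugates in $G$. The automorphism orbits of $G$ are the orbits of the natural action of $\mathrm{Aut}(G)$ on $G$ (the orbit $\{1\}$ is counted). A group $G$ is central-by-finite if its center $Z(G)$ has finite index in $G$. *)

theory Defs
  imports "HOL-Algebra.Algebra"
begin

definition conjugates :: "('a, 'b) monoid_scheme \<Rightarrow> 'a \<Rightarrow> 'a set"
  where "conjugates G x = {g \<otimes>\<^bsub>G\<^esub> x \<otimes>\<^bsub>G\<^esub> inv\<^bsub>G\<^esub> g | g. g \<in> carrier G}"

definition FC_group :: "('a, 'b) monoid_scheme \<Rightarrow> bool"
  where "FC_group G \<longleftrightarrow> group G \<and> (\<forall>x \<in> carrier G. finite (conjugates G x))"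

definition automorphism_orbits :: "('a, 'b) monoid_scheme \<Rightarrow> 'a set set"
  where "automorphism_orbits G = orbits (AutoGroup G) (carrier G) (\<lambda>\<alpha>. \<alpha>)"

definition center :: "('a, 'b) monoid_scheme \<Rightarrow> 'a set"
  where "center G = {z \<in> carrier G. \<forall>g \<in> carrier G. z \<otimes>\<^bsub>G\<^esub> g = g \<otimes>\<^bsub>G\<^esub> z}"

definition central_by_finite :: "('a, 'b) monoid_scheme \<Rightarrow> bool"
  where "central_by_finite G \<longleftrightarrow> group G \<and> finite (rcosets\<^bsub>G\<^esub> (center G))"

lemma (in group) action_by_automorphisms:
  "group_action (AutoGroup G) (carrier G) (\<lambda>\<alpha>. \<alpha>)"
proof -
  have sub: "auto G \<subseteq> Bij (carrier G)"
    by (simp add: auto_def)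
  have "(\<lambda>\<alpha>. \<alpha>) \<in> hom (AutoGroup G) (BijGroup (carrier G))"
    using sub by (auto simp: hom_def AutoGroup_def BijGroup_def)
  then show ?thesis
    by (simp add: group_action_def group_hom_def group_hom_axioms_def AutoGroup group_BijGroup)
qed

lemma (in group) center_is_subgroup: "subgroup (center G) G"
proof (rule subgroupI)
  show "center G \<noteq> {}"
    using one_closed by (auto simp: center_def)
next
  fix a assume a: "a \<in> center G"
  have "inv a \<otimes> g = g \<otimes> inv a" if g: "g \<in> carrier G" for g
  proof -
    have ac: "a \<in> carrier G" and comm: "a \<otimes> g = g \<otimes> a"
      using a g by (auto simp: center_def)
    have "inv a \<otimes> g = inv a \<otimes> (g \<otimes> a) \<otimes> inv a"
      using ac g by (simp add: m_assoc)
    also have "\<dots> = inv a \<otimes> (a \<otimes> g) \<otimes> inv a"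
      by (simp only: comm)
    also have "\<dots> = g \<otimes> inv a"
      using ac g by (simp add: m_assoc[symmetric])
    finally show ?thesis .
  qed
  with a show "inv a \<in> center G"
    by (simp add: center_def)
next
  fix a b assume a: "a \<in> center G" and b: "b \<in> center G"
  have ac: "a \<in> carrier G" and bc: "b \<in> carrier G"
    using a b by (auto simp: center_def)
  have "a \<otimes> b \<otimes> g = g \<otimes> (a \<otimes> b)" if g: "g \<in> carrier G" for g
  proof -
    have "a \<otimes> b \<otimes> g = a \<otimes> (b \<otimes> g)"
      using ac bc g by (rule m_assoc)
    also have "\<dots> = a \<otimes> (g \<otimes> b)"
      using b g by (simp add: center_def)
    also have "\<dots> = a \<otimes> g \<otimes> b"
      using ac bc g by (simp add: m_assoc)
    also have "\<dots> = g \<otimes> a \<otimes> b"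
      using a g by (simp add: center_def)
    also have "\<dots> = g \<otimes> (a \<otimes> b)"
      using ac bc g by (simp add: m_assoc)
    finally show ?thesis .
  qed
  with ac bc show "a \<otimes> b \<in> center G"
    by (simp add: center_def)
qed (auto simp: center_def)

end

theory Submission
  imports Defs
begin

hide_const (open) Divisibility.prime

text \<open>Suppose that \<open>G\<close> is not central-by-finite. The sizes of conjugacy classes are constant on
  automorphism orbits, hence bounded, and an argument of B. H. Neumann shows that there are only finitely many
  commutators (\<open>finite_commutators\<close>). So their centralizer \<open>C\<close> is a characteristic
  subgroup of finite index, and the derived series becomes stationary at a perfect characteristic subgroup
  \<open>R\<close>, which commutes with \<open>C\<close> and is not contained in \<open>C\<close>, since
  \<open>G\<close> is not soluble. The image \<open>Q\<close> of \<open>R\<close> in the quotient by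
  \<open>C\<close> is a nontrivial finite perfect group. Moreover \<open>C\<close> is not abelian, because an
  abelian subgroup of finite index would force the center to have finite index.

  An element \<open>x\<close> in the product of \<open>R\<close> and \<open>C\<close> carries a label that
  automorphisms of \<open>G\<close> preserve: the orbit of its image under the automorphisms of
  \<open>Q\<close>, together with a characteristic property of \<open>x\<close>. If the center of
  \<open>C\<close> is not contained in \<open>R\<close>, the properties are membership in \<open>R\<close> and
  in the centralizer of \<open>C\<close>, and every orbit on \<open>Q\<close> occurs in three labels.
  Otherwise the properties are whether \<open>x\<close> centralizes \<open>C\<close> and whether its order is
  prime to \<open>p\<close>, where \<open>p\<close> is a prime divisor of the order of some element in the
  center of \<open>C\<close>; then every orbit on \<open>Q\<close> occurs in two labels, and the orbits of
  elements of order prime to \<open>p\<close> occur in a third. Since \<open>G\<close> has at most eleven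
  orbits and \<open>Q\<close> is no \<open>p\<close>-group, \<open>Q\<close> has at most four orbits.

  Finite perfect nontrivial groups with at most four automorphism orbits have order 60 and elements of orders
  1, 2, 3, 5, like the alternating group of degree 5; moreover their elements of orders 3 and 5 are inverted
  by conjugation and generate their own centralizers (\<open>four_orbits_order_60\<close>). So
  \<open>Q\<close> has exactly four orbits, the first case is impossible, and in the second case the labels
  are exactly eleven, whence elements with the same label are related by an automorphism of \<open>G\<close>.
  This is too much symmetry: the squares of the elements of \<open>C\<close> give a contradiction for
  \<open>p = 2\<close> (\<open>p_not_2\<close>), and the elements of \<open>R\<close> inverting a lift of an
  element of order \<open>p\<close> give one for \<open>p = 3\<close> and \<open>p = 5\<close>.

  The result on finite groups rests on Sylow's theorems, transfer and counting. Elements of different orders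
  lie in different orbits, so at most three primes divide the order. If there are two primes and elements of
  these orders commute, the orbits are determined by the orders, and centralizers of normal sets lead to a
  contradiction (\<open>mixed_group.no_commuting\<close>). If no such elements commute, all elements have
  prime power order, and one counts elements according to whether Sylow subgroups are their own normalizers
  (\<open>few_types_False\<close>). If there are three primes, all nontrivial elements have prime order and
  elements of the same order are related. Counting shows that one prime is 2, and counting pairs of
  involutions determines the numbers of elements; this leaves the orders 60 and 504, the latter of which is
  excluded by the action on the Sylow 2-subgroups (\<open>even_case.order_60\<close>).\<close>

section \<open>Conjugation, centralizers and normalizers\<close>

context group begin

lemma inv_cancel_left [simp]:
  "x \<in> carrier G \<Longrightarrow> y \<in> carrier G \<Longrightarrow> inv x \<otimes> (x \<otimes> y) = y"
  "x \<in> carrier G \<Longrightarrow> y \<in> carrier G \<Longrightarrow> x \<otimes> (inv x \<otimes> y) = y"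
  by (simp_all flip: m_assoc)

lemmas word = m_assoc inv_mult_group

definition cj :: "'a \<Rightarrow> 'a \<Rightarrow> 'a" where "cj g x = g \<otimes> x \<otimes> inv g"

definition cen :: "'a set \<Rightarrow> 'a set"
  where "cen S = {g \<in> carrier G. \<forall>s\<in>S. g \<otimes> s = s \<otimes> g}"

definition nor :: "'a set \<Rightarrow> 'a set" where "nor H = {g \<in> carrier G. cj g ` H = H}"

lemma cj_closed [simp]: "g \<in> carrier G \<Longrightarrow> x \<in> carrier G \<Longrightarrow> cj g x \<in> carrier G"
  by (simp add: cj_def)

lemma cj_one [simp]: "x \<in> carrier G \<Longrightarrow> cj \<one> x = x" "g \<in> carrier G \<Longrightarrow> cj g \<one> = \<one>"
  by (simp_all add: cj_def)

lemma cj_cj: "g \<in> carrier G \<Longrightarrow> h \<in> carrier G \<Longrightarrow> x \<in> carrier G \<Longrightarrow> cj g (cj h x) = cj (g \<otimes> h) x"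
  by (simp add: cj_def word)

lemma cj_mult: "g \<in> carrier G \<Longrightarrow> x \<in> carrier G \<Longrightarrow> y \<in> carrier G \<Longrightarrow> cj g (x \<otimes> y) = cj g x \<otimes> cj g y"
  by (simp add: cj_def word)

lemma cj_inv: "g \<in> carrier G \<Longrightarrow> x \<in> carrier G \<Longrightarrow> cj g (inv x) = inv (cj g x)"
  by (simp add: cj_def word)

lemma cj_inv_cancel [simp]:
  "g \<in> carrier G \<Longrightarrow> x \<in> carrier G \<Longrightarrow> cj (inv g) (cj g x) = x"
  "g \<in> carrier G \<Longrightarrow> x \<in> carrier G \<Longrightarrow> cj g (cj (inv g) x) = x"
  by (simp_all add: cj_cj)

lemma cj_eq_iff [simp]:
  "g \<in> carrier G \<Longrightarrow> x \<in> carrier G \<Longrightarrow> y \<in> carrier G \<Longrightarrow> cj g x = cj g y \<longleftrightarrow> x = y"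
  by (metis cj_inv_cancel(1))

lemma cj_fix_iff: "g \<in> carrier G \<Longrightarrow> x \<in> carrier G \<Longrightarrow> cj g x = x \<longleftrightarrow> g \<otimes> x = x \<otimes> g"
  by (metis cj_def inv_solve_right' m_closed)

lemma cj_eq_one_iff [simp]: "g \<in> carrier G \<Longrightarrow> x \<in> carrier G \<Longrightarrow> cj g x = \<one> \<longleftrightarrow> x = \<one>"
  by (metis cj_eq_iff cj_one(2) one_closed)

lemma cj_pow: "g \<in> carrier G \<Longrightarrow> x \<in> carrier G \<Longrightarrow> cj g (x [^] (n::nat)) = cj g x [^] n"
  by (induction n) (simp_all add: cj_mult)

lemma inj_cj: "g \<in> carrier G \<Longrightarrow> inj_on (cj g) (carrier G)"
  by (rule inj_onI) simp

lemma cj_image_image: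
  "g \<in> carrier G \<Longrightarrow> h \<in> carrier G \<Longrightarrow> H \<subseteq> carrier G \<Longrightarrow> cj g ` cj h ` H = cj (g \<otimes> h) ` H"
  unfolding image_image by (rule image_cong[OF refl]) (auto simp: cj_cj subset_eq)

lemma cj_image_one [simp]: "H \<subseteq> carrier G \<Longrightarrow> cj \<one> ` H = H"
  by (simp add: subset_eq)

lemma cj_image_closed: "g \<in> carrier G \<Longrightarrow> H \<subseteq> carrier G \<Longrightarrow> cj g ` H \<subseteq> carrier G"
  by auto

lemma cj_mem_image_iff:
  assumes "g \<in> carrier G" "x \<in> carrier G" "H \<subseteq> carrier G"
  shows "x \<in> cj g ` H \<longleftrightarrow> cj (inv g) x \<in> H"
proof
  assume "x \<in> cj g ` H" then show "cj (inv g) x \<in> H" using assms by auto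
next
  assume "cj (inv g) x \<in> H"
  then have "cj g (cj (inv g) x) \<in> cj g ` H" by blast
  then show "x \<in> cj g ` H" using assms by simp
qed

lemma cj_hom: "g \<in> carrier G \<Longrightarrow> cj g \<in> hom G G"
  by (auto simp: hom_def cj_mult)

lemma subgroup_cj: assumes "g \<in> carrier G" "subgroup H G" shows "subgroup (cj g ` H) G"
proof -
  interpret group_hom G G "cj g"
    by unfold_locales (rule cj_hom[OF assms(1)])
  show ?thesis using assms(2) by (rule subgroup_img_is_subgroup)
qed

lemma card_cj: "g \<in> carrier G \<Longrightarrow> H \<subseteq> carrier G \<Longrightarrow> card (cj g ` H) = card H"
  by (meson card_image inj_cj inj_on_subset)

lemma cen_sub: "cen S \<subseteq> carrier G" by (auto simp: cen_def)

lemma subgroup_cen: assumes "S \<subseteq> carrier G" shows "subgroup (cen S) G"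
proof (rule subgroupI)
  show "cen S \<subseteq> carrier G" by (rule cen_sub)
  show "cen S \<noteq> {}" using assms by (auto simp: cen_def intro!: exI[of _ "\<one>"])
  fix a assume a: "a \<in> cen S"
  then have ac: "a \<in> carrier G" by (simp add: cen_def)
  have sc: "s \<in> carrier G" if "s \<in> S" for s using that assms by auto
  have "inv a \<otimes> s = s \<otimes> inv a" if s: "s \<in> S" for s
  proof -
    have "cj a s = s" using a s sc[OF s] by (simp add: cen_def cj_fix_iff)
    then have "cj (inv a) s = s" using ac sc[OF s] cj_inv_cancel(1) by metis
    then show ?thesis using ac sc[OF s] by (simp add: cj_fix_iff)
  qed
  then show "inv a \<in> cen S" using ac by (simp add: cen_def)
  fix b assume b: "b \<in> cen S"
  have bc: "b \<in> carrier G" using b by (simp add: cen_def)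
  have "a \<otimes> b \<otimes> s = s \<otimes> (a \<otimes> b)" if s: "s \<in> S" for s
  proof -
    have "a \<otimes> b \<otimes> s = a \<otimes> (s \<otimes> b)" using b s sc[OF s] ac bc by (simp add: cen_def m_assoc)
    also have "\<dots> = (s \<otimes> a) \<otimes> b" using a s sc[OF s] ac bc by (simp add: cen_def flip: m_assoc)
    finally show ?thesis using sc[OF s] ac bc by (simp add: m_assoc)
  qed
  then show "a \<otimes> b \<in> cen S" using ac bc by (simp add: cen_def)
qed

lemma cen_iff: "g \<in> carrier G \<Longrightarrow> S \<subseteq> carrier G \<Longrightarrow> g \<in> cen S \<longleftrightarrow> (\<forall>s\<in>S. cj g s = s)"
  by (auto simp: cen_def cj_fix_iff subset_eq)

lemma cen_cj: assumes "g \<in> carrier G" "S \<subseteq> carrier G" shows "cen (cj g ` S) = cj g ` cen S"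
proof -
  have "h \<in> cen (cj g ` S) \<longleftrightarrow> h \<in> cj g ` cen S" if h: "h \<in> carrier G" for h
  proof -
    have e: "cj h (cj g s) = cj g s \<longleftrightarrow> cj (cj (inv g) h) s = s" if "s \<in> S" for s
    proof -
      have s: "s \<in> carrier G" using that assms by auto
      have "cj (inv g) (cj h (cj g s)) = cj (cj (inv g) h) s"
        using s h assms by (simp add: cj_def word)
      then show ?thesis using s h assms
        by (metis cj_closed cj_inv_cancel inv_closed)
    qed
    have "h \<in> cj g ` cen S \<longleftrightarrow> cj (inv g) h \<in> cen S"
      using cj_mem_image_iff[OF assms(1) h cen_sub] .
    also have "\<dots> \<longleftrightarrow> (\<forall>s\<in>S. cj (cj (inv g) h) s = s)"
      using h assms by (intro cen_iff) auto
    also have "\<dots> \<longleftrightarrow> (\<forall>s\<in>S. cj h (cj g s) = cj g s)" using e by auto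
    also have "\<dots> \<longleftrightarrow> h \<in> cen (cj g ` S)"
      using h assms cen_iff[of h "cj g ` S"] by (auto simp: subset_eq)
    finally show ?thesis by simp
  qed
  moreover have "cj g ` cen S \<subseteq> carrier G" by (rule cj_image_closed[OF assms(1) cen_sub])
  ultimately show ?thesis using cen_sub by blast
qed

lemma subgroup_nor: assumes "H \<subseteq> carrier G" shows "subgroup (nor H) G"
proof (rule subgroupI)
  show "nor H \<subseteq> carrier G" by (auto simp: nor_def)
  show "nor H \<noteq> {}" using assms by (auto simp: nor_def intro!: exI[of _ "\<one>"])
  fix a assume a: "a \<in> nor H"
  then have ac: "a \<in> carrier G" and aH: "cj a ` H = H" by (auto simp: nor_def)
  have "cj (inv a) ` H = cj (inv a) ` cj a ` H" by (simp only: aH)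
  also have "\<dots> = H" using cj_image_image[of "inv a" a H] ac assms by simp
  finally show "inv a \<in> nor H" using ac by (simp add: nor_def)
  fix b assume b: "b \<in> nor H"
  then have bc: "b \<in> carrier G" and bH: "cj b ` H = H" by (auto simp: nor_def)
  have "cj (a \<otimes> b) ` H = cj a ` cj b ` H" using ac bc assms by (simp only: cj_image_image)
  then show "a \<otimes> b \<in> nor H" using ac bc by (simp add: nor_def aH bH)
qed

lemma subgroup_sub_nor: assumes "subgroup H G" shows "H \<subseteq> nor H"
proof
  fix h assume h: "h \<in> H"
  interpret H: subgroup H G by fact
  have "cj h ` H \<subseteq> H" using h by (auto simp: cj_def)
  moreover have "x \<in> cj h ` H" if "x \<in> H" for x
    using h that by (subst cj_mem_image_iff) (auto simp: cj_def H.subset)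
  ultimately show "h \<in> nor H" using h by (auto simp: nor_def)
qed

lemma norD: "g \<in> nor H \<Longrightarrow> x \<in> H \<Longrightarrow> cj g x \<in> H" by (auto simp: nor_def)

lemma norI_finite:
  assumes "finite H" "H \<subseteq> carrier G" "g \<in> carrier G" "\<And>x. x \<in> H \<Longrightarrow> cj g x \<in> H"
  shows "g \<in> nor H"
proof -
  have "cj g ` H \<subseteq> H" using assms by auto
  moreover have "card (cj g ` H) = card H" by (rule card_cj) fact+
  ultimately have "cj g ` H = H" using assms(1) by (simp add: card_subset_eq)
  then show ?thesis using assms by (simp add: nor_def)
qed

lemma subgroup_Int: "subgroup H G \<Longrightarrow> subgroup K G \<Longrightarrow> subgroup (H \<inter> K) G"
  by (rule subgroups_Inter_pair)

lemma subgroup_pow: "subgroup H G \<Longrightarrow> x \<in> H \<Longrightarrow> x [^] (n::nat) \<in> H"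
  by (induction n) (auto simp: subgroup.one_closed subgroup.m_closed)

section \<open>Actions of subgroups on sets\<close>

text \<open>An action is given by a bare function, so that conjugation of elements, conjugation of subgroups and
  translation of cosets can be treated alike.\<close>

definition acts :: "'a set \<Rightarrow> ('a \<Rightarrow> 'x \<Rightarrow> 'x) \<Rightarrow> 'x set \<Rightarrow> bool"
  where "acts K act E \<longleftrightarrow> subgroup K G \<and>
    (\<forall>x\<in>E. act \<one> x = x \<and> (\<forall>g\<in>K. act g x \<in> E \<and> (\<forall>h\<in>K. act g (act h x) = act (g \<otimes> h) x)))"

lemma actsD:
  assumes "acts K act E"
  shows "subgroup K G" "x \<in> E \<Longrightarrow> act \<one> x = x" "x \<in> E \<Longrightarrow> g \<in> K \<Longrightarrow> act g x \<in> E"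
    "x \<in> E \<Longrightarrow> g \<in> K \<Longrightarrow> h \<in> K \<Longrightarrow> act g (act h x) = act (g \<otimes> h) x"
  using assms by (auto simp: acts_def)

lemma acts_inv:
  assumes "acts K act E" "x \<in> E" "g \<in> K" shows "act (inv g) (act g x) = x"
  using assms actsD[OF assms(1)] subgroup.m_inv_closed[of K G g] subgroup.mem_carrier[of K G g]
  by (metis l_inv)

lemma orbit_stabilizer:
  assumes "acts K act E" "finite K" "x \<in> E"
  shows "card K = card ((\<lambda>g. act g x) ` K) * card {g\<in>K. act g x = x}"
proof -
  interpret K: subgroup K G by (rule actsD[OF assms(1)])
  have "card {g\<in>K. act g x = y} = card {g\<in>K. act g x = x}" if y: "y \<in> (\<lambda>g. act g x) ` K" for y
  proof -
    obtain k where k: "k \<in> K" "y = act k x" using y by auto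
    have "bij_betw (\<lambda>g. k \<otimes> g) {g\<in>K. act g x = x} {g\<in>K. act g x = y}"
    proof (rule bij_betwI[where g = "\<lambda>g. inv k \<otimes> g"])
      show "(\<otimes>) k \<in> {g\<in>K. act g x = x} \<rightarrow> {g\<in>K. act g x = y}"
        using k actsD(4)[OF assms(1,3)] by (fastforce)
      have "act (inv k \<otimes> g) x = x" if "g \<in> K" "act g x = y" for g
        using k that actsD(4)[OF assms(1,3), of "inv k" g] acts_inv[OF assms(1,3) k(1)] by simp
      then show "(\<otimes>) (inv k) \<in> {g\<in>K. act g x = y} \<rightarrow> {g\<in>K. act g x = x}" using k by auto
    qed (use k in auto)
    then show ?thesis by (simp add: bij_betw_same_card)
  qed
  then have "(\<Sum>y\<in>(\<lambda>g. act g x) ` K. card {g\<in>K. act g x = y}) = card ((\<lambda>g. act g x) ` K) * card {g\<in>K. act g x = x}"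
    by simp
  moreover have "(\<Sum>y\<in>(\<lambda>g. act g x) ` K. card {g\<in>K. act g x = y}) = card K"
    using sum.image_gen[OF assms(2), of "\<lambda>_. 1::nat" "\<lambda>g. act g x"] by simp
  ultimately show ?thesis by simp
qed

lemma orbit_eq:
  assumes "acts K act E" "x \<in> E" "y \<in> (\<lambda>g. act g x) ` K"
  shows "(\<lambda>g. act g y) ` K = (\<lambda>g. act g x) ` K"
proof -
  interpret K: subgroup K G by (rule actsD[OF assms(1)])
  obtain k where k: "k \<in> K" "y = act k x" using assms(3) by auto
  have "act g y \<in> (\<lambda>g. act g x) ` K" if "g \<in> K" for g
    using k that actsD(4)[OF assms(1,2), of g k] by auto
  moreover have "act g x \<in> (\<lambda>g. act g y) ` K" if "g \<in> K" for g
  proof -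
    have "act (g \<otimes> inv k) y = act g x"
      using k that actsD(4)[OF assms(1,2), of "g \<otimes> inv k" k] by (simp add: word)
    then show ?thesis using k that by (metis K.m_closed K.m_inv_closed imageI)
  qed
  ultimately show ?thesis by blast
qed

lemma dvd_card_acts:
  assumes "acts K act E" "finite E" "\<And>x. x \<in> E \<Longrightarrow> k dvd card ((\<lambda>g. act g x) ` K)"
  shows "k dvd card E"
proof -
  interpret K: subgroup K G by (rule actsD[OF assms(1)])
  define C where "C = (\<lambda>x. (\<lambda>g. act g x) ` K) ` E"
  have self: "x \<in> (\<lambda>g. act g x) ` K" if "x \<in> E" for x
    using actsD(2)[OF assms(1) that] by (metis K.one_closed imageI)
  have into: "(\<lambda>g. act g x) ` K \<subseteq> E" if "x \<in> E" for x using actsD(3)[OF assms(1) that] by auto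
  have U: "\<Union>C = E"
  proof
    show "\<Union>C \<subseteq> E" unfolding C_def by (rule UN_least) (rule into)
    show "E \<subseteq> \<Union>C" unfolding C_def by (rule subsetI, rule UN_I, assumption, rule self)
  qed
  have "c1 \<inter> c2 = {}" if c: "c1 \<in> C" "c2 \<in> C" "c1 \<noteq> c2" for c1 c2
  proof (rule ccontr)
    assume "c1 \<inter> c2 \<noteq> {}" then obtain y where y: "y \<in> c1" "y \<in> c2" by auto
    obtain x1 x2 where "x1 \<in> E" "x2 \<in> E" "c1 = (\<lambda>g. act g x1) ` K" "c2 = (\<lambda>g. act g x2) ` K"
      using c(1,2) unfolding C_def by auto
    then show False using orbit_eq[OF assms(1)] y c(3) by metis
  qed
  then have "k dvd card (\<Union>C)"
    using assms(2,3) U by (intro dvd_partition) (auto simp: C_def)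
  then show ?thesis by (simp only: U)
qed

lemma acts_subset: "acts K act E \<Longrightarrow> Y \<subseteq> E \<Longrightarrow> (\<And>g x. g \<in> K \<Longrightarrow> x \<in> Y \<Longrightarrow> act g x \<in> Y) \<Longrightarrow> acts K act Y"
  by (auto simp: acts_def subset_eq)

lemma acts_cj: "subgroup K G \<Longrightarrow> E \<subseteq> carrier G \<Longrightarrow> (\<And>g x. g \<in> K \<Longrightarrow> x \<in> E \<Longrightarrow> cj g x \<in> E) \<Longrightarrow> acts K cj E"
  by (auto simp: acts_def subset_eq cj_cj subgroup.mem_carrier)

lemma acts_cj_sets:
  "subgroup K G \<Longrightarrow> EE \<subseteq> Pow (carrier G) \<Longrightarrow> (\<And>g E. g \<in> K \<Longrightarrow> E \<in> EE \<Longrightarrow> cj g ` E \<in> EE) \<Longrightarrow> acts K (\<lambda>g E. cj g ` E) EE"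
  using cj_image_image subgroup.mem_carrier[of K G] unfolding acts_def
  by (metis PowD cj_image_one subsetD)

lemma acts_cosets:
  "subgroup K G \<Longrightarrow> EE \<subseteq> Pow (carrier G) \<Longrightarrow> (\<And>g E. g \<in> K \<Longrightarrow> E \<in> EE \<Longrightarrow> E #> inv g \<in> EE) \<Longrightarrow> acts K (\<lambda>g E. E #> inv g) EE"
  unfolding acts_def by (auto simp: coset_mult_assoc inv_mult_group subgroup.mem_carrier subset_eq subgroup.m_inv_closed)

text \<open>The orbits outside the fixed points have lengths that divide the order of the acting group and exceed 1,
  hence are multiples of \<open>p\<close>.\<close>

lemma fixed_points_mod:
  assumes "acts K act E" "finite E" "prime p" "card K = p ^ n"
  shows "card E mod p = card {x\<in>E. \<forall>g\<in>K. act g x = x} mod p"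
proof -
  interpret K: subgroup K G by (rule actsD[OF assms(1)])
  have "0 < card K" using assms(3,4) by (simp add: prime_gt_0_nat)
  then have fK: "finite K" by (rule card_ge_0_finite)
  define F where "F = {x\<in>E. \<forall>g\<in>K. act g x = x}"
  have FX: "F \<subseteq> E" by (auto simp: F_def)
  have mv: "act g x \<in> E - F" if "g \<in> K" "x \<in> E - F" for g x
  proof -
    have "act (inv g) (act g x) = x" using that by (intro acts_inv[OF assms(1)]) auto
    then have "act g x \<in> F \<Longrightarrow> x \<in> F" using that(1) by (auto simp: F_def)
    then show ?thesis using actsD(3)[OF assms(1)] that by auto
  qed
  have a: "acts K act (E - F)" by (rule acts_subset[OF assms(1)]) (use mv in auto)
  have "p dvd card (E - F)"
  proof (rule dvd_card_acts[OF a])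
    fix x assume x: "x \<in> E - F"
    have "card ((\<lambda>g. act g x) ` K) dvd p ^ n"
      using orbit_stabilizer[OF a fK x] assms(4) by (metis dvd_triv_left)
    then obtain j where j: "card ((\<lambda>g. act g x) ` K) = p ^ j"
      using assms(3) divides_primepow_nat by blast
    have "j \<noteq> 0"
    proof
      assume "j = 0"
      then obtain z where z: "(\<lambda>g. act g x) ` K = {z}" using j card_1_singletonE by auto
      have "act \<one> x = x" using actsD(2)[OF a x] .
      then have "act g x = x" if "g \<in> K" for g using z that by (metis K.one_closed imageI singletonD)
      then show False using x by (auto simp: F_def)
    qed
    then show "p dvd card ((\<lambda>g. act g x) ` K)" by (simp add: j)
  qed (use assms(2) in auto)
  moreover have "card E = card (E - F) + card F"
    using FX assms(2) by (metis card_Diff_subset card_mono finite_subset le_add_diff_inverse2)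
  ultimately show ?thesis unfolding F_def[symmetric] by (metis mod_add_left_eq add_0 mod_0_imp_dvd dvd_imp_mod_0)
qed

end

section \<open>Sylow theory inside a subgroup\<close>

context group begin

lemma acts_restrict: "acts K act E \<Longrightarrow> subgroup H G \<Longrightarrow> H \<subseteq> K \<Longrightarrow> acts H act E"
  unfolding acts_def by (meson subsetD)

text \<open>Right translation by inverses is a left action on the right cosets, which is why the cosets are written with
  an inverse.\<close>

lemma coset_count:
  assumes "subgroup H G" "subgroup K G" "H \<subseteq> K" "finite K"
  shows "card K = card ((\<lambda>x. H #> inv x) ` K) * card H"
    and "acts K (\<lambda>g A. A #> inv g) ((\<lambda>x. H #> inv x) ` K)"
proof -
  interpret H: subgroup H G by fact
  interpret K: subgroup K G by fact
  define E where "E = (\<lambda>x. H #> inv x) ` K"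
  have a: "acts K (\<lambda>g A. A #> inv g) E"
  proof (rule acts_cosets[OF assms(2)])
    show "E \<subseteq> Pow (carrier G)" unfolding E_def using r_coset_subset_G[OF H.subset K.mem_carrier[OF K.m_inv_closed]] by auto
    fix g A assume "g \<in> K" "A \<in> E"
    then obtain x where x: "x \<in> K" "A = H #> inv x" unfolding E_def by auto
    have "A #> inv g = H #> inv (g \<otimes> x)"
      using x \<open>g \<in> K\<close> by (simp add: coset_mult_assoc H.subset inv_mult_group)
    then show "A #> inv g \<in> E" using x \<open>g \<in> K\<close> unfolding E_def by auto
  qed
  then show "acts K (\<lambda>g A. A #> inv g) ((\<lambda>x. H #> inv x) ` K)" by (simp only: E_def)
  have HE: "H \<in> E" unfolding E_def using H.subset by (auto intro!: image_eqI[of _ _ "\<one>"])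
  have "{g\<in>K. H #> inv g = H} = H"
  proof -
    have "g \<in> H" if "g \<in> K" "H #> inv g = H" for g
      using coset_join1[OF that(2)] that(1) assms(1) H.m_inv_closed[of "inv g"] by simp
    moreover have "H #> inv g = H" if "g \<in> H" for g
      using that by (intro coset_join2) (auto simp: assms(1))
    ultimately show ?thesis using assms(3) by auto
  qed
  then show "card K = card ((\<lambda>x. H #> inv x) ` K) * card H"
    using orbit_stabilizer[OF a assms(4) HE] by simp
qed

lemma card_subgroup_dvd:
  "subgroup H G \<Longrightarrow> subgroup K G \<Longrightarrow> H \<subseteq> K \<Longrightarrow> finite K \<Longrightarrow> card H dvd card K"
  using coset_count(1)[of H K] by (metis dvd_triv_right)

lemma pow_card_subgroup: assumes "subgroup H G" "finite H" "x \<in> H" shows "x [^] card H = \<one>"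
proof -
  interpret H: group "G\<lparr>carrier := H\<rparr>" using assms(1) by (rule subgroup_imp_group)
  show ?thesis using H.pow_order_eq_1[of x] assms by (simp add: order_def flip: nat_pow_consistent)
qed

lemma ord_dvd_card: "subgroup H G \<Longrightarrow> finite H \<Longrightarrow> x \<in> H \<Longrightarrow> ord x dvd card H"
  using pow_card_subgroup[of H x] pow_eq_id[of x "card H"] subgroup.mem_carrier[of H G x] by auto

text \<open>Sylow's theorem for a group is transported to a subgroup by making the subgroup the carrier.\<close>

lemma sylow_exists:
  assumes "subgroup H G" "finite H" "prime p" "p ^ a dvd card H"
  shows "\<exists>K. subgroup K G \<and> K \<subseteq> H \<and> card K = p ^ a"
proof -
  interpret H: group "G\<lparr>carrier := H\<rparr>" using assms(1) by (rule subgroup_imp_group)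
  obtain m where "card H = p ^ a * m" using assms(4) by auto
  then obtain K where K: "subgroup K (G\<lparr>carrier := H\<rparr>)" "card K = p ^ a"
    using sylow_thm[OF assms(3) H.is_group, of a m] assms(2) by (auto simp: order_def)
  then show ?thesis using incl_subgroup[OF assms(1) K(1)] subgroup.subset[OF K(1)] by auto
qed

lemma cauchy:
  assumes "subgroup H G" "finite H" "prime p" "p dvd card H"
  shows "\<exists>x\<in>H. ord x = p"
proof -
  obtain K where K: "subgroup K G" "K \<subseteq> H" "card K = p"
    using sylow_exists[of H p 1] assms by auto
  have f: "finite K" using K(2) assms(2) finite_subset by auto
  have "K \<noteq> {\<one>}" using K(3) prime_gt_1_nat[OF assms(3)] by auto
  then obtain x where x: "x \<in> K" "x \<noteq> \<one>" using subgroup.one_closed[OF K(1)] by auto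
  have "ord x dvd p" using ord_dvd_card[OF K(1) f x(1)] K(3) by simp
  moreover have "ord x \<noteq> 1" using x K(1) ord_eq_1 subgroup.mem_carrier by metis
  ultimately show ?thesis using x K(2) assms(3) by (auto simp: prime_nat_iff)
qed

text \<open>If another prime divided the order, Cauchy's theorem would provide an element of that order.\<close>

lemma pgroup_card:
  assumes "subgroup H G" "finite H" "prime p" "\<And>x q. x \<in> H \<Longrightarrow> prime q \<Longrightarrow> ord x = q \<Longrightarrow> q = p"
  shows "\<exists>n. card H = p ^ n"
proof -
  have "q = p" if "prime q" "q dvd card H" for q
    using cauchy[OF assms(1,2) that] assms(4) that(1) by auto
  moreover have "card H \<noteq> 0" using assms(1,2) subgroup_nonempty by (metis card_eq_0_iff)
  ultimately have "prime_factors (card H) \<subseteq> {p}" by (auto simp: prime_factors_dvd)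
  then have "card H = p ^ multiplicity p (card H)"
    using prod_prime_factors[of "card H"] \<open>card H \<noteq> 0\<close> not_dvd_imp_multiplicity_0
    by (metis (mono_tags, lifting) One_nat_def finite.emptyI finite.insertI normalize_nat_def id_apply
        prod.insert prod.empty empty_iff mult.right_neutral prime_factors_dvd subset_singletonD
        assms(3) mem_Collect_eq power_0 insert_iff)
  then show ?thesis by blast
qed

definition syl :: "'a set \<Rightarrow> nat \<Rightarrow> 'a set set" where
  "syl K p = {P. subgroup P G \<and> P \<subseteq> K \<and> card P = p ^ multiplicity p (card K)}"

lemma sylD: "P \<in> syl K p \<Longrightarrow> subgroup P G" "P \<in> syl K p \<Longrightarrow> P \<subseteq> K"
   "P \<in> syl K p \<Longrightarrow> card P = p ^ multiplicity p (card K)"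
  by (auto simp: syl_def)

lemma syl_carrier: "P \<in> syl K p \<Longrightarrow> P \<subseteq> carrier G"
  by (auto simp: syl_def dest: subgroup.subset)

lemma syl_nonempty: "subgroup K G \<Longrightarrow> finite K \<Longrightarrow> prime p \<Longrightarrow> \<exists>P. P \<in> syl K p"
  using sylow_exists[of K p "multiplicity p (card K)"] by (auto simp: syl_def multiplicity_dvd)

lemma syl_cj: assumes "P \<in> syl K p" "g \<in> K" "subgroup K G" shows "cj g ` P \<in> syl K p"
proof -
  interpret K: subgroup K G by fact
  have "cj g ` P \<subseteq> K" using assms sylD(2)[OF assms(1)] by (auto simp: cj_def)
  then show ?thesis using assms(1,2) syl_carrier[OF assms(1)] subgroup_cj[of g P] card_cj[of g P]
    by (auto simp: syl_def)
qed

lemma acts_syl: "subgroup K G \<Longrightarrow> acts K (\<lambda>g A. cj g ` A) (syl K p)"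
  using syl_carrier syl_cj by (intro acts_cj_sets) blast+

text \<open>The subgroup \<open>L\<close> acts on the cosets of the Sylow subgroup, whose number is prime to
  \<open>p\<close>; a fixed coset yields the conjugating element.\<close>

lemma pgroup_in_syl:
  assumes "subgroup K G" "finite K" "prime p" "P \<in> syl K p"
    and "subgroup L G" "L \<subseteq> K" "card L = p ^ n"
  shows "\<exists>g\<in>K. L \<subseteq> cj g ` P"
proof -
  interpret K: subgroup K G by fact
  interpret L: subgroup L G by fact
  interpret P: subgroup P G by (rule sylD[OF assms(4)])
  define E where "E = (\<lambda>x. P #> inv x) ` K"
  note cc = coset_count[OF P.is_subgroup assms(1) sylD(2)[OF assms(4)] assms(2), folded E_def]
  have K0: "card K > 0" using K.one_closed assms(2) by (metis card_gt_0_iff empty_iff)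
  have nd: "\<not> p dvd card E"
  proof
    assume "p dvd card E"
    then have "p ^ Suc (multiplicity p (card K)) dvd card K"
      using cc(1) sylD(3)[OF assms(4)] by (metis mult_dvd_mono dvd_refl power_Suc)
    then show False using K0 assms(3)
      by (metis Suc_n_not_le_n neq0_conv not_prime_unit power_dvd_iff_le_multiplicity)
  qed
  have aL: "acts L (\<lambda>g A. A #> inv g) E" by (rule acts_restrict[OF cc(2) assms(5,6)])
  have "card E mod p = card {x\<in>E. \<forall>g\<in>L. x #> inv g = x} mod p"
    by (rule fixed_points_mod[OF aL _ assms(3,7)]) (use assms(2) in \<open>auto simp: E_def\<close>)
  then have "card {x\<in>E. \<forall>g\<in>L. x #> inv g = x} \<noteq> 0" using nd by (metis dvd_eq_mod_eq_0 mod_0)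
  then obtain A where A: "A \<in> E" "\<And>g. g \<in> L \<Longrightarrow> A #> inv g = A"
    by (metis (mono_tags, lifting) card.empty empty_Collect_eq)
  then obtain x where x: "x \<in> K" "A = P #> inv x" by (auto simp: E_def)
  have "l \<in> cj x ` P" if l: "l \<in> L" for l
  proof -
    have "(P #> inv x) #> inv l = P #> inv x" using A(2)[OF l] x(2) by simp
    then have "(P #> inv x) #> inv l #> x = P #> inv x #> x" by simp
    then have "P #> (inv x \<otimes> inv l \<otimes> x) = P"
      using x l by (simp add: coset_mult_assoc P.subset)
    then have "inv x \<otimes> inv l \<otimes> x \<in> P" by (rule coset_join1) (use x l P.is_subgroup in simp_all)
    then have "inv (inv x \<otimes> inv l \<otimes> x) \<in> P" by (rule P.m_inv_closed)
    then have "cj (inv x) l \<in> P" using x l by (simp add: cj_def word)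
    then show ?thesis using x l P.subset by (simp add: cj_mem_image_iff)
  qed
  then show ?thesis using x by blast
qed

lemma syl_conj:
  assumes "subgroup K G" "finite K" "prime p" "P \<in> syl K p" "P' \<in> syl K p"
  shows "\<exists>g\<in>K. P' = cj g ` P"
proof -
  obtain g where g: "g \<in> K" "P' \<subseteq> cj g ` P"
    using pgroup_in_syl[OF assms(1-4) sylD(1,2,3)[OF assms(5)]] by auto
  have "card (cj g ` P) = card P'"
    using card_cj[of g P] syl_carrier[OF assms(4)] g(1) assms(1) sylD(3)[OF assms(4)] sylD(3)[OF assms(5)]
    by (simp add: subgroup.mem_carrier)
  moreover have "finite (cj g ` P)" using sylD(2)[OF assms(4)] assms(2) finite_subset by auto
  ultimately show ?thesis using g card_subset_eq by metis
qed

lemma card_syl: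
  assumes "subgroup K G" "finite K" "prime p" "P \<in> syl K p"
  shows "card K = card (syl K p) * card (nor P \<inter> K)"
proof -
  interpret K: subgroup K G by fact
  have "(\<lambda>g. cj g ` P) ` K = syl K p"
    using syl_conj[OF assms] syl_cj[OF assms(4) _ assms(1)] by (auto simp: image_iff)
  moreover have "{g\<in>K. cj g ` P = P} = nor P \<inter> K" by (auto simp: nor_def)
  ultimately show ?thesis using orbit_stabilizer[OF acts_syl[OF assms(1)] assms(2) assms(4)] by simp
qed

lemma finite_syl: "finite K \<Longrightarrow> finite (syl K p)"
  by (rule finite_subset[of _ "Pow K"]) (auto simp: syl_def)

lemma generate_singleton:
  assumes "x \<in> carrier G" shows "subgroup (generate G {x}) G" "x \<in> generate G {x}"
    "card (generate G {x}) = ord x"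
  using assms generate_is_subgroup[of "{x}"] generate_pow_card[of x] generate.incl[of x "{x}" G] by auto

lemma elt_in_syl:
  assumes "subgroup K G" "finite K" "prime p" "x \<in> K" "ord x = p ^ k"
  shows "\<exists>P\<in>syl K p. x \<in> P"
proof -
  have xc: "x \<in> carrier G" using assms subgroup.mem_carrier by metis
  obtain P where P: "P \<in> syl K p" using syl_nonempty[OF assms(1-3)] by auto
  have "generate G {x} \<subseteq> K" using assms(1,4) by (intro generate_subgroup_incl) auto
  then obtain g where "g \<in> K" "generate G {x} \<subseteq> cj g ` P"
    using pgroup_in_syl[OF assms(1-3) P generate_singleton(1)[OF xc], of k] generate_singleton(3)[OF xc] assms(5) by auto
  then show ?thesis using syl_cj[OF P _ assms(1)] generate_singleton(2)[OF xc] by blast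
qed

section \<open>Groups of prime power order\<close>

text \<open>The number of fixed points in \<open>N\<close> is divisible by \<open>p\<close>, and the identity is one of
  them.\<close>

lemma pgroup_fixed_element:
  assumes "subgroup L G" "card L = p ^ n" "prime p"
    and "subgroup N G" "card N = p ^ m" "N \<noteq> {\<one>}" "\<And>l x. l \<in> L \<Longrightarrow> x \<in> N \<Longrightarrow> cj l x \<in> N"
  shows "\<exists>z\<in>N. z \<noteq> \<one> \<and> (\<forall>l\<in>L. cj l z = z)"
proof -
  interpret N: subgroup N G by fact
  interpret L: subgroup L G by fact
  have "0 < card N" using assms(3,5) by (simp add: prime_gt_0_nat)
  then have fN: "finite N" by (rule card_ge_0_finite)
  have "m \<noteq> 0" using assms(5,6) N.one_closed by (metis card_1_singletonE power_0 singletonD)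
  then have "p dvd card N" using assms(5) by simp
  define F where "F = {x\<in>N. \<forall>g\<in>L. cj g x = x}"
  have "acts L cj N" by (rule acts_cj) (use assms in auto)
  then have "card N mod p = card F mod p"
    unfolding F_def using fixed_points_mod[OF _ fN assms(3,2)] by blast
  then have "p dvd card F" using \<open>p dvd card N\<close> by (metis dvd_eq_mod_eq_0)
  moreover have o: "\<one> \<in> F" by (simp add: F_def)
  ultimately have "F \<noteq> {\<one>}" using assms(3) by (metis One_nat_def card.empty card_insert_disjoint empty_iff finite.emptyI not_prime_unit nat_dvd_1_iff_1 One_nat_def)
  then show ?thesis using o by (auto simp: F_def)
qed

text \<open>The subgroup \<open>H\<close> acts on its cosets in \<open>K\<close>. Besides \<open>H\<close> itself there
  must be further fixed cosets, because the number of fixed cosets is divisible by \<open>p\<close>, and they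
  come from elements of the normalizer.\<close>

lemma normalizer_grows:
  assumes "subgroup K G" "card K = p ^ n" "prime p" "subgroup H G" "H \<subset> K"
  shows "\<exists>x\<in>K - H. x \<in> nor H"
proof -
  interpret K: subgroup K G by fact
  interpret H: subgroup H G by fact
  have "0 < card K" using assms(2,3) by (simp add: prime_gt_0_nat)
  then have fK: "finite K" by (rule card_ge_0_finite)
  have fH: "finite H" using fK assms(5) finite_subset by auto
  define E where "E = (\<lambda>x. H #> inv x) ` K"
  have HK: "H \<subseteq> K" using assms(5) by auto
  note cc = coset_count[OF assms(4,1) HK fK, folded E_def]
  have HE: "H \<in> E" unfolding E_def using H.subset by (auto intro!: image_eqI[of _ _ "\<one>"])
  have aH: "acts H (\<lambda>g A. A #> inv g) E" by (rule acts_restrict[OF cc(2) assms(4) HK])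
  have "card E dvd p ^ n" using cc(1) assms(2) by (metis dvd_triv_left)
  then obtain j where j: "card E = p ^ j" using assms(3) divides_primepow_nat by blast
  have "card H dvd p ^ n" using cc(1) assms(2) by (metis dvd_triv_right)
  then obtain i where i: "card H = p ^ i" using assms(3) divides_primepow_nat by blast
  have "j \<noteq> 0" using cc(1) j card_subset_eq[OF fK HK] assms(5) by auto
  define F where "F = {x\<in>E. \<forall>g\<in>H. x #> inv g = x}"
  have "card E mod p = card F mod p" unfolding F_def
    by (rule fixed_points_mod[OF aH _ assms(3) i]) (use fK in \<open>auto simp: E_def\<close>)
  then have pF: "p dvd card F" using \<open>j \<noteq> 0\<close> j by (metis dvd_eq_mod_eq_0 dvd_power gr0I)
  have "H \<in> F" unfolding F_def using HE coset_join2[OF _ assms(4)] by auto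
  moreover have "card F \<noteq> 1" using pF assms(3) not_prime_unit nat_dvd_1_iff_1 by metis
  ultimately obtain A where A: "A \<in> F" "A \<noteq> H"
    by (metis card_1_singleton_iff is_singletonI' is_singleton_def One_nat_def emptyE)
  then obtain x where x: "x \<in> K" "A = H #> inv x" by (auto simp: F_def E_def)
  have xH: "x \<notin> H" using A(2) x coset_join2[of "inv x" H] assms(4) by auto
  have "cj (inv x) l \<in> H" if l: "l \<in> H" for l
  proof -
    have "(H #> inv x) #> inv l = H #> inv x" using A(1) x(2) l by (auto simp: F_def)
    then have "(H #> inv x) #> inv l #> x = H #> inv x #> x" by simp
    then have "H #> (inv x \<otimes> inv l \<otimes> x) = H"
      using x l by (simp add: coset_mult_assoc H.subset)
    then have "inv x \<otimes> inv l \<otimes> x \<in> H" by (rule coset_join1) (use x l assms(4) in simp_all)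
    then have "inv (inv x \<otimes> inv l \<otimes> x) \<in> H" by (rule H.m_inv_closed)
    then show ?thesis using x l by (simp add: cj_def word)
  qed
  then have "inv x \<in> nor H" using x by (intro norI_finite[OF fH H.subset]) auto
  then have "x \<in> nor H" using subgroup.m_inv_closed[OF subgroup_nor[OF H.subset], of "inv x"] x by simp
  then show ?thesis using x xH by auto
qed

text \<open>A subgroup of index \<open>p\<close> is normal because normalizers grow, and the quotient is cyclic.\<close>

lemma order_prime_power_not_perfect:
  assumes "order G = p ^ n" "n > 0" "prime p" shows "derived G (carrier G) \<noteq> carrier G"
proof -
  have "order G > 0" using assms by (simp add: prime_gt_0_nat)
  then have fG: "finite (carrier G)" by (simp add: order_gt_0_iff_finite)
  obtain M where M: "subgroup M G" "card M = p ^ (n - 1)"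
    using sylow_exists[OF subgroup_self fG assms(3), of "n - 1"] assms(1) by (auto simp: order_def le_imp_power_dvd)
  have pn: "p ^ n = p * p ^ (n - 1)" using assms(2) by (metis power_minus_mult mult.commute)
  then have cl: "card M < card (carrier G)" using M(2) assms(1,3) prime_gt_1_nat[OF assms(3)] by (simp add: order_def)
  then have Mp: "M \<subset> carrier G" using subgroup.subset[OF M(1)] by auto
  obtain x where x: "x \<in> carrier G" "x \<notin> M" "x \<in> nor M"
    using normalizer_grows[OF subgroup_self _ assms(3) M(1) Mp, of n] assms(1) by (auto simp: order_def)
  have sN: "subgroup (nor M) G" by (rule subgroup_nor[OF subgroup.subset[OF M(1)]])
  have MN: "M \<subseteq> nor M" by (rule subgroup_sub_nor[OF M(1)])
  have fN: "finite (nor M)" using fG subgroup.subset[OF sN] finite_subset by auto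
  have "card (nor M) dvd p ^ n"
    using card_subgroup_dvd[OF sN subgroup_self subgroup.subset[OF sN] fG] assms(1) by (simp add: order_def)
  then obtain i where i: "i \<le> n" "card (nor M) = p ^ i" using assms(3) divides_primepow_nat by blast
  have "card M < card (nor M)" using x MN fN by (intro psubset_card_mono) auto
  then have "n - 1 < i" using M(2) i(2) prime_gt_1_nat[OF assms(3)] by simp
  then have "i = n" using i by simp
  then have "nor M = carrier G" using i(2) assms(1) subgroup.subset[OF sN] card_subset_eq[OF fG] by (simp add: order_def)
  then have nM: "M \<lhd> G" unfolding normal_inv_iff using M(1) norD[of _ M] by (auto simp: cj_def)
  interpret M: normal M G by fact
  interpret Q: group "G Mod M" by (rule M.factorgroup_is_group)
  have "card (rcosets M) * card M = order G" using lagrange[OF M(1)] by simp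
  then have "card (rcosets M) * p ^ (n - 1) = p * p ^ (n - 1)" using M(2) assms(1) pn by simp
  then have cQ: "card (carrier (G Mod M)) = p ^ 1" using assms(3) by (auto simp: FactGroup_def)
  have fQ: "finite (carrier (G Mod M))" using cQ assms(3) by (metis card_gt_0_iff prime_gt_0_nat power_one_right)
  have "carrier (G Mod M) \<noteq> {\<one>\<^bsub>G Mod M\<^esub>}" using cQ prime_gt_1_nat[OF assms(3)] by auto
  then obtain z where z: "z \<in> carrier (G Mod M)" "z \<noteq> \<one>\<^bsub>G Mod M\<^esub>" "\<And>l. l \<in> carrier (G Mod M) \<Longrightarrow> Q.cj l z = z"
    using Q.pgroup_fixed_element[OF Q.subgroup_self cQ assms(3) Q.subgroup_self cQ] by auto
  have zc: "z \<in> center (G Mod M)" using z Q.cj_fix_iff unfolding center_def by auto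
  have "card (center (G Mod M)) dvd p"
    using Q.card_subgroup_dvd[OF Q.center_is_subgroup Q.subgroup_self] fQ cQ by (auto simp: center_def)
  moreover have "card (center (G Mod M)) \<noteq> 1"
    using zc z(2) subgroup.one_closed[OF Q.center_is_subgroup] by (metis card_1_singletonE singletonD)
  ultimately have "card (center (G Mod M)) = card (carrier (G Mod M))" using cQ assms(3) by (auto simp: prime_nat_iff)
  then have "center (G Mod M) = carrier (G Mod M)" using fQ by (intro card_subset_eq) (auto simp: center_def)
  then have "comm_group (G Mod M)" by (intro Q.group_comm_groupI) (auto simp: center_def)
  then have "derived G (carrier G) \<subseteq> M"
    using derived_of_subgroup_minimal[of M "carrier G"] nM subgroup_self by simp
  then show ?thesis using Mp by auto
qed

text \<open>Otherwise the quotient would be a perfect group of prime power order.\<close>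

lemma perfect_no_p_quotient:
  assumes "derived G (carrier G) = carrier G" "N \<lhd> G" "finite (carrier G)" "prime p" "order G = card N * p ^ n"
  shows "N = carrier G"
proof -
  interpret N: normal N G by fact
  interpret Q: group "G Mod N" by (rule N.factorgroup_is_group)
  interpret h: group_hom G "G Mod N" "\<lambda>a. N #> a"
    by unfold_locales (rule N.r_coset_hom_Mod)
  have im: "(\<lambda>a. N #> a) ` carrier G = carrier (G Mod N)" by (simp add: carrier_FactGroup)
  have perf: "derived (G Mod N) (carrier (G Mod N)) = carrier (G Mod N)"
    using h.derived_img[of "carrier G"] assms(1) im by simp
  have c0: "card N > 0" using N.one_closed finite_subset[OF N.subset assms(3)] by (metis card_gt_0_iff empty_iff)
  have "card (rcosets N) * card N = order G" using lagrange[OF N.is_subgroup] by simp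
  then have o: "order (G Mod N) = p ^ n" using assms(5) c0 by (auto simp: FactGroup_def order_def)
  then have "n = 0" using Q.order_prime_power_not_perfect[OF o _ assms(4)] perf by auto
  then show ?thesis using assms(3,5) N.subset by (intro card_subset_eq) (auto simp: order_def)
qed

end

section \<open>Fixed-point-free action of an elementary abelian group\<close>

lemma (in comm_monoid) finprod_swap_lessThan:
  assumes "\<And>i j. f i j \<in> carrier G"
  shows "finprod G (\<lambda>i. finprod G (\<lambda>j. f i j) {..<n}) {..<m::nat}
       = finprod G (\<lambda>j. finprod G (\<lambda>i. f i j) {..<m}) {..<n::nat}"
proof (induction n)
  case 0 then show ?case by simp
next
  case (Suc n)
  have "finprod G (\<lambda>i. finprod G (\<lambda>j. f i j) {..<Suc n}) {..<m}
      = finprod G (\<lambda>i. f i n \<otimes> finprod G (\<lambda>j. f i j) {..<n}) {..<m}"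
    using assms by (intro finprod_cong refl) (auto simp: lessThan_Suc simp_implies_def Pi_def)
  also have "\<dots> = finprod G (\<lambda>i. f i n) {..<m} \<otimes> finprod G (\<lambda>i. finprod G (\<lambda>j. f i j) {..<n}) {..<m}"
    using assms by (intro finprod_multf) (auto simp: Pi_def)
  also have "\<dots> = finprod G (\<lambda>j. finprod G (\<lambda>i. f i j) {..<m}) {..<Suc n}"
    using assms by (simp add: Suc lessThan_Suc Pi_def)
  finally show ?case .
qed

context group begin

text \<open>The product of the images of a central element \<open>x\<close> of \<open>D\<close> under the powers of
  \<open>e\<close> is fixed by \<open>e\<close>, hence trivial if \<open>e\<close> is not. If
  \<open>e1\<close> were not a power of \<open>e2\<close>, form these products for all the elements
  \<open>e1 \<otimes> e2 [^] i\<close>, and multiply them. After the order of multiplication is exchanged, the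
  zeroth powers contribute \<open>x [^] r\<close>, and the others contribute images of such products for
  powers of \<open>e2\<close>. Hence \<open>x [^] r = \<one>\<close>, although the order of \<open>x\<close>
  is a power of \<open>p\<close>.\<close>

lemma elementary_abelian_fixed_point_free:
  assumes "prime p" "prime r" "r \<noteq> p" "subgroup D G" "card D = p ^ m" "D \<noteq> {\<one>}"
    and "subgroup E G" "\<And>e. e \<in> E \<Longrightarrow> e [^] r = \<one>" "\<And>e f. e \<in> E \<Longrightarrow> f \<in> E \<Longrightarrow> e \<otimes> f = f \<otimes> e"
    and "E \<subseteq> nor D" "\<And>e d. e \<in> E \<Longrightarrow> d \<in> D \<Longrightarrow> e \<noteq> \<one> \<Longrightarrow> d \<noteq> \<one> \<Longrightarrow> cj e d \<noteq> d"
  shows "card E \<le> r"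
proof (cases "E = {\<one>}")
  case True then show ?thesis using assms(2) prime_gt_0_nat[of r] by simp
next
  case False
  interpret D: subgroup D G by fact
  interpret E: subgroup E G by fact
  obtain e2 where e2: "e2 \<in> E" "e2 \<noteq> \<one>" using False E.one_closed by auto
  have "E \<subseteq> (\<lambda>i. e2 [^] i) ` {..<r}"
  proof (rule ccontr)
    assume "\<not> ?thesis"
    then obtain e1 where e1: "e1 \<in> E" "e1 \<notin> (\<lambda>i. e2 [^] i) ` {..<r}" by auto
    define Z where "Z = D \<inter> cen D"
    have sZ: "subgroup Z G" unfolding Z_def by (intro subgroup_Int assms(4) subgroup_cen D.subset)
    interpret Z: subgroup Z G by fact
    interpret C: comm_group "G\<lparr>carrier := Z\<rparr>"
    proof -
      interpret g: group "G\<lparr>carrier := Z\<rparr>" by (rule subgroup_imp_group[OF sZ])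
      have comm: "x \<otimes> y = y \<otimes> x" if "x \<in> Z" "y \<in> Z" for x y using that unfolding Z_def cen_def by blast
      show "comm_group (G\<lparr>carrier := Z\<rparr>)" by (rule g.group_comm_groupI, simp, erule (1) comm)
    qed
    have EZ: "cj e z \<in> Z" if "e \<in> E" "z \<in> Z" for e z
    proof -
      have e: "e \<in> carrier G" "cj e ` D = D" using that(1) assms(10) by (auto simp: nor_def)
      have "cj e ` cen D = cen D" using cen_cj[OF e(1) D.subset] e(2) by simp
      then show ?thesis using that(2) e(2) unfolding Z_def by blast
    qed
    have Epow: "e [^] i \<in> E" if "e \<in> E" for e and i :: nat using subgroup_pow[OF assms(7) that] .
    define N where "N e x n = finprod (G\<lparr>carrier := Z\<rparr>) (\<lambda>i. cj (e [^] i) x) {..<n}" for e x and n :: nat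
    have Ncl: "N e x n \<in> Z" if "e \<in> E" "x \<in> Z" for e x n
      unfolding N_def using C.finprod_closed[of "\<lambda>i. cj (e [^] i) x" "{..<n}"] EZ Epow that by (auto simp: Pi_def)
    have NSuc: "N e x (Suc n) = N e x n \<otimes> cj (e [^] n) x" if "e \<in> E" "x \<in> Z" for e x n
    proof -
      have "N e x (Suc n) = cj (e [^] n) x \<otimes> N e x n"
        unfolding N_def lessThan_Suc using that EZ Epow by (subst C.finprod_insert) (auto simp: Pi_def)
      then show ?thesis using C.m_comm[of "N e x n" "cj (e [^] n) x"] Ncl[OF that] EZ[OF Epow[OF that(1)] that(2)] by simp
    qed
    have shift: "cj e (N e x n) \<otimes> x = N e x n \<otimes> cj (e [^] n) x" if "e \<in> E" "x \<in> Z" for e x n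
    proof (induction n)
      case 0
      have "N e x 0 = \<one>" by (simp add: N_def)
      then show ?case using that by simp
    next
      case (Suc n)
      note cl = Ncl[OF that] EZ[OF Epow[OF that(1)] that(2)]
      have ec: "e \<in> carrier G" using that by simp
      have ee: "e \<otimes> e [^] n = e [^] Suc n" by (rule nat_pow_Suc2[OF ec, symmetric])
      have "cj e (N e x (Suc n)) \<otimes> x = cj e (N e x n) \<otimes> cj (e [^] Suc n) x \<otimes> x"
        using ec cl[of n] that cj_cj[of e "e [^] n" x] ee by (simp add: NSuc cj_mult)
      also have "\<dots> = cj e (N e x n) \<otimes> (x \<otimes> cj (e [^] Suc n) x)"
        using C.m_comm[of x "cj (e [^] Suc n) x"] cl[of "Suc n"] cl[of n] that ec by (simp add: m_assoc del: nat_pow_Suc)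
      also have "\<dots> = N e x n \<otimes> cj (e [^] n) x \<otimes> cj (e [^] Suc n) x"
        using cl[of "Suc n"] cl[of n] that ec Suc by (simp flip: m_assoc del: nat_pow_Suc)
      finally show ?case by (simp add: NSuc[OF that] del: nat_pow_Suc)
    qed
    text \<open>The norm of a point under \<open>\<langle>e\<rangle>\<close> is fixed by \<open>e\<close>.\<close>
    have norm_one: "N e x r = \<one>" if "e \<in> E" "e \<noteq> \<one>" "x \<in> Z" for e x
    proof -
      have "cj e (N e x r) \<otimes> x = N e x r \<otimes> x" using shift[OF that(1,3), of r] assms(8)[OF that(1)] that by simp
      then have "cj e (N e x r) = N e x r" using Ncl[OF that(1,3), of r] that EZ[OF that(1)] by simp
      then show ?thesis using assms(11)[of e "N e x r"] that Ncl[OF that(1,3), of r] by (auto simp: Z_def)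
    qed
    have cj_N: "cj e (N f x n) = finprod (G\<lparr>carrier := Z\<rparr>) (\<lambda>i. cj e (cj (f [^] i) x)) {..<n}"
      if "e \<in> E" "f \<in> E" "x \<in> Z" for e f x n
    proof (induction n)
      case 0 show ?case using that by (simp add: N_def)
    next
      case (Suc n)
      have "cj e (N f x (Suc n)) = cj e (N f x n) \<otimes> cj e (cj (f [^] n) x)"
        using that Ncl[of f x n] by (simp add: NSuc cj_mult)
      also have "\<dots> = cj e (cj (f [^] n) x) \<otimes> cj e (N f x n)"
        using C.m_comm[of "cj e (N f x n)" "cj e (cj (f [^] n) x)"] EZ Epow Ncl that by simp
      finally show ?case unfolding Suc lessThan_Suc using that EZ Epow by (subst C.finprod_insert) (auto simp: Pi_def)
    qed
    have "\<exists>d\<in>D. d \<noteq> \<one> \<and> (\<forall>l\<in>D. cj l d = d)"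
      using pgroup_fixed_element[OF assms(4,5,1,4,5,6)] subgroup_sub_nor[OF assms(4)] norD by blast
    then obtain d where d: "d \<in> D" "d \<noteq> \<one>" "\<forall>l\<in>D. cj l d = d" by auto
    have dZ: "d \<in> Z" unfolding Z_def cen_def using d D.mem_carrier
      by (auto simp: cj_fix_iff)
    define f where "f i j = cj ((e1 \<otimes> e2 [^] i) [^] j) d" for i j :: nat
    have fZ: "f i j \<in> Z" for i j unfolding f_def using EZ[OF Epow dZ] e1 e2 Epow by simp
    have f_alt: "f i j = cj (e1 [^] j) (cj ((e2 [^] j) [^] i) d)" for i j
    proof -
      have "(e1 \<otimes> e2 [^] i) [^] j = e1 [^] j \<otimes> (e2 [^] i) [^] j"
        using e1 e2 Epow assms(9) by (intro pow_mult_distrib) auto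
      also have "(e2 [^] i) [^] j = (e2 [^] j) [^] i" using e2 by (simp add: nat_pow_pow mult.commute)
      finally show ?thesis unfolding f_def using e1 e2 d by (simp add: cj_cj)
    qed
    have ne: "e1 \<otimes> e2 [^] i \<noteq> \<one>" for i :: nat
    proof
      assume "e1 \<otimes> e2 [^] i = \<one>"
      then have "e1 = inv (e2 [^] i)" using e1(1) e2(1) inv_equality[of e1 "e2 [^] i"] by simp
      also have "\<dots> = e2 [^] (i * (r - 1))"
      proof -
        have "e2 [^] (i * (r - 1)) \<otimes> e2 [^] i = e2 [^] (i * r)"
          using e2 prime_gt_0_nat[OF assms(2)] by (simp add: nat_pow_mult) (metis add.commute mult_Suc_right Suc_pred)
        also have "\<dots> = (e2 [^] r) [^] i" using e2 by (simp add: nat_pow_pow mult.commute)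
        finally show ?thesis using e2 assms(8)[of e2] by (intro inv_equality) auto
      qed
      also have "\<dots> = e2 [^] ((i * (r - 1)) mod r)"
      proof -
        let ?k = "i * (r - 1)"
        have "e2 [^] ?k = e2 [^] (r * (?k div r) + ?k mod r)" by (simp only: mult_div_mod_eq)
        also have "\<dots> = (e2 [^] r) [^] (?k div r) \<otimes> e2 [^] (?k mod r)" using e2 by (simp add: nat_pow_pow nat_pow_mult)
        finally show ?thesis using e2 assms(8)[of e2] by simp
      qed
      finally show False using e1(2) prime_gt_0_nat[OF assms(2)] by (auto simp: image_iff)
    qed
    have row: "finprod (G\<lparr>carrier := Z\<rparr>) (\<lambda>j. f i j) {..<r} = \<one>" for i
      using norm_one[of "e1 \<otimes> e2 [^] i" d] ne e1 e2 Epow dZ unfolding N_def f_def by simp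
    have col: "finprod (G\<lparr>carrier := Z\<rparr>) (\<lambda>i. f i j) {..<r} = (if j = 0 then d [^] r else \<one>)" if "j < r" for j
    proof (cases "j = 0")
      case True
      then have "finprod (G\<lparr>carrier := Z\<rparr>) (\<lambda>i. f i j) {..<r} = finprod (G\<lparr>carrier := Z\<rparr>) (\<lambda>i. d) {..<r}"
        unfolding f_alt using e1 e2 dZ by (intro C.finprod_cong) (auto simp: simp_implies_def)
      also have "\<dots> = d [^]\<^bsub>G\<lparr>carrier := Z\<rparr>\<^esub> r" using dZ by (subst C.finprod_const) auto
      also have "\<dots> = d [^] r" by (simp flip: nat_pow_consistent)
      finally show ?thesis using True by simp
    next
      case False
      have "ord e2 dvd r" using assms(8)[OF e2(1)] pow_eq_id[of e2 r] e2 by simp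
      moreover have "ord e2 \<noteq> 1" using e2 ord_eq_1[of e2] by simp
      ultimately have "ord e2 = r" using assms(2) by (auto simp: prime_nat_iff)
      then have "e2 [^] j \<noteq> \<one>" using pow_eq_id[of e2 j] e2 False that by (auto dest: dvd_imp_le)
      then have "N (e2 [^] j) d r = \<one>" using norm_one[of "e2 [^] j" d] e2 Epow dZ by simp
      moreover have "finprod (G\<lparr>carrier := Z\<rparr>) (\<lambda>i. f i j) {..<r} = cj (e1 [^] j) (N (e2 [^] j) d r)"
        unfolding f_alt using cj_N[of "e1 [^] j" "e2 [^] j" d r] Epow e1 e2 dZ by simp
      ultimately show ?thesis using e1 False by simp
    qed
    have "\<one> = finprod (G\<lparr>carrier := Z\<rparr>) (\<lambda>i. finprod (G\<lparr>carrier := Z\<rparr>) (\<lambda>j. f i j) {..<r}) {..<r}"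
      using row C.finprod_one_eqI[of "{..<r}" "\<lambda>i. \<one>"] by simp
    also have "\<dots> = finprod (G\<lparr>carrier := Z\<rparr>) (\<lambda>j. finprod (G\<lparr>carrier := Z\<rparr>) (\<lambda>i. f i j) {..<r}) {..<r}"
      using fZ by (intro C.finprod_swap_lessThan) auto
    also have "\<dots> = finprod (G\<lparr>carrier := Z\<rparr>) (\<lambda>j. if j = 0 then d [^] r else \<one>) {..<r}"
      using col Z.one_closed subgroup_pow[OF sZ dZ] by (intro C.finprod_cong) (auto simp: simp_implies_def)
    also have "{..<r} = insert 0 {1..<r}" using prime_gt_0_nat[OF assms(2)] by auto
    also have "finprod (G\<lparr>carrier := Z\<rparr>) (\<lambda>j. if j = 0 then d [^] r else \<one>) (insert 0 {1..<r})
        = d [^] r \<otimes> finprod (G\<lparr>carrier := Z\<rparr>) (\<lambda>j. if j = 0 then d [^] r else \<one>) {1..<r}"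
      using subgroup_pow[OF sZ dZ] by (subst C.finprod_insert) (auto simp: Pi_def)
    also have "finprod (G\<lparr>carrier := Z\<rparr>) (\<lambda>j. if j = 0 then d [^] r else \<one>) {1..<r} = \<one>"
      using C.finprod_one_eqI[of "{1..<r}" "\<lambda>j. if j = 0 then d [^] r else \<one>"] by auto
    finally have "d [^] r = \<one>" using d by simp
    then have "ord d dvd r" using d pow_eq_id by simp
    moreover have "ord d dvd p ^ m"
      using ord_dvd_card[OF assms(4) _ d(1)] assms(1,5) by (metis card_ge_0_finite prime_gt_0_nat zero_less_power)
    moreover have "coprime r (p ^ m)" using assms(1-3) by (simp add: primes_coprime)
    ultimately have "ord d = 1" by (metis coprime_common_divisor_nat nat_dvd_1_iff_1)
    then show False using d ord_eq_1[of d] by simp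
  qed
  then have "card E \<le> card ((\<lambda>i. e2 [^] i) ` {..<r})" by (intro card_mono) auto
  also have "\<dots> \<le> r" using card_image_le[of "{..<r}" "\<lambda>i. e2 [^] i"] by simp
  finally show ?thesis .
qed

end

section \<open>Transfer into an abelian subgroup of finite index\<close>

text \<open>The transfer into an abelian subgroup of finite index is computed from an arbitrary choice
  \<open>\<tau>\<close> of coset representatives. Since it is a homomorphism into an abelian group, it is
  trivial on a perfect group.\<close>

locale transfer_setup = group G + H: subgroup H G for G (structure) and H +
  fixes \<tau> :: "'a set \<Rightarrow> 'a"
  assumes abelian: "\<And>x y. x \<in> H \<Longrightarrow> y \<in> H \<Longrightarrow> x \<otimes> y = y \<otimes> x"
    and finite_index: "finite (rcosets H)"
    and rep: "\<And>c. c \<in> rcosets H \<Longrightarrow> \<tau> c \<in> c"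
begin

definition transfer :: "'a \<Rightarrow> 'a" where
  "transfer g = finprod (G\<lparr>carrier := H\<rparr>) (\<lambda>c. \<tau> c \<otimes> g \<otimes> inv (\<tau> (c #> g))) (rcosets H)"

lemma comm_group_H: "comm_group (G\<lparr>carrier := H\<rparr>)"
proof -
  interpret g: group "G\<lparr>carrier := H\<rparr>" by (rule subgroup_imp_group) unfold_locales
  show ?thesis by (rule g.group_comm_groupI, simp, erule (1) abelian)
qed

sublocale C: comm_group "G\<lparr>carrier := H\<rparr>" by (rule comm_group_H)

lemma coset_shift: "c \<in> rcosets H \<Longrightarrow> g \<in> carrier G \<Longrightarrow> c #> g \<in> rcosets H"
  by (auto simp: RCOSETS_def coset_mult_assoc H.subset intro!: exI bexI)

lemma rep_closed: "c \<in> rcosets H \<Longrightarrow> \<tau> c \<in> carrier G"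
  using rep H.rcosets_carrier[OF is_group] by blast

lemma factor_closed:
  assumes "c \<in> rcosets H" "g \<in> carrier G" shows "\<tau> c \<otimes> g \<otimes> inv (\<tau> (c #> g)) \<in> H"
proof -
  obtain x where x: "x \<in> carrier G" "c = H #> x" using assms(1) by (auto simp: RCOSETS_def)
  obtain h where h: "h \<in> H" "\<tau> c = h \<otimes> x" using rep[OF assms(1)] x(2) by (auto simp: r_coset_def)
  have "c #> g = H #> (x \<otimes> g)" using x assms by (simp add: coset_mult_assoc H.subset)
  then obtain k where k: "k \<in> H" "\<tau> (c #> g) = k \<otimes> (x \<otimes> g)"
    using rep[OF coset_shift[OF assms]] by (auto simp: r_coset_def)
  have "\<tau> c \<otimes> g \<otimes> inv (\<tau> (c #> g)) = h \<otimes> inv k" using h k x assms by (simp add: word)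
  then show ?thesis using h k by simp
qed

lemma shift_bij: assumes "g \<in> carrier G" shows "inj_on (\<lambda>c. c #> g) (rcosets H)" "(\<lambda>c. c #> g) ` (rcosets H) = rcosets H"
proof -
  have cancel: "c #> g #> inv g = c" if "c \<in> rcosets H" "g \<in> carrier G" for c g
    using that H.rcosets_carrier[OF is_group that(1)] by (simp add: coset_mult_assoc)
  show "inj_on (\<lambda>c. c #> g) (rcosets H)" by (rule inj_onI) (metis cancel assms)
  show "(\<lambda>c. c #> g) ` (rcosets H) = rcosets H"
  proof
    show "(\<lambda>c. c #> g) ` (rcosets H) \<subseteq> rcosets H" using coset_shift assms by auto
    show "rcosets H \<subseteq> (\<lambda>c. c #> g) ` (rcosets H)"
    proof
      fix c assume c: "c \<in> rcosets H"
      have "c = (c #> inv g) #> g" using cancel[OF c, of "inv g"] assms by simp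
      then show "c \<in> (\<lambda>c. c #> g) ` (rcosets H)" using coset_shift[OF c, of "inv g"] assms by blast
    qed
  qed
qed

lemma transfer_closed: "g \<in> carrier G \<Longrightarrow> transfer g \<in> H"
  unfolding transfer_def using C.finprod_closed[of "\<lambda>c. \<tau> c \<otimes> g \<otimes> inv (\<tau> (c #> g))" "rcosets H"] factor_closed
  by (auto simp: Pi_def)

lemma transfer_mult:
  assumes "g \<in> carrier G" "h \<in> carrier G" shows "transfer (g \<otimes> h) = transfer g \<otimes> transfer h"
proof -
  let ?H = "G\<lparr>carrier := H\<rparr>"
  have e: "\<tau> c \<otimes> (g \<otimes> h) \<otimes> inv (\<tau> (c #> (g \<otimes> h)))
      = (\<tau> c \<otimes> g \<otimes> inv (\<tau> (c #> g))) \<otimes> (\<tau> (c #> g) \<otimes> h \<otimes> inv (\<tau> (c #> g #> h)))" if c: "c \<in> rcosets H" for c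
  proof -
    have "c #> (g \<otimes> h) = c #> g #> h" using assms H.rcosets_carrier[OF is_group c] by (simp add: coset_mult_assoc)
    then show ?thesis
      using rep_closed[OF c] rep_closed[OF coset_shift[OF c assms(1)]]
        rep_closed[OF coset_shift[OF coset_shift[OF c assms(1)] assms(2)]] assms by (simp add: word)
  qed
  have "transfer (g \<otimes> h) = finprod ?H (\<lambda>c. (\<tau> c \<otimes> g \<otimes> inv (\<tau> (c #> g))) \<otimes>\<^bsub>?H\<^esub> (\<tau> (c #> g) \<otimes> h \<otimes> inv (\<tau> (c #> g #> h)))) (rcosets H)"
    unfolding transfer_def using e factor_closed[OF coset_shift] factor_closed assms
    by (intro C.finprod_cong) (auto simp: simp_implies_def)
  also have "\<dots> = transfer g \<otimes>\<^bsub>?H\<^esub> finprod ?H (\<lambda>c. \<tau> (c #> g) \<otimes> h \<otimes> inv (\<tau> (c #> g #> h))) (rcosets H)"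
    unfolding transfer_def using factor_closed[OF coset_shift] factor_closed assms by (intro C.finprod_multf) auto
  also have "finprod ?H (\<lambda>c. \<tau> (c #> g) \<otimes> h \<otimes> inv (\<tau> (c #> g #> h))) (rcosets H) = transfer h"
    unfolding transfer_def using C.finprod_reindex[of "\<lambda>c. \<tau> c \<otimes> h \<otimes> inv (\<tau> (c #> h))" "\<lambda>c. c #> g" "rcosets H"]
      shift_bij[OF assms(1)] factor_closed assms by (simp add: Pi_def)
  finally show ?thesis by simp
qed

lemma transfer_perfect:
  assumes "derived G (carrier G) = carrier G" "g \<in> carrier G" shows "transfer g = \<one>"
proof -
  interpret h: group_hom G "G\<lparr>carrier := H\<rparr>" transfer
    by unfold_locales (auto simp: hom_def transfer_closed transfer_mult)
  have "transfer ` carrier G = derived (G\<lparr>carrier := H\<rparr>) (transfer ` carrier G)"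
    using h.derived_img[of "carrier G"] assms(1) by simp
  also have "\<dots> = {\<one>}" using C.derived_eq_singleton[of "transfer ` carrier G"] transfer_closed by auto
  finally show ?thesis using assms(2) by auto
qed

end

context group begin

text \<open>On a central element the transfer is the power map whose exponent is the index.\<close>

lemma perfect_central_exponent:
  assumes "derived G (carrier G) = carrier G" "subgroup A G" "finite (rcosets A)"
    "\<And>a g. a \<in> A \<Longrightarrow> g \<in> carrier G \<Longrightarrow> a \<otimes> g = g \<otimes> a" "a \<in> A"
  shows "a [^] card (rcosets A) = \<one>"
proof -
  interpret A: subgroup A G by fact
  have "\<exists>x. x \<in> c" if "c \<in> rcosets A" for c using that rcos_self[OF _ assms(2)] by (auto simp: RCOSETS_def)
  then have sel: "(SOME x. x \<in> c) \<in> c" if "c \<in> rcosets A" for c using someI_ex[of "\<lambda>x. x \<in> c"] that by auto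
  interpret T: transfer_setup G A "\<lambda>c. SOME x. x \<in> c"
    by unfold_locales (use assms sel in auto)
  let ?A = "G\<lparr>carrier := A\<rparr>"
  have same: "c #> a = c" if c: "c \<in> rcosets A" for c
  proof -
    obtain x where x: "x \<in> carrier G" "c = A #> x" using c by (auto simp: RCOSETS_def)
    have "c #> a = A #> a #> x" using x assms(4)[OF assms(5) x(1)] assms(5) by (simp add: coset_mult_assoc A.subset)
    then show ?thesis using x coset_join2[of a A] assms(2,5) by simp
  qed
  have "T.transfer a = finprod ?A (\<lambda>c. a) (rcosets A)"
    unfolding T.transfer_def
  proof (rule T.C.finprod_cong')
    show "(\<lambda>c. a) \<in> rcosets A \<rightarrow> carrier ?A" using assms(5) by auto
    fix c assume c: "c \<in> rcosets A"
    show "(SOME x. x \<in> c) \<otimes> a \<otimes> inv (SOME x. x \<in> c #> a) = a"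
      using same[OF c] T.rep_closed[OF c] assms(4)[OF assms(5) T.rep_closed[OF c]] assms(5) by (simp add: m_assoc flip: assms(4))
  qed simp
  also have "\<dots> = a [^]\<^bsub>?A\<^esub> card (rcosets A)" using assms(5) by (subst T.C.finprod_const) auto
  also have "\<dots> = a [^] card (rcosets A)" by (simp flip: nat_pow_consistent)
  finally show ?thesis using T.transfer_perfect[OF assms(1), of a] assms(5) by simp
qed

text \<open>By the hypothesis \<open>P\<close> translates the nontrivial cosets without fixed points. If the
  representatives are chosen compatibly with this translation, the nontrivial cosets contribute nothing to the
  transfer of an element of \<open>P\<close>, and the trivial coset contributes the element itself. The
  transfer being trivial, so is \<open>P\<close>.\<close>

lemma perfect_abelian_TI:
  assumes "derived G (carrier G) = carrier G" "subgroup P G" "finite (carrier G)"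
    "\<And>x y. x \<in> P \<Longrightarrow> y \<in> P \<Longrightarrow> x \<otimes> y = y \<otimes> x"
    "\<And>g x. g \<in> carrier G \<Longrightarrow> g \<notin> P \<Longrightarrow> x \<in> P \<Longrightarrow> cj g x \<in> P \<Longrightarrow> x = \<one>"
  shows "P = {\<one>}"
proof -
  interpret P: subgroup P G by fact
  define orb where "orb c = {c #> y | y. y \<in> P}" for c
  define base where "base c = (SOME d. d \<in> orb c)" for c
  define off where "off c = (THE y. y \<in> P \<and> base c #> y = c)" for c
  define \<tau> where "\<tau> c = (if c = P then \<one> else (SOME x. x \<in> base c) \<otimes> off c)" for c
  have cc: "c \<subseteq> carrier G" if "c \<in> rcosets P" for c using P.rcosets_carrier[OF is_group that] .
  have sh: "c #> y \<in> rcosets P" if "c \<in> rcosets P" "y \<in> P" for c y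
    using that by (auto simp: RCOSETS_def coset_mult_assoc P.subset intro!: exI bexI)
  have ac: "c #> y #> z = c #> (y \<otimes> z)" if "c \<in> rcosets P" "y \<in> P" "z \<in> P" for c y z
    using that cc by (simp add: coset_mult_assoc)
  have Pc: "P \<in> rcosets P" using P.subgroup_in_rcosets[OF is_group] .
  have Psh: "P #> y = P" if "y \<in> P" for y using coset_join2[OF _ assms(2)] that by simp
  have free: "y = z" if c: "c \<in> rcosets P" "c \<noteq> P" "y \<in> P" "z \<in> P" "c #> y = c #> z" for c y z
  proof -
    note that = c
    obtain x where x: "x \<in> carrier G" "c = P #> x" using c by (auto simp: RCOSETS_def)
    have "x \<notin> P" using x that(2) Psh by auto
    have "P #> x #> y #> inv z = P #> x #> z #> inv z" using that x by simp
    then have "P #> (x \<otimes> (y \<otimes> inv z)) = P #> x" using x that by (simp add: coset_mult_assoc P.subset word)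
    then have "P #> (x \<otimes> (y \<otimes> inv z)) #> inv x = P #> x #> inv x" by simp
    then have "P #> cj x (y \<otimes> inv z) = P" using x that by (simp add: coset_mult_assoc P.subset cj_def word)
    then have "cj x (y \<otimes> inv z) \<in> P" by (rule coset_join1) (use x that assms(2) in simp_all)
    then have "y \<otimes> inv z = \<one>" using assms(5)[OF x(1) \<open>x \<notin> P\<close>] that by simp
    then show ?thesis using that by (metis P.mem_carrier inv_equality inv_inv inv_closed)
  qed
  have orb_sh: "orb (c #> y) = orb c" if "c \<in> rcosets P" "y \<in> P" for c y
  proof -
    have 1: "c #> y #> z \<in> orb c" if "z \<in> P" for z using ac \<open>c \<in> rcosets P\<close> \<open>y \<in> P\<close> that by (auto simp: orb_def)
    have 2: "c #> z \<in> orb (c #> y)" if "z \<in> P" for z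
    proof -
      have "c #> z = c #> y #> (inv y \<otimes> z)" using ac[of c y "inv y \<otimes> z"] \<open>c \<in> rcosets P\<close> \<open>y \<in> P\<close> that by simp
      then show ?thesis using \<open>y \<in> P\<close> that unfolding orb_def by blast
    qed
    have "orb (c #> y) \<subseteq> orb c" using 1 unfolding orb_def[of "c #> y"] by auto
    moreover have "orb c \<subseteq> orb (c #> y)" using 2 unfolding orb_def[of c] by auto
    ultimately show ?thesis by (rule equalityI)
  qed
  have base: "base c \<in> orb c" "base c \<in> rcosets P" "base c \<noteq> P" "\<exists>y\<in>P. base c #> y = c" if "c \<in> rcosets P" "c \<noteq> P" for c
  proof -
    have "c #> \<one> \<in> orb c" unfolding orb_def mem_Collect_eq by (rule exI[of _ "\<one>"]) simp
    then show b: "base c \<in> orb c" unfolding base_def by (rule someI)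
    then obtain y where y: "y \<in> P" "base c = c #> y" by (auto simp: orb_def)
    show "base c \<in> rcosets P" using y sh that by simp
    have e: "base c #> inv y = c" using y ac[of c y "inv y"] cc that by simp
    then show "\<exists>y\<in>P. base c #> y = c" using y by blast
    show "base c \<noteq> P" using e Psh[of "inv y"] y that by auto
  qed
  have off: "off c \<in> P" "base c #> off c = c" if c: "c \<in> rcosets P" "c \<noteq> P" for c
  proof -
    have "\<exists>!y. y \<in> P \<and> base c #> y = c" using base(4)[OF c] free[OF base(2,3)[OF c]] by metis
    from theI'[OF this] show "off c \<in> P" "base c #> off c = c" unfolding off_def by auto
  qed
  have equi: "\<tau> (c #> y) = \<tau> c \<otimes> y" if c: "c \<in> rcosets P" "c \<noteq> P" "y \<in> P" for c y
  proof -
    have ne: "c #> y \<noteq> P"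
    proof
      assume "c #> y = P"
      then have "c #> y #> inv y = P" using Psh[of "inv y"] c(3) by simp
      then show False using ac[of c y "inv y"] cc[OF c(1)] c by simp
    qed
    have b: "base (c #> y) = base c" unfolding base_def using orb_sh c by simp
    have "base c #> off (c #> y) = base c #> (off c \<otimes> y)"
      using off[OF sh[OF c(1,3)] ne] b off[OF c(1,2)] ac[OF base(2)[OF c(1,2)], of "off c" y] c by simp
    then have "off (c #> y) = off c \<otimes> y"
      using free[OF base(2,3)[OF c(1,2)]] off[OF sh[OF c(1,3)] ne] off[OF c(1,2)] c(3) by simp
    moreover have "(SOME x. x \<in> base c) \<in> carrier G"
      using cc[OF base(2)[OF c(1,2)]] some_in_eq[of "base c"] base(2)[OF c(1,2)] P.rcosets_non_empty by blast
    ultimately show ?thesis using ne b c off[OF c(1,2)] by (simp add: \<tau>_def m_assoc)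
  qed
  have rep: "\<tau> c \<in> c" if c: "c \<in> rcosets P" for c
  proof (cases "c = P")
    case True then show ?thesis by (simp add: \<tau>_def)
  next
    case False
    have "(SOME x. x \<in> base c) \<in> base c" using base(2)[OF c False] P.rcosets_non_empty some_in_eq by blast
    then have "(SOME x. x \<in> base c) \<otimes> off c \<in> base c #> off c" by (auto simp: r_coset_def)
    then show ?thesis using off(2)[OF c False] False by (simp add: \<tau>_def)
  qed
  have fr: "finite (rcosets P)" using rcosets_finite assms(2,3) by (auto simp: RCOSETS_def)
  interpret T: transfer_setup G P \<tau> by unfold_locales (use assms(4) fr rep in auto)
  have "x = \<one>" if x: "x \<in> P" for x
  proof -
    let ?P = "G\<lparr>carrier := P\<rparr>"
    have i: "rcosets P = insert P (rcosets P - {P})" using Pc by auto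
    have one: "\<tau> c \<otimes> x \<otimes> inv (\<tau> (c #> x)) = \<one>" if "c \<in> rcosets P - {P}" for c
      using equi[of c x] that x T.rep_closed[of c] by simp
    have "T.transfer x = (\<tau> P \<otimes> x \<otimes> inv (\<tau> (P #> x))) \<otimes> finprod ?P (\<lambda>c. \<tau> c \<otimes> x \<otimes> inv (\<tau> (c #> x))) (rcosets P - {P})"
      unfolding T.transfer_def using T.factor_closed x fr Pc
      by (subst i, subst T.C.finprod_insert) auto
    also have "finprod ?P (\<lambda>c. \<tau> c \<otimes> x \<otimes> inv (\<tau> (c #> x))) (rcosets P - {P}) = \<one>"
      using T.C.finprod_one_eqI[of "rcosets P - {P}" "\<lambda>c. \<tau> c \<otimes> x \<otimes> inv (\<tau> (c #> x))"] one by auto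
    also have "\<tau> P \<otimes> x \<otimes> inv (\<tau> (P #> x)) = x" using Psh[OF x] x by (simp add: \<tau>_def)
    finally show ?thesis using T.transfer_perfect[OF assms(1)] x by simp
  qed
  then show ?thesis using P.one_closed by auto
qed

end

section \<open>Elements related by an automorphism\<close>

context group begin

text \<open>Automorphisms are arbitrary functions that restrict to automorphisms of the carrier. Conjugation by an
  element is then one of them as it stands.\<close>

definition aeq :: "'a \<Rightarrow> 'a \<Rightarrow> bool" where "aeq x y \<longleftrightarrow> (\<exists>\<phi>\<in>iso G G. \<phi> x = y)"

lemma iso_hom: "\<phi> \<in> iso G G \<Longrightarrow> group_hom G G \<phi>"
  by unfold_locales (auto simp: iso_def)

lemma iso_bij: "\<phi> \<in> iso G G \<Longrightarrow> bij_betw \<phi> (carrier G) (carrier G)"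
  by (simp add: iso_def)

lemma iso_closed: "\<phi> \<in> iso G G \<Longrightarrow> x \<in> carrier G \<Longrightarrow> \<phi> x \<in> carrier G"
  by (meson bij_betwE iso_bij)

lemma iso_inj: "\<phi> \<in> iso G G \<Longrightarrow> x \<in> carrier G \<Longrightarrow> y \<in> carrier G \<Longrightarrow> \<phi> x = \<phi> y \<longleftrightarrow> x = y"
  by (meson bij_betw_def inj_on_eq_iff iso_bij)

lemma iso_mult: "\<phi> \<in> iso G G \<Longrightarrow> x \<in> carrier G \<Longrightarrow> y \<in> carrier G \<Longrightarrow> \<phi> (x \<otimes> y) = \<phi> x \<otimes> \<phi> y"
  by (simp add: iso_def hom_mult)

lemma iso_one: "\<phi> \<in> iso G G \<Longrightarrow> \<phi> \<one> = \<one>"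
  using group_hom.hom_one[OF iso_hom] .

lemma iso_cj: "\<phi> \<in> iso G G \<Longrightarrow> g \<in> carrier G \<Longrightarrow> x \<in> carrier G \<Longrightarrow> \<phi> (cj g x) = cj (\<phi> g) (\<phi> x)"
  unfolding cj_def using group_hom.hom_inv[OF iso_hom] by (simp add: iso_mult)

lemma iso_pow: "\<phi> \<in> iso G G \<Longrightarrow> x \<in> carrier G \<Longrightarrow> \<phi> (x [^] (n::nat)) = \<phi> x [^] n"
  using group_hom.hom_nat_pow[OF iso_hom] .

lemma iso_ord: assumes "\<phi> \<in> iso G G" "x \<in> carrier G" shows "ord (\<phi> x) = ord x"
proof -
  have "\<phi> x [^] n = \<one> \<longleftrightarrow> ord x dvd n" for n :: nat
  proof -
    have "\<phi> x [^] n = \<one> \<longleftrightarrow> \<phi> (x [^] n) = \<phi> \<one>" using assms by (simp add: iso_pow iso_one)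
    also have "\<dots> \<longleftrightarrow> x [^] n = \<one>" using assms by (simp add: iso_inj)
    also have "\<dots> \<longleftrightarrow> ord x dvd n" using assms(2) by (rule pow_eq_id)
    finally show ?thesis .
  qed
  then show ?thesis using ord_unique[of "\<phi> x"] iso_closed[OF assms] by simp
qed

lemma iso_card: "\<phi> \<in> iso G G \<Longrightarrow> S \<subseteq> carrier G \<Longrightarrow> card (\<phi> ` S) = card S"
  by (meson bij_betw_def card_image inj_on_subset iso_bij)

lemma iso_mem: "\<phi> \<in> iso G G \<Longrightarrow> S \<subseteq> carrier G \<Longrightarrow> x \<in> carrier G \<Longrightarrow> \<phi> x \<in> \<phi> ` S \<longleftrightarrow> x \<in> S"
  using iso_inj[of \<phi>] by (auto simp: subset_eq)

lemma iso_surj: assumes "\<phi> \<in> iso G G" "y \<in> carrier G" shows "\<exists>x\<in>carrier G. y = \<phi> x"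
  using iso_bij[OF assms(1)] assms(2) unfolding bij_betw_def by auto

lemma iso_subgroup: "\<phi> \<in> iso G G \<Longrightarrow> subgroup H G \<Longrightarrow> subgroup (\<phi> ` H) G"
  using group_hom.subgroup_img_is_subgroup[OF iso_hom] .

lemma iso_image_closed: "\<phi> \<in> iso G G \<Longrightarrow> S \<subseteq> carrier G \<Longrightarrow> \<phi> ` S \<subseteq> carrier G"
  using iso_closed by auto

lemma iso_image_eqI:
  assumes "\<phi> \<in> iso G G" "A \<subseteq> carrier G" "B \<subseteq> carrier G" "\<And>x. x \<in> carrier G \<Longrightarrow> \<phi> x \<in> A \<longleftrightarrow> x \<in> B"
  shows "A = \<phi> ` B"
proof
  show "A \<subseteq> \<phi> ` B"
  proof
    fix y assume y: "y \<in> A"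
    then obtain x where "x \<in> carrier G" "y = \<phi> x" using iso_surj[OF assms(1)] assms(2) by blast
    then show "y \<in> \<phi> ` B" using assms(4)[of x] y by auto
  qed
  show "\<phi> ` B \<subseteq> A" using assms(3,4) by auto
qed

lemma iso_cen: assumes "\<phi> \<in> iso G G" "S \<subseteq> carrier G" shows "cen (\<phi> ` S) = \<phi> ` cen S"
proof -
  have "\<phi> x \<in> cen (\<phi> ` S) \<longleftrightarrow> x \<in> cen S" if x: "x \<in> carrier G" for x
  proof -
    have "\<phi> x \<otimes> \<phi> s = \<phi> s \<otimes> \<phi> x \<longleftrightarrow> x \<otimes> s = s \<otimes> x" if "s \<in> S" for s
    proof -
      have s: "s \<in> carrier G" using that assms(2) by auto
      show ?thesis using iso_mult[OF assms(1), of x s] iso_mult[OF assms(1), of s x]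
          iso_inj[OF assms(1), of "x \<otimes> s" "s \<otimes> x"] x s by simp
    qed
    then show ?thesis using x iso_closed[OF assms(1) x] by (simp add: cen_def)
  qed
  then show ?thesis by (intro iso_image_eqI[OF assms(1)] cen_sub)
qed

lemma iso_nor: assumes "\<phi> \<in> iso G G" "S \<subseteq> carrier G" shows "nor (\<phi> ` S) = \<phi> ` nor S"
proof -
  have "\<phi> x \<in> nor (\<phi> ` S) \<longleftrightarrow> x \<in> nor S" if x: "x \<in> carrier G" for x
  proof -
    have e: "cj (\<phi> x) ` \<phi> ` S = \<phi> ` cj x ` S"
      unfolding image_image using assms x iso_cj[OF assms(1) x] by (intro image_cong) auto
    have "inj_on \<phi> (carrier G)" using iso_bij[OF assms(1)] by (simp add: bij_betw_def)
    then have "\<phi> ` cj x ` S = \<phi> ` S \<longleftrightarrow> cj x ` S = S"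
      using assms(2) cj_image_closed[OF x assms(2)] by (simp add: inj_on_image_eq_iff)
    then show ?thesis using x iso_closed[OF assms(1) x] e by (simp add: nor_def)
  qed
  moreover have "nor (\<phi> ` S) \<subseteq> carrier G" "nor S \<subseteq> carrier G" by (auto simp: nor_def)
  ultimately show ?thesis by (intro iso_image_eqI[OF assms(1)])
qed

lemma iso_syl: assumes "\<phi> \<in> iso G G" "P \<in> syl (carrier G) p" shows "\<phi> ` P \<in> syl (carrier G) p"
  using iso_subgroup[OF assms(1) sylD(1)[OF assms(2)]] iso_card[OF assms(1) syl_carrier[OF assms(2)]]
    iso_image_closed[OF assms(1) syl_carrier[OF assms(2)]] sylD(3)[OF assms(2)] by (simp add: syl_def)

lemma iso_syl_image: assumes "\<phi> \<in> iso G G" "finite (carrier G)"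
  shows "(`) \<phi> ` syl (carrier G) p = syl (carrier G) p" "inj_on ((`) \<phi>) (syl (carrier G) p)"
proof -
  show i: "inj_on ((`) \<phi>) (syl (carrier G) p)"
    using iso_bij[OF assms(1)] syl_carrier unfolding bij_betw_def
    by (intro inj_onI) (metis inj_on_image_eq_iff)
  show "(`) \<phi> ` syl (carrier G) p = syl (carrier G) p"
    by (rule card_subset_eq[OF finite_syl[OF assms(2)]]) (use iso_syl[OF assms(1)] card_image[OF i] in auto)
qed

lemma cj_iso: assumes "g \<in> carrier G" shows "cj g \<in> iso G G"
proof -
  have "cj g ` carrier G = carrier G"
  proof
    show "carrier G \<subseteq> cj g ` carrier G"
    proof
      fix y assume "y \<in> carrier G"
      then have "y = cj g (cj (inv g) y)" "cj (inv g) y \<in> carrier G" using assms by simp_all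
      then show "y \<in> cj g ` carrier G" by blast
    qed
  qed (use assms in auto)
  then show ?thesis using assms cj_hom[OF assms] inj_cj[OF assms] by (simp add: iso_def bij_betw_def)
qed

lemma aeq_refl: "aeq x x" unfolding aeq_def by (rule bexI[OF _ iso_set_refl]) simp
lemma aeq_cj: "g \<in> carrier G \<Longrightarrow> aeq x (cj g x)" unfolding aeq_def using cj_iso by blast
lemma aeq_trans: "aeq x y \<Longrightarrow> aeq y z \<Longrightarrow> aeq x z"
  unfolding aeq_def using iso_set_trans by (metis comp_apply)
lemma aeq_sym: "aeq x y \<Longrightarrow> x \<in> carrier G \<Longrightarrow> aeq y x"
  unfolding aeq_def using iso_set_sym iso_bij by (metis bij_betw_def inv_into_f_f)
lemma aeq_ord: "aeq x y \<Longrightarrow> x \<in> carrier G \<Longrightarrow> ord y = ord x"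
  unfolding aeq_def using iso_ord by auto
lemma aeq_card_cen: "aeq x y \<Longrightarrow> x \<in> carrier G \<Longrightarrow> card (cen {y}) = card (cen {x})"
  unfolding aeq_def using iso_cen[of _ "{x}"] iso_card[of _ "cen {x}"] cen_sub by auto

lemma nor_cj: "g \<in> carrier G \<Longrightarrow> H \<subseteq> carrier G \<Longrightarrow> nor (cj g ` H) = cj g ` nor H"
  by (rule iso_nor[OF cj_iso])

lemma card_center_cj:
  assumes "g \<in> carrier G" "P \<subseteq> carrier G" shows "card (cj g ` P \<inter> cen (cj g ` P)) = card (P \<inter> cen P)"
proof -
  have "cj g ` P \<inter> cen (cj g ` P) = cj g ` (P \<inter> cen P)"
    using cen_cj[OF assms] inj_on_image_Int[OF inj_cj[OF assms(1)] assms(2) cen_sub] by simp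
  then show ?thesis using card_cj[OF assms(1), of "P \<inter> cen P"] assms(2) by auto
qed

text \<open>The center is properly contained in the centralizer of \<open>x\<close>, which is properly contained in
  \<open>P\<close>.\<close>

lemma nonabelian_center_index:
  assumes "subgroup P G" "finite P" "x \<in> P" "y \<in> P" "x \<otimes> y \<noteq> y \<otimes> x"
  shows "4 * card (P \<inter> cen P) \<le> card P"
proof -
  interpret P: subgroup P G by fact
  have s1: "subgroup (P \<inter> cen P) G" and s2: "subgroup (P \<inter> cen {x}) G"
    using assms(1,3) P.subset by (auto intro!: subgroup_Int subgroup_cen)
  have double: "2 * card A \<le> card B" if "subgroup A G" "subgroup B G" "A \<subset> B" "finite B" for A B
  proof -
    have d: "card A dvd card B" using that by (intro card_subgroup_dvd) auto
    then obtain k where k: "card B = card A * k" by auto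
    have "card A < card B" using that by (intro psubset_card_mono) auto
    then have "k \<noteq> 0" "k \<noteq> 1" using k by auto
    then have "k \<ge> 2" by linarith
    then show ?thesis using k by simp
  qed
  have "x \<in> P \<inter> cen {x}" using assms(3) by (auto simp: cen_def)
  moreover have "x \<notin> P \<inter> cen P" using assms(3-5) by (auto simp: cen_def)
  moreover have "P \<inter> cen P \<subseteq> P \<inter> cen {x}" using assms(3) by (auto simp: cen_def)
  ultimately have "2 * card (P \<inter> cen P) \<le> card (P \<inter> cen {x})" using s1 s2 assms(2) by (intro double) auto
  moreover have "y \<notin> P \<inter> cen {x}" using assms by (auto simp: cen_def)
  then have "2 * card (P \<inter> cen {x}) \<le> card P" using s2 assms by (intro double) auto
  ultimately show ?thesis by simp
qed

lemma prime_power_of_order: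
  assumes "x \<in> carrier G" "prime q" "q dvd ord x" "ord x \<noteq> 0" shows "ord (x [^] (ord x div q)) = q"
proof -
  have "ord x div q dvd ord x" using assms(3) by (metis dvd_div_mult_self dvd_triv_left)
  moreover have "ord x div q \<noteq> 0" using assms(2-4) by (metis dvd_div_eq_0_iff)
  ultimately show ?thesis using ord_pow[OF assms(1), of "ord x div q"] assms(2-4)
    by (metis dvd_div_mult_self nonzero_mult_div_cancel_left)
qed

end

section \<open>A prime whose elements have centralizers of prime power order\<close>

text \<open>The last hypothesis says that an element of order \<open>p\<close> commutes with no element of another prime
  order. The centralizer of every nontrivial \<open>p\<close>-element is then a \<open>p\<close>-group, and it
  is a Sylow subgroup if and only if the element is central in a Sylow subgroup.\<close>

locale p_local = group +
  fixes p i m :: nat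
  assumes prime_p: "prime p" and order_pm: "order G = p ^ i * m" and p_ndvd: "\<not> p dvd m" and i_pos: "i > 0"
    and cen_p: "\<And>x. x \<in> carrier G \<Longrightarrow> ord x = p \<Longrightarrow> \<exists>k. card (cen {x}) = p ^ k"
begin

lemma p_pos: "p > 0" and m_pos: "m > 0"
  using prime_p p_ndvd by (auto simp: prime_gt_0_nat intro!: Nat.gr0I)

lemma fin: "finite (carrier G)"
  using order_pm p_pos m_pos order_gt_0_iff_finite by simp

lemma finite_sub: "subgroup H G \<Longrightarrow> finite H"
  using fin finite_subset subgroup.subset by metis

lemma mult_p: "multiplicity p (order G) = i"
  using prime_p p_ndvd m_pos p_pos unfolding order_pm
  by (simp add: prime_elem_multiplicity_mult_distrib not_dvd_imp_multiplicity_0)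

lemma card_Sp: "P \<in> syl (carrier G) p \<Longrightarrow> card P = p ^ i"
  using sylD(3)[of P "carrier G" p] mult_p by (simp add: order_def)

lemma Sp_ex: "\<exists>P. P \<in> syl (carrier G) p" using syl_nonempty[OF subgroup_self fin prime_p] .

lemma ord_pos: "x \<in> carrier G \<Longrightarrow> ord x \<noteq> 0"
  using ord_dvd_card[OF subgroup_self fin] fin by (metis card_0_eq dvd_0_left_iff empty_iff)

definition Ep where "Ep = {x \<in> carrier G. x \<noteq> \<one> \<and> (\<exists>k. ord x = p ^ k)}"

lemma p_subgroup_mem: assumes "subgroup P G" "card P = p ^ k" "x \<in> P" "x \<noteq> \<one>" shows "x \<in> Ep"
  using ord_dvd_card[OF assms(1) finite_sub[OF assms(1)] assms(3)] assms divides_primepow_nat[OF prime_p] subgroup.mem_carrier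
  by (fastforce simp: Ep_def)

lemma subgroup_cen1: "x \<in> carrier G \<Longrightarrow> subgroup (cen {x}) G" by (intro subgroup_cen) auto

lemma cen_pgroup: assumes "x \<in> Ep" shows "\<exists>k. card (cen {x}) = p ^ k"
proof -
  have x: "x \<in> carrier G" "x \<noteq> \<one>" using assms by (auto simp: Ep_def)
  obtain k where k: "ord x = p ^ k" using assms by (auto simp: Ep_def)
  have "k \<noteq> 0" using k x ord_eq_1[of x] by (intro notI) simp
  then have o: "ord (x [^] (ord x div p)) = p" using prime_power_of_order[OF x(1) prime_p] k ord_pos[OF x(1)] by simp
  define y where "y = x [^] (ord x div p)"
  have y: "y \<in> carrier G" "ord y = p" using x o by (simp_all add: y_def)
  have "cen {x} \<subseteq> cen {y}"
  proof
    fix g assume g: "g \<in> cen {x}"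
    then have gc: "g \<in> carrier G" by (simp add: cen_def)
    have "cj g x = x" using g x gc by (simp add: cen_def cj_fix_iff)
    then have "cj g y = y" unfolding y_def using gc x by (simp add: cj_pow)
    then show "g \<in> cen {y}" using gc y by (simp add: cen_def cj_fix_iff)
  qed
  moreover obtain l where "card (cen {y}) = p ^ l" using cen_p[OF y] by auto
  ultimately have "card (cen {x}) dvd p ^ l"
    using card_subgroup_dvd[OF subgroup_cen1[OF x(1)] subgroup_cen1[OF y(1)] _ finite_sub[OF subgroup_cen1[OF y(1)]]] by simp
  then show ?thesis using divides_primepow_nat[OF prime_p] by blast
qed

lemma Ep_in_syl: assumes "subgroup K G" "x \<in> Ep" "x \<in> K" shows "\<exists>P\<in>syl K p. x \<in> P"
  using assms elt_in_syl[OF assms(1) finite_sub[OF assms(1)] prime_p] by (auto simp: Ep_def)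

lemma Ep_eq: "Ep = (\<Union>P\<in>syl (carrier G) p. P - {\<one>})"
proof
  show "Ep \<subseteq> (\<Union>P\<in>syl (carrier G) p. P - {\<one>})"
  proof
    fix x assume x: "x \<in> Ep"
    then have "x \<in> carrier G" "x \<noteq> \<one>" by (auto simp: Ep_def)
    then show "x \<in> (\<Union>P\<in>syl (carrier G) p. P - {\<one>})" using Ep_in_syl[OF subgroup_self x] by blast
  qed
  show "(\<Union>P\<in>syl (carrier G) p. P - {\<one>}) \<subseteq> Ep" using p_subgroup_mem[OF sylD(1) sylD(3)] by blast
qed

lemma cen_below_syl: assumes "x \<in> Ep" shows "\<exists>P\<in>syl (carrier G) p. cen {x} \<subseteq> P"
proof -
  have x: "x \<in> carrier G" using assms by (simp add: Ep_def)
  obtain k where k: "card (cen {x}) = p ^ k" using cen_pgroup[OF assms] by auto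
  obtain P where P: "P \<in> syl (carrier G) p" using Sp_ex by auto
  obtain g where "g \<in> carrier G" "cen {x} \<subseteq> cj g ` P"
    using pgroup_in_syl[OF subgroup_self fin prime_p P subgroup_cen1[OF x] cen_sub k] by auto
  then show ?thesis using syl_cj[OF P _ subgroup_self] by auto
qed

lemma count_Sp: "P \<in> syl (carrier G) p \<Longrightarrow> card (syl (carrier G) p) * card (nor P) = p ^ i * m"
  using card_syl[OF subgroup_self fin prime_p, of P] order_pm subgroup.subset[OF subgroup_nor[OF syl_carrier]]
  by (auto simp: order_def Int_absorb2)

text \<open>The normalizer contains the Sylow subgroup with an index of at least \<open>q\<close>, so there are at most
  \<open>m / q\<close> Sylow subgroups to hold the \<open>p\<close>-elements.\<close>

lemma count_Ep_nonselfnormal: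
  assumes "P \<in> syl (carrier G) p" "nor P \<noteq> P" "\<And>d. d dvd m \<Longrightarrow> d \<noteq> 1 \<Longrightarrow> q \<le> d"
  shows "q * card Ep \<le> m * (p ^ i - 1)"
proof -
  have s: "subgroup P G" by (rule sylD[OF assms(1)])
  have sn: "subgroup (nor P) G" by (rule subgroup_nor[OF syl_carrier[OF assms(1)]])
  have "card P dvd card (nor P)" using subgroup_sub_nor[OF s] by (intro card_subgroup_dvd s sn finite_sub) auto
  then obtain k where k: "card (nor P) = card P * k" by auto
  have "P \<subset> nor P" using subgroup_sub_nor[OF s] assms(2) by auto
  then have "card P < card (nor P)" using finite_sub[OF sn] by (intro psubset_card_mono) auto
  then have "k \<noteq> 1" using k by auto
  have "card (syl (carrier G) p) * (p ^ i * k) = p ^ i * m" using count_Sp[OF assms(1)] k card_Sp[OF assms(1)] by simp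
  then have "p ^ i * (card (syl (carrier G) p) * k) = p ^ i * m" by (simp add: ac_simps)
  then have e: "card (syl (carrier G) p) * k = m" using p_pos by simp
  then have "k dvd m" by (metis dvd_triv_right)
  then have "q \<le> k" using assms(3) \<open>k \<noteq> 1\<close> by simp
  then have n: "q * card (syl (carrier G) p) \<le> m" using e by (metis mult.commute mult_le_mono2)
  have "card Ep \<le> (\<Sum>P\<in>syl (carrier G) p. card (P - {\<one>}))"
    unfolding Ep_eq by (rule card_UN_le[OF finite_syl[OF fin]])
  also have "\<dots> = (\<Sum>P\<in>syl (carrier G) p. p ^ i - 1)"
    using card_Sp subgroup.one_closed[OF sylD(1)] by (intro sum.cong refl) (simp add: card_Diff_singleton)
  also have "\<dots> = card (syl (carrier G) p) * (p ^ i - 1)" by simp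
  finally have "q * card Ep \<le> (q * card (syl (carrier G) p)) * (p ^ i - 1)" by simp
  also have "\<dots> \<le> m * (p ^ i - 1)" using n by (rule mult_le_mono1)
  finally show ?thesis .
qed

lemma card_Sp_selfnormal: assumes "P \<in> syl (carrier G) p" "nor P = P" shows "card (syl (carrier G) p) = m"
  using count_Sp[OF assms(1)] card_Sp[OF assms(1)] assms(2) p_pos by simp

lemma selfnormal_all:
  assumes "P \<in> syl (carrier G) p" "nor P = P" "P' \<in> syl (carrier G) p" shows "nor P' = P'"
proof -
  obtain g where g: "g \<in> carrier G" "P' = cj g ` P" using syl_conj[OF subgroup_self fin prime_p assms(1,3)] by auto
  then show ?thesis using nor_cj[OF g(1) syl_carrier[OF assms(1)]] assms(2) by simp
qed

lemma cen_syl_unique: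
  assumes "x \<in> Ep" "card (cen {x}) = p ^ i" "P \<in> syl (carrier G) p" "x \<in> cen P" shows "P = cen {x}"
proof -
  have x: "x \<in> carrier G" using assms(1) by (simp add: Ep_def)
  have "P \<subseteq> cen {x}" using assms(4) syl_carrier[OF assms(3)] by (auto simp: cen_def)
  then show ?thesis using card_subset_eq[OF finite_sub[OF subgroup_cen1[OF x]]] card_Sp[OF assms(3)] assms(2) by auto
qed

lemma cen_in_syl: assumes "x \<in> Ep" "card (cen {x}) = p ^ i" shows "cen {x} \<in> syl (carrier G) p"
proof -
  have x: "x \<in> carrier G" using assms(1) by (simp add: Ep_def)
  then show ?thesis using subgroup_cen1[OF x] cen_sub assms(2) mult_p by (simp add: syl_def order_def)
qed

text \<open>An element whose centralizer has order \<open>p ^ i\<close> is central in that centralizer and in no other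
  Sylow subgroup, so the centers of the Sylow subgroups partition \<open>T\<close>.\<close>

lemma card_central_blocks:
  assumes "T \<subseteq> Ep" "\<And>x. x \<in> T \<Longrightarrow> card (cen {x}) = p ^ i"
    "\<And>P. P \<in> syl (carrier G) p \<Longrightarrow> P \<inter> cen P - {\<one>} \<subseteq> T" "P \<in> syl (carrier G) p"
  shows "card T = card (syl (carrier G) p) * (card (P \<inter> cen P) - 1)"
proof -
  have "T = (\<Union>P\<in>syl (carrier G) p. P \<inter> cen P - {\<one>})"
  proof
    show "T \<subseteq> (\<Union>P\<in>syl (carrier G) p. P \<inter> cen P - {\<one>})"
    proof
      fix x assume x: "x \<in> T"
      then have E: "x \<in> Ep" using assms(1) by auto
      then have "x \<in> cen {x} \<inter> cen (cen {x}) - {\<one>}" by (auto simp: Ep_def cen_def)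
      then show "x \<in> (\<Union>P\<in>syl (carrier G) p. P \<inter> cen P - {\<one>})" using cen_in_syl[OF E assms(2)[OF x]] by auto
    qed
  qed (use assms(3) in auto)
  then have "card T = (\<Sum>P\<in>syl (carrier G) p. card (P \<inter> cen P - {\<one>}))"
  proof (simp only:, intro card_UN_disjoint ballI impI)
    show "finite (syl (carrier G) p)" by (rule finite_syl[OF fin])
    fix P1 assume P1: "P1 \<in> syl (carrier G) p"
    show "finite (P1 \<inter> cen P1 - {\<one>})" using finite_sub[OF sylD(1)[OF P1]] by auto
    fix P2 assume P2: "P2 \<in> syl (carrier G) p" "P1 \<noteq> P2"
    show "(P1 \<inter> cen P1 - {\<one>}) \<inter> (P2 \<inter> cen P2 - {\<one>}) = {}"
    proof (rule ccontr)
      assume "\<not> ?thesis"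
      then obtain x where x: "x \<in> P1 \<inter> cen P1 - {\<one>}" "x \<in> P2 \<inter> cen P2 - {\<one>}" by auto
      then have "x \<in> T" using assms(3)[OF P1] by auto
      then have "P1 = cen {x}" "P2 = cen {x}" using cen_syl_unique[OF _ assms(2)] assms(1) x P1 P2 by auto
      then show False using P2 by simp
    qed
  qed
  also have "\<dots> = (\<Sum>P'\<in>syl (carrier G) p. card (P \<inter> cen P) - 1)"
  proof (intro sum.cong refl)
    fix P' assume P': "P' \<in> syl (carrier G) p"
    obtain g where "g \<in> carrier G" "P' = cj g ` P" using syl_conj[OF subgroup_self fin prime_p assms(4) P'] by auto
    then have "card (P' \<inter> cen P') = card (P \<inter> cen P)" using card_center_cj[of g P] syl_carrier[OF assms(4)] by simp
    moreover have "\<one> \<in> P' \<inter> cen P'"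
      using subgroup.one_closed[OF subgroup_Int[OF sylD(1)[OF P'] subgroup_cen[OF syl_carrier[OF P']]]] .
    ultimately show "card (P' \<inter> cen P' - {\<one>}) = card (P \<inter> cen P) - 1" by (simp add: card_Diff_singleton)
  qed
  finally show ?thesis by simp
qed

lemma central_card:
  assumes "P \<in> syl (carrier G) p" "z \<in> P \<inter> cen P" "z \<noteq> \<one>" shows "card (cen {z}) = p ^ i" "z \<in> Ep"
proof -
  show z: "z \<in> Ep" using p_subgroup_mem[OF sylD(1)[OF assms(1)] card_Sp[OF assms(1)]] assms by auto
  then have zc: "z \<in> carrier G" by (simp add: Ep_def)
  obtain P' where P': "P' \<in> syl (carrier G) p" "cen {z} \<subseteq> P'" using cen_below_syl[OF z] by auto
  have "P \<subseteq> cen {z}" using assms(2) syl_carrier[OF assms(1)] by (auto simp: cen_def)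
  then have "card P \<le> card (cen {z})" using finite_sub[OF subgroup_cen1[OF zc]] by (intro card_mono)
  moreover have "card (cen {z}) \<le> card P'" using P' finite_sub[OF sylD(1)[OF P'(1)]] by (intro card_mono)
  ultimately show "card (cen {z}) = p ^ i" using card_Sp assms(1) P'(1) by simp
qed

lemma center_ex: assumes "P \<in> syl (carrier G) p" shows "\<exists>z. z \<in> P \<inter> cen P \<and> z \<noteq> \<one>"
proof -
  have s: "subgroup P G" by (rule sylD[OF assms])
  have "card P \<noteq> 1" using card_Sp[OF assms] i_pos prime_gt_1_nat[OF prime_p] by simp
  then have "P \<noteq> {\<one>}" by auto
  then obtain z where z: "z \<in> P" "z \<noteq> \<one>" "\<forall>l\<in>P. cj l z = z"
    using pgroup_fixed_element[OF s card_Sp[OF assms] prime_p s card_Sp[OF assms]] subgroup_sub_nor[OF s] norD by blast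
  moreover have "z \<in> cen P" using z syl_carrier[OF assms] by (auto simp: cen_def cj_fix_iff subset_eq)
  ultimately show ?thesis by blast
qed

text \<open>Some \<open>p\<close>-element is central in a Sylow subgroup, and the orders of centralizers are constant on
  a type.\<close>

lemma single_type_central:
  assumes "\<forall>x\<in>Ep. \<forall>y\<in>Ep. aeq x y" "x \<in> Ep" shows "card (cen {x}) = p ^ i"
proof -
  obtain P where P: "P \<in> syl (carrier G) p" using Sp_ex by auto
  obtain z where z: "z \<in> P \<inter> cen P" "z \<noteq> \<one>" using center_ex[OF P] by auto
  note c = central_card[OF P z]
  have "aeq z x" using assms c(2) by auto
  then show ?thesis using aeq_card_cen[of z x] c by (simp add: Ep_def)
qed

lemma Ep_nonempty: "\<exists>x. x \<in> Ep"
proof -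
  obtain P where P: "P \<in> syl (carrier G) p" using Sp_ex by auto
  obtain z where z: "z \<in> P \<inter> cen P" "z \<noteq> \<one>" using center_ex[OF P] by auto
  show ?thesis using central_card(2)[OF P z] by auto
qed

text \<open>Both Sylow subgroups lie in the centralizer of \<open>d\<close>, which is a \<open>p\<close>-group.\<close>

lemma abelian_meet_eq:
  assumes "P \<in> syl (carrier G) p" "P' \<in> syl (carrier G) p" "d \<in> P" "d \<in> P'" "d \<noteq> \<one>"
    "\<And>x. x \<in> P \<Longrightarrow> x \<otimes> d = d \<otimes> x" "\<And>x. x \<in> P' \<Longrightarrow> x \<otimes> d = d \<otimes> x"
  shows "P = P'"
proof -
  have "d \<in> P \<inter> cen P" "d \<in> P' \<inter> cen P'" using assms syl_carrier[OF assms(1)] by (auto simp: cen_def)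
  then show ?thesis using cen_syl_unique[OF central_card(2,1)[OF assms(1) _ assms(5)]] assms(1,2) by (metis IntD2)
qed

text \<open>If the Sylow subgroups were abelian, \<open>P1\<close> and \<open>P2\<close> would coincide; so they are
  nonabelian.\<close>

lemma nonTI_center_small:
  assumes "P1 \<in> syl (carrier G) p" "P2 \<in> syl (carrier G) p" "P1 \<noteq> P2" "P1 \<inter> P2 \<noteq> {\<one>}" "P \<in> syl (carrier G) p"
  shows "4 * card (P \<inter> cen P) \<le> p ^ i"
proof -
  have "\<one> \<in> P1 \<inter> P2" using subgroup.one_closed sylD(1) assms(1,2) by blast
  then obtain d where d: "d \<in> P1" "d \<in> P2" "d \<noteq> \<one>" using assms(4) by auto
  have "\<exists>P'\<in>syl (carrier G) p. \<exists>x\<in>P'. \<exists>y\<in>P'. x \<otimes> y \<noteq> y \<otimes> x"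
    using abelian_meet_eq[OF assms(1,2) d] assms(1-3) d by metis
  then obtain P' x y where P': "P' \<in> syl (carrier G) p" "x \<in> P'" "y \<in> P'" "x \<otimes> y \<noteq> y \<otimes> x" by blast
  have "4 * card (P' \<inter> cen P') \<le> card P'"
    using nonabelian_center_index[OF sylD(1)[OF P'(1)] finite_sub[OF sylD(1)[OF P'(1)]] P'(2-4)] .
  moreover obtain g where "g \<in> carrier G" "P = cj g ` P'" using syl_conj[OF subgroup_self fin prime_p P'(1) assms(5)] by auto
  then have "card (P \<inter> cen P) = card (P' \<inter> cen P')" using card_center_cj[of g P'] syl_carrier[OF P'(1)] by simp
  ultimately show ?thesis using card_Sp[OF P'(1)] by simp
qed

end

section \<open>Two primes without commuting elements\<close>

locale pr_group = group +
  fixes p r i j :: nat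
  assumes perfect: "derived G (carrier G) = carrier G"
    and prime_p: "prime p" and prime_r: "prime r" and p_ne_r: "p \<noteq> r"
    and order_eq: "order G = p ^ i * r ^ j"
    and nontrivial: "carrier G \<noteq> {\<one>}"
    and no_commuting: "\<And>x y. x \<in> carrier G \<Longrightarrow> y \<in> carrier G \<Longrightarrow> ord x = p \<Longrightarrow> ord y = r \<Longrightarrow> x \<otimes> y \<noteq> y \<otimes> x"
begin

lemma swap: "pr_group G r p j i"
proof unfold_locales
  show "x \<otimes> y \<noteq> y \<otimes> x" if "x \<in> carrier G" "y \<in> carrier G" "ord x = r" "ord y = p" for x y
    using no_commuting[OF that(2,1,4,3)] by metis
qed (use perfect prime_p prime_r p_ne_r order_eq nontrivial in \<open>simp_all add: mult.commute\<close>)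

lemma pos: "p > 0" "r > 0" using prime_p prime_r by (simp_all add: prime_gt_0_nat)

lemma ipos: "i > 0"
proof (rule ccontr)
  assume "\<not> i > 0" then have o: "order G = r ^ j" using order_eq by simp
  have "j > 0"
  proof (rule ccontr)
    assume "\<not> j > 0" then have "order G = 1" using o by simp
    then show False using nontrivial one_closed by (metis card_1_singletonE order_def singletonD)
  qed
  then show False using order_prime_power_not_perfect[OF o _ prime_r] perfect by simp
qed

sublocale p_local G p i "r ^ j"
proof
  show "\<not> p dvd r ^ j" using prime_p prime_r p_ne_r by (metis prime_dvd_power_nat primes_dvd_imp_eq)
  fix x assume x: "x \<in> carrier G" "ord x = p"
  have fin: "finite (carrier G)" using order_eq pos order_gt_0_iff_finite by simp
  have s: "subgroup (cen {x}) G" using x by (intro subgroup_cen) auto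
  have f: "finite (cen {x})" using fin cen_sub finite_subset by metis
  show "\<exists>k. card (cen {x}) = p ^ k"
  proof (rule pgroup_card[OF s f prime_p])
    fix y q assume y: "y \<in> cen {x}" "prime q" "ord y = q"
    have yc: "y \<in> carrier G" using y cen_sub by auto
    have "q dvd p ^ i * r ^ j" using ord_dvd_card[OF subgroup_self fin yc] y(3) order_eq by (simp add: order_def)
    then have "q = p \<or> q = r" using y(2) prime_p prime_r
      by (metis prime_dvd_mult_iff prime_dvd_power_nat primes_dvd_imp_eq)
    moreover have "x \<otimes> y = y \<otimes> x" using y(1) by (simp add: cen_def)
    ultimately show "q = p" using no_commuting[OF x(1) yc x(2)] y(3) by auto
  qed
qed (use prime_p order_eq ipos in auto)

lemma card_subgroup: assumes "subgroup H G" shows "\<exists>a e. card H = p ^ a * r ^ e"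
proof -
  have "card H dvd p ^ i * r ^ j"
    using card_subgroup_dvd[OF assms subgroup_self subgroup.subset[OF assms] fin] order_eq by (simp add: order_def)
  then obtain u v where "card H = u * v" "u dvd p ^ i" "v dvd r ^ j" using division_decomp by blast
  moreover obtain a where "u = p ^ a" using \<open>u dvd p ^ i\<close> divides_primepow_nat[OF prime_p] by auto
  moreover obtain e where "v = r ^ e" using \<open>v dvd r ^ j\<close> divides_primepow_nat[OF prime_r] by auto
  ultimately show ?thesis by auto
qed

lemma two_le: assumes "d dvd r ^ j" "d \<noteq> 1" shows "(2::nat) \<le> d"
proof -
  have "d \<noteq> 0" using assms(1) m_pos by (intro notI) simp
  then show ?thesis using assms(2) by linarith
qed

lemma mult_pr: "multiplicity p (p ^ a * r ^ e) = a" "multiplicity r (p ^ a * r ^ e) = e"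
  using prime_p prime_r p_ne_r pos
  by (simp_all add: prime_elem_multiplicity_mult_distrib multiplicity_distinct_prime_power)

lemma syl_card_prod: "subgroup H G \<Longrightarrow> S \<in> syl H p \<Longrightarrow> T \<in> syl H r \<Longrightarrow> card H = card S * card T"
  using card_subgroup[of H] sylD(3)[of S H p] sylD(3)[of T H r] mult_pr by auto

lemma card_Sr: "P \<in> syl (carrier G) r \<Longrightarrow> card P = r ^ j"
  using sylD(3)[of P "carrier G" r] order_eq mult_pr by (simp add: order_def)

lemma ord_cases: assumes "x \<in> carrier G" shows "(\<exists>k. ord x = p ^ k) \<or> (\<exists>k. ord x = r ^ k)"
proof (rule ccontr)
  assume n: "\<not> ?thesis"
  have "ord x dvd p ^ i * r ^ j" using ord_dvd_card[OF subgroup_self fin assms] order_eq by (simp add: order_def)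
  then obtain u v where uv: "ord x = u * v" "u dvd p ^ i" "v dvd r ^ j" using division_decomp by blast
  then obtain k l where "u = p ^ k" "v = r ^ l" using divides_primepow_nat[OF prime_p] divides_primepow_nat[OF prime_r] by blast
  then have kl: "ord x = p ^ k * r ^ l" using uv by simp
  have "k \<noteq> 0" using n kl by (metis mult_1 power_0)
  moreover have "l \<noteq> 0" using n kl by (metis mult.right_neutral power_0)
  ultimately have "p dvd ord x" "r dvd ord x" using kl by (auto simp: dvd_mult2 dvd_mult)
  then have "ord (x [^] (ord x div p)) = p" "ord (x [^] (ord x div r)) = r"
    using prime_power_of_order assms prime_p prime_r ord_pos by auto
  then have "x [^] (ord x div p) \<otimes> x [^] (ord x div r) \<noteq> x [^] (ord x div r) \<otimes> x [^] (ord x div p)"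
    using no_commuting assms by auto
  then show False using assms by (simp add: nat_pow_mult add.commute)
qed

definition Er where "Er = {x \<in> carrier G. x \<noteq> \<one> \<and> (\<exists>k. ord x = r ^ k)}"

lemma Er_swap: "p_local.Ep G r = Er" "pr_group.Er G p = Ep"
proof -
  interpret s: pr_group G r p j i by (rule swap)
  show "p_local.Ep G r = Er" "pr_group.Er G p = Ep" by (simp_all add: Er_def s.Er_def Ep_def s.Ep_def)
qed

lemma Ep_Er: "x \<in> Ep \<Longrightarrow> x \<in> Er \<Longrightarrow> False"
proof -
  assume a: "x \<in> Ep" "x \<in> Er"
  then obtain k where "ord x = p ^ k" by (auto simp: Ep_def)
  moreover obtain l where "ord x = r ^ l" using a by (auto simp: Er_def)
  moreover have "coprime (p ^ k) (r ^ l)" using prime_p prime_r p_ne_r by (simp add: primes_coprime)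
  ultimately have "ord x = 1" by simp
  then show False using a ord_eq_1[of x] by (simp add: Ep_def)
qed

lemma carrier_split: "carrier G = insert \<one> (Ep \<union> Er)"
  using ord_cases by (auto simp: Ep_def Er_def)

lemma order_split: "p ^ i * r ^ j = 1 + card Ep + card Er"
proof -
  have f: "finite Ep" "finite Er" using fin by (auto simp: Ep_def Er_def)
  have "card (carrier G) = Suc (card (Ep \<union> Er))"
    using f by (subst carrier_split, subst card_insert_disjoint) (auto simp: Ep_def Er_def)
  also have "card (Ep \<union> Er) = card Ep + card Er" using f Ep_Er by (intro card_Un_disjoint) auto
  finally show ?thesis using order_eq by (simp add: order_def)
qed

lemma commute_False: assumes "x \<in> Ep" "y \<in> Er" "x \<otimes> y = y \<otimes> x" shows False
proof -
  obtain k where k: "ord x = p ^ k" using assms(1) by (auto simp: Ep_def)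
  obtain l where l: "ord y = r ^ l" using assms(2) by (auto simp: Er_def)
  have c: "x \<in> carrier G" "y \<in> carrier G" "x \<noteq> \<one>" "y \<noteq> \<one>" using assms by (auto simp: Ep_def Er_def)
  have "k \<noteq> 0" using k c(1,3) ord_eq_1[of x] by (intro notI) simp
  moreover have "l \<noteq> 0" using l c(2,4) ord_eq_1[of y] by (intro notI) simp
  ultimately have "p dvd ord x" "r dvd ord y" using k l by auto
  then have o: "ord (x [^] (ord x div p)) = p" "ord (y [^] (ord y div r)) = r"
    using prime_power_of_order c prime_p prime_r ord_pos by auto
  have pw: "u [^] n \<otimes> v = v \<otimes> u [^] n" if "u \<in> carrier G" "v \<in> carrier G" "u \<otimes> v = v \<otimes> u" for u v and n :: nat
    using that by (metis group_commutes_pow)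
  show False using no_commuting[OF _ _ o] pw[of x y] pw[of y "x [^] (ord x div p)"] c assms(3) by simp
qed

lemma Sp_not_normal: assumes "P \<in> syl (carrier G) p" shows "nor P \<noteq> carrier G"
proof
  assume n: "nor P = carrier G"
  have s: "subgroup P G" by (rule sylD[OF assms])
  have "P \<lhd> G" unfolding normal_inv_iff using s n norD[of _ P] by (auto simp: cj_def)
  then have "P = carrier G"
    by (rule perfect_no_p_quotient[OF perfect _ fin prime_r, of _ j]) (simp add: card_Sp[OF assms] order_eq)
  then have "order G = p ^ i" using card_Sp[OF assms] by (simp add: order_def)
  then show False using order_prime_power_not_perfect[OF _ i_pos prime_p] perfect by simp
qed

text \<open>The \<open>p\<close>-elements leave room for just one Sylow \<open>r\<close>-subgroup, which is therefore
  normal.\<close>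

lemma selfnormal_TI_False:
  assumes sn0: "\<forall>P\<in>syl (carrier G) p. nor P = P"
    and TI: "\<forall>P\<in>syl (carrier G) p. \<forall>P'\<in>syl (carrier G) p. P \<noteq> P' \<longrightarrow> P \<inter> P' = {\<one>}"
  shows False
proof -
  have sn: "\<And>P. P \<in> syl (carrier G) p \<Longrightarrow> nor P = P" using sn0 by blast
  interpret s: pr_group G r p j i by (rule swap)
  obtain P where P: "P \<in> syl (carrier G) p" using Sp_ex by auto
  have n: "card (syl (carrier G) p) = r ^ j" by (rule card_Sp_selfnormal[OF P sn[OF P]])
  have "card Ep = (\<Sum>P\<in>syl (carrier G) p. card (P - {\<one>}))"
    unfolding Ep_eq using TI finite_syl[OF fin] finite_sub[OF sylD(1)] by (intro card_UN_disjoint) auto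
  also have "\<dots> = (\<Sum>P\<in>syl (carrier G) p. p ^ i - 1)"
    using card_Sp subgroup.one_closed[OF sylD(1)] by (intro sum.cong refl) (simp add: card_Diff_singleton)
  also have "\<dots> = r ^ j * (p ^ i - 1)" using n by simp
  finally have "card Ep = r ^ j * p ^ i - r ^ j" by (simp add: right_diff_distrib')
  moreover have "r ^ j \<le> r ^ j * p ^ i" using pos by simp
  ultimately have "card Er = r ^ j - 1" using order_split by (simp add: mult.commute)
  moreover obtain Q where Q: "Q \<in> syl (carrier G) r" using s.Sp_ex by auto
  moreover have "card (Q - {\<one>}) = r ^ j - 1" using card_Sr[OF Q] subgroup.one_closed[OF sylD(1)[OF Q]] by (simp add: card_Diff_singleton)
  moreover have QE: "Q - {\<one>} \<subseteq> Er" using s.Ep_eq Q Er_swap by auto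
  ultimately have E: "Q - {\<one>} = Er" using fin by (intro card_subset_eq) (auto simp: Er_def)
  have "cj g x \<in> Q" if g: "g \<in> carrier G" and x: "x \<in> Q" for g x
  proof (cases "x = \<one>")
    case True then show ?thesis using g x by simp
  next
    case False
    have xc: "x \<in> carrier G" using syl_carrier[OF Q] x by auto
    have "x \<in> Er" using x False E by auto
    then have "cj g x \<in> Er" using iso_ord[OF cj_iso[OF g] xc] g xc by (simp add: Er_def)
    then show ?thesis using E by auto
  qed
  then have "nor Q = carrier G" using norI_finite[OF finite_sub[OF sylD(1)[OF Q]] syl_carrier[OF Q]] by (auto simp: nor_def)
  then show False using s.Sp_not_normal[OF Q] by simp
qed

end

context pr_group begin

lemma set_mult_memI: "h \<in> H \<Longrightarrow> k \<in> K \<Longrightarrow> h \<otimes> k \<in> H <#> K"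
  by (auto simp: set_mult_def)

lemma Sp_in_sub: assumes "P \<in> syl (carrier G) p" "subgroup K G" "P \<subseteq> K" shows "P \<in> syl K p"
proof -
  obtain a e where ae: "card K = p ^ a * r ^ e" using card_subgroup[OF assms(2)] by auto
  have "p ^ i dvd card K" using card_subgroup_dvd[OF sylD(1)[OF assms(1)] assms(2,3) finite_sub[OF assms(2)]] card_Sp[OF assms(1)] by simp
  then have "i \<le> a" using mult_pr(1)[of a e] ae pos prime_p
    by (metis power_dvd_iff_le_multiplicity not_prime_unit mult_eq_0_iff power_eq_0_iff less_numeral_extra(3))
  moreover have "p ^ a dvd card K" using ae by simp
  then have "p ^ a dvd p ^ i * r ^ j"
    using card_subgroup_dvd[OF assms(2) subgroup_self subgroup.subset[OF assms(2)] fin] order_eq by (metis order_def dvd_trans)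
  then have "a \<le> i" using mult_pr(1)[of i j] pos prime_p
    by (metis power_dvd_iff_le_multiplicity not_prime_unit mult_eq_0_iff power_eq_0_iff less_numeral_extra(3))
  ultimately show ?thesis using ae mult_pr(1)[of a e] card_Sp[OF assms(1)] sylD(1)[OF assms(1)] assms(3) by (simp add: syl_def)
qed

lemma Sp_Er_disjoint: "subgroup P G \<Longrightarrow> card P = p ^ k \<Longrightarrow> subgroup Q G \<Longrightarrow> card Q = r ^ l \<Longrightarrow> P \<inter> Q = {\<one>}"
proof -
  assume a: "subgroup P G" "card P = p ^ k" "subgroup Q G" "card Q = r ^ l"
  interpret s: pr_group G r p j i by (rule swap)
  have "x = \<one>" if "x \<in> P" "x \<in> Q" for x
    using p_subgroup_mem[OF a(1,2) that(1)] s.p_subgroup_mem[OF a(3,4) that(2)] Ep_Er Er_swap by auto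
  then show ?thesis using a subgroup.one_closed by blast
qed

text \<open>Let \<open>D\<close> be a largest intersection of two Sylow \<open>p\<close>-subgroups, and let
  \<open>S\<close> be a Sylow \<open>p\<close>-subgroup of \<open>H = nor D\<close>. The conjugates of
  \<open>S\<close> in \<open>H\<close> pairwise meet in \<open>D\<close> because of the maximality of
  \<open>D\<close>, and their number is the index of \<open>S\<close> in \<open>H\<close>, as in a Frobenius
  group. What their elements outside \<open>D\<close> leave uncovered contains \<open>D <#> T\<close> and has
  the same size; the uncovered set is invariant under conjugation by elements of \<open>H\<close>, hence so is
  \<open>D <#> T\<close>.\<close>

lemma local_structure:
  assumes sn0: "\<forall>P\<in>syl (carrier G) p. nor P = P"
    and P: "P1 \<in> syl (carrier G) p" "P2 \<in> syl (carrier G) p" "P1 \<noteq> P2" and D: "D = P1 \<inter> P2"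
    and mx0: "\<forall>P\<in>syl (carrier G) p. \<forall>P'\<in>syl (carrier G) p. P \<noteq> P' \<longrightarrow> card (P \<inter> P') \<le> card D"
    and T: "T \<in> syl (nor D) r"
  shows "D \<subset> P1 \<inter> nor D" "P1 \<inter> nor D \<in> syl (nor D) p" "T \<noteq> {\<one>}" "subgroup (D <#> T) G"
    "card (D <#> T) = card D * card T" "D <#> T \<subseteq> nor D"
    "\<And>h. h \<in> nor D \<Longrightarrow> cj h ` (D <#> T) = D <#> T"
proof -
  have sn: "\<And>P. P \<in> syl (carrier G) p \<Longrightarrow> nor P = P" using sn0 by blast
  have mx: "\<And>P P'. P \<in> syl (carrier G) p \<Longrightarrow> P' \<in> syl (carrier G) p \<Longrightarrow> P \<noteq> P' \<Longrightarrow> card (P \<inter> P') \<le> card D" using mx0 by blast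
  define H where "H = nor D"
  have sD: "subgroup D G" unfolding D by (intro subgroup_Int sylD(1)[OF P(1)] sylD(1)[OF P(2)])
  interpret D: subgroup D G by fact
  have sH: "subgroup H G" unfolding H_def by (rule subgroup_nor[OF D.subset])
  interpret H: subgroup H G by fact
  have DH: "D \<subseteq> H" unfolding H_def by (rule subgroup_sub_nor[OF sD])
  have fH: "finite H" by (rule finite_sub[OF sH])
  have fD: "finite D" by (rule finite_sub[OF sD])
  have T': "T \<in> syl H r" using T by (simp add: H_def)
  have cjD: "cj h ` D = D" if "h \<in> H" for h using that unfolding H_def nor_def by blast
  have big: "P = P'" if "P \<in> syl (carrier G) p" "P' \<in> syl (carrier G) p" "D \<subset> P \<inter> P'" for P P'
  proof (rule ccontr)
    assume "P \<noteq> P'"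
    then have "card (P \<inter> P') \<le> card D" using mx that by auto
    moreover have "card D < card (P \<inter> P')" using that(3) finite_sub[OF sylD(1)[OF that(1)]] by (intro psubset_card_mono) auto
    ultimately show False by simp
  qed
  have main: "D \<subset> P \<inter> H \<and> P \<inter> H \<in> syl H p" if PS: "P \<in> syl (carrier G) p" "D \<subset> P" for P
  proof -
    obtain x where x: "x \<in> P - D" "x \<in> nor D"
      using normalizer_grows[OF sylD(1)[OF PS(1)] card_Sp[OF PS(1)] prime_p sD PS(2)] by auto
    have 1: "D \<subset> P \<inter> H" using x PS(2) DH by (auto simp: H_def)
    have sS: "subgroup (P \<inter> H) G" by (intro subgroup_Int sylD(1)[OF PS(1)] sH)
    obtain S where S: "S \<in> syl H p" using syl_nonempty[OF sH fH prime_p] by auto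
    have "card (P \<inter> H) dvd p ^ i" using card_subgroup_dvd[OF sS sylD(1)[OF PS(1)] _ finite_sub[OF sylD(1)[OF PS(1)]]] card_Sp[OF PS(1)] by auto
    then obtain k where k: "card (P \<inter> H) = p ^ k" using divides_primepow_nat[OF prime_p] by auto
    obtain g where g: "g \<in> H" "P \<inter> H \<subseteq> cj g ` S" using pgroup_in_syl[OF sH fH prime_p S sS _ k] by auto
    define S2 where "S2 = cj g ` S"
    have S2: "S2 \<in> syl H p" "P \<inter> H \<subseteq> S2" unfolding S2_def using syl_cj[OF S g(1) sH] g(2) by auto
    obtain P0 where P0: "P0 \<in> syl (carrier G) p" using Sp_ex by auto
    obtain g2 where g2: "g2 \<in> carrier G" "S2 \<subseteq> cj g2 ` P0"
      using pgroup_in_syl[OF subgroup_self fin prime_p P0 sylD(1)[OF S2(1)] _ sylD(3)[OF S2(1)]] sylD(2)[OF S2(1)] H.subset by auto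
    have P3: "cj g2 ` P0 \<in> syl (carrier G) p" by (rule syl_cj[OF P0 g2(1) subgroup_self])
    have "D \<subset> P \<inter> cj g2 ` P0" using 1 S2(2) g2(2) by auto
    then have "P = cj g2 ` P0" by (rule big[OF PS(1) P3])
    then have "S2 = P \<inter> H" using S2 g2(2) sylD(2)[OF S2(1)] by auto
    then show ?thesis using 1 S2(1) by simp
  qed
  have "D \<noteq> P1"
  proof
    assume "D = P1"
    then have "P1 \<subseteq> P2" using D by auto
    then have "P1 = P2" using card_subset_eq[OF finite_sub[OF sylD(1)[OF P(2)]]] card_Sp P by auto
    then show False using P(3) by simp
  qed
  then have D1: "D \<subset> P1" using D by auto
  have "D \<noteq> P2"
  proof
    assume "D = P2"
    then have "P2 \<subseteq> P1" using D by auto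
    then have "P2 = P1" using card_subset_eq[OF finite_sub[OF sylD(1)[OF P(1)]]] card_Sp P by auto
    then show False using P(3) by simp
  qed
  then have D2: "D \<subset> P2" using D by auto
  define S where "S = P1 \<inter> H"
  have S: "D \<subset> S" "S \<in> syl H p" unfolding S_def using main[OF P(1) D1] by auto
  show "D \<subset> P1 \<inter> nor D" "P1 \<inter> nor D \<in> syl (nor D) p" using S unfolding S_def H_def by auto
  have form: "\<exists>P\<in>syl (carrier G) p. S' = P \<inter> H \<and> D \<subset> S'" if S': "S' \<in> syl H p" for S'
  proof -
    obtain h where h: "h \<in> H" "S' = cj h ` S" using syl_conj[OF sH fH prime_p S(2) S'] by auto
    have hc: "h \<in> carrier G" using h by auto
    have "cj h ` H = H" using subgroup_sub_nor[OF sH] h(1) by (auto simp: nor_def)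
    then have "S' = cj h ` P1 \<inter> H"
      using h(2) inj_on_image_Int[OF inj_cj[OF hc] syl_carrier[OF P(1)] H.subset] by (simp add: S_def)
    moreover have "D \<subset> S'"
    proof -
      have "cj h ` D \<subset> cj h ` S" using S(1) inj_cj[OF hc] syl_carrier[OF P(1)]
        by (metis S_def Int_lower1 image_strict_mono inj_on_subset subset_trans)
      then show ?thesis using cjD[OF h(1)] h(2) by simp
    qed
    ultimately show ?thesis using syl_cj[OF P(1) hc subgroup_self] by blast
  qed
  have meet: "S' = S''" if m: "S' \<in> syl H p" "S'' \<in> syl H p" "v \<in> S'" "v \<in> S''" "v \<notin> D" for S' S'' v
  proof -
    obtain P' where P': "P' \<in> syl (carrier G) p" "S' = P' \<inter> H" "D \<subset> S'" using form[OF m(1)] by auto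
    obtain P'' where P'': "P'' \<in> syl (carrier G) p" "S'' = P'' \<inter> H" "D \<subset> S''" using form[OF m(2)] by auto
    have "D \<subset> P' \<inter> P''" using P' P'' m(3-5) by auto
    then have "P' = P''" by (rule big[OF P'(1) P''(1)])
    then show ?thesis using P' P'' by simp
  qed
  have SH: "S \<subseteq> H" by (auto simp: S_def)
  have sS: "subgroup S G" by (rule sylD[OF S(2)])
  have "nor S \<inter> H = S"
  proof
    show "S \<subseteq> nor S \<inter> H" using subgroup_sub_nor[OF sS] SH by auto
    show "nor S \<inter> H \<subseteq> S"
    proof
      fix h assume h: "h \<in> nor S \<inter> H"
      then have hc: "h \<in> carrier G" and hS: "cj h ` S = S" by (auto simp: nor_def)
      have "S \<subseteq> cj h ` P1" using hS S_def by blast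
      then have "D \<subset> P1 \<inter> cj h ` P1" using S(1) unfolding S_def by auto
      then have "P1 = cj h ` P1" by (rule big[OF P(1) syl_cj[OF P(1) hc subgroup_self]])
      then have "h \<in> nor P1" using hc by (simp add: nor_def)
      then show "h \<in> S" using sn[OF P(1)] h by (simp add: S_def)
    qed
  qed
  then have cH: "card H = card (syl H p) * card S" using card_syl[OF sH fH prime_p S(2)] by simp
  have cH2: "card H = card S * card T" by (rule syl_card_prod[OF sH S(2) T'])
  have S0: "card S > 0" using finite_sub[OF sS] subgroup.one_closed[OF sS] by (metis card_gt_0_iff empty_iff)
  have k: "card (syl H p) = card T" using cH cH2 S0 by simp
  show "T \<noteq> {\<one>}"
  proof
    assume "T = {\<one>}"
    then have "card (syl H p) = 1" using k by simp
    then obtain A where "syl H p = {A}" by (rule card_1_singletonE)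
    moreover have "P1 \<inter> H \<in> syl H p" "P2 \<inter> H \<in> syl H p" "D \<subset> P1 \<inter> H" using main[OF P(1) D1] main[OF P(2) D2] by auto
    ultimately show False using D by auto
  qed
  have sT: "subgroup T G" by (rule sylD[OF T'])
  interpret T: subgroup T G by fact
  have TH: "T \<subseteq> H" by (rule sylD[OF T'])
  have cjDm: "cj t d \<in> D" if "t \<in> H" "d \<in> D" for t d using cjD[OF that(1)] that(2) by blast
  have sub: "D <#> T \<subseteq> H" unfolding set_mult_def using DH TH by auto
  then show "D <#> T \<subseteq> nor D" by (simp add: H_def)
  obtain l where "card D = p ^ l"
    using card_subgroup_dvd[OF sD sylD(1)[OF P(1)] _ finite_sub[OF sylD(1)[OF P(1)]]] card_Sp[OF P(1)] divides_primepow_nat[OF prime_p] D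
    by (metis inf_le1)
  then have DT: "D \<inter> T = {\<one>}" using Sp_Er_disjoint[OF sD _ sT] sylD(3)[OF T'] by simp
  show c: "card (D <#> T) = card D * card T"
  proof -
    have "inj_on (\<lambda>(d, t). d \<otimes> t) (D \<times> T)"
    proof (rule inj_onI, clarsimp)
      fix d t d' t' assume a: "d \<in> D" "t \<in> T" "d' \<in> D" "t' \<in> T" "d \<otimes> t = d' \<otimes> t'"
      have "inv d' \<otimes> (d \<otimes> t) \<otimes> inv t = inv d' \<otimes> (d' \<otimes> t') \<otimes> inv t" by (simp only: a(5))
      then have "inv d' \<otimes> d = t' \<otimes> inv t" using a(1-4) by (simp add: word)
      then have "inv d' \<otimes> d \<in> D \<inter> T" using a by (metis D.m_closed D.m_inv_closed IntI T.m_closed T.m_inv_closed)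
      then have "inv d' \<otimes> d = \<one>" using DT by auto
      then have "d = d'" using a by (metis D.mem_carrier inv_equality inv_inv inv_closed)
      then show "d = d' \<and> t = t'" using a by simp
    qed
    moreover have "D <#> T = (\<lambda>(d, t). d \<otimes> t) ` (D \<times> T)" by (auto simp: set_mult_def)
    ultimately show ?thesis by (simp add: card_image card_cartesian_product)
  qed
  show "subgroup (D <#> T) G"
  proof (rule subgroupI)
    show "D <#> T \<subseteq> carrier G" using sub H.subset by auto
    show "D <#> T \<noteq> {}" using set_mult_memI[OF D.one_closed T.one_closed] by blast
    fix a assume "a \<in> D <#> T"
    then obtain d t where a: "d \<in> D" "t \<in> T" "a = d \<otimes> t" by (auto simp: set_mult_def)
    have "inv a = cj (inv t) (inv d) \<otimes> inv t" using a by (simp add: cj_def word)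
    then show "inv a \<in> D <#> T" using cjDm[of "inv t" "inv d"] a TH by (auto simp: set_mult_def)
    fix b assume "b \<in> D <#> T"
    then obtain d' t' where b: "d' \<in> D" "t' \<in> T" "b = d' \<otimes> t'" by (auto simp: set_mult_def)
    have "a \<otimes> b = (d \<otimes> cj t d') \<otimes> (t \<otimes> t')" using a b by (simp add: cj_def word)
    then show "a \<otimes> b \<in> D <#> T" using cjDm[of t d'] a b TH by (auto simp: set_mult_def)
  qed
  define U where "U = (\<Union>S'\<in>syl H p. S' - D)"
  have cU: "card U = card T * (card S - card D)"
  proof -
    have "card U = (\<Sum>S'\<in>syl H p. card (S' - D))"
      unfolding U_def using meet finite_syl[OF fH] finite_sub[OF sylD(1)] by (intro card_UN_disjoint) auto
    also have "\<dots> = (\<Sum>S'\<in>syl H p. card S - card D)"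
      using form fD sylD(3)[of _ H p] sylD(3)[OF S(2)] by (intro sum.cong refl) (metis card_Diff_subset psubset_imp_subset)
    finally show ?thesis using k by simp
  qed
  have UH: "U \<subseteq> H" unfolding U_def using sylD(2) by auto
  have "card D \<le> card S" using S(1) finite_sub[OF sS] by (intro card_mono) auto
  have "card (H - U) = card H - card U" using UH fH by (intro card_Diff_subset finite_subset[OF UH]) auto
  also have "\<dots> = card S * card T - card T * (card S - card D)" using cH2 cU by simp
  also have "\<dots> = card D * card T"
  proof -
    obtain k where "card S = card D + k" using \<open>card D \<le> card S\<close> le_Suc_ex by blast
    then show ?thesis by (simp add: algebra_simps)
  qed
  finally have cHU: "card (H - U) = card (D <#> T)" using c by simp
  have "D <#> T \<subseteq> H - U"
  proof
    fix v assume v: "v \<in> D <#> T"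
    then obtain d t where dt: "d \<in> D" "t \<in> T" "v = d \<otimes> t" by (auto simp: set_mult_def)
    have "v \<notin> U"
    proof
      assume "v \<in> U"
      then obtain S' where S': "S' \<in> syl H p" "v \<in> S'" "v \<notin> D" by (auto simp: U_def)
      interpret S': subgroup S' G by (rule sylD[OF S'(1)])
      have "d \<in> S'" using form[OF S'(1)] dt(1) by auto
      then have "inv d \<otimes> v \<in> S'" using S'(2) by simp
      then have "t \<in> S'" using dt by simp
      moreover have "S' \<inter> T = {\<one>}" using Sp_Er_disjoint[OF sylD(1,3)[OF S'(1)] sT sylD(3)[OF T']] .
      ultimately have "t = \<one>" using dt by auto
      then show False using dt S'(3) by simp
    qed
    then show "v \<in> H - U" using v sub by auto
  qed
  then have eq: "D <#> T = H - U" using cHU fH by (intro card_subset_eq) auto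
  show "cj h ` (D <#> T) = D <#> T" if "h \<in> nor D" for h
  proof -
    have hH: "h \<in> H" using that by (simp add: H_def)
    have hc: "h \<in> carrier G" using hH by auto
    have 1: "cj h v \<notin> U" if v: "v \<in> H" "v \<notin> U" for v
    proof
      assume "cj h v \<in> U"
      then obtain S' where S': "S' \<in> syl H p" "cj h v \<in> S'" "cj h v \<notin> D" by (auto simp: U_def)
      have "v \<in> cj (inv h) ` S'" using S'(2) v(1) hc by (metis H.mem_carrier cj_inv_cancel(1) imageI)
      moreover have "cj (inv h) ` S' \<in> syl H p" using syl_cj[OF S'(1) _ sH, of "inv h"] hH by simp
      moreover have "v \<notin> D" using S'(3) cjDm[OF hH] by auto
      ultimately show False using v(2) by (auto simp: U_def)
    qed
    have 2: "cj h v \<in> H" if "v \<in> H" for v using hH that by (simp add: cj_def)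
    have "h \<in> nor (H - U)"
    proof (rule norI_finite)
      show "finite (H - U)" using fH by simp
      show "H - U \<subseteq> carrier G" using H.subset by blast
      show "h \<in> carrier G" by (rule hc)
      show "cj h x \<in> H - U" if "x \<in> H - U" for x using 1[of x] 2[of x] that by simp
    qed
    then show ?thesis unfolding eq nor_def by blast
  qed
qed

lemma maximal_intersection:
  assumes "P1 \<in> syl (carrier G) p" "P2 \<in> syl (carrier G) p" "P1 \<noteq> P2"
  shows "\<exists>P1\<in>syl (carrier G) p. \<exists>P2\<in>syl (carrier G) p. P1 \<noteq> P2 \<and>
     (\<forall>P\<in>syl (carrier G) p. \<forall>P'\<in>syl (carrier G) p. P \<noteq> P' \<longrightarrow> card (P \<inter> P') \<le> card (P1 \<inter> P2))"
proof -
  let ?Q = "\<lambda>(P, P'). P \<in> syl (carrier G) p \<and> P' \<in> syl (carrier G) p \<and> P \<noteq> P'"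
  have le: "card (P \<inter> P') < Suc (card (carrier G))" if "P \<in> syl (carrier G) p" for P P'
    using card_mono[OF fin, of "P \<inter> P'"] syl_carrier[OF that] by (auto simp: less_Suc_eq_le)
  have "\<forall>y. ?Q y \<longrightarrow> (\<lambda>(P, P'). card (P \<inter> P')) y < Suc (card (carrier G))"
    using le by auto
  then obtain x where "?Q x" "\<And>y. ?Q y \<Longrightarrow> (\<lambda>(P, P'). card (P \<inter> P')) y \<le> (\<lambda>(P, P'). card (P \<inter> P')) x"
    using ex_has_greatest_nat[of ?Q "(P1, P2)" "\<lambda>(P, P'). card (P \<inter> P')"] assms by blast
  then show ?thesis by (cases x) fastforce
qed

text \<open>By a Frattini argument an element \<open>u\<close> of order \<open>p\<close> normalizes the subgroup
  \<open>T\<close> of the previous analysis. As \<open>T\<close> acts without fixed points on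
  \<open>D\<close>, the elements of order \<open>r\<close> in its center generate a group of order
  \<open>r\<close>, on which \<open>u\<close> acts without fixed points.\<close>

lemma selfnormal_nonTI_dvd:
  assumes sn0: "\<forall>P\<in>syl (carrier G) p. nor P = P"
    and P: "P1 \<in> syl (carrier G) p" "P2 \<in> syl (carrier G) p" "P1 \<noteq> P2" "P1 \<inter> P2 \<noteq> {\<one>}"
  shows "p dvd r - 1"
proof -
  have sn: "\<And>P. P \<in> syl (carrier G) p \<Longrightarrow> nor P = P" using sn0 by blast
  interpret s: pr_group G r p j i by (rule swap)
  obtain Q1 Q2 where Q: "Q1 \<in> syl (carrier G) p" "Q2 \<in> syl (carrier G) p" "Q1 \<noteq> Q2"
    and mx: "\<forall>P\<in>syl (carrier G) p. \<forall>P'\<in>syl (carrier G) p. P \<noteq> P' \<longrightarrow> card (P \<inter> P') \<le> card (Q1 \<inter> Q2)"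
    using maximal_intersection[OF P(1-3)] by blast
  define D where "D = Q1 \<inter> Q2"
  have sD: "subgroup D G" unfolding D_def by (intro subgroup_Int sylD(1)[OF Q(1)] sylD(1)[OF Q(2)])
  interpret D: subgroup D G by fact
  have sH: "subgroup (nor D) G" by (rule subgroup_nor[OF D.subset])
  interpret H: subgroup "nor D" G by fact
  have fH: "finite (nor D)" by (rule finite_sub[OF sH])
  obtain T where T: "T \<in> syl (nor D) r" using syl_nonempty[OF sH fH prime_r] by auto
  note loc = local_structure[OF sn0 Q D_def mx[folded D_def] T]
  have sT: "subgroup T G" by (rule sylD[OF T])
  interpret T: subgroup T G by fact
  define S where "S = Q1 \<inter> nor D"
  have S: "D \<subset> S" "S \<in> syl (nor D) p" unfolding S_def using loc(1,2) by auto
  have D1: "D \<noteq> {\<one>}"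
  proof
    assume "D = {\<one>}"
    then have "card (P1 \<inter> P2) \<le> 1" using mx P(1-3) D_def by simp
    moreover have "\<one> \<in> P1 \<inter> P2" using subgroup.one_closed sylD(1) P by blast
    ultimately show False using P(4) finite_sub[OF subgroup_Int[OF sylD(1)[OF P(1)] sylD(1)[OF P(2)]]]
      by (metis One_nat_def card_le_Suc0_iff_eq equals0D is_singletonI' is_singleton_def singletonD empty_iff)
  qed
  obtain l where cD: "card D = p ^ l"
    using card_subgroup_dvd[OF sD sylD(1)[OF Q(1)] _ finite_sub[OF sylD(1)[OF Q(1)]]] card_Sp[OF Q(1)] divides_primepow_nat[OF prime_p] D_def
    by (metis inf_le1)
  define M where "M = D <#> T"
  have sM: "subgroup M G" unfolding M_def by (rule loc(4))
  have TM: "T \<subseteq> M"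
  proof
    fix t assume "t \<in> T"
    then have "\<one> \<otimes> t \<in> M" unfolding M_def by (intro set_mult_memI D.one_closed)
    then show "t \<in> M" using \<open>t \<in> T\<close> by simp
  qed
  have cM: "card M = p ^ l * r ^ multiplicity r (card (nor D))" unfolding M_def using loc(5) cD sylD(3)[OF T] by simp
  have TsM: "T \<in> syl M r" using sT TM sylD(3)[OF T] cM mult_pr(2) by (simp add: syl_def)
  define N where "N = nor T \<inter> nor D"
  have sN: "subgroup N G" unfolding N_def by (intro subgroup_Int subgroup_nor T.subset sH)
  interpret N: subgroup N G by fact
  have "nor D \<subseteq> (\<lambda>(d, n). d \<otimes> n) ` (D \<times> N)"
  proof
    fix h assume h: "h \<in> nor D"
    have hc: "h \<in> carrier G" using h by simp
    have hM: "cj h ` M = M" unfolding M_def by (rule loc(7)[OF h])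
    have cT: "cj h ` T \<in> syl M r" using subgroup_cj[OF hc sT] card_cj[OF hc T.subset] TM hM TsM by (auto simp: syl_def)
    then obtain y where y: "y \<in> M" "cj h ` T = cj y ` T" using syl_conj[OF sM finite_sub[OF sM] prime_r TsM cT] by blast
    then obtain d t where dt: "d \<in> D" "t \<in> T" "y = d \<otimes> t" by (auto simp: M_def set_mult_def)
    have "t \<in> nor T" using subgroup_sub_nor[OF sT] dt by auto
    then have "cj t ` T = T" unfolding nor_def by blast
    then have "cj y ` T = cj d ` T" using dt cj_image_image[of d t T] T.subset by simp
    then have "cj (inv d \<otimes> h) ` T = T"
      using y(2) cj_image_image[of "inv d" h T] cj_image_image[of "inv d" d T] dt hc T.subset by simp
    then have "inv d \<otimes> h \<in> nor T" using dt hc by (simp add: nor_def[of T])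
    moreover have "inv d \<otimes> h \<in> nor D" using dt(1) h subgroup_sub_nor[OF sD] by (intro H.m_closed H.m_inv_closed) auto
    ultimately have "inv d \<otimes> h \<in> N" by (simp add: N_def)
    moreover have "h = d \<otimes> (inv d \<otimes> h)" using dt hc by simp
    ultimately show "h \<in> (\<lambda>(d, n). d \<otimes> n) ` (D \<times> N)" using dt(1) by (intro image_eqI[of _ _ "(d, inv d \<otimes> h)"]) simp_all
  qed
  then have "card (nor D) \<le> card (D \<times> N)" using finite_sub[OF sD] finite_sub[OF sN]
    by (meson card_image_le card_mono finite_SigmaI finite_imageI le_trans)
  then have le: "card S * card T \<le> card D * card N" using syl_card_prod[OF sH S(2) T] by (simp add: card_cartesian_product)
  have "p dvd card N"
  proof (rule ccontr)
    assume nd: "\<not> p dvd card N"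
    obtain a e where ae: "card N = p ^ a * r ^ e" using card_subgroup[OF sN] by auto
    then have "a = 0" using nd by (cases a) auto
    then have cN: "card N = r ^ e" using ae by simp
    have "card N dvd card (nor D)" by (rule card_subgroup_dvd[OF sN sH _ fH]) (auto simp: N_def)
    then have "r ^ e dvd card T" using cN sylD(3)[OF T] by (simp add: multiplicity_dvd' ) (metis H.one_closed fH card_0_eq empty_iff le_imp_power_dvd multiplicity_geI not_prime_unit prime_r)
    moreover have "card T > 0" using finite_sub[OF sT] T.one_closed by (metis card_gt_0_iff empty_iff)
    ultimately have "card N \<le> card T" using cN by (auto dest: dvd_imp_le)
    then have "card S * card T \<le> card D * card T" using le by (meson le_trans mult_le_mono2)
    then have "card S \<le> card D" using \<open>card T > 0\<close> by simp
    moreover have "card D < card S" using S(1) finite_sub[OF sylD(1)[OF S(2)]] by (intro psubset_card_mono)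
    ultimately show False by simp
  qed
  then obtain u where u: "u \<in> N" "ord u = p" using cauchy[OF sN finite_sub[OF sN] prime_p] by auto
  have uc: "u \<in> carrier G" using u by simp
  have uE: "u \<in> Ep" using u uc prime_gt_1_nat[OF prime_p] by (auto simp: Ep_def intro: exI[of _ 1])
  define Z where "Z = {x \<in> T \<inter> cen T. x [^] r = \<one>}"
  have sZT: "subgroup (T \<inter> cen T) G" by (intro subgroup_Int sT subgroup_cen T.subset)
  interpret ZT: subgroup "T \<inter> cen T" G by fact
  have zcomm: "x \<otimes> y = y \<otimes> x" if "x \<in> T \<inter> cen T" "y \<in> T" for x y using that unfolding cen_def by blast
  have sZ: "subgroup Z G"
  proof (rule subgroupI)
    show "Z \<subseteq> carrier G" by (auto simp: Z_def)
    show "Z \<noteq> {}" using ZT.one_closed by (auto simp: Z_def)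
    fix a assume a: "a \<in> Z"
    then show "inv a \<in> Z" using ZT.m_inv_closed[of a] by (auto simp: Z_def nat_pow_inv)
    fix b assume b: "b \<in> Z"
    have "(a \<otimes> b) [^] r = a [^] r \<otimes> b [^] r" using a b zcomm[of a b] by (intro pow_mult_distrib) (auto simp: Z_def)
    then show "a \<otimes> b \<in> Z" using a b ZT.m_closed[of a b] by (auto simp: Z_def)
  qed
  interpret Z: subgroup Z G by fact
  have ZEr: "x \<in> Er" if "x \<in> Z" "x \<noteq> \<one>" for x
    using s.p_subgroup_mem[OF sT sylD(3)[OF T], of x] that Er_swap by (auto simp: Z_def)
  have DEp: "x \<in> Ep" if "x \<in> D" "x \<noteq> \<one>" for x using p_subgroup_mem[OF sD cD that] .
  have "card Z \<le> r"
  proof (rule elementary_abelian_fixed_point_free[OF prime_p prime_r _ sD cD D1 sZ])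
    show "r \<noteq> p" using p_ne_r by simp
    show "e [^] r = \<one>" if "e \<in> Z" for e using that by (simp add: Z_def)
    show "e \<otimes> f = f \<otimes> e" if "e \<in> Z" "f \<in> Z" for e f using that zcomm by (auto simp: Z_def)
    show "Z \<subseteq> nor D" using sylD(2)[OF T] by (auto simp: Z_def)
    show "cj e d \<noteq> d" if "e \<in> Z" "d \<in> D" "e \<noteq> \<one>" "d \<noteq> \<one>" for e d
      using commute_False[OF DEp[OF that(2,4)] ZEr[OF that(1,3)]] that cj_fix_iff[of e d] by auto
  qed
  moreover have "\<exists>t. card Z = r ^ t"
  proof -
    have "card Z dvd card T" by (rule card_subgroup_dvd[OF sZ sT _ finite_sub[OF sT]]) (auto simp: Z_def)
    then show ?thesis using sylD(3)[OF T] divides_primepow_nat[OF prime_r] by auto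
  qed
  moreover have "Z \<noteq> {\<one>}"
  proof -
    obtain z where z: "z \<in> T" "z \<noteq> \<one>" "\<forall>l\<in>T. cj l z = z"
      using pgroup_fixed_element[OF sT sylD(3)[OF T] prime_r sT sylD(3)[OF T] loc(3)] by (auto simp: cj_def)
    have "z \<otimes> s = s \<otimes> z" if "s \<in> T" for s using z that cj_fix_iff[of s z] by simp
    then have zc: "z \<in> cen T" unfolding cen_def using T.mem_carrier[OF z(1)] by blast
    have "z \<in> Er" using s.p_subgroup_mem[OF sT sylD(3)[OF T] z(1,2)] Er_swap by simp
    then obtain k where k: "ord z = r ^ k" by (auto simp: Er_def)
    have "k \<noteq> 0" using k z(1,2) ord_eq_1[of z] by (auto intro!: notI)
    then have "r dvd ord z" using k by simp
    then have o: "ord (z [^] (ord z div r)) = r" using prime_power_of_order[OF _ prime_r] z(1) ord_pos[of z] by simp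
    have "z [^] (ord z div r) \<in> Z"
      using subgroup_pow[OF sZT, of z] z zc o pow_ord_eq_1[of "z [^] (ord z div r)"] by (auto simp: Z_def)
    moreover have "z [^] (ord z div r) \<noteq> \<one>" using o prime_gt_1_nat[OF prime_r] by auto
    ultimately show ?thesis by auto
  qed
  ultimately have cZ: "card Z = r"
  proof -
    assume a: "card Z \<le> r" "\<exists>t. card Z = r ^ t" "Z \<noteq> {\<one>}"
    then obtain t where t: "card Z = r ^ t" by auto
    have "t \<noteq> 0" using t a(3) Z.one_closed by (metis card_1_singletonE power_0 singletonD)
    moreover have "\<not> t \<ge> 2" using t a(1) prime_gt_1_nat[OF prime_r] by (metis One_nat_def Suc_1 not_less_eq_eq power_increasing_iff power_one_right)
    ultimately have "t = 1" by simp
    then show ?thesis using t by simp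
  qed
  have uT: "cj u ` T = T" using u(1) unfolding N_def nor_def by blast
  have uZ: "cj u x \<in> Z" if "x \<in> Z" for x
  proof -
    have "cj u ` cen T = cen T" using cen_cj[OF uc T.subset] uT by simp
    then have "cj u x \<in> T \<inter> cen T" using that uT unfolding Z_def by blast
    moreover have "cj u x [^] r = \<one>" using cj_pow[OF uc, of x r] that uc by (simp add: Z_def)
    ultimately show ?thesis by (simp add: Z_def)
  qed
  have "Z \<subseteq> carrier G" by (auto simp: Z_def)
  have unZ: "u \<in> nor Z" by (rule norI_finite[OF finite_sub[OF sZ] Z.subset uc uZ])
  have gU: "subgroup (generate G {u}) G" "card (generate G {u}) = p ^ 1" using generate_singleton[OF uc] u(2) by simp_all
  have gsub: "generate G {u} \<subseteq> nor Z" by (rule generate_subgroup_incl[OF _ subgroup_nor]) (use unZ in auto)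
  have a: "acts (generate G {u}) cj (Z - {\<one>})"
    using gsub gU(1) norD[of _ Z] subgroup.mem_carrier[OF gU(1)] by (intro acts_cj) auto
  have "card (Z - {\<one>}) mod p = card {x\<in>Z - {\<one>}. \<forall>g\<in>generate G {u}. cj g x = x} mod p"
    by (rule fixed_points_mod[OF a _ prime_p gU(2)]) (use finite_sub[OF sZ] in auto)
  also have "{x\<in>Z - {\<one>}. \<forall>g\<in>generate G {u}. cj g x = x} = {}"
  proof -
    have "cj u x \<noteq> x" if "x \<in> Z" "x \<noteq> \<one>" for x
      using commute_False[OF uE ZEr[OF that]] cj_fix_iff[OF uc, of x] that by auto
    then show ?thesis using generate_singleton(2)[OF uc] by blast
  qed
  finally have "card (Z - {\<one>}) mod p = 0" by simp
  then show ?thesis using cZ Z.one_closed by (auto simp: card_Diff_singleton)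
qed

end

lemma double_count:
  assumes "finite A" "finite B"
  shows "(\<Sum>x\<in>A. card {y\<in>B. R x y}) = (\<Sum>y\<in>B. card {x\<in>A. R x y})"
  using sum.swap_restrict[OF assms, of "\<lambda>_ _. 1::nat" R] by simp

context pr_group begin

text \<open>Each of the two primes would divide the predecessor of the other.\<close>

lemma both_selfnormal_False:
  assumes "\<forall>P\<in>syl (carrier G) p. nor P = P" "\<forall>P\<in>syl (carrier G) r. nor P = P"
  shows False
proof -
  interpret s: pr_group G r p j i by (rule swap)
  obtain P1 P2 where P: "P1 \<in> syl (carrier G) p" "P2 \<in> syl (carrier G) p" "P1 \<noteq> P2" "P1 \<inter> P2 \<noteq> {\<one>}"
    using selfnormal_TI_False[OF assms(1)] by blast
  obtain Q1 Q2 where Q: "Q1 \<in> syl (carrier G) r" "Q2 \<in> syl (carrier G) r" "Q1 \<noteq> Q2" "Q1 \<inter> Q2 \<noteq> {\<one>}"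
    using s.selfnormal_TI_False[OF assms(2)] by blast
  have "p dvd r - 1" "r dvd p - 1" using selfnormal_nonTI_dvd[OF assms(1) P] s.selfnormal_nonTI_dvd[OF assms(2) Q] by auto
  then have "p \<le> r - 1" "r \<le> p - 1" using prime_gt_1_nat[OF prime_p] prime_gt_1_nat[OF prime_r] by (auto intro!: dvd_imp_le)
  then show False using pos by simp
qed

lemma count_both: "p ^ i \<ge> 2" "r ^ j \<ge> 2"
proof -
  interpret s: pr_group G r p j i by (rule swap)
  show "p ^ i \<ge> 2" "r ^ j \<ge> 2" using i_pos s.i_pos prime_ge_2_nat[OF prime_p] prime_ge_2_nat[OF prime_r]
    by (metis One_nat_def Suc_leI le_trans power_increasing power_one_right pos One_nat_def)+
qed

text \<open>Normalizers larger than the Sylow subgroups halve the numbers of Sylow subgroups, and too few elements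
  remain.\<close>

lemma both_nonselfnormal_False:
  assumes "P \<in> syl (carrier G) p" "nor P \<noteq> P" "Q \<in> syl (carrier G) r" "nor Q \<noteq> Q"
  shows False
proof -
  interpret s: pr_group G r p j i by (rule swap)
  define b c where "b = r ^ j" and "c = p ^ i"
  have "2 * card Ep \<le> b * (c - 1)" using count_Ep_nonselfnormal[OF assms(1,2) two_le] by (simp add: b_def c_def)
  moreover have "2 * card Er \<le> c * (b - 1)" using s.count_Ep_nonselfnormal[OF assms(3,4) s.two_le] Er_swap by (simp add: b_def c_def)
  moreover have "c * b = 1 + card Ep + card Er" using order_split by (simp add: b_def c_def)
  moreover have "b * (c - 1) = c * b - b" "c * (b - 1) = c * b - c" by (simp_all add: diff_mult_distrib2 mult.commute)
  moreover have "b \<ge> 2" "c \<ge> 2" using count_both by (simp_all add: b_def c_def)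
  moreover have "b \<le> c * b" "c \<le> c * b" using \<open>b \<ge> 2\<close> \<open>c \<ge> 2\<close> by auto
  ultimately show False by linarith
qed

text \<open>The \<open>p\<close>-elements are all central in Sylow subgroups and make up at most a quarter of the group,
  the \<open>r\<close>-elements make up less than half of it.\<close>

lemma single_selfnormal_False:
  assumes "\<forall>x\<in>Ep. \<forall>y\<in>Ep. aeq x y"
    and sn0: "\<forall>P\<in>syl (carrier G) p. nor P = P"
    and Q: "Q \<in> syl (carrier G) r" "nor Q \<noteq> Q"
  shows False
proof -
  have sn: "\<And>P. P \<in> syl (carrier G) p \<Longrightarrow> nor P = P" using sn0 by blast
  interpret s: pr_group G r p j i by (rule swap)
  obtain P1 P2 where P: "P1 \<in> syl (carrier G) p" "P2 \<in> syl (carrier G) p" "P1 \<noteq> P2" "P1 \<inter> P2 \<noteq> {\<one>}"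
    using selfnormal_TI_False[OF sn0] by blast
  define b c \<zeta> where "b = r ^ j" and "c = p ^ i" and "\<zeta> = card (P1 \<inter> cen P1)"
  have "card Ep = card (syl (carrier G) p) * (\<zeta> - 1)"
    unfolding \<zeta>_def using single_type_central[OF assms(1)] central_card(2) P(1)
    by (intro card_central_blocks) auto
  then have EX: "card Ep = b * (\<zeta> - 1)" using card_Sp_selfnormal[OF P(1) sn[OF P(1)]] by (simp add: b_def)
  have z4: "4 * \<zeta> \<le> c" unfolding \<zeta>_def c_def by (rule nonTI_center_small[OF P P(1)])
  from z4 have b4: "b * (4 * \<zeta>) \<le> b * c" by (rule mult_le_mono2)
  have "\<one> \<in> P1 \<inter> cen P1" using subgroup.one_closed[OF subgroup_Int[OF sylD(1)[OF P(1)] subgroup_cen[OF syl_carrier[OF P(1)]]]] .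
  then have "\<zeta> > 0" unfolding \<zeta>_def using finite_sub[OF sylD(1)[OF P(1)]] by (metis card_gt_0_iff empty_iff finite_Int)
  then have "4 * (b * (\<zeta> - 1)) + 4 * b = b * (4 * \<zeta>)" by (cases \<zeta>) (auto simp: algebra_simps)
  then have X: "4 * (b * (\<zeta> - 1)) + 4 * b \<le> c * b" using b4 by (simp add: mult.commute)
  have "2 * card Er \<le> c * (b - 1)" using s.count_Ep_nonselfnormal[OF Q s.two_le] Er_swap by (simp add: b_def c_def)
  moreover have "b - 1 + 1 = b" using count_both by (simp add: b_def)
  then have "c * (b - 1) + c = c * b" by (metis distrib_left mult_1_right)
  ultimately have Y: "2 * card Er + c \<le> c * b" by linarith
  have "c * b = 1 + card Ep + card Er" using order_split by (simp add: b_def c_def)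
  moreover have "b \<ge> 2" "c \<ge> 2" using count_both by (simp_all add: b_def c_def)
  ultimately show False using X Y EX by linarith
qed

definition nsyl where "nsyl v = card {P \<in> syl (carrier G) p. v \<in> P}"

lemma nsyl_aeq: assumes "aeq x y" "x \<in> carrier G" shows "nsyl y = nsyl x"
proof -
  obtain \<phi> where \<phi>: "\<phi> \<in> iso G G" "y = \<phi> x" using assms(1) by (auto simp: aeq_def)
  have "{P \<in> syl (carrier G) p. y \<in> P} = (`) \<phi> ` {P \<in> syl (carrier G) p. x \<in> P}"
  proof -
    have "y \<in> \<phi> ` P \<longleftrightarrow> x \<in> P" if "P \<in> syl (carrier G) p" for P
      using iso_mem[OF \<phi>(1) syl_carrier[OF that] assms(2)] \<phi>(2) by simp
    then have "{P \<in> (`) \<phi> ` syl (carrier G) p. y \<in> P} = (`) \<phi> ` {P \<in> syl (carrier G) p. x \<in> P}"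
      by auto
    then show ?thesis using iso_syl_image(1)[OF \<phi>(1) fin] by simp
  qed
  moreover have "inj_on ((`) \<phi>) {P \<in> syl (carrier G) p. x \<in> P}"
    using iso_syl_image(2)[OF \<phi>(1) fin] by (rule inj_on_subset) auto
  ultimately show ?thesis unfolding nsyl_def by (simp add: card_image)
qed

lemma nsyl_unique:
  assumes "nsyl v = 1" "P' \<in> syl (carrier G) p" "P'' \<in> syl (carrier G) p" "v \<in> P'" "v \<in> P''" shows "P' = P''"
proof -
  have "finite {P \<in> syl (carrier G) p. v \<in> P}" using finite_syl[OF fin] by simp
  then show ?thesis using card_le_Suc0_iff_eq[of "{P \<in> syl (carrier G) p. v \<in> P}"] assms by (simp add: nsyl_def)
qed

definition nnor where "nnor v = card {Q \<in> syl (carrier G) r. v \<in> nor Q}"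

lemma nnor_aeq: assumes "aeq x y" "x \<in> carrier G" shows "nnor y = nnor x"
proof -
  obtain \<phi> where \<phi>: "\<phi> \<in> iso G G" "y = \<phi> x" using assms(1) by (auto simp: aeq_def)
  have "{Q \<in> syl (carrier G) r. y \<in> nor Q} = (`) \<phi> ` {Q \<in> syl (carrier G) r. x \<in> nor Q}"
  proof -
    have "y \<in> nor (\<phi> ` Q) \<longleftrightarrow> x \<in> nor Q" if "Q \<in> syl (carrier G) r" for Q
      using iso_nor[OF \<phi>(1) syl_carrier[OF that]] iso_mem[OF \<phi>(1) _ assms(2), of "nor Q"] \<phi>(2)
      by (auto simp: nor_def[of Q])
    then have "{Q \<in> (`) \<phi> ` syl (carrier G) r. y \<in> nor Q} = (`) \<phi> ` {Q \<in> syl (carrier G) r. x \<in> nor Q}"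
      by auto
    then show ?thesis using iso_syl_image(1)[OF \<phi>(1) fin] by simp
  qed
  moreover have "inj_on ((`) \<phi>) {Q \<in> syl (carrier G) r. x \<in> nor Q}"
    using iso_syl_image(2)[OF \<phi>(1) fin] by (rule inj_on_subset) auto
  ultimately show ?thesis unfolding nnor_def by (simp add: card_image)
qed

text \<open>A Sylow \<open>r\<close>-subgroup \<open>Q\<close> permutes the \<open>r ^ j\<close> self-normalizing Sylow
  \<open>p\<close>-subgroups regularly. If \<open>v\<close> lies in \<open>P\<close> and in a conjugate of
  \<open>P\<close> by an element of \<open>Q\<close>, then that element commutes with \<open>v\<close>, hence
  is trivial.\<close>

lemma nsyl_normalizing:
  assumes sn0: "\<forall>P\<in>syl (carrier G) p. nor P = P"
    and Q: "Q \<in> syl (carrier G) r" and v: "v \<in> Ep" "v \<in> nor Q"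
  shows "nsyl v = 1"
proof -
  have sn: "\<And>P. P \<in> syl (carrier G) p \<Longrightarrow> nor P = P" using sn0 by blast
  interpret s: pr_group G r p j i by (rule swap)
  have sQ: "subgroup Q G" by (rule sylD[OF Q])
  interpret Q: subgroup Q G by fact
  obtain P where P: "P \<in> syl (carrier G) p" "v \<in> P" using Ep_in_syl[OF subgroup_self v(1)] v(1) by (auto simp: Ep_def)
  interpret P: subgroup P G by (rule sylD[OF P(1)])
  have PQ: "P \<inter> Q = {\<one>}" using Sp_Er_disjoint[OF P.is_subgroup card_Sp[OF P(1)] sQ card_Sr[OF Q]] .
  have a: "acts Q (\<lambda>g A. cj g ` A) (syl (carrier G) p)"
    by (rule acts_restrict[OF acts_syl[OF subgroup_self] sQ Q.subset])
  have "{g\<in>Q. cj g ` P = P} = {\<one>}"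
  proof -
    have "{g\<in>Q. cj g ` P = P} = nor P \<inter> Q" by (auto simp: nor_def)
    then show ?thesis using sn[OF P(1)] PQ by simp
  qed
  then have "card ((\<lambda>g. cj g ` P) ` Q) = card (syl (carrier G) p)"
    using orbit_stabilizer[OF a finite_sub[OF sQ] P(1)] card_Sr[OF Q] card_Sp_selfnormal[OF P(1) sn[OF P(1)]] by simp
  then have orb: "(\<lambda>g. cj g ` P) ` Q = syl (carrier G) p"
    using actsD(3)[OF a P(1)] finite_syl[OF fin] by (intro card_subset_eq) auto
  have vc: "v \<in> carrier G" using v by (simp add: Ep_def)
  have uniq: "P' = P" if P': "P' \<in> syl (carrier G) p" "v \<in> P'" for P'
  proof -
    obtain s where s: "s \<in> Q" "P' = cj s ` P" using P'(1) orb by blast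
    have sc: "s \<in> carrier G" using s by simp
    have 1: "cj (inv s) v \<in> P" using P'(2) s cj_mem_image_iff[OF sc vc P.subset] by simp
    have "inv v \<otimes> cj (inv s) v \<in> P" using 1 P(2) by simp
    moreover have "inv v \<otimes> cj (inv s) v = cj (inv v) (inv s) \<otimes> s" using sc vc by (simp add: cj_def word)
    moreover have "cj (inv v) (inv s) \<otimes> s \<in> Q"
      using norD[of "inv v" Q "inv s"] subgroup.m_inv_closed[OF subgroup_nor[OF Q.subset] v(2)] s by simp
    ultimately have "inv v \<otimes> cj (inv s) v = \<one>" using PQ by auto
    then have "cj (inv s) v = v" using sc vc by (metis cj_closed inv_closed inv_equality inv_inv inv_comm)
    then have "inv s \<otimes> v = v \<otimes> inv s" using sc vc cj_fix_iff by simp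
    then have "inv s \<notin> Er" using commute_False[OF v(1)] by metis
    then have "inv s = \<one>" using s.p_subgroup_mem[OF sQ card_Sr[OF Q], of "inv s"] s Er_swap by auto
    then have "s = \<one>" using sc by (metis inv_inv inv_one)
    then show ?thesis using s P.subset by simp
  qed
  have "{P' \<in> syl (carrier G) p. v \<in> P'} = {P}" using P uniq by blast
  then show ?thesis by (simp add: nsyl_def)
qed

text \<open>Otherwise this would hold in every Sylow subgroup. The centralizer of a nontrivial element common to
  \<open>P1\<close> and \<open>P2\<close> contains central elements of both and lies in a single Sylow
  subgroup, so that \<open>P1 = P2\<close>.\<close>

lemma nsyl_central:
  assumes P12: "P1 \<in> syl (carrier G) p" "P2 \<in> syl (carrier G) p" "P1 \<noteq> P2" "P1 \<inter> P2 \<noteq> {\<one>}"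
    and P: "P \<in> syl (carrier G) p" and z: "z \<in> P \<inter> cen P" "z \<noteq> \<one>"
  shows "nsyl z \<noteq> 1"
proof
  assume n: "nsyl z = 1"
  note one = nsyl_unique
  have tr: "\<exists>z'. z' \<in> P' \<inter> cen P' \<and> nsyl z' = 1" if P': "P' \<in> syl (carrier G) p" for P'
  proof -
    obtain g where g: "g \<in> carrier G" "P' = cj g ` P" using syl_conj[OF subgroup_self fin prime_p P P'] by auto
    have "cj g z \<in> P' \<inter> cen P'" using g z(1) cen_cj[OF g(1) syl_carrier[OF P]] by auto
    moreover have "nsyl (cj g z) = 1" using nsyl_aeq[OF aeq_cj[OF g(1)]] n z(1) syl_carrier[OF P] by auto
    ultimately show ?thesis by blast
  qed
  obtain z1 z2 where z12: "z1 \<in> P1 \<inter> cen P1" "nsyl z1 = 1" "z2 \<in> P2 \<inter> cen P2" "nsyl z2 = 1"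
    using tr[OF P12(1)] tr[OF P12(2)] by auto
  have "\<one> \<in> P1 \<inter> P2" using subgroup.one_closed sylD(1) P12(1,2) by blast
  then obtain d where d: "d \<in> P1" "d \<in> P2" "d \<noteq> \<one>" using P12(4) by auto
  have dE: "d \<in> Ep" using p_subgroup_mem[OF sylD(1)[OF P12(1)] card_Sp[OF P12(1)] d(1,3)] .
  obtain P3 where P3: "P3 \<in> syl (carrier G) p" "cen {d} \<subseteq> P3" using cen_below_syl[OF dE] by auto
  have "z1 \<in> cen {d}" "z2 \<in> cen {d}" using z12 d by (auto simp: cen_def)
  then have "P1 = P3" "P2 = P3" using one[OF z12(2) P12(1) P3(1)] one[OF z12(4) P12(2) P3(1)] P3(2) z12 by auto
  then show False using P12(3) by simp
qed

text \<open>The equations count incidences: \<open>y\<close> elements lie in a single one of the \<open>b\<close> Sylow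
  \<open>p\<close>-subgroups and normalize \<open>M\<close> of the \<open>n\<close> Sylow
  \<open>r\<close>-subgroups, while \<open>b * z\<close> elements lie in \<open>F\<close> Sylow
  \<open>p\<close>-subgroups. The other nontrivial elements of the group are central in Sylow
  \<open>r\<close>-subgroups.\<close>

lemma type_count_arith:
  fixes b c n w y z \<eta> F M :: nat
  assumes e1: "y + F * (b * z) + b = b * c" and e2: "b * c = 1 + y + b * z + n * (\<eta> - 1)"
    and e3: "M * y = n * (b * (w - 1))" and nw: "n * w = c" "w \<ge> 2"
    and zc: "4 * (z + 1) \<le> c" and \<eta>: "\<eta> = b \<or> 4 * \<eta> \<le> b" "\<eta> \<ge> 1" and F: "F \<ge> 2" and M: "M \<ge> 1" and b: "b \<ge> 2" and n: "n \<ge> 1" and z: "z \<ge> 1"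
  shows "F = b"
proof -
  obtain w' where w': "w = Suc w'" "w' \<ge> 1" using nw(2) by (cases w) auto
  obtain \<eta>' where \<eta>': "\<eta> = Suc \<eta>'" using \<eta>(2) by (cases \<eta>) auto
  have c: "c = n * w' + n" using nw w' by simp
  have e3': "M * y = n * (b * w')" using e3 w' by simp
  have e2': "b * c = 1 + y + b * z + n * \<eta>'" using e2 \<eta>' by simp
  have \<eta>b: "n * \<eta>' + n \<le> n * b" using \<eta> \<eta>' b by (metis Suc_leI add.commute mult_Suc_right mult_le_mono2 le_trans le_add2 mult_2 numeral_Bit0 order_refl add_leD1 mult_le_cancel1 le_add1 mult.commute nat_mult_1 one_le_numeral mult_le_mono1)
  have "M = 1"
  proof (rule ccontr)
    assume "M \<noteq> 1"
    then have "2 * y \<le> M * y" using M by (intro mult_le_mono1) auto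
    then have A: "2 * y \<le> n * (b * w')" using e3' by simp
    have B: "4 * (b * z) + 4 * b \<le> b * c" using mult_le_mono2[OF zc, of b] by (simp add: algebra_simps)
    have C: "b * c = n * (b * w') + n * b" using c by (simp add: algebra_simps)
    have D: "n * b \<le> n * (b * w')" using w'(2) by simp
    show False using A B C D e2' \<eta>b b n by linarith
  qed
  then have y: "y = n * (b * w')" using e3' by simp
  have C: "b * c = n * (b * w') + n * b" using c by (simp add: algebra_simps)
  have E1: "F * (b * z) + b = n * b" using e1 y C by linarith
  have E1': "F * z + 1 = n"
  proof -
    have "b * (F * z + 1) = b * n" using E1 by (simp add: algebra_simps)
    then have "F * z + 1 = n \<or> b = 0" by (simp only: mult_cancel1)
    then show ?thesis using b by simp
  qed
  have E2: "1 + b * z + n * \<eta>' = n * b" using e2' y C by linarith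
  show ?thesis
  proof (cases "\<eta> = b")
    case True
    then have "b = \<eta>' + 1" using \<eta>' by simp
    then have "n * b = n * \<eta>' + n" by (simp only: distrib_left mult_1_right)
    then have "1 + b * z = n" using E2 by linarith
    then have "b * z = F * z" using E1' by linarith
    then show ?thesis using z by simp
  next
    case False
    then have "4 * (\<eta>' + 1) \<le> b" using \<eta> \<eta>' by simp
    then have G: "n * (4 * (\<eta>' + 1)) \<le> n * b" by (rule mult_le_mono2)
    have "2 * z \<le> F * z" using F by (rule mult_le_mono1)
    then have "2 * z + 1 \<le> n" using E1' by linarith
    then have "b * (2 * z + 1) \<le> b * n" by (rule mult_le_mono2)
    then have "2 * (b * z) + b \<le> n * b" by (simp add: algebra_simps)
    moreover have "4 * (n * \<eta>') + 4 * n \<le> n * b" using G by (simp add: algebra_simps)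
    ultimately have False using E2 n b by linarith
    then show ?thesis ..
  qed
qed

text \<open>The number of Sylow \<open>p\<close>-subgroups that contain a given element distinguishes the
  \<open>p\<close>-elements that normalize a Sylow \<open>r\<close>-subgroup from those that are central in a
  Sylow \<open>p\<close>-subgroup, so there are exactly two types of \<open>p\<close>-elements. Counting
  incidences shows that the elements of the second type lie in all the Sylow \<open>p\<close>-subgroups.
  Together with the identity they form the intersection of any two of these, and the local analysis provides a
  normal subgroup whose index is a power of \<open>p\<close>.\<close>

lemma two_types_False:
  assumes single: "\<forall>x\<in>Er. \<forall>y\<in>Er. aeq x y"
    and two: "\<forall>x\<in>Ep. \<forall>y\<in>Ep. \<forall>z\<in>Ep. aeq x y \<or> aeq x z \<or> aeq y z"
    and sn0: "\<forall>P\<in>syl (carrier G) p. nor P = P"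
    and Q: "Q \<in> syl (carrier G) r" "nor Q \<noteq> Q"
  shows False
proof -
  have sn: "\<And>P. P \<in> syl (carrier G) p \<Longrightarrow> nor P = P" using sn0 by blast
  interpret s: pr_group G r p j i by (rule swap)
  obtain P1 P2 where P: "P1 \<in> syl (carrier G) p" "P2 \<in> syl (carrier G) p" "P1 \<noteq> P2" "P1 \<inter> P2 \<noteq> {\<one>}"
    using selfnormal_TI_False[OF sn0] by blast
  let ?Sp = "syl (carrier G) p" and ?Sr = "syl (carrier G) r"
  have fE: "finite Ep" using fin by (simp add: Ep_def)
  have Epc: "x \<in> carrier G" if "x \<in> Ep" for x using that by (simp add: Ep_def)
  define b c \<zeta> \<eta> where "b = r ^ j" and "c = p ^ i" and "\<zeta> = card (P1 \<inter> cen P1)" and "\<eta> = card (Q \<inter> cen Q)"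
  have nSp: "card ?Sp = b" using card_Sp_selfnormal[OF P(1) sn[OF P(1)]] by (simp add: b_def)
  have sQ: "subgroup Q G" by (rule sylD[OF Q(1)])
  have sNQ: "subgroup (nor Q) G" by (rule subgroup_nor[OF syl_carrier[OF Q(1)]])
  have Ep_in_nor: "Ep \<inter> nor Q' = nor Q' - Q'" if Q': "Q' \<in> ?Sr" for Q'
  proof -
    have sQ': "subgroup Q' G" by (rule sylD[OF Q'])
    have sN: "subgroup (nor Q') G" by (rule subgroup_nor[OF syl_carrier[OF Q']])
    have QN: "Q' \<in> syl (nor Q') r" by (rule s.Sp_in_sub[OF Q' sN subgroup_sub_nor[OF sQ']])
    have "x \<in> Q'" if x: "x \<in> nor Q'" "x \<in> Er" for x
    proof -
      obtain Q2 where Q2: "Q2 \<in> syl (nor Q') r" "x \<in> Q2" using s.Ep_in_syl[OF sN _ x(1)] x(2) Er_swap by auto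
      then obtain g where "g \<in> nor Q'" "Q2 = cj g ` Q'" using syl_conj[OF sN finite_sub[OF sN] prime_r QN Q2(1)] by auto
      then show ?thesis using Q2(2) by (simp add: nor_def)
    qed
    moreover have "x \<notin> Ep" if "x \<in> Q'" for x
    proof
      assume "x \<in> Ep"
      then have "x \<noteq> \<one>" by (simp add: Ep_def)
      then have "x \<in> Er" using s.p_subgroup_mem[OF sQ' card_Sr[OF Q'] that] Er_swap by simp
      then show False using Ep_Er \<open>x \<in> Ep\<close> by blast
    qed
    moreover have "x = \<one> \<or> x \<in> Ep \<or> x \<in> Er" if "x \<in> nor Q'" for x
      using that carrier_split subgroup.mem_carrier[OF sN that] by auto
    ultimately show ?thesis using subgroup.one_closed[OF sQ'] by blast
  qed
  have cardN: "card (nor Q') = card (nor Q)" if Q': "Q' \<in> ?Sr" for Q'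
  proof -
    obtain g where g: "g \<in> carrier G" "Q' = cj g ` Q" using syl_conj[OF subgroup_self fin prime_r Q(1) Q'] by auto
    then show ?thesis using nor_cj[OF g(1) syl_carrier[OF Q(1)]] card_cj[OF g(1), of "nor Q"] subgroup.subset[OF sNQ] by simp
  qed
  have "b dvd card (nor Q)" using card_subgroup_dvd[OF sQ sNQ subgroup_sub_nor[OF sQ] finite_sub[OF sNQ]] card_Sr[OF Q(1)] by (simp add: b_def)
  then obtain w where w: "card (nor Q) = b * w" by auto
  have "card Q < card (nor Q)" using subgroup_sub_nor[OF sQ] Q(2) finite_sub[OF sNQ] by (intro psubset_card_mono) auto
  then have "w \<noteq> 0" "w \<noteq> 1" using w card_Sr[OF Q(1)] by (auto simp: b_def)
  then have w2: "w \<ge> 2" by linarith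
  define n where "n = card ?Sr"
  have b2: "b \<ge> 2" "c \<ge> 2" using count_both by (simp_all add: b_def c_def)
  have "n * (b * w) = b * c" using s.count_Sp[OF Q(1)] w by (simp add: n_def b_def c_def)
  then have "b * (n * w) = b * c" by (simp add: ac_simps)
  then have nw: "n * w = c" using b2 by simp
  have n1: "n \<ge> 1" using nw b2 by (cases n) auto
  have EN: "card (Ep \<inter> nor Q') = b * (w - 1)" if Q': "Q' \<in> ?Sr" for Q'
  proof -
    have "card (nor Q' - Q') = card (nor Q') - card Q'"
      using subgroup_sub_nor[OF sylD(1)[OF Q']] finite_sub[OF sylD(1)[OF Q']] by (rule card_Diff_subset[rotated])
    then show ?thesis using Ep_in_nor[OF Q'] cardN[OF Q'] w card_Sr[OF Q'] by (simp add: b_def diff_mult_distrib2)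
  qed
  have "card (Ep \<inter> nor Q) > 0" using EN[OF Q(1)] w2 b2 by simp
  then obtain v0 where v0: "v0 \<in> Ep" "v0 \<in> nor Q" by (metis IntE card_gt_0_iff ex_in_conv)
  have f0: "nsyl v0 = 1" by (rule nsyl_normalizing[OF sn0 Q(1) v0])
  obtain z0 where z0: "z0 \<in> P1 \<inter> cen P1" "z0 \<noteq> \<one>" using center_ex[OF P(1)] by auto
  have z0E: "z0 \<in> Ep" by (rule central_card(2)[OF P(1) z0])
  have fz: "nsyl z0 \<noteq> 1" by (rule nsyl_central[OF P P(1) z0])
  define F where "F = nsyl z0"
  define Y Z where "Y = {x\<in>Ep. nsyl x = 1}" and "Z = {x\<in>Ep. nsyl x \<noteq> 1}"
  have Yt: "aeq v0 x" if "x \<in> Y" for x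
  proof -
    have x: "x \<in> Ep" "nsyl x = 1" using that by (auto simp: Y_def)
    have "\<not> aeq v0 z0" "\<not> aeq x z0" using nsyl_aeq f0 fz x Epc v0(1) by metis+
    then show ?thesis using two v0(1) x(1) z0E by blast
  qed
  have Zt: "aeq z0 x" if "x \<in> Z" for x
  proof -
    have x: "x \<in> Ep" "nsyl x \<noteq> 1" using that by (auto simp: Z_def)
    have "\<not> aeq z0 v0" "\<not> aeq v0 x" using nsyl_aeq f0 fz x Epc v0(1) z0E by metis+
    then show ?thesis using two z0E x(1) v0(1) aeq_sym[of x v0] Epc by blast
  qed
  have ZF: "nsyl x = F" if "x \<in> Z" for x using nsyl_aeq[OF Zt[OF that]] z0E Epc by (simp add: F_def)
  have YZ: "Ep = Y \<union> Z" "Y \<inter> Z = {}" "finite Y" "finite Z" using fE by (auto simp: Y_def Z_def)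
  have "nsyl z0 \<noteq> 0" using P(1) z0 finite_syl[OF fin, of p] by (auto simp: nsyl_def)
  then have F2: "F \<ge> 2" using fz by (simp add: F_def)
  have cenZ: "P' \<inter> cen P' - {\<one>} \<subseteq> Z" if "P' \<in> ?Sp" for P'
    using nsyl_central[OF P that] central_card(2)[OF that] by (auto simp: Z_def)
  have cZ: "card Z = b * (\<zeta> - 1)"
  proof -
    have "card (cen {x}) = p ^ i" if "x \<in> Z" for x
      using aeq_card_cen[OF Zt[OF that]] z0E Epc central_card(1)[OF P(1) z0] by simp
    then have "card Z = card ?Sp * (card (P1 \<inter> cen P1) - 1)"
      using cenZ P(1) by (intro card_central_blocks) (auto simp: Z_def)
    then show ?thesis using nSp by (simp add: \<zeta>_def)
  qed
  have e1: "card Y + F * card Z = b * (c - 1)"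
  proof -
    have "(\<Sum>v\<in>Ep. nsyl v) = (\<Sum>P'\<in>?Sp. card {v\<in>Ep. v \<in> P'})"
      unfolding nsyl_def by (rule double_count[OF fE finite_syl[OF fin]])
    also have "\<dots> = (\<Sum>P'\<in>?Sp. c - 1)"
    proof (intro sum.cong refl)
      fix P' assume P': "P' \<in> ?Sp"
      have "{v\<in>Ep. v \<in> P'} = P' - {\<one>}" using Ep_eq P' by (auto simp: Ep_def)
      then show "card {v\<in>Ep. v \<in> P'} = c - 1"
        using card_Sp[OF P'] subgroup.one_closed[OF sylD(1)[OF P']] by (simp add: card_Diff_singleton c_def)
    qed
    also have "\<dots> = b * (c - 1)" using nSp by simp
    finally have "(\<Sum>v\<in>Y \<union> Z. nsyl v) = b * (c - 1)" using YZ(1) by simp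
    moreover have "(\<Sum>v\<in>Y \<union> Z. nsyl v) = (\<Sum>v\<in>Y. nsyl v) + (\<Sum>v\<in>Z. nsyl v)" using YZ by (intro sum.union_disjoint) auto
    moreover have "(\<Sum>v\<in>Y. nsyl v) = card Y" by (simp add: Y_def)
    moreover have "(\<Sum>v\<in>Z. nsyl v) = F * card Z" using ZF by simp
    ultimately show ?thesis by simp
  qed
  define M where "M = nnor v0"
  have e3: "M * card Y = n * (b * (w - 1))"
  proof -
    have inY: "v \<in> Y" if "v \<in> Ep" "v \<in> nor Q'" "Q' \<in> ?Sr" for v Q'
      using nsyl_normalizing[OF sn0 that(3,1,2)] that by (simp add: Y_def)
    have "(\<Sum>v\<in>Y. nnor v) = (\<Sum>Q'\<in>?Sr. card {v\<in>Y. v \<in> nor Q'})"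
      unfolding nnor_def by (rule double_count[OF YZ(3) finite_syl[OF fin]])
    also have "\<dots> = (\<Sum>Q'\<in>?Sr. b * (w - 1))"
    proof (intro sum.cong refl)
      fix Q' assume Q': "Q' \<in> ?Sr"
      have "{v\<in>Y. v \<in> nor Q'} = Ep \<inter> nor Q'" using inY Q' by (auto simp: Y_def)
      then show "card {v\<in>Y. v \<in> nor Q'} = b * (w - 1)" using EN[OF Q'] by simp
    qed
    also have "\<dots> = n * (b * (w - 1))" by (simp add: n_def)
    finally show ?thesis using nnor_aeq[OF Yt] v0(1) Epc by (simp add: M_def mult.commute)
  qed
  have M1: "M \<ge> 1"
  proof -
    have "Q \<in> {Q \<in> ?Sr. v0 \<in> nor Q}" using Q(1) v0 by simp
    then have "nnor v0 \<noteq> 0" unfolding nnor_def using finite_syl[OF fin, of r] by (metis (no_types, lifting) card_0_eq empty_iff finite_subset mem_Collect_eq subsetI)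
    then show ?thesis by (simp add: M_def)
  qed
  have cEr: "card Er = n * (\<eta> - 1)"
  proof -
    have "card (p_local.Ep G r) = card ?Sr * (card (Q \<inter> cen Q) - 1)"
      using s.single_type_central s.central_card(2) Q(1) single Er_swap by (intro s.card_central_blocks) auto
    then show ?thesis using Er_swap by (simp add: n_def \<eta>_def)
  qed
  have e2: "b * c = 1 + card Y + card Z + n * (\<eta> - 1)"
    using order_split cEr card_Un_disjoint[OF YZ(3,4,2)] YZ(1) by (simp add: b_def c_def mult.commute)
  have one_cen: "\<one> \<in> P1 \<inter> cen P1" using subgroup.one_closed[OF subgroup_Int[OF sylD(1)[OF P(1)] subgroup_cen[OF syl_carrier[OF P(1)]]]] .
  have "{\<one>, z0} \<subseteq> P1 \<inter> cen P1" using one_cen z0 by auto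
  then have "card {\<one>, z0} \<le> \<zeta>" unfolding \<zeta>_def using finite_sub[OF sylD(1)[OF P(1)]] by (intro card_mono) auto
  then have z2: "\<zeta> \<ge> 2" using z0(2) by simp
  have zc: "4 * ((\<zeta> - 1) + 1) \<le> c" using nonTI_center_small[OF P P(1)] z2 by (simp add: \<zeta>_def c_def)
  have \<eta>b: "\<eta> = b \<or> 4 * \<eta> \<le> b"
  proof (cases "\<exists>x\<in>Q. \<exists>y\<in>Q. x \<otimes> y \<noteq> y \<otimes> x")
    case True
    then show ?thesis using nonabelian_center_index[OF sQ finite_sub[OF sQ]] card_Sr[OF Q(1)] by (auto simp: \<eta>_def b_def)
  next
    case False
    then have "Q \<inter> cen Q = Q" using syl_carrier[OF Q(1)] by (auto simp: cen_def)
    then show ?thesis using card_Sr[OF Q(1)] by (simp add: \<eta>_def b_def)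
  qed
  have "\<one> \<in> Q \<inter> cen Q" using subgroup.one_closed[OF subgroup_Int[OF sQ subgroup_cen[OF syl_carrier[OF Q(1)]]]] .
  then have \<eta>1: "\<eta> \<ge> 1" unfolding \<eta>_def using finite_sub[OF sQ] by (metis One_nat_def Suc_leI card_gt_0_iff empty_iff finite_Int)
  have "F = b"
  proof (rule type_count_arith[OF _ _ e3 nw w2 zc \<eta>b \<eta>1 F2 M1 b2(1) n1])
    have "c - 1 + 1 = c" using b2 by simp
    then have "b * (c - 1) + b = b * c" by (metis distrib_left mult_1_right)
    then show "card Y + F * (b * (\<zeta> - 1)) + b = b * c" using e1 cZ by simp
    show "b * c = 1 + card Y + b * (\<zeta> - 1) + n * (\<eta> - 1)" using e2 cZ by simp
    show "\<zeta> - 1 \<ge> 1" using z2 by simp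
  qed
  text \<open>Now every element of \<open>Z\<close> lies in all the Sylow \<open>p\<close>-subgroups, so that any two of these have the same intersection.\<close>
  have Zall: "x \<in> P'" if "x \<in> Z" "P' \<in> ?Sp" for x P'
  proof -
    have "card {P \<in> ?Sp. x \<in> P} = card ?Sp" using ZF[OF that(1)] \<open>F = b\<close> nSp by (simp add: nsyl_def)
    then have "{P \<in> ?Sp. x \<in> P} = ?Sp" using finite_syl[OF fin] by (intro card_subset_eq) auto
    then show ?thesis using that(2) by auto
  qed
  define D where "D = P1 \<inter> P2"
  have meet: "P' \<inter> P'' = insert \<one> Z" if PP: "P' \<in> ?Sp" "P'' \<in> ?Sp" "P' \<noteq> P''" for P' P''
  proof -
    have "x \<in> Z" if x: "x \<in> P'" "x \<in> P''" "x \<noteq> \<one>" for x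
    proof -
      have "x \<in> Ep" using Ep_eq PP x by auto
      moreover have "nsyl x \<noteq> 1" using nsyl_unique[OF _ PP(1,2) x(1,2)] PP(3) by blast
      ultimately show ?thesis by (simp add: Z_def)
    qed
    then have "P' \<inter> P'' \<subseteq> insert \<one> Z" by blast
    moreover have "\<one> \<in> P' \<inter> P''" using subgroup.one_closed sylD(1) PP by blast
    then have "insert \<one> Z \<subseteq> P' \<inter> P''" using Zall[OF _ PP(1)] Zall[OF _ PP(2)] by blast
    ultimately show ?thesis by (rule equalityI)
  qed
  have DZ: "D = insert \<one> Z" unfolding D_def by (rule meet[OF P(1-3)])
  have sD: "subgroup D G" unfolding D_def by (intro subgroup_Int sylD(1)[OF P(1)] sylD(1)[OF P(2)])
  interpret D: subgroup D G by fact
  have "cj g x \<in> D" if g: "g \<in> carrier G" and x: "x \<in> D" for g x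
  proof (cases "x = \<one>")
    case True then show ?thesis using g D.one_closed by simp
  next
    case False
    then have x: "x \<in> Ep" "nsyl x \<noteq> 1" using x DZ by (auto simp: Z_def)
    have "cj g x \<in> Ep" using iso_ord[OF cj_iso[OF g] Epc[OF x(1)]] x g Epc[OF x(1)] by (simp add: Ep_def)
    moreover have "nsyl (cj g x) \<noteq> 1" using nsyl_aeq[OF aeq_cj[OF g] Epc[OF x(1)]] x by simp
    ultimately show ?thesis using DZ by (simp add: Z_def)
  qed
  then have "g \<in> nor D" if "g \<in> carrier G" for g using that finite_sub[OF sD] D.subset by (intro norI_finite) auto
  then have nD: "nor D = carrier G" by (auto simp: nor_def)
  obtain T where T: "T \<in> syl (carrier G) r" using s.Sp_ex by auto
  have mx: "\<forall>P\<in>?Sp. \<forall>P'\<in>?Sp. P \<noteq> P' \<longrightarrow> card (P \<inter> P') \<le> card D"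
    using meet DZ by simp
  note loc = local_structure[OF sn0 P(1-3) D_def mx, unfolded nD, OF T]
  have sM: "subgroup (D <#> T) G" by (rule loc(4))
  have nM: "(D <#> T) \<lhd> G" unfolding normal_inv_iff
  proof (intro conjI ballI sM)
    fix x h assume "x \<in> carrier G" "h \<in> D <#> T"
    then have "cj x h \<in> D <#> T" using loc(7)[of x] by blast
    then show "x \<otimes> h \<otimes> inv x \<in> D <#> T" by (simp add: cj_def)
  qed
  have "card D dvd c" using card_subgroup_dvd[OF sD sylD(1)[OF P(1)] _ finite_sub[OF sylD(1)[OF P(1)]]] card_Sp[OF P(1)] by (simp add: D_def c_def)
  then obtain k where k: "c = card D * k" by auto
  then have "k dvd p ^ i" by (simp add: c_def)
  then obtain e where e: "k = p ^ e" using divides_primepow_nat[OF prime_p] by auto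
  have "order G = card (D <#> T) * p ^ e" using loc(5) order_eq k e card_Sr[OF T] by (simp add: c_def)
  then have "D <#> T = carrier G" by (rule perfect_no_p_quotient[OF perfect nM fin prime_p])
  then have "card D * b = c * b" using loc(5) order_eq card_Sr[OF T] by (simp add: c_def b_def order_def)
  then have "card D = card P1" "card D = card P2" using b2 card_Sp P by (simp_all add: c_def)
  note cD = this
  have "D = P1" by (rule card_subset_eq[OF finite_sub[OF sylD(1)[OF P(1)]] _ cD(1)]) (simp add: D_def)
  moreover have "D = P2" by (rule card_subset_eq[OF finite_sub[OF sylD(1)[OF P(2)]] _ cD(2)]) (simp add: D_def)
  ultimately show False using P(3) by simp
qed

text \<open>There are four cases, according to which Sylow subgroups are their own normalizers. The hardest is that of
  self-normalizing Sylow \<open>p\<close>-subgroups together with Sylow \<open>r\<close>-subgroups that have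
  larger normalizers.\<close>

theorem few_types_False:
  assumes single: "\<forall>x\<in>Er. \<forall>y\<in>Er. aeq x y"
    and two: "\<forall>x\<in>Ep. \<forall>y\<in>Ep. \<forall>z\<in>Ep. aeq x y \<or> aeq x z \<or> aeq y z"
  shows False
proof -
  interpret s: pr_group G r p j i by (rule swap)
  obtain P where P: "P \<in> syl (carrier G) p" using Sp_ex by auto
  obtain Q where Q: "Q \<in> syl (carrier G) r" using s.Sp_ex by auto
  have p_sn: "\<forall>P'\<in>syl (carrier G) p. nor P' = P'" if "nor P = P" using selfnormal_all[OF P that] by blast
  have r_sn: "\<forall>Q'\<in>syl (carrier G) r. nor Q' = Q'" if "nor Q = Q" using s.selfnormal_all[OF Q that] by blast
  consider "nor P = P" "nor Q = Q" | "nor P = P" "nor Q \<noteq> Q" | "nor P \<noteq> P" "nor Q = Q" | "nor P \<noteq> P" "nor Q \<noteq> Q" by blast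
  then show False
  proof cases
    case 1 then show ?thesis using both_selfnormal_False[OF p_sn r_sn] by simp
  next
    case 2 then show ?thesis using two_types_False[OF single two p_sn Q] by simp
  next
    case 3
    have "\<forall>x\<in>p_local.Ep G r. \<forall>y\<in>p_local.Ep G r. aeq x y" using single Er_swap by simp
    then show ?thesis using s.single_selfnormal_False[OF _ r_sn P] 3 by simp
  next
    case 4 then show ?thesis using both_nonselfnormal_False[OF P _ Q] by simp
  qed
qed

end

section \<open>Two primes with commuting elements\<close>

locale mixed_group = group +
  fixes p r i j :: nat
  assumes perfect: "derived G (carrier G) = carrier G"
    and prime_p: "prime p" and prime_r: "prime r" and p_ne_r: "p \<noteq> r"
    and order_eq: "order G = p ^ i * r ^ j" and i_pos: "i > 0" and j_pos: "j > 0"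
    and type_p: "\<forall>x\<in>carrier G. \<forall>y\<in>carrier G. ord x = p \<longrightarrow> ord y = p \<longrightarrow> aeq x y"
    and type_r: "\<forall>x\<in>carrier G. \<forall>y\<in>carrier G. ord x = r \<longrightarrow> ord y = r \<longrightarrow> aeq x y"
    and exp_p: "\<And>x k. x \<in> carrier G \<Longrightarrow> ord x = p ^ k \<Longrightarrow> k \<le> 1"
    and exp_r: "\<And>x k. x \<in> carrier G \<Longrightarrow> ord x = r ^ k \<Longrightarrow> k \<le> 1"
begin

lemma swap: "mixed_group G r p j i"
  by unfold_locales
    (use perfect prime_p prime_r p_ne_r order_eq i_pos j_pos type_p type_r exp_p exp_r in \<open>simp_all add: mult.commute\<close>)

lemma pos: "p > 0" "r > 0" using prime_p prime_r by (simp_all add: prime_gt_0_nat)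

lemma fin: "finite (carrier G)"
  using order_eq pos order_gt_0_iff_finite by simp

lemma finite_sub: "subgroup H G \<Longrightarrow> finite H"
  using fin finite_subset subgroup.subset by metis

lemma card_Sp: "P \<in> syl (carrier G) p \<Longrightarrow> card P = p ^ i"
proof -
  have "multiplicity p (p ^ i * r ^ j) = i" using prime_p prime_r p_ne_r pos
    by (simp add: prime_elem_multiplicity_mult_distrib multiplicity_distinct_prime_power)
  then show "P \<in> syl (carrier G) p \<Longrightarrow> card P = p ^ i"
    using sylD(3)[of P "carrier G" p] order_eq by (simp add: order_def)
qed

lemma ord_dvd: "x \<in> carrier G \<Longrightarrow> ord x dvd p ^ i * r ^ j"
  using ord_dvd_card[OF subgroup_self fin] order_eq by (simp add: order_def)

lemma prime_ord_cases: assumes "x \<in> carrier G" "prime q" "ord x = q" shows "q = p \<or> q = r"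
  using ord_dvd[OF assms(1)] assms(2,3) prime_p prime_r
  by (metis prime_dvd_mult_iff prime_dvd_power_nat primes_dvd_imp_eq)

text \<open>The nontrivial \<open>p\<close>-elements have order \<open>p\<close> and form a single orbit, so a
  nontrivial normal \<open>p\<close>-subgroup would drag all of them into every Sylow
  \<open>p\<close>-subgroup, which would then be normal.\<close>

lemma no_normal_p_subgroup:
  assumes "subgroup N G" "nor N = carrier G" "card N = p ^ k" "N \<noteq> {\<one>}" shows False
proof -
  obtain P where P: "P \<in> syl (carrier G) p" using syl_nonempty[OF subgroup_self fin prime_p] by auto
  have sP: "subgroup P G" by (rule sylD[OF P])
  have below: "M \<subseteq> P" if M: "subgroup M G" "nor M = carrier G" "card M = p ^ k" for M
  proof -
    have Mc: "M \<subseteq> carrier G" using M(1) by (rule subgroup.subset)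
    obtain g where g: "g \<in> carrier G" "M \<subseteq> cj g ` P"
      using pgroup_in_syl[OF subgroup_self fin prime_p P M(1) Mc M(3)] by auto
    have "cj g ` M = M" using g(1) M(2) unfolding nor_def by blast
    then have "cj g ` M \<subseteq> cj g ` P" using g(2) by simp
    then show ?thesis using iso_mem[OF cj_iso[OF g(1)] syl_carrier[OF P]] Mc by blast
  qed
  have "k \<noteq> 0" using assms(3,4) subgroup.one_closed[OF assms(1)] by (metis card_1_singletonE power_0 singletonD)
  then obtain x where x: "x \<in> N" "ord x = p" using cauchy[OF assms(1) finite_sub[OF assms(1)] prime_p] assms(3) by auto
  have xc: "x \<in> carrier G" using x assms(1) subgroup.mem_carrier by metis
  have inP: "y \<in> P" if y: "y \<in> carrier G" "ord y = p" for y
  proof -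
    have "aeq x y" using type_p xc y x(2) by blast
    then obtain \<phi> where \<phi>: "\<phi> \<in> iso G G" "\<phi> x = y" by (auto simp: aeq_def)
    have Nc: "N \<subseteq> carrier G" using assms(1) by (rule subgroup.subset)
    have "\<phi> ` carrier G = carrier G" using iso_bij[OF \<phi>(1)] by (simp add: bij_betw_def)
    then have "nor (\<phi> ` N) = carrier G" using iso_nor[OF \<phi>(1) Nc] assms(2) by simp
    then have "\<phi> ` N \<subseteq> P" using below[OF iso_subgroup[OF \<phi>(1) assms(1)]] iso_card[OF \<phi>(1) Nc] assms(3) by simp
    then show ?thesis using \<phi>(2) x(1) by auto
  qed
  have "cj g y \<in> P" if g: "g \<in> carrier G" and y: "y \<in> P" for g y
  proof (cases "y = \<one>")
    case True then show ?thesis using g y by simp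
  next
    case False
    have yc: "y \<in> carrier G" using y syl_carrier[OF P] by auto
    have "ord y dvd p ^ i" using ord_dvd_card[OF sP finite_sub[OF sP] y] card_Sp[OF P] by simp
    then obtain l where l: "ord y = p ^ l" using divides_primepow_nat[OF prime_p] by auto
    then have "l \<noteq> 0" using False ord_eq_1[OF yc] by (intro notI) simp
    then have "l = 1" using exp_p[OF yc l] by linarith
    then show ?thesis using inP[of "cj g y"] iso_ord[OF cj_iso[OF g] yc] l g yc by simp
  qed
  then have "P \<lhd> G" unfolding normal_inv_iff using sP by (auto simp: cj_def)
  then have "P = carrier G"
    by (rule perfect_no_p_quotient[OF perfect _ fin prime_r, of _ j]) (simp add: card_Sp[OF P] order_eq)
  then have "order G = p ^ i" using card_Sp[OF P] by (simp add: order_def)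
  then show False using order_prime_power_not_perfect[OF _ i_pos prime_p] perfect by simp
qed

lemma no_abelian_normal_with_p:
  assumes "subgroup B G" "nor B = carrier G" "\<And>x y. x \<in> B \<Longrightarrow> y \<in> B \<Longrightarrow> x \<otimes> y = y \<otimes> x" "b \<in> B" "ord b = p"
  shows False
proof -
  interpret B: subgroup B G by fact
  define N where "N = {x \<in> B. x [^] p = \<one>}"
  have sN: "subgroup N G"
  proof (rule subgroupI)
    show "N \<subseteq> carrier G" by (auto simp: N_def)
    show "N \<noteq> {}" using B.one_closed by (auto simp: N_def intro!: exI[of _ "\<one>"])
    fix x assume x: "x \<in> N"
    then show "inv x \<in> N" by (simp add: N_def nat_pow_inv)
    fix y assume y: "y \<in> N"
    have "(x \<otimes> y) [^] p = x [^] p \<otimes> y [^] p" using x y assms(3) by (intro pow_mult_distrib) (auto simp: N_def)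
    then show "x \<otimes> y \<in> N" using x y by (simp add: N_def)
  qed
  have "\<exists>k. card N = p ^ k"
  proof (rule pgroup_card[OF sN finite_sub[OF sN] prime_p])
    fix x q assume x: "x \<in> N" "prime q" "ord x = q"
    then have "q dvd p" using pow_eq_id[of x p] by (simp add: N_def)
    then show "q = p" using x(2) prime_p by (simp add: primes_dvd_imp_eq)
  qed
  then obtain k where k: "card N = p ^ k" by auto
  have "b [^] p = \<one>" using assms(4,5) pow_ord_eq_1[of b] by simp
  then have bN: "b \<in> N" using assms(4) by (simp add: N_def)
  have "b \<noteq> \<one>" using assms(5) prime_gt_1_nat[OF prime_p] by auto
  then have "N \<noteq> {\<one>}" using bN by auto
  moreover have "g \<in> nor N" if g: "g \<in> carrier G" for g
  proof (rule norI_finite[OF finite_sub[OF sN] subgroup.subset[OF sN] g])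
    fix x assume x: "x \<in> N"
    have "cj g x \<in> B" using assms(2) g x norD[of g B x] by (simp add: N_def)
    moreover have "cj g x [^] p = \<one>" using cj_pow[OF g, of x p] x g by (simp add: N_def)
    ultimately show "cj g x \<in> N" by (simp add: N_def)
  qed
  then have "nor N = carrier G" by (auto simp: nor_def)
  ultimately show False using no_normal_p_subgroup[OF sN _ k] by simp
qed

lemma full_Sylow_in_centralizer: assumes "x \<in> carrier G" "ord x = p" shows "p ^ i dvd card (cen {x})"
proof -
  obtain P where P: "P \<in> syl (carrier G) p" using syl_nonempty[OF subgroup_self fin prime_p] by auto
  have s: "subgroup P G" by (rule sylD[OF P])
  have "card P \<noteq> 1" using card_Sp[OF P] i_pos prime_gt_1_nat[OF prime_p] by simp
  then have "P \<noteq> {\<one>}" by auto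
  then obtain z where z: "z \<in> P" "z \<noteq> \<one>" "\<forall>l\<in>P. cj l z = z"
    using pgroup_fixed_element[OF s card_Sp[OF P] prime_p s card_Sp[OF P]] subgroup_sub_nor[OF s] norD by blast
  have zc: "z \<in> carrier G" using z syl_carrier[OF P] by auto
  have "ord z dvd p ^ i" using ord_dvd_card[OF s finite_sub[OF s] z(1)] card_Sp[OF P] by simp
  then obtain l where l: "ord z = p ^ l" using divides_primepow_nat[OF prime_p] by auto
  then have "l \<noteq> 0" using z(2) ord_eq_1[OF zc] by (intro notI) simp
  then have "l = 1" using exp_p[OF zc l] by linarith
  then have "aeq z x" using type_p assms zc l by simp
  then have "card (cen {x}) = card (cen {z})" using aeq_card_cen zc by simp
  moreover have "P \<subseteq> cen {z}"
  proof
    fix x assume "x \<in> P"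
    then have "x \<in> carrier G" "cj x z = z" using z syl_carrier[OF P] by auto
    then show "x \<in> cen {z}" using zc by (simp add: cen_def cj_fix_iff)
  qed
  then have "card P dvd card (cen {z})" using zc by (intro card_subgroup_dvd s subgroup_cen finite_sub) auto
  ultimately show ?thesis using card_Sp[OF P] by simp
qed

text \<open>The class of \<open>x\<close> has a size that is a power of \<open>r\<close>. Its part reached by the
  centralizer of \<open>y\<close> has a size divisible by that power, because this centralizer contains a
  Sylow \<open>r\<close>-subgroup; so the centralizer of \<open>y\<close> is transitive on the class of
  \<open>x\<close>.\<close>

lemma class_commutes:
  assumes "x \<in> carrier G" "ord x = p" "y \<in> carrier G" "r ^ j dvd card (cen {y})" "x \<otimes> y = y \<otimes> x" "g \<in> carrier G"
  shows "cj g x \<otimes> y = y \<otimes> cj g x"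
proof -
  have sx: "subgroup (cen {x}) G" and sy: "subgroup (cen {y}) G" using assms by (auto intro!: subgroup_cen)
  have aG: "acts (carrier G) cj (carrier G)" by (rule acts_cj[OF subgroup_self]) auto
  have ay: "acts (cen {y}) cj (carrier G)" by (rule acts_restrict[OF aG sy cen_sub])
  let ?C = "(\<lambda>g. cj g x) ` carrier G" and ?O = "(\<lambda>g. cj g x) ` cen {y}"
  have "{g\<in>carrier G. cj g x = x} = cen {x}" using assms(1) by (auto simp: cen_def cj_fix_iff)
  then have C: "p ^ i * r ^ j = card ?C * card (cen {x})"
    using orbit_stabilizer[OF aG fin assms(1)] order_eq by (simp add: order_def)
  have "{g\<in>cen {y}. cj g x = x} = cen {y} \<inter> cen {x}" using assms(1) by (auto simp: cen_def cj_fix_iff)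
  then have O: "card (cen {y}) = card ?O * card (cen {y} \<inter> cen {x})"
    using orbit_stabilizer[OF ay finite_sub[OF sy] assms(1)] by simp
  obtain u where u: "card (cen {x}) = p ^ i * u" using full_Sylow_in_centralizer[OF assms(1,2)] by auto
  have "p ^ i * r ^ j = p ^ i * (card ?C * u)" using C u by (simp add: ac_simps)
  then have "r ^ j = card ?C * u" using pos by simp
  then have "card ?C dvd r ^ j" by (metis dvd_triv_left)
  then obtain f where f: "card ?C = r ^ f" using divides_primepow_nat[OF prime_r] by blast
  have "card (cen {y} \<inter> cen {x}) dvd card (cen {x})"
    using sx sy by (intro card_subgroup_dvd subgroup_Int finite_sub) auto
  then have "card (cen {y} \<inter> cen {x}) * r ^ f dvd p ^ i * r ^ j" using C f by (metis mult.commute mult_dvd_mono dvd_refl)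
  moreover have "r ^ j * r ^ f dvd card ?O * (card (cen {y} \<inter> cen {x}) * r ^ f)"
    using assms(4) O by (metis mult.assoc mult_dvd_mono dvd_refl)
  ultimately have "r ^ j * r ^ f dvd card ?O * (p ^ i * r ^ j)"
    by (meson dvd_trans mult_dvd_mono dvd_refl)
  then have "r ^ f * r ^ j dvd (card ?O * p ^ i) * r ^ j" by (simp only: ac_simps)
  then have "r ^ f dvd card ?O * p ^ i" using pos by simp
  moreover have "coprime (r ^ f) (p ^ i)" using prime_p prime_r p_ne_r by (simp add: primes_coprime)
  ultimately have "r ^ f dvd card ?O" by (simp add: coprime_dvd_mult_left_iff)
  moreover have "card ?O > 0" using subgroup.one_closed[OF sy] finite_sub[OF sy] by (auto simp: card_gt_0_iff)
  ultimately have "card ?C \<le> card ?O" using f by (auto dest: dvd_imp_le)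
  moreover have "?O \<subseteq> ?C" using cen_sub by auto
  ultimately have "?O = ?C" using fin by (intro card_seteq) auto
  then obtain k where k: "k \<in> cen {y}" "cj g x = cj k x" using assms(6) by blast
  have kc: "k \<in> carrier G" using k cen_sub by auto
  have ky: "cj k y = y" using k(1) assms(3) kc by (simp add: cen_def cj_fix_iff)
  have "cj k (x \<otimes> y) = cj k (y \<otimes> x)" using assms(5) by simp
  then show ?thesis using ky k(2) kc assms(1,3) by (simp add: cj_mult)
qed

text \<open>Let \<open>M\<close> be the centralizer of the class of \<open>x\<close>, which contains \<open>y\<close>,
  and \<open>N\<close> the centralizer of \<open>M\<close>, which contains \<open>x\<close>. Both are normal,
  and they meet trivially since their intersection is abelian. Being no \<open>r\<close>-group,
  \<open>M\<close> contains an element \<open>x1\<close> of order \<open>p\<close>. The centralizer of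
  \<open>x \<otimes> x1\<close> is the intersection of the centralizers of \<open>x\<close> and of
  \<open>x1\<close>, but it has the same order as that of \<open>x\<close>, because
  \<open>x \<otimes> x1\<close> has order \<open>p\<close> and is therefore related to \<open>x\<close>. So
  everything that centralizes \<open>x\<close>, in particular \<open>M\<close>, centralizes \<open>x1\<close>,
  and \<open>x1\<close> lies in the intersection of \<open>M\<close> and \<open>N\<close>.\<close>

theorem no_commuting:
  assumes x: "x \<in> carrier G" "ord x = p" and y: "y \<in> carrier G" "ord y = r" and xy: "x \<otimes> y = y \<otimes> x"
  shows False
proof -
  interpret s: mixed_group G r p j i by (rule swap)
  define K where "K = (\<lambda>g. cj g x) ` carrier G"
  define M where "M = cen K"
  define N where "N = cen M"
  have Kc: "K \<subseteq> carrier G" using x by (auto simp: K_def)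
  have xK: "x \<in> K" unfolding K_def using x by (auto intro!: image_eqI[of _ _ "\<one>"])
  have sM: "subgroup M G" unfolding M_def by (rule subgroup_cen[OF Kc])
  have sN: "subgroup N G" unfolding N_def by (rule subgroup_cen[OF subgroup.subset[OF sM]])
  have Knor: "cj g ` K = K" if g: "g \<in> carrier G" for g
  proof -
    have "K \<subseteq> carrier G" "finite K" using Kc fin finite_subset by auto
    moreover have "cj g z \<in> K" if "z \<in> K" for z
    proof -
      obtain h where "h \<in> carrier G" "z = cj h x" using \<open>z \<in> K\<close> by (auto simp: K_def)
      then have "cj g z = cj (g \<otimes> h) x" "g \<otimes> h \<in> carrier G" using g x by (simp_all add: cj_cj)
      then show ?thesis by (auto simp: K_def)
    qed
    ultimately have "g \<in> nor K" using g by (intro norI_finite) auto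
    then show ?thesis unfolding nor_def by blast
  qed
  have nM: "cj g ` M = M" if "g \<in> carrier G" for g unfolding M_def using cen_cj[OF that Kc] Knor[OF that] by simp
  have nN: "cj g ` N = N" if "g \<in> carrier G" for g
    unfolding N_def using cen_cj[OF that subgroup.subset[OF sM]] nM[OF that] by simp
  have MN: "u \<otimes> v = v \<otimes> u" if "u \<in> M" "v \<in> N" for u v using that unfolding N_def cen_def by simp
  have yM: "y \<in> M"
    unfolding M_def cen_def K_def
    using class_commutes[OF x y(1) s.full_Sylow_in_centralizer[OF y] xy] y by auto
  have xN: "x \<in> N" using x xK unfolding N_def M_def cen_def by auto
  define B where "B = N \<inter> M"
  have sB: "subgroup B G" unfolding B_def by (intro subgroup_Int sN sM)
  have nB: "nor B = carrier G"
  proof -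
    have "cj g ` B = B" if g: "g \<in> carrier G" for g
      unfolding B_def using inj_on_image_Int[OF inj_cj[OF g] subgroup.subset[OF sN] subgroup.subset[OF sM]] nM[OF g] nN[OF g] by simp
    then show ?thesis by (auto simp: nor_def)
  qed
  have B1: "b = \<one>" if b: "b \<in> B" for b
  proof (rule ccontr)
    assume "b \<noteq> \<one>"
    then have "card B \<noteq> 1" using b subgroup.one_closed[OF sB] by (metis card_1_singletonE singletonD)
    then obtain q where q: "prime q" "q dvd card B" using prime_factor_nat by blast
    obtain b' where b': "b' \<in> B" "ord b' = q" using cauchy[OF sB finite_sub[OF sB] q] by auto
    have comm: "u \<otimes> v = v \<otimes> u" if "u \<in> B" "v \<in> B" for u v using MN[of u v] that by (simp add: B_def)
    have "q = p \<or> q = r" using prime_ord_cases[OF _ q(1) b'(2)] b'(1) subgroup.mem_carrier[OF sB] by blast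
    then show False
      using no_abelian_normal_with_p[OF sB nB comm b'(1)] s.no_abelian_normal_with_p[OF sB nB comm b'(1)] b'(2) by auto
  qed
  have "\<exists>x1\<in>M. ord x1 = p"
  proof (rule ccontr)
    assume n: "\<not> ?thesis"
    have "\<exists>k. card M = r ^ k"
    proof (rule pgroup_card[OF sM finite_sub[OF sM] prime_r])
      fix z q assume "z \<in> M" "prime q" "ord z = q"
      then show "q = r" using prime_ord_cases[of z q] subgroup.mem_carrier[OF sM] n by auto
    qed
    then obtain k where k: "card M = r ^ k" by auto
    have "y \<noteq> \<one>" using y prime_gt_1_nat[OF prime_r] by auto
    then have "M \<noteq> {\<one>}" using yM by auto
    moreover have "nor M = carrier G" using nM by (auto simp: nor_def)
    ultimately show False using s.no_normal_p_subgroup[OF sM _ k] by simp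
  qed
  then obtain x1 where x1: "x1 \<in> M" "ord x1 = p" by auto
  have x1c: "x1 \<in> carrier G" using x1 subgroup.mem_carrier[OF sM] by simp
  have nt: "x \<noteq> \<one>" "x1 \<noteq> \<one>" using x x1 prime_gt_1_nat[OF prime_p] by auto
  define w where "w = x \<otimes> x1"
  have wc: "w \<in> carrier G" using x x1c by (simp add: w_def)
  have "w [^] p = x [^] p \<otimes> x1 [^] p" unfolding w_def using MN[OF x1(1) xN] x x1c by (intro pow_mult_distrib) auto
  also have "\<dots> = \<one>" using pow_ord_eq_1[of x] pow_ord_eq_1[of x1] x x1 x1c by simp
  finally have "ord w dvd p" using pow_eq_id[OF wc] by simp
  moreover have "w \<noteq> \<one>"
  proof
    assume "w = \<one>"
    then have "x = inv x1" using x x1c inv_equality[of x x1] by (simp add: w_def)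
    then have "x \<in> B" using xN x1(1) subgroup.m_inv_closed[OF sM] by (simp add: B_def)
    then show False using B1 nt by simp
  qed
  then have "ord w \<noteq> 1" using ord_eq_1[OF wc] by simp
  ultimately have "ord w = p" using prime_p by (auto simp: prime_nat_iff)
  then have "aeq x w" using type_p x wc by blast
  then have cw: "card (cen {w}) = card (cen {x})" using aeq_card_cen x by simp
  have sub: "cen {w} \<subseteq> cen {x} \<inter> cen {x1}"
  proof
    fix g assume g: "g \<in> cen {w}"
    then have gc: "g \<in> carrier G" by (simp add: cen_def)
    have "cj g w = w" using g wc gc by (simp add: cen_def cj_fix_iff)
    then have e: "cj g x \<otimes> cj g x1 = x \<otimes> x1" using gc x x1c by (simp add: w_def cj_mult)
    have gx: "cj g x \<in> N" "cj g x1 \<in> M" using nN[OF gc] nM[OF gc] xN x1(1) by blast+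
    have "inv x \<otimes> (cj g x \<otimes> cj g x1) \<otimes> inv (cj g x1) = inv x \<otimes> (x \<otimes> x1) \<otimes> inv (cj g x1)" by (simp only: e)
    then have e2: "inv x \<otimes> cj g x = x1 \<otimes> inv (cj g x1)" using gc x x1c by (simp add: m_assoc)
    have "inv x \<otimes> cj g x \<in> N" using gx(1) xN by (simp add: subgroup.m_closed[OF sN] subgroup.m_inv_closed[OF sN])
    moreover have "x1 \<otimes> inv (cj g x1) \<in> M" using gx(2) x1 by (simp add: subgroup.m_closed[OF sM] subgroup.m_inv_closed[OF sM])
    ultimately have "inv x \<otimes> cj g x = \<one>" "x1 \<otimes> inv (cj g x1) = \<one>" using B1 e2 by (auto simp: B_def)
    then have "cj g x = x" "cj g x1 = x1" using gc x x1c
      by (metis cj_closed inv_closed inv_equality inv_inv inv_comm, metis cj_closed inv_closed inv_equality inv_inv)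
    then show "g \<in> cen {x} \<inter> cen {x1}" using gc x x1c by (simp add: cen_def cj_fix_iff)
  qed
  have "cen {w} = cen {x}"
    using sub cw finite_sub[OF subgroup_cen[of "{x}"]] x by (intro card_subset_eq) auto
  then have "cen {x} \<subseteq> cen {x1}" using sub by auto
  moreover have "M \<subseteq> cen {x}" using xK unfolding M_def cen_def by auto
  ultimately have "M \<subseteq> cen {x1}" by auto
  then have "x1 \<in> N" using x1c unfolding N_def cen_def by auto
  then show False using B1 x1(1) nt by (simp add: B_def)
qed

end

section \<open>Three primes\<close>

context p_local begin

text \<open>If a Sylow subgroup is its own normalizer, either the Sylow subgroups meet trivially, hence are abelian and
  the transfer applies, or they are nonabelian and have a small center, to whose conjugates all the
  \<open>p\<close>-elements belong.\<close>

lemma card_Ep_bound: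
  assumes perf: "derived G (carrier G) = carrier G" and single: "\<forall>x\<in>Ep. \<forall>y\<in>Ep. aeq x y"
    and q: "\<And>d. d dvd m \<Longrightarrow> d \<noteq> 1 \<Longrightarrow> q \<le> d" "q \<le> 4"
  shows "q * card Ep \<le> m * (p ^ i - 1)"
proof -
  obtain P where P: "P \<in> syl (carrier G) p" using Sp_ex by auto
  interpret P: subgroup P G by (rule sylD[OF P])
  have cen: "card (cen {x}) = p ^ i" if "x \<in> Ep" for x using single_type_central[OF single that] .
  show ?thesis
  proof (cases "nor P = P")
    case False
    then show ?thesis using count_Ep_nonselfnormal[OF P _ q(1)] by blast
  next
    case True
    note sn = selfnormal_all[OF P True]
    show ?thesis
    proof (cases "\<forall>P'\<in>syl (carrier G) p. \<forall>P''\<in>syl (carrier G) p. P' \<noteq> P'' \<longrightarrow> P' \<inter> P'' = {\<one>}")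
      case TI: True
      have "P = {\<one>}"
      proof (rule perfect_abelian_TI[OF perf P.is_subgroup fin])
        fix x y assume xy: "x \<in> P" "y \<in> P"
        show "x \<otimes> y = y \<otimes> x"
        proof (cases "x = \<one>")
          case True then show ?thesis using xy by simp
        next
          case False
          have xE: "x \<in> Ep" using p_subgroup_mem[OF P.is_subgroup card_Sp[OF P] xy(1) False] .
          have "x \<in> cen {x}" using xy by (simp add: cen_def)
          then have "P = cen {x}" using TI P cen_in_syl[OF xE cen[OF xE]] xy(1) False by blast
          then have "y \<in> cen {x}" using xy(2) by blast
          then show ?thesis unfolding cen_def by (simp only: mem_Collect_eq ball_simps)
        qed
      next
        fix g x assume g: "g \<in> carrier G" "g \<notin> P" "x \<in> P" "cj g x \<in> P"
        have "cj g ` P \<noteq> P" using g True by (auto simp: nor_def)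
        then have "P \<inter> cj g ` P = {\<one>}" using TI P syl_cj[OF P g(1) subgroup_self] by metis
        then have "cj g x = \<one>" using g by blast
        then show "x = \<one>" using g by simp
      qed
      then have "p ^ i = 1" using card_Sp[OF P] by simp
      moreover have "1 < p ^ i" using one_less_power[OF prime_gt_1_nat[OF prime_p] i_pos] .
      ultimately show ?thesis by linarith
    next
      case False
      then obtain P1 P2 where P12: "P1 \<in> syl (carrier G) p" "P2 \<in> syl (carrier G) p" "P1 \<noteq> P2" "P1 \<inter> P2 \<noteq> {\<one>}" by blast
      define \<zeta> where "\<zeta> = card (P \<inter> cen P)"
      have "card Ep = card (syl (carrier G) p) * (\<zeta> - 1)"
        unfolding \<zeta>_def using cen central_card(2) P by (intro card_central_blocks) auto
      then have e: "card Ep = m * (\<zeta> - 1)" using card_Sp_selfnormal[OF P True] by simp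
      have "4 * \<zeta> \<le> p ^ i" unfolding \<zeta>_def by (rule nonTI_center_small[OF P12 P])
      then have "4 * (\<zeta> - 1) \<le> p ^ i - 1" by simp
      then have "m * (4 * (\<zeta> - 1)) \<le> m * (p ^ i - 1)" by (rule mult_le_mono2)
      moreover have "q * card Ep \<le> 4 * card Ep" using q(2) by (rule mult_le_mono1)
      moreover have "4 * card Ep = m * (4 * (\<zeta> - 1))" by (simp add: e)
      ultimately show ?thesis by linarith
    qed
  qed
qed

end

context group begin

text \<open>The product of two commuting elements of different prime orders does not have prime order.\<close>

lemma p_local_of_prime_orders:
  assumes "\<forall>x\<in>carrier G. x \<noteq> \<one> \<longrightarrow> prime (ord x)" "prime p" "order G = p ^ i * m" "\<not> p dvd m" "i > 0"
  shows "p_local G p i m"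
proof
  fix x assume x: "x \<in> carrier G" "ord x = p"
  have "order G > 0" using assms(2-4) by (auto simp: prime_gt_0_nat intro!: Nat.gr0I)
  then have fin: "finite (carrier G)" by (simp add: order_gt_0_iff_finite)
  have s: "subgroup (cen {x}) G" using x by (intro subgroup_cen) auto
  have f: "finite (cen {x})" using fin cen_sub finite_subset by metis
  show "\<exists>k. card (cen {x}) = p ^ k"
  proof (rule pgroup_card[OF s f assms(2)])
    fix y q assume y: "y \<in> cen {x}" "prime q" "ord y = q"
    have yc: "y \<in> carrier G" and xy: "x \<otimes> y = y \<otimes> x" using y by (auto simp: cen_def)
    show "q = p"
    proof (rule ccontr)
      assume "q \<noteq> p"
      have pw: "(x \<otimes> y) [^] n = x [^] n \<otimes> y [^] n" for n :: nat using x yc xy by (intro pow_mult_distrib)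
      have ne: "x \<otimes> y \<noteq> \<one>"
      proof
        assume "x \<otimes> y = \<one>"
        then have "x = inv y" using x yc inv_equality[of x y] by simp
        then show False using x y yc \<open>q \<noteq> p\<close> by simp
      qed
      define t where "t = ord (x \<otimes> y)"
      have pt: "prime t" unfolding t_def using assms(1) ne x yc by simp
      have t1: "x [^] t \<otimes> y [^] t = \<one>" using pw[of t] pow_ord_eq_1[of "x \<otimes> y"] x yc by (simp add: t_def)
      have "(x [^] t \<otimes> y [^] t) [^] p = x [^] (t * p) \<otimes> y [^] (t * p)"
        using pw[of "t * p"] pw[of t] x yc by (simp add: nat_pow_pow flip: pw)
      moreover have "x [^] (t * p) = \<one>" using pow_eq_id[of x "t * p"] x by simp
      ultimately have "y [^] (t * p) = \<one>" using t1 x yc by simp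
      then have "q dvd t * p" using pow_eq_id[of y "t * p"] y(3) yc by simp
      then have "q = t" using \<open>q \<noteq> p\<close> y(2) pt assms(2) by (metis prime_dvd_mult_iff primes_dvd_imp_eq)
      have "(x [^] t \<otimes> y [^] t) [^] q = x [^] (t * q) \<otimes> y [^] (t * q)"
        using pw[of "t * q"] pw[of t] x yc by (simp add: nat_pow_pow flip: pw)
      moreover have "y [^] (t * q) = \<one>" using pow_eq_id[of y "t * q"] y yc by simp
      ultimately have "x [^] (t * q) = \<one>" using t1 x yc by simp
      then have "p dvd t * q" using pow_eq_id[of x "t * q"] x by simp
      then have "p = q" using \<open>q = t\<close> y(2) assms(2) by (metis prime_dvd_mult_iff primes_dvd_imp_eq)
      then show False using \<open>q \<noteq> p\<close> by simp
    qed
  qed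
qed (use assms in auto)

end

locale three_primes = group +
  fixes p q r i j k :: nat
  assumes perfect: "derived G (carrier G) = carrier G"
    and primes: "prime p" "prime q" "prime r" and distinct: "p \<noteq> q" "p \<noteq> r" "q \<noteq> r"
    and order_eq: "order G = p ^ i * q ^ j * r ^ k" and pos: "i > 0" "j > 0" "k > 0"
    and prime_ord: "\<forall>x\<in>carrier G. x \<noteq> \<one> \<longrightarrow> prime (ord x)"
    and type: "\<forall>x\<in>carrier G. \<forall>y\<in>carrier G. ord x = ord y \<longrightarrow> aeq x y"
begin

lemma swap_qr: "three_primes G p r q i k j"
  by unfold_locales (use perfect primes distinct order_eq pos prime_ord type in \<open>auto simp: ac_simps\<close>)

lemma rotate: "three_primes G q p r j i k"
  by unfold_locales (use perfect primes distinct order_eq pos prime_ord type in \<open>auto simp: ac_simps\<close>)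

lemma not_dvd: "\<not> p dvd q ^ a * r ^ b"
  using primes distinct by (metis prime_dvd_mult_iff prime_dvd_power_nat primes_dvd_imp_eq)

sublocale p_local G p i "q ^ j * r ^ k"
  by (rule p_local_of_prime_orders) (use prime_ord primes order_eq not_dvd pos in \<open>simp_all add: ac_simps\<close>)

lemma Ep_alt: "Ep = {x\<in>carrier G. ord x = p}"
proof -
  have "ord x = p" if "x \<in> carrier G" "x \<noteq> \<one>" "ord x = p ^ l" for x l
    using prime_ord that by (metis prime_power_eq_one_iff prime_dvd_power_nat primes(1) primes_dvd_imp_eq dvd_refl)
  moreover have "x \<noteq> \<one>" if "ord x = p" for x using that primes(1) prime_gt_1_nat[of p] by auto
  moreover have "p = p ^ 1" by simp
  ultimately show ?thesis unfolding Ep_def by (auto intro: exI[of _ 1])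
qed

lemma single: "\<forall>x\<in>Ep. \<forall>y\<in>Ep. aeq x y" using type by (simp add: Ep_alt)

lemma ord_cases: assumes "x \<in> carrier G" "x \<noteq> \<one>" shows "ord x = p \<or> ord x = q \<or> ord x = r"
proof -
  have "ord x dvd p ^ i * q ^ j * r ^ k" using ord_dvd_card[OF subgroup_self fin assms(1)] order_eq by (simp add: order_def)
  then show ?thesis using prime_ord assms primes by (metis prime_dvd_mult_iff prime_dvd_power_nat primes_dvd_imp_eq)
qed

lemma order_split: "p ^ i * q ^ j * r ^ k = 1 + card {x\<in>carrier G. ord x = p} + card {x\<in>carrier G. ord x = q} + card {x\<in>carrier G. ord x = r}"
proof -
  have gt: "1 < p" "1 < q" "1 < r" using prime_gt_1_nat primes by blast+
  have "carrier G = insert \<one> ({x\<in>carrier G. ord x = p} \<union> {x\<in>carrier G. ord x = q} \<union> {x\<in>carrier G. ord x = r})"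
    using ord_cases by auto
  then have "card (carrier G) = card (insert \<one> ({x\<in>carrier G. ord x = p} \<union> {x\<in>carrier G. ord x = q} \<union> {x\<in>carrier G. ord x = r}))"
    by simp
  also have "\<dots> = Suc (card ({x\<in>carrier G. ord x = p} \<union> {x\<in>carrier G. ord x = q} \<union> {x\<in>carrier G. ord x = r}))"
    using fin gt by (intro card_insert_disjoint) auto
  also have "card ({x\<in>carrier G. ord x = p} \<union> {x\<in>carrier G. ord x = q} \<union> {x\<in>carrier G. ord x = r})
     = card ({x\<in>carrier G. ord x = p} \<union> {x\<in>carrier G. ord x = q}) + card {x\<in>carrier G. ord x = r}"
    using fin distinct by (intro card_Un_disjoint) auto
  also have "card ({x\<in>carrier G. ord x = p} \<union> {x\<in>carrier G. ord x = q}) = card {x\<in>carrier G. ord x = p} + card {x\<in>carrier G. ord x = q}"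
    using fin distinct by (intro card_Un_disjoint) auto
  finally show ?thesis using order_eq by (simp add: order_def)
qed

lemma bound:
  assumes "\<And>d. d dvd q ^ j * r ^ k \<Longrightarrow> d \<noteq> 1 \<Longrightarrow> n \<le> d" "n \<le> 4"
  shows "n * card {x\<in>carrier G. ord x = p} + q ^ j * r ^ k \<le> p ^ i * q ^ j * r ^ k"
proof -
  have "n * card {x\<in>carrier G. ord x = p} \<le> q ^ j * r ^ k * (p ^ i - 1)"
    using card_Ep_bound[OF perfect single assms] Ep_alt by simp
  moreover obtain a where a: "p ^ i = Suc a" using p_pos not0_implies_Suc[of "p ^ i"] by auto
  moreover have "p ^ i * q ^ j * r ^ k = q ^ j * r ^ k + q ^ j * r ^ k * a"
    by (simp only: a add_mult_distrib add_mult_distrib2 mult_Suc_right ac_simps mult_Suc)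
  ultimately show ?thesis by (simp only: diff_Suc_1)
qed

text \<open>In a group of odd order the bound on the number of elements of each prime order holds with the factor 3, and
  too few elements remain.\<close>

lemma two_is_one_of_the_primes: "p = 2 \<or> q = 2 \<or> r = 2"
proof (rule ccontr)
  assume n: "\<not> ?thesis"
  interpret Q: three_primes G q p r j i k by (rule rotate)
  interpret R0: three_primes G p r q i k j by (rule swap_qr)
  interpret R: three_primes G r p q k i j by (rule R0.rotate)
  have odd: "odd p" "odd q" "odd r" using n primes by (metis primes_dvd_imp_eq two_is_prime_nat)+
  have three: "3 \<le> d" if "d dvd u" "odd u" "d \<noteq> 1" for d u :: nat
  proof -
    have "odd d" using that by (meson dvd_trans)
    then show ?thesis using that(3) by (cases "d = 0"; cases "d = 2") (auto simp: numeral_eq_Suc)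
  qed
  have b: "3 * card {x\<in>carrier G. ord x = p} + q ^ j * r ^ k \<le> p ^ i * q ^ j * r ^ k"
    using three odd by (intro bound) auto
  have c: "3 * card {x\<in>carrier G. ord x = q} + p ^ i * r ^ k \<le> q ^ j * p ^ i * r ^ k"
    using three odd by (intro Q.bound) auto
  have d: "3 * card {x\<in>carrier G. ord x = r} + p ^ i * q ^ j \<le> r ^ k * p ^ i * q ^ j"
    using three odd by (intro R.bound) auto
  have gt: "1 < q ^ j" "1 < p ^ i" "1 < r ^ k" using one_less_power prime_gt_1_nat primes pos by blast+
  have gt2: "1 < q ^ j * r ^ k" "1 < p ^ i * r ^ k" "1 < p ^ i * q ^ j" using gt less_1_mult by blast+
  have arith: "False" if "N = 1 + x + y + z" "3 * x + A \<le> N" "3 * y + B \<le> N" "3 * z + C \<le> N" "1 < A" "1 < B" "1 < C"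
    for N x y z A B C :: nat using that by linarith
  have e: "q ^ j * p ^ i * r ^ k = p ^ i * q ^ j * r ^ k" "r ^ k * p ^ i * q ^ j = p ^ i * q ^ j * r ^ k" by (simp_all only: ac_simps)
  show False by (rule arith[OF order_split b c[unfolded e(1)] d[unfolded e(2)] gt2])
qed

end

section \<open>Three primes, one of them even\<close>

text \<open>Here \<open>a\<close>, \<open>b\<close>, \<open>c\<close> are the orders of the Sylow subgroups,
  \<open>\<kappa> * (b * c)\<close> is the number of involutions, \<open>nb\<close> and \<open>nc\<close> are
  the numbers of elements of the odd prime orders. The count of all elements and the estimate for the pairs of
  involutions are compatible only if all the inequalities are equalities.\<close>

lemma three_primes_count_arith:
  fixes a b c \<kappa> nb nc :: nat
  assumes split: "a * b * c = 1 + \<kappa> * (b * c) + nb + nc"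
    and b2: "2 * nb + a * c \<le> a * b * c" and c2: "2 * nc + a * b \<le> a * b * c"
    and pairs: "(\<kappa> * (b * c)) * (\<kappa> * (b * c)) \<le> \<kappa> * (b * c) * (a - 1) + nb * b + nc * c"
    and pos: "a \<ge> 2" "b \<ge> 3" "c \<ge> 3" "\<kappa> \<ge> 1"
  shows "\<kappa> = 1 \<and> a * (b + c) = 2 + 2 * (b * c) \<and> 2 * nb + a * c = a * b * c \<and> 2 * nc + a * b = a * b * c"
proof -
  define A B C K U Y where "A = int a" and "B = int b" and "C = int c" and "K = int \<kappa>" and "U = int nb" and "Y = int nc"
  have s: "A * B * C = 1 + K * (B * C) + U + Y" using split unfolding A_def B_def C_def K_def U_def Y_def
    by (metis of_nat_1 of_nat_add of_nat_mult)
  have x: "2 * U \<le> A * B * C - A * C" using b2 unfolding A_def B_def C_def U_def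
    by (metis (mono_tags, opaque_lifting) of_nat_add of_nat_le_iff of_nat_mult of_nat_numeral le_diff_eq)
  have y: "2 * Y \<le> A * B * C - A * B" using c2 unfolding A_def B_def C_def Y_def
    by (metis (mono_tags, opaque_lifting) of_nat_add of_nat_le_iff of_nat_mult of_nat_numeral le_diff_eq)
  have p: "(K * (B * C)) * (K * (B * C)) \<le> K * (B * C) * (A - 1) + U * B + Y * C"
  proof -
    have "int ((\<kappa> * (b * c)) * (\<kappa> * (b * c))) \<le> int (\<kappa> * (b * c) * (a - 1) + nb * b + nc * c)" using pairs by linarith
    moreover have "int (a - 1) = A - 1" using pos(1) by (simp add: A_def of_nat_diff)
    ultimately show ?thesis unfolding B_def C_def K_def U_def Y_def by simp
  qed
  have ps: "A \<ge> 2" "B \<ge> 3" "C \<ge> 3" "K \<ge> 1" using pos by (simp_all add: A_def B_def C_def K_def)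
  have BC: "B * C > 0" using ps by simp
  have xB: "2 * U * B \<le> (A * B * C - A * C) * B" using x ps by (intro mult_right_mono) auto
  have yC: "2 * Y * C \<le> (A * B * C - A * B) * C" using y ps by (intro mult_right_mono) auto
  have "(B * C) * (2 * (K * K * (B * C))) \<le> (B * C) * (2 * K * (A - 1) + A * (B + C - 2))"
  proof -
    have "2 * ((K * (B * C)) * (K * (B * C))) \<le> 2 * (K * (B * C) * (A - 1)) + (A * B * C - A * C) * B + (A * B * C - A * B) * C"
      using p xB yC by linarith
    moreover have "(A * B * C - A * C) * B + (A * B * C - A * B) * C = (B * C) * (A * (B + C - 2))"
      by (simp add: algebra_simps)
    ultimately show ?thesis by (simp add: algebra_simps)
  qed
  then have I1: "2 * (K * K * (B * C)) \<le> 2 * K * (A - 1) + A * (B + C - 2)" using BC by (simp only: mult_le_cancel_left_pos)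
  have I2: "A * (B + C) \<le> 2 + 2 * (K * (B * C))" using s x y by (simp add: algebra_simps)
  have "K * (A * (B + C)) \<le> K * (2 + 2 * (K * (B * C)))" using I2 ps by (intro mult_left_mono) auto
  then have "A * (K * (B + C)) \<le> A * (2 * K + (B + C - 2))" using I1 by (simp add: algebra_simps)
  then have "K * (B + C) \<le> 2 * K + (B + C - 2)" using ps by (simp add: mult_le_cancel_left_pos)
  then have "(K - 1) * (B + C - 2) \<le> 0" by (simp add: algebra_simps)
  moreover have "B + C - 2 > 0" using ps by linarith
  ultimately have "K \<le> 1" by (simp add: mult_le_0_iff)
  then have K1: "K = 1" using ps by simp
  have E: "A * (B + C) = 2 + 2 * (B * C)" using I1 I2 K1 by (simp add: algebra_simps)
  have "2 * U = A * B * C - A * C" "2 * Y = A * B * C - A * B" using s x y E K1 by (simp_all add: algebra_simps)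
  then have "int (2 * nb + a * c) = int (a * b * c)" "int (2 * nc + a * b) = int (a * b * c)"
    unfolding A_def B_def C_def U_def Y_def by simp_all
  moreover have "int (a * (b + c)) = int (2 + 2 * (b * c))" using E unfolding A_def B_def C_def by simp
  moreover have "\<kappa> = 1" using K1 by (simp add: K_def)
  ultimately show ?thesis by linarith
qed

text \<open>With \<open>s = a - 1\<close> and \<open>b = s * e\<close> the equation implies
  \<open>c = 2 + s * f\<close>. Substituting this shows that \<open>e \<ge> 2\<close> is impossible for
  reasons of size, and then that \<open>f = 1\<close>.\<close>

lemma final_arith:
  fixes a b c e :: nat
  assumes E: "a * (b + c) = 2 + 2 * (b * c)" and b: "b = (a - 1) * e" and "a \<ge> 4" "c \<ge> 3" "b \<ge> 3"
  shows "b = a - 1 \<and> c = a + 1"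
proof -
  define s where "s = int a - 1"
  define B C I where "B = int b" and "C = int c" and "I = int e"
  have s3: "s \<ge> 3" using assms(3) by (simp add: s_def)
  have B: "B = s * I" using b assms(3) by (simp add: B_def s_def I_def of_nat_diff)
  have E': "(s + 1) * (B + C) = 2 + 2 * (B * C)"
  proof -
    have "int (a * (b + c)) = int (2 + 2 * (b * c))" using E by simp
    then show ?thesis by (simp add: s_def B_def C_def)
  qed
  have I1: "I \<ge> 1" using b assms(5) by (cases e) (auto simp: I_def)
  have "C - 2 = s * (2 * I * C - s * I - I - C)" using E' B by (simp add: algebra_simps)
  then obtain f where f: "C = 2 + s * f" by (metis add.commute diff_add_cancel)
  have C3: "C \<ge> 3" using assms(4) by (simp add: C_def)
  have "s * f \<ge> 1" using f C3 by linarith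
  moreover have "s * f \<le> 0" if "f \<le> 0" using mult_nonneg_nonpos[OF _ that, of s] s3 by simp
  ultimately have f1: "f \<ge> 1" by linarith
  have eq: "s * (s * (2 * I * f - I - f)) = s * (f + 2 - 3 * I)" using E' B f by (simp add: algebra_simps)
  then have eq: "s * (2 * I * f - I - f) = f + 2 - 3 * I" using s3 by simp
  have "I = 1"
  proof (rule ccontr)
    assume "I \<noteq> 1"
    then have I2: "I \<ge> 2" using I1 by linarith
    have "2 * I * f - I - f = I * (f - 1) + f * (I - 1)" by (simp add: algebra_simps)
    moreover have "I * (f - 1) \<ge> 0" using I1 f1 by simp
    moreover have "f * (I - 1) \<ge> f * 1" using I2 f1 by (intro mult_left_mono) auto
    ultimately have "2 * I * f - I - f \<ge> f" by linarith
    then have "s * (2 * I * f - I - f) \<ge> 3 * f" using s3 f1 by (intro mult_mono) auto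
    then show False using eq I2 f1 by linarith
  qed
  then have "s * (f - 1) = f - 1" using eq by (simp add: algebra_simps)
  then have "(s - 1) * (f - 1) = 0" by (simp add: algebra_simps)
  then have "f = 1" using s3 by simp
  then have "C = s + 2" "B = s" using f B \<open>I = 1\<close> by simp_all
  then show ?thesis using assms(3) by (simp add: C_def B_def s_def)
qed

text \<open>The exponent \<open>k\<close> is even by reduction modulo 4, so \<open>2 ^ i\<close> is the product of two
  numbers that differ by 2.\<close>

lemma two_power_plus_one_eq_three_power:
  assumes "(2::nat) ^ i + 1 = 3 ^ k" "i \<ge> 2" shows "i = 3 \<and> k = 2"
proof -
  have "k mod 2 = 0"
  proof (rule ccontr)
    assume "k mod 2 \<noteq> 0"
    then obtain l where l: "k = 2 * l + 1" by (metis not_mod_2_eq_0_eq_1 mult_div_mod_eq)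
    have "(3::nat) ^ k mod 4 = 3"
    proof -
      have "(9::nat) ^ l mod 4 = 1" by (induction l) (auto simp: mod_mult_right_eq[symmetric])
      moreover have "(3::nat) ^ k = 3 * 9 ^ l" using l by (simp add: power_mult)
      moreover have "(3 * 9 ^ l) mod 4 = (3 * (9 ^ l mod 4)) mod (4::nat)" by (rule mod_mult_right_eq[symmetric])
      ultimately show ?thesis by simp
    qed
    moreover have "(2::nat) ^ i mod 4 = 0" using assms(2) le_imp_power_dvd[of 2 i "2::nat"] by (simp add: mod_eq_0_iff_dvd)
    then have "((2::nat) ^ i + 1) mod 4 = 1" by (metis mod_add_left_eq add_0 mod_less one_less_numeral_iff semiring_norm(76))
    ultimately show False using assms(1) by simp
  qed
  then obtain l where l: "k = 2 * l" by auto
  define t where "t = (3::nat) ^ l"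
  have t1: "t \<ge> 1" by (simp add: t_def)
  have tt: "t * t = 2 ^ i + 1" using assms(1) l by (simp add: t_def power_mult_distrib mult_2 power_add)
  have "(t - 1) * (t + 1) = 2 ^ i" using tt t1 by (cases t) (auto simp: algebra_simps)
  then have "t - 1 dvd 2 ^ i" "t + 1 dvd 2 ^ i" by (metis dvd_triv_left, metis dvd_triv_right)
  then obtain u v where u: "t - 1 = 2 ^ u" and v: "t + 1 = 2 ^ v"
    using divides_primepow_nat[OF two_is_prime_nat] by blast
  have uv: "(2::nat) ^ v = 2 ^ u + 2" using u v t1 by linarith
  have "u < v" using uv by (metis less_add_same_cancel1 one_less_numeral_iff power_less_imp_less_exp semiring_norm(76) zero_less_numeral)
  then have "(2::nat) ^ u dvd 2 ^ u + 2" using uv by (metis le_imp_power_dvd less_imp_le)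
  then have "(2::nat) ^ u dvd 2" by (metis dvd_add_right_iff dvd_refl)
  then have "(2::nat) ^ u \<le> 2" by (rule dvd_imp_le) simp
  have "u = 0 \<or> u = 1"
  proof (rule ccontr)
    assume "\<not> ?thesis"
    then have "2 \<le> u" by linarith
    then have "(2::nat) ^ 2 \<le> 2 ^ u" by (rule power_increasing) simp
    then show False using \<open>(2::nat) ^ u \<le> 2\<close> by simp
  qed
  then have "u = 1"
  proof
    assume "u = 0"
    then have "(2::nat) ^ v = 3" using uv by simp
    moreover have "even ((2::nat) ^ v)" using \<open>u < v\<close> by simp
    ultimately show ?thesis by simp
  qed
  then have "t = 3" using u t1 by simp
  then have "(3::nat) ^ l = 3 ^ 1" by (simp add: t_def)
  then have "l = 1" by (subst (asm) power_inject_exp) auto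
  have "(2::nat) ^ i = 2 ^ 3" using tt \<open>t = 3\<close> by simp
  then have "i = 3" by (subst (asm) power_inject_exp) auto
  then show ?thesis using l \<open>l = 1\<close> by simp
qed

locale even_case = three_primes G 2 q r i j k for G (structure) and q r i j k
begin

lemma swap: "even_case G r q i k j"
  by (rule even_case.intro) (rule swap_qr)

sublocale Q: p_local G q j "2 ^ i * r ^ k"
proof -
  interpret Q: three_primes G q 2 r j i k by (rule rotate)
  show "p_local G q j (2 ^ i * r ^ k)" by unfold_locales
qed

sublocale R: p_local G r k "2 ^ i * q ^ j"
proof -
  interpret R0: three_primes G 2 r q i k j by (rule swap_qr)
  interpret R: three_primes G r 2 q k i j by (rule R0.rotate)
  show "p_local G r k (2 ^ i * q ^ j)" by unfold_locales
qed

lemma EQ: "Q.Ep = {x\<in>carrier G. ord x = q}"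
proof -
  interpret Q: three_primes G q 2 r j i k by (rule rotate)
  show ?thesis by (rule Q.Ep_alt)
qed

lemma odd_qr: "odd q" "odd r"
  using primes distinct by (metis primes_dvd_imp_eq two_is_prime_nat)+

lemma ge3: "q \<ge> 3" "r \<ge> 3" "q ^ j \<ge> 3" "r ^ k \<ge> 3"
proof -
  show q: "q \<ge> 3" using primes(2) distinct(1) prime_ge_2_nat[of q] by linarith
  show r: "r \<ge> 3" using primes(3) distinct(2) prime_ge_2_nat[of r] by linarith
  have "q ^ 1 \<le> q ^ j" using q pos by (intro power_increasing) auto
  then show "q ^ j \<ge> 3" using q by simp
  have "r ^ 1 \<le> r ^ k" using r pos by (intro power_increasing) auto
  then show "r ^ k \<ge> 3" using r by simp
qed

lemma card_cen_2: "x \<in> carrier G \<Longrightarrow> ord x = 2 \<Longrightarrow> card (cen {x}) = 2 ^ i"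
  using single_type_central[OF single] Ep_alt by simp

lemma card_cen_q: "x \<in> carrier G \<Longrightarrow> ord x = q \<Longrightarrow> card (cen {x}) = q ^ j"
proof -
  interpret Q: three_primes G q 2 r j i k by (rule rotate)
  show "x \<in> carrier G \<Longrightarrow> ord x = q \<Longrightarrow> card (cen {x}) = q ^ j"
    using Q.single_type_central[OF Q.single] Q.Ep_alt by simp
qed

lemma invol_iff: "t \<in> carrier G \<Longrightarrow> ord t = 2 \<longleftrightarrow> t \<noteq> \<one> \<and> t \<otimes> t = \<one>"
proof -
  assume t: "t \<in> carrier G"
  have "ord t = 2 \<longleftrightarrow> ord t dvd 2 \<and> ord t \<noteq> 1" by (auto simp: dvd_def) (metis One_nat_def Suc_1 dvd_triv_left nat_dvd_1_iff_1 prime_nat_iff two_is_prime_nat)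
  also have "\<dots> \<longleftrightarrow> t [^] (2::nat) = \<one> \<and> t \<noteq> \<one>" unfolding pow_eq_id[OF t] ord_eq_1[OF t, symmetric] by simp
  also have "t [^] (2::nat) = t \<otimes> t" using t by (simp add: numeral_2_eq_2)
  finally show ?thesis by auto
qed

definition I where "I = {t\<in>carrier G. ord t = 2}"

lemma I_iff: "t \<in> I \<longleftrightarrow> t \<in> carrier G \<and> t \<noteq> \<one> \<and> t \<otimes> t = \<one>"
  using invol_iff by (auto simp: I_def)

lemma I_inv: "t \<in> I \<Longrightarrow> inv t = t"
  unfolding I_iff using inv_equality by auto

definition inverting where "inverting x = {t\<in>I. cj t x = inv x}"

text \<open>The product of two elements that invert \<open>x\<close> centralizes \<open>x\<close>.\<close>

lemma inverting_coset:
  assumes "x \<in> carrier G" "t \<in> inverting x" "u \<in> inverting x" shows "t \<otimes> u \<in> cen {x}"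
proof -
  have c: "t \<in> carrier G" "u \<in> carrier G" "cj t x = inv x" "cj u x = inv x"
    using assms(2,3) by (auto simp: inverting_def I_iff)
  have "cj (t \<otimes> u) x = cj t (cj u x)" by (rule cj_cj[symmetric, OF c(1,2) assms(1)])
  also have "\<dots> = x" using c assms(1) by (simp add: cj_inv)
  finally show ?thesis using c assms(1) by (simp add: cen_def cj_fix_iff)
qed

lemma card_inverting_le: assumes "x \<in> carrier G" shows "card (inverting x) \<le> card (cen {x})"
proof (cases "inverting x = {}")
  case False
  then obtain t where t: "t \<in> inverting x" by auto
  have tc: "t \<in> carrier G" using t by (auto simp: inverting_def I_iff)
  have "inj_on ((\<otimes>) t) (inverting x)"
    using inj_on_cmult[OF tc] by (rule inj_on_subset) (auto simp: inverting_def I_iff)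
  moreover have "(\<otimes>) t ` inverting x \<subseteq> cen {x}" using inverting_coset[OF assms t] by auto
  ultimately show ?thesis using finite_sub[OF subgroup_cen1[OF assms]] by (meson card_inj_on_le)
qed simp

lemma finite_I: "finite I" using fin by (simp add: I_def)

text \<open>If \<open>t \<otimes> u = x\<close> with involutions \<open>t\<close> and \<open>u\<close>, then
  \<open>t\<close> inverts \<open>x\<close> and determines \<open>u\<close>. Grouping the pairs of involutions
  by their products bounds their number.\<close>

lemma pairs_inverting: "card I * card I \<le> card I * (2 ^ i - 1) + (\<Sum>x | x \<in> carrier G \<and> ord x = q. card (inverting x)) + (\<Sum>x | x \<in> carrier G \<and> ord x = r. card (inverting x))"
proof -
  define W where "W x = {(t, u). t \<in> I \<and> u \<in> I \<and> t \<otimes> u = x}" for x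
  have fW: "finite (W x)" for x by (rule finite_subset[of _ "I \<times> I"]) (auto simp: W_def finite_I)
  have "I \<times> I = (\<Union>x\<in>carrier G. W x)" by (auto simp: W_def I_iff)
  then have "card (I \<times> I) = (\<Sum>x\<in>carrier G. card (W x))"
    using fin fW by (simp only:, intro card_UN_disjoint) (auto simp: W_def)
  also have "\<dots> \<le> (\<Sum>x\<in>carrier G. if x = \<one> then card I else if ord x = 2 then 2 ^ i - 2 else card (inverting x))"
  proof (rule sum_mono)
    fix x assume x: "x \<in> carrier G"
    have W: "W x \<subseteq> (\<lambda>t. (t, t \<otimes> x)) ` {t\<in>I. t \<otimes> x \<in> I}"
    proof
      fix w assume "w \<in> W x"
      then obtain t u where w: "w = (t, u)" "t \<in> I" "u \<in> I" "t \<otimes> u = x" by (auto simp: W_def)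
      have "t \<otimes> x = u" using w(2-4) I_inv[OF w(2)] by (metis I_iff inv_cancel_left(1))
      then show "w \<in> (\<lambda>t. (t, t \<otimes> x)) ` {t\<in>I. t \<otimes> x \<in> I}" using w by auto
    qed
    have WI: "card (W x) \<le> card {t\<in>I. t \<otimes> x \<in> I}"
      using card_mono[OF _ W] card_image_le[of "{t\<in>I. t \<otimes> x \<in> I}" "\<lambda>t. (t, t \<otimes> x)"] finite_I by fastforce
    have sub: "{t\<in>I. t \<otimes> x \<in> I} \<subseteq> inverting x"
    proof
      fix t assume t: "t \<in> {t\<in>I. t \<otimes> x \<in> I}"
      then have tc: "t \<in> carrier G" by (simp add: I_iff)
      have "t \<otimes> x \<otimes> (t \<otimes> x) = \<one>" using t by (simp add: I_iff)
      then have "t \<otimes> x \<otimes> t \<otimes> x = \<one>" using tc x by (simp add: m_assoc)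
      then have "t \<otimes> x \<otimes> t = inv x" using tc x inv_equality[of "t \<otimes> x \<otimes> t" x] by simp
      then show "t \<in> inverting x" using t I_inv[of t] by (simp add: inverting_def cj_def)
    qed
    have fi: "finite (inverting x)" using finite_I by (simp add: inverting_def)
    consider "x = \<one>" | "x \<noteq> \<one>" "ord x = 2" | "x \<noteq> \<one>" "ord x = q" | "x \<noteq> \<one>" "ord x = r" using ord_cases[OF x] by auto
    then show "card (W x) \<le> (if x = \<one> then card I else if ord x = 2 then 2 ^ i - 2 else card (inverting x))"
    proof cases
      case 1
      have "card {t\<in>I. t \<otimes> x \<in> I} \<le> card I" using finite_I by (intro card_mono) auto
      then show ?thesis using WI 1 by simp
    next
      case 2
      have xI: "x \<in> I" using 2 x by (simp add: I_def)
      have "{t\<in>I. t \<otimes> x \<in> I} \<subseteq> cen {x} - {\<one>, x}"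
      proof
        fix t assume t: "t \<in> {t\<in>I. t \<otimes> x \<in> I}"
        then have tc: "t \<in> carrier G" "t \<noteq> \<one>" by (auto simp: I_iff)
        have "cj t x = x" using sub t I_inv[OF xI] by (auto simp: inverting_def)
        then have "t \<in> cen {x}" using tc x by (simp add: cen_def cj_fix_iff)
        moreover have "t \<noteq> x" using t by (auto simp: I_iff)
        ultimately show "t \<in> cen {x} - {\<one>, x}" using tc by simp
      qed
      then have "card {t\<in>I. t \<otimes> x \<in> I} \<le> card (cen {x} - {\<one>, x})"
        using finite_sub[OF subgroup_cen1[OF x]] by (intro card_mono) auto
      also have "\<dots> = card (cen {x}) - card {\<one>, x}"
        using x by (intro card_Diff_subset) (auto simp: cen_def)
      also have "\<dots> = 2 ^ i - 2" using card_cen_2[OF x] 2 by simp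
      finally show ?thesis using WI 2 by simp
    next
      case 3
      have "card {t\<in>I. t \<otimes> x \<in> I} \<le> card (inverting x)" using sub fi by (intro card_mono)
      then show ?thesis using WI 3 distinct by simp
    next
      case 4
      have "card {t\<in>I. t \<otimes> x \<in> I} \<le> card (inverting x)" using sub fi by (intro card_mono)
      then show ?thesis using WI 4 distinct by simp
    qed
  qed
  also have "\<dots> = card I + card I * (2 ^ i - 2) + (\<Sum>x | x \<in> carrier G \<and> ord x = q. card (inverting x)) + (\<Sum>x | x \<in> carrier G \<and> ord x = r. card (inverting x))"
  proof -
    define f where "f x = (if x = \<one> then card I else if ord x = 2 then 2 ^ i - 2 else card (inverting x))" for x
    let ?S = "\<lambda>n. {x\<in>carrier G. ord x = n}"
    have gt: "1 < q" "1 < r" using ge3 by simp_all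
    have "carrier G = insert \<one> (?S 2 \<union> (?S q \<union> ?S r))" using ord_cases by auto
    then have "sum f (carrier G) = sum f (insert \<one> (?S 2 \<union> (?S q \<union> ?S r)))" by simp
    also have "\<dots> = f \<one> + sum f (?S 2 \<union> (?S q \<union> ?S r))" using fin gt by (intro sum.insert) auto
    also have "sum f (?S 2 \<union> (?S q \<union> ?S r)) = sum f (?S 2) + sum f (?S q \<union> ?S r)"
      using fin distinct by (intro sum.union_disjoint) auto
    also have "sum f (?S q \<union> ?S r) = sum f (?S q) + sum f (?S r)"
      using fin distinct by (intro sum.union_disjoint) auto
    also have "sum f (?S 2) = (\<Sum>x\<in>?S 2. 2 ^ i - 2)" by (intro sum.cong) (auto simp: f_def)
    also have "sum f (?S q) = (\<Sum>x\<in>?S q. card (inverting x))" using gt distinct by (intro sum.cong) (auto simp: f_def)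
    also have "sum f (?S r) = (\<Sum>x\<in>?S r. card (inverting x))" using gt distinct by (intro sum.cong) (auto simp: f_def)
    finally have "sum f (carrier G) = card I + (card I * (2 ^ i - 2) + ((\<Sum>x\<in>?S q. card (inverting x)) + (\<Sum>x\<in>?S r. card (inverting x))))"
      by (simp add: f_def I_def)
    then show ?thesis unfolding f_def by simp
  qed
  finally have "card I * card I \<le> card I + card I * (2 ^ i - 2) + (\<Sum>x | x \<in> carrier G \<and> ord x = q. card (inverting x)) + (\<Sum>x | x \<in> carrier G \<and> ord x = r. card (inverting x))"
    by (simp add: card_cartesian_product)
  moreover have "card I + card I * (2 ^ i - 2) = card I * (2 ^ i - 1)"
  proof -
    have "(2::nat) ^ 1 \<le> 2 ^ i" using i_pos by (intro power_increasing) auto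
    then have "2 ^ i - 1 = Suc (2 ^ i - 2)" by simp
    then show ?thesis by (simp only: mult_Suc_right)
  qed
  ultimately show ?thesis by simp
qed

lemma sum_inverting_le: "(\<Sum>x | x \<in> carrier G \<and> ord x = q. card (inverting x)) \<le> card {x\<in>carrier G. ord x = q} * q ^ j"
proof -
  have "(\<Sum>x | x \<in> carrier G \<and> ord x = q. card (inverting x)) \<le> (\<Sum>x | x \<in> carrier G \<and> ord x = q. q ^ j)"
    using card_inverting_le card_cen_q by (intro sum_mono) fastforce
  then show ?thesis by simp
qed

lemma inverting_swap: "even_case.inverting G = inverting"
proof -
  interpret S: even_case G r q i k j by (rule swap)
  show ?thesis by (intro ext) (simp add: S.inverting_def inverting_def S.I_def I_def)
qed

lemma pairs_le: "card I * card I \<le> card I * (2 ^ i - 1) + card {x\<in>carrier G. ord x = q} * q ^ j + card {x\<in>carrier G. ord x = r} * r ^ k"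
proof -
  interpret S: even_case G r q i k j by (rule swap)
  show ?thesis using pairs_inverting sum_inverting_le S.sum_inverting_le by simp
qed

text \<open>The centralizer of an involution is a Sylow 2-subgroup, so every class of involutions has
  \<open>q ^ j * r ^ k\<close> elements.\<close>

lemma involution_classes: "\<exists>\<kappa>\<ge>1. card I = \<kappa> * (q ^ j * r ^ k)"
proof -
  have a: "acts (carrier G) cj I"
    by (rule acts_cj[OF subgroup_self]) (auto simp: I_def iso_ord[OF cj_iso])
  have "q ^ j * r ^ k dvd card I"
  proof (rule dvd_card_acts[OF a finite_I])
    fix x assume x: "x \<in> I"
    then have xc: "x \<in> carrier G" "ord x = 2" by (simp_all add: I_def)
    have "{g\<in>carrier G. cj g x = x} = cen {x}" using xc by (auto simp: cen_def cj_fix_iff)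
    then have "2 ^ i * (q ^ j * r ^ k) = card ((\<lambda>g. cj g x) ` carrier G) * 2 ^ i"
      using orbit_stabilizer[OF a fin x] card_cen_2[OF xc] order_pm by (simp add: order_def)
    then have "card ((\<lambda>g. cj g x) ` carrier G) = q ^ j * r ^ k" by simp
    then show "q ^ j * r ^ k dvd card ((\<lambda>g. cj g x) ` carrier G)" by simp
  qed
  then obtain \<kappa> where \<kappa>: "card I = \<kappa> * (q ^ j * r ^ k)" by (metis dvdE mult.commute)
  obtain t where "t \<in> Ep" using Ep_nonempty by auto
  then have "t \<in> I" using Ep_alt by (simp add: I_def)
  then have "card I \<noteq> 0" using finite_I by auto
  then have "\<kappa> \<ge> 1" using \<kappa> by (cases \<kappa>) auto
  then show ?thesis using \<kappa> by blast
qed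

lemma counts:
  "card I = q ^ j * r ^ k" "2 ^ i * (q ^ j + r ^ k) = 2 + 2 * (q ^ j * r ^ k)"
  "2 * card {x\<in>carrier G. ord x = q} + 2 ^ i * r ^ k = 2 ^ i * q ^ j * r ^ k"
proof -
  interpret QQ: three_primes G q 2 r j i k by (rule rotate)
  interpret R0: three_primes G 2 r q i k j by (rule swap_qr)
  interpret RR: three_primes G r 2 q k i j by (rule R0.rotate)
  have two: "2 \<le> d" if "d dvd u" "u > 0" "d \<noteq> 1" for d u :: nat
  proof -
    have "d \<noteq> 0" using that by (intro notI) simp
    then show ?thesis using that(3) by linarith
  qed
  have gq: "q ^ j > 0" "r ^ k > 0" using ge3 by simp_all
  obtain \<kappa> where \<kappa>: "\<kappa> \<ge> 1" "card I = \<kappa> * (q ^ j * r ^ k)" using involution_classes by auto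
  have "\<kappa> = 1 \<and> 2 ^ i * (q ^ j + r ^ k) = 2 + 2 * (q ^ j * r ^ k) \<and>
     2 * card {x\<in>carrier G. ord x = q} + 2 ^ i * r ^ k = 2 ^ i * q ^ j * r ^ k \<and>
     2 * card {x\<in>carrier G. ord x = r} + 2 ^ i * q ^ j = 2 ^ i * q ^ j * r ^ k"
  proof (rule three_primes_count_arith)
    show "2 ^ i * q ^ j * r ^ k = 1 + \<kappa> * (q ^ j * r ^ k) + card {x\<in>carrier G. ord x = q} + card {x\<in>carrier G. ord x = r}"
      using order_split \<kappa>(2) by (simp add: I_def)
    have "2 * card {x\<in>carrier G. ord x = q} + 2 ^ i * r ^ k \<le> q ^ j * 2 ^ i * r ^ k"
      by (rule QQ.bound) (use gq in \<open>auto intro!: two\<close>)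
    then show "2 * card {x\<in>carrier G. ord x = q} + 2 ^ i * r ^ k \<le> 2 ^ i * q ^ j * r ^ k" by (simp only: ac_simps)
    have "2 * card {x\<in>carrier G. ord x = r} + 2 ^ i * q ^ j \<le> r ^ k * 2 ^ i * q ^ j"
      by (rule RR.bound) (use gq in \<open>auto intro!: two\<close>)
    then show "2 * card {x\<in>carrier G. ord x = r} + 2 ^ i * q ^ j \<le> 2 ^ i * q ^ j * r ^ k" by (simp only: ac_simps)
    show "\<kappa> * (q ^ j * r ^ k) * (\<kappa> * (q ^ j * r ^ k)) \<le> \<kappa> * (q ^ j * r ^ k) * (2 ^ i - 1) +
      card {x\<in>carrier G. ord x = q} * q ^ j + card {x\<in>carrier G. ord x = r} * r ^ k" using pairs_le \<kappa>(2) by simp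
    have "(2::nat) ^ 1 \<le> 2 ^ i" using i_pos by (intro power_increasing) auto
    then show "(2::nat) \<le> 2 ^ i" by simp
  qed (use ge3 \<kappa> in auto)
  then show "card I = q ^ j * r ^ k" "2 ^ i * (q ^ j + r ^ k) = 2 + 2 * (q ^ j * r ^ k)"
    "2 * card {x\<in>carrier G. ord x = q} + 2 ^ i * r ^ k = 2 ^ i * q ^ j * r ^ k" using \<kappa>(2) by auto
qed

end

lemma pairs_arith:
  fixes a b c x y n :: nat
  assumes "n = b * c" "a * (b + c) = 2 + 2 * (b * c)" "2 * x + a * c = a * b * c" "2 * y + a * b = a * b * c" "a \<ge> 1"
  shows "n * n = n * (a - 1) + x * b + y * c"
proof -
  define A B C V W where "A = int a" and "B = int b" and "C = int c" and "V = int x" and "W = int y"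
  have 1: "A * (B + C) = 2 + 2 * (B * C)"
  proof -
    have "int (a * (b + c)) = int (2 + 2 * (b * c))" using assms(2) by simp
    then show ?thesis by (simp add: A_def B_def C_def)
  qed
  have 2: "2 * V = A * B * C - A * C"
  proof -
    have "int (2 * x + a * c) = int (a * b * c)" using assms(3) by simp
    then show ?thesis by (simp add: A_def B_def C_def V_def)
  qed
  have 3: "2 * W = A * B * C - A * B"
  proof -
    have "int (2 * y + a * b) = int (a * b * c)" using assms(4) by simp
    then show ?thesis by (simp add: A_def B_def C_def W_def)
  qed
  have "2 * ((B * C) * (A - 1) + V * B + W * C) = 2 * ((B * C) * (A - 1)) + (2 * V) * B + (2 * W) * C" by (simp add: algebra_simps)
  also have "\<dots> = (B * C) * (A * (B + C) - 2)" unfolding 2 3 by (simp add: algebra_simps)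
  also have "\<dots> = 2 * ((B * C) * (B * C))" unfolding 1 by simp
  finally have "(B * C) * (B * C) = (B * C) * (A - 1) + V * B + W * C" by simp
  moreover have "int (a - 1) = A - 1" using assms(5) by (simp add: A_def of_nat_diff)
  ultimately have "int (n * n) = int (n * (a - 1) + x * b + y * c)"
    unfolding assms(1) by (simp add: B_def C_def V_def W_def)
  then show ?thesis by (simp only: of_nat_eq_iff)
qed

context p_local begin

lemma abelian_syl_eq_cen:
  assumes "\<And>x. x \<in> Ep \<Longrightarrow> card (cen {x}) = p ^ i" "P \<in> syl (carrier G) p"
    "\<And>x y. x \<in> P \<Longrightarrow> y \<in> P \<Longrightarrow> x \<otimes> y = y \<otimes> x" "x \<in> P" "x \<noteq> \<one>"
  shows "P = cen {x}"
proof (rule card_subset_eq)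
  have x: "x \<in> Ep" using p_subgroup_mem[OF sylD(1)[OF assms(2)] card_Sp[OF assms(2)]] assms(4,5) .
  then have xc: "x \<in> carrier G" by (simp add: Ep_def)
  show "finite (cen {x})" by (rule finite_sub[OF subgroup_cen1[OF xc]])
  show "P \<subseteq> cen {x}" using assms(3,4) syl_carrier[OF assms(2)] unfolding cen_def by blast
  show "card P = card (cen {x})" using assms(1)[OF x] card_Sp[OF assms(2)] by simp
qed

lemma card_Ep_abelian:
  assumes c: "\<And>x. x \<in> Ep \<Longrightarrow> card (cen {x}) = p ^ i" and P: "P \<in> syl (carrier G) p"
    and ab: "\<And>x y. x \<in> P \<Longrightarrow> y \<in> P \<Longrightarrow> x \<otimes> y = y \<otimes> x"
  shows "card Ep = card (syl (carrier G) p) * (p ^ i - 1)"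
proof -
  have "P \<inter> cen P = P" using ab syl_carrier[OF P] unfolding cen_def by blast
  moreover have "card Ep = card (syl (carrier G) p) * (card (P \<inter> cen P) - 1)"
    using c central_card(2) P by (intro card_central_blocks) auto
  ultimately show ?thesis using card_Sp[OF P] by simp
qed

end

context even_case begin

text \<open>The counting inequalities leave no slack, so every element of order \<open>q\<close> is inverted by as many
  involutions as its centralizer allows.\<close>

lemma card_inverting: assumes x: "x \<in> carrier G" "ord x = q" shows "card (inverting x) = q ^ j"
proof (rule ccontr)
  assume ne: "card (inverting x) \<noteq> q ^ j"
  interpret S: even_case G r q i k j by (rule swap)
  let ?Q = "{x. x \<in> carrier G \<and> ord x = q}" and ?R = "{x. x \<in> carrier G \<and> ord x = r}"
  have le: "card (inverting y) \<le> q ^ j" if "y \<in> ?Q" for y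
    using card_inverting_le[of y] card_cen_q[of y] that by simp
  have "(\<Sum>x\<in>?Q. card (inverting x)) < (\<Sum>x\<in>?Q. q ^ j)"
  proof (rule sum_strict_mono_ex1)
    show "finite ?Q" using fin by simp
    show "\<forall>y\<in>?Q. card (inverting y) \<le> q ^ j" using le by blast
    have "card (inverting x) < q ^ j" using ne le[of x] x by simp
    then show "\<exists>y\<in>?Q. card (inverting y) < q ^ j" using x by blast
  qed
  then have lt: "(\<Sum>x\<in>?Q. card (inverting x)) < card ?Q * q ^ j" by simp
  have r: "(\<Sum>x\<in>?R. card (inverting x)) \<le> card ?R * r ^ k" using S.sum_inverting_le inverting_swap by simp
  have "card I * card I = card I * (2 ^ i - 1) + card ?Q * q ^ j + card ?R * r ^ k"
  proof (rule pairs_arith)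
    show "card I = q ^ j * r ^ k" "2 ^ i * (q ^ j + r ^ k) = 2 + 2 * (q ^ j * r ^ k)"
      "2 * card ?Q + 2 ^ i * r ^ k = 2 ^ i * q ^ j * r ^ k" by (rule counts)+
    have "2 ^ i * r ^ k * q ^ j = 2 ^ i * q ^ j * r ^ k" by (simp only: ac_simps)
    then show "2 * card ?R + 2 ^ i * q ^ j = 2 ^ i * q ^ j * r ^ k" using S.counts(3) by simp
  qed simp
  then show False using pairs_inverting lt r by linarith
qed

lemma ex_inverting: assumes "x \<in> carrier G" "ord x = q" shows "\<exists>t. t \<in> inverting x"
proof -
  have "card (inverting x) \<noteq> 0" using card_inverting[OF assms] ge3 by simp
  then show ?thesis by (metis card.empty ex_in_conv)
qed

text \<open>The involutions inverting \<open>x\<close> fill the coset of \<open>t\<close>, so \<open>y\<close> is the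
  product of \<open>t\<close> and another involution.\<close>

lemma inverted_cen:
  assumes x: "x \<in> carrier G" "ord x = q" and t: "t \<in> inverting x" and y: "y \<in> cen {x}" shows "cj t y = inv y"
proof -
  have tI: "t \<in> I" using t by (simp add: inverting_def)
  then have tc: "t \<in> carrier G" by (simp add: I_iff)
  have "(\<otimes>) t ` inverting x = cen {x}"
  proof (rule card_subset_eq)
    show "finite (cen {x})" by (rule finite_sub[OF subgroup_cen1[OF x(1)]])
    show "(\<otimes>) t ` inverting x \<subseteq> cen {x}" using inverting_coset[OF x(1) t] by auto
    have "inj_on ((\<otimes>) t) (inverting x)"
      using inj_on_cmult[OF tc] by (rule inj_on_subset) (auto simp: inverting_def I_iff)
    then show "card ((\<otimes>) t ` inverting x) = card (cen {x})"
      using card_inverting[OF x] card_cen_q[OF x] by (simp add: card_image)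
  qed
  then obtain u where u: "u \<in> inverting x" "y = t \<otimes> u" using y by blast
  have uI: "u \<in> I" using u by (simp add: inverting_def)
  then have uc: "u \<in> carrier G" by (simp add: I_iff)
  have "t \<otimes> (t \<otimes> u) = u" using inv_cancel_left(1)[OF tc uc] I_inv[OF tI] by simp
  then have "cj t y = u \<otimes> t" using u(2) I_inv[OF tI] by (simp add: cj_def)
  moreover have "inv y = u \<otimes> t" using u(2) tc uc by (simp add: inv_mult_group I_inv[OF tI] I_inv[OF uI])
  ultimately show ?thesis by simp
qed

text \<open>Inversion agrees on the centralizer with conjugation by an involution, hence is multiplicative.\<close>

lemma cen_comm:
  assumes x: "x \<in> carrier G" "ord x = q" and y: "y \<in> cen {x}" and z: "z \<in> cen {x}" shows "y \<otimes> z = z \<otimes> y"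
proof -
  obtain t where t: "t \<in> inverting x" using ex_inverting[OF x] by auto
  have c: "t \<in> carrier G" "y \<in> carrier G" "z \<in> carrier G" using t y z cen_sub by (auto simp: inverting_def I_iff)
  have "y \<otimes> z \<in> cen {x}" using y z subgroup.m_closed[OF subgroup_cen1[OF x(1)]] by blast
  then have "inv (y \<otimes> z) = cj t (y \<otimes> z)" using inverted_cen[OF x t] by simp
  also have "\<dots> = inv y \<otimes> inv z" using c inverted_cen[OF x t] y z by (simp add: cj_mult)
  also have "\<dots> = inv (z \<otimes> y)" using c by (simp add: inv_mult_group)
  finally show ?thesis using c by (metis inv_inv m_closed)
qed

lemma card_cen_Q: "x \<in> Q.Ep \<Longrightarrow> card (cen {x}) = q ^ j" using card_cen_q by (simp add: EQ)

lemma card_cen_E: "x \<in> Ep \<Longrightarrow> card (cen {x}) = 2 ^ i" using card_cen_2 by (simp add: Ep_alt)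

lemma syl_q_abelian: assumes P: "P \<in> syl (carrier G) q" and xy: "x \<in> P" "y \<in> P" shows "x \<otimes> y = y \<otimes> x"
proof -
  obtain z where z: "z \<in> P \<inter> cen P" "z \<noteq> \<one>" using Q.center_ex[OF P] by auto
  have zE: "z \<in> Q.Ep" using Q.central_card(2)[OF P z] .
  have "P = cen {z}" using Q.cen_syl_unique[OF zE card_cen_Q[OF zE] P] z by blast
  moreover have "z \<in> carrier G" "ord z = q" using zE by (simp_all add: EQ)
  ultimately show ?thesis using cen_comm xy by blast
qed

lemma syl_q_eq: "P \<in> syl (carrier G) q \<Longrightarrow> x \<in> P \<Longrightarrow> x \<noteq> \<one> \<Longrightarrow> P = cen {x}"
  using Q.abelian_syl_eq_cen[OF card_cen_Q] syl_q_abelian by blast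

lemma syl_2_sq: assumes P: "P \<in> syl (carrier G) 2" and "x \<in> P" shows "x \<otimes> x = \<one>"
proof (cases "x = \<one>")
  case False
  then have "x \<in> Ep" using p_subgroup_mem[OF sylD(1)[OF P] card_Sp[OF P] assms(2)] by simp
  then show ?thesis using I_iff by (simp add: Ep_alt I_def)
qed simp

lemma syl_2_abelian: assumes P: "P \<in> syl (carrier G) 2" and xy: "x \<in> P" "y \<in> P" shows "x \<otimes> y = y \<otimes> x"
proof -
  have c: "x \<in> carrier G" "y \<in> carrier G" using syl_carrier[OF P] xy by auto
  have i: "inv x = x" "inv y = y" using syl_2_sq[OF P] xy c inv_equality by blast+
  have "x \<otimes> y \<in> P" using xy subgroup.m_closed[OF sylD(1)[OF P]] by blast
  then have "inv (x \<otimes> y) = x \<otimes> y" using syl_2_sq[OF P] c inv_equality by blast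
  then show ?thesis using i c by (simp add: inv_mult_group)
qed

lemma syl_2_eq: "P \<in> syl (carrier G) 2 \<Longrightarrow> x \<in> P \<Longrightarrow> x \<noteq> \<one> \<Longrightarrow> P = cen {x}"
  using abelian_syl_eq_cen[OF card_cen_E] syl_2_abelian by blast

lemma card_nor_q: assumes P: "P \<in> syl (carrier G) q" shows "card (nor P) = 2 * q ^ j"
proof -
  define n where "n = card (syl (carrier G) q)"
  have e: "card {x\<in>carrier G. ord x = q} = n * (q ^ j - 1)"
    using Q.card_Ep_abelian[OF card_cen_Q P syl_q_abelian[OF P]] unfolding EQ n_def by simp
  obtain b where b: "q ^ j = Suc b" "b > 0" using ge3(3) by (cases "q ^ j") auto
  have "2 * (n * b) + 2 ^ i * r ^ k = 2 ^ i * Suc b * r ^ k" using counts(3) e b(1) by simp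
  then have "b * (2 * n) = b * (2 ^ i * r ^ k)" by (simp add: algebra_simps)
  then have n: "2 * n = 2 ^ i * r ^ k" using b(2) by simp
  have "n * card (nor P) = q ^ j * (2 ^ i * r ^ k)" using Q.count_Sp[OF P] by (simp add: n_def)
  then have "n * card (nor P) = n * (2 * q ^ j)" using n by (metis mult.assoc mult.commute)
  moreover have "n > 0" using n ge3 by (intro Nat.gr0I) auto
  ultimately show ?thesis by simp
qed

lemma two_pow_ge_4: "(2::nat) ^ i \<ge> 4"
proof -
  have "i \<noteq> 1"
  proof
    assume "i = 1"
    then have e: "q ^ j + r ^ k = 1 + q ^ j * r ^ k" using counts(2) by simp
    obtain b where b: "q ^ j = Suc (Suc b)" using ge3(3) by (metis add_2_eq_Suc le_Suc_ex numeral_3_eq_3 add_Suc)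
    obtain c where c: "r ^ k = Suc (Suc c)" using ge3(4) by (metis add_2_eq_Suc le_Suc_ex numeral_3_eq_3 add_Suc)
    show False using e unfolding b c by simp
  qed
  then have "2 \<le> i" using i_pos by linarith
  then have "(2::nat) ^ 2 \<le> 2 ^ i" by (intro power_increasing) auto
  then show ?thesis by simp
qed

lemma card_nor_2: assumes P: "P \<in> syl (carrier G) 2"
  shows "card (syl (carrier G) 2) * (2 ^ i - 1) = q ^ j * r ^ k" "card (nor P) = 2 ^ i * (2 ^ i - 1)"
proof -
  define n where "n = card (syl (carrier G) 2)"
  have "Ep = I" by (simp add: Ep_alt I_def)
  then have e: "n * (2 ^ i - 1) = q ^ j * r ^ k"
    using card_Ep_abelian[OF card_cen_E P syl_2_abelian[OF P]] counts(1) unfolding n_def by simp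
  then show "card (syl (carrier G) 2) * (2 ^ i - 1) = q ^ j * r ^ k" by (simp add: n_def)
  have "n * card (nor P) = 2 ^ i * (n * (2 ^ i - 1))" using count_Sp[OF P] e by (simp add: n_def)
  also have "\<dots> = n * (2 ^ i * (2 ^ i - 1))" by (simp only: ac_simps)
  finally have "n * card (nor P) = n * (2 ^ i * (2 ^ i - 1))" .
  moreover have "n > 0" using e ge3 by (intro Nat.gr0I) auto
  ultimately show "card (nor P) = 2 ^ i * (2 ^ i - 1)" by simp
qed

lemma syl_2_ne_one: "P \<in> syl (carrier G) 2 \<Longrightarrow> P \<noteq> {\<one>}"
  using card_Sp[of P] two_pow_ge_4 by auto

text \<open>The involution fixes a nontrivial element of \<open>P\<close>, and \<open>P\<close> is the centralizer of
  that element.\<close>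

lemma involution_normalizing: assumes P: "P \<in> syl (carrier G) 2" and t: "t \<in> nor P" "ord t = 2" shows "t \<in> P"
proof -
  have tc: "t \<in> carrier G" using t subgroup.mem_carrier[OF subgroup_nor[OF syl_carrier[OF P]]] by blast
  note gs = generate_singleton[OF tc]
  have gn: "generate G {t} \<subseteq> nor P"
    using t(1) by (intro generate_subgroup_incl subgroup_nor[OF syl_carrier[OF P]]) auto
  have "\<exists>z\<in>P. z \<noteq> \<one> \<and> (\<forall>l\<in>generate G {t}. cj l z = z)"
  proof (rule pgroup_fixed_element[OF gs(1) _ two_is_prime_nat sylD(1)[OF P] card_Sp[OF P] syl_2_ne_one[OF P]])
    show "card (generate G {t}) = 2 ^ 1" using gs(3) t(2) by simp
    show "\<And>l x. l \<in> generate G {t} \<Longrightarrow> x \<in> P \<Longrightarrow> cj l x \<in> P" using gn norD by blast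
  qed
  then obtain z where z: "z \<in> P" "z \<noteq> \<one>" "cj t z = z" using gs(2) by auto
  have "t \<in> cen {z}" using z(3) tc cj_fix_iff[OF tc, of z] syl_carrier[OF P] z(1) unfolding cen_def by blast
  then show ?thesis using syl_2_eq[OF P z(1,2)] by simp
qed

lemma not_commuting_2_q:
  assumes "t \<in> carrier G" "ord t = 2" "u \<in> carrier G" "ord u = q" "t \<otimes> u = u \<otimes> t" shows False
proof -
  have "t \<in> cen {u}" using assms unfolding cen_def by simp
  then have "2 dvd q ^ j" using ord_dvd_card[OF subgroup_cen1 finite_sub[OF subgroup_cen1]] assms card_cen_q by metis
  then show False using odd_qr by simp
qed

lemma ord_q_subgroup:
  assumes "subgroup U G" "card U = q ^ s" "u \<in> U" "u \<noteq> \<one>" shows "u \<in> carrier G" "ord u = q"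
  using Q.p_subgroup_mem[OF assms] by (simp_all add: EQ)

text \<open>The normalizer of a full Sylow \<open>q\<close>-subgroup has order \<open>2 * q ^ j\<close>, so a normalizer
  of \<open>U\<close> larger than \<open>U\<close> would contain an involution \<open>t\<close>. It belongs to
  \<open>P\<close>, and its commutators with elements of \<open>U\<close> lie in both \<open>P\<close> and
  \<open>U\<close>; but an involution commutes with no element of order \<open>q\<close>.\<close>

lemma selfnormal_in_normalizer:
  assumes P: "P \<in> syl (carrier G) 2" and N: "card (nor P) = 2 ^ i * (q ^ s * r ^ l)" and s: "s > 0"
    and U: "U \<in> syl (nor P) q"
  shows "card U = q ^ s" "nor U \<inter> nor P = U" "\<And>u. u \<in> U \<Longrightarrow> u \<noteq> \<one> \<Longrightarrow> U = cen {u} \<inter> nor P"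
proof -
  let ?N = "nor P"
  have sN: "subgroup ?N G" by (rule subgroup_nor[OF syl_carrier[OF P]])
  have sU: "subgroup U G" by (rule sylD[OF U])
  have cop: "coprime q 2" "coprime q r" using primes distinct odd_qr by (simp_all add: primes_coprime)
  have "multiplicity q (2 ^ i * (q ^ s * r ^ l)) = s" using primes distinct Q.p_pos R.p_pos
    by (simp add: prime_elem_multiplicity_mult_distrib multiplicity_distinct_prime_power)
  then show cU: "card U = q ^ s" using sylD(3)[OF U] N by simp
  have max: "L = U" if L: "subgroup L G" "L \<subseteq> ?N" "card L = q ^ e" "U \<subseteq> L" for L e
  proof -
    have "q ^ e dvd 2 ^ i * (q ^ s * r ^ l)" using card_subgroup_dvd[OF L(1) sN L(2) finite_sub[OF sN]] N L(3) by simp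
    then have "q ^ e dvd q ^ s" using cop by (simp add: coprime_dvd_mult_left_iff coprime_dvd_mult_right_iff)
    then have "card L \<le> card U" using L(3) cU Q.p_pos by (simp add: dvd_imp_le)
    then show ?thesis using card_seteq[OF finite_sub[OF L(1)] L(4)] by simp
  qed
  have V: "U = cen {u} \<inter> ?N" "cen {u} \<in> syl (carrier G) q" if u: "u \<in> U" "u \<noteq> \<one>" for u
  proof -
    note uo = ord_q_subgroup[OF sU cU u]
    have uE: "u \<in> Q.Ep" using uo by (simp add: EQ)
    show V: "cen {u} \<in> syl (carrier G) q" by (rule Q.cen_in_syl[OF uE card_cen_Q[OF uE]])
    obtain V' where V': "V' \<in> syl (carrier G) q" using Q.Sp_ex by auto
    obtain g where g: "g \<in> carrier G" "U \<subseteq> cj g ` V'"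
      using pgroup_in_syl[OF subgroup_self fin primes(2) V' sU subgroup.subset[OF sU] cU] by auto
    have "cj g ` V' = cen {u}" using syl_q_eq[OF syl_cj[OF V' g(1) subgroup_self]] g(2) u by blast
    then have UV: "U \<subseteq> cen {u} \<inter> ?N" using g(2) sylD(2)[OF U] by blast
    have si: "subgroup (cen {u} \<inter> ?N) G" by (intro subgroup_Int sN sylD(1)[OF V])
    have "card (cen {u} \<inter> ?N) dvd q ^ j"
      using card_subgroup_dvd[OF si sylD(1)[OF V] _ finite_sub[OF sylD(1)[OF V]]] card_cen_q[OF uo] by simp
    then obtain e where "card (cen {u} \<inter> ?N) = q ^ e" using divides_primepow_nat[OF primes(2)] by blast
    then show "U = cen {u} \<inter> ?N" using max[OF si _ _ UV] by simp
  qed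
  then show "\<And>u. u \<in> U \<Longrightarrow> u \<noteq> \<one> \<Longrightarrow> U = cen {u} \<inter> nor P" by blast
  have "1 < q ^ s" using one_less_power[OF prime_gt_1_nat[OF primes(2)] s] .
  then have "U \<noteq> {\<one>}" using cU by auto
  then obtain u where u: "u \<in> U" "u \<noteq> \<one>" using subgroup.one_closed[OF sU] by blast
  note uo = ord_q_subgroup[OF sU cU u]
  have sNU: "subgroup (nor U) G" by (rule subgroup_nor[OF subgroup.subset[OF sU]])
  have si: "subgroup (nor U \<inter> ?N) G" by (intro subgroup_Int sNU sN)
  have sVN: "subgroup (nor (cen {u})) G" by (rule subgroup_nor[OF cen_sub])
  have "nor U \<subseteq> nor (cen {u})"
  proof
    fix g assume g: "g \<in> nor U"
    have gc: "g \<in> carrier G" using g unfolding nor_def by blast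
    have gu: "cj g u \<in> U" "cj g u \<noteq> \<one>" using norD[OF g u(1)] gc uo u(2) by simp_all
    have "cj g ` cen {u} = cen {cj g u}" using cen_cj[OF gc, of "{u}"] uo by simp
    also have "\<dots> = cen {u}" using syl_q_eq[OF V(2)[OF u] _ gu(2)] V(1)[OF u] gu(1) by blast
    finally show "g \<in> nor (cen {u})" using gc unfolding nor_def by blast
  qed
  then have "card (nor U \<inter> ?N) dvd card (nor (cen {u}))" by (intro card_subgroup_dvd si sVN finite_sub[OF sVN]) blast
  then have d: "card (nor U \<inter> ?N) dvd 2 * q ^ j" using card_nor_q[OF V(2)[OF u]] by simp
  have "odd (card (nor U \<inter> ?N))"
  proof
    assume "even (card (nor U \<inter> ?N))"
    then obtain t where t: "t \<in> nor U" "t \<in> ?N" "ord t = 2" using cauchy[OF si finite_sub[OF si] two_is_prime_nat] by blast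
    have tc: "t \<in> carrier G" using t(1) subgroup.mem_carrier[OF sNU] by blast
    have tP: "t \<in> P" by (rule involution_normalizing[OF P t(2,3)])
    have uN: "u \<in> ?N" using sylD(2)[OF U] u(1) by blast
    define w where "w = cj t u \<otimes> inv u"
    have w1: "w \<in> U" unfolding w_def using norD[OF t(1) u(1)] u(1) sU by (simp add: subgroup.m_closed subgroup.m_inv_closed)
    have "w = t \<otimes> cj u (inv t)" unfolding w_def cj_def using tc uo by (simp add: m_assoc)
    then have w2: "w \<in> P" using tP norD[OF uN] sylD(1)[OF P] by (simp add: subgroup.m_closed subgroup.m_inv_closed)
    have "w = \<one>"
    proof (rule ccontr)
      assume w: "w \<noteq> \<one>"
      have "ord w = q" using ord_q_subgroup[OF sU cU w1 w] by simp
      moreover have "w \<in> Ep" using p_subgroup_mem[OF sylD(1)[OF P] card_Sp[OF P] w2 w] .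
      ultimately show False using distinct by (simp add: Ep_alt)
    qed
    then have "cj t u \<otimes> inv u = u \<otimes> inv u" unfolding w_def using uo by simp
    then have "cj t u = u" using right_cancel[of "inv u" "cj t u" u] tc uo by simp
    then have "t \<otimes> u = u \<otimes> t" using cj_fix_iff tc uo by blast
    then show False using not_commuting_2_q tc t(3) uo by blast
  qed
  then have "coprime (card (nor U \<inter> ?N)) 2" by (simp add: coprime_right_2_iff_odd)
  then have "card (nor U \<inter> ?N) dvd q ^ j" using d by (simp add: coprime_dvd_mult_right_iff)
  then obtain e where "card (nor U \<inter> ?N) = q ^ e" using divides_primepow_nat[OF primes(2)] by blast
  then show "nor U \<inter> nor P = U" using max[OF si] subgroup_sub_nor[OF sU] sylD(2)[OF U] by blast
qed

text \<open>The Sylow \<open>q\<close>-subgroups of the normalizer of \<open>P\<close> meet trivially, and being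
  self-normalizing they are as many as their index.\<close>

lemma count_q_in_normalizer:
  assumes P: "P \<in> syl (carrier G) 2" and N: "card (nor P) = 2 ^ i * (q ^ s * r ^ l)" and s: "s > 0"
  shows "2 ^ i * r ^ l * (q ^ s - 1) \<le> card {x\<in>nor P. ord x = q}"
proof -
  have sN: "subgroup (nor P) G" by (rule subgroup_nor[OF syl_carrier[OF P]])
  note fN = finite_sub[OF sN]
  note sn = selfnormal_in_normalizer[OF P N s]
  obtain U where U: "U \<in> syl (nor P) q" using syl_nonempty[OF sN fN primes(2)] by auto
  have "2 ^ i * (q ^ s * r ^ l) = card (syl (nor P) q) * q ^ s"
    using card_syl[OF sN fN primes(2) U] sn(1,2)[OF U] N by simp
  then have "q ^ s * (2 ^ i * r ^ l) = q ^ s * card (syl (nor P) q)" by (simp only: ac_simps)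
  then have n: "card (syl (nor P) q) = 2 ^ i * r ^ l" using Q.p_pos by simp
  have "card (\<Union>U\<in>syl (nor P) q. U - {\<one>}) = (\<Sum>U\<in>syl (nor P) q. card (U - {\<one>}))"
  proof (rule card_UN_disjoint)
    show "finite (syl (nor P) q)" by (rule finite_syl[OF fN])
    show "\<forall>U\<in>syl (nor P) q. finite (U - {\<one>})" using finite_sub sylD(1) by blast
    show "\<forall>U\<in>syl (nor P) q. \<forall>U'\<in>syl (nor P) q. U \<noteq> U' \<longrightarrow> (U - {\<one>}) \<inter> (U' - {\<one>}) = {}"
    proof (intro ballI impI)
      fix U U' assume U: "U \<in> syl (nor P) q" "U' \<in> syl (nor P) q" "U \<noteq> U'"
      show "(U - {\<one>}) \<inter> (U' - {\<one>}) = {}"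
      proof (rule ccontr)
        assume "(U - {\<one>}) \<inter> (U' - {\<one>}) \<noteq> {}"
        then obtain u where "u \<in> U" "u \<in> U'" "u \<noteq> \<one>" by blast
        then have "U = cen {u} \<inter> nor P" "U' = cen {u} \<inter> nor P" using sn(3) U by blast+
        then show False using U(3) by simp
      qed
    qed
  qed
  also have "\<dots> = (\<Sum>U\<in>syl (nor P) q. q ^ s - 1)"
  proof (rule sum.cong[OF refl])
    fix U assume U: "U \<in> syl (nor P) q"
    have "card (U - {\<one>}) = card U - 1" using subgroup.one_closed[OF sylD(1)[OF U]] by simp
    then show "card (U - {\<one>}) = q ^ s - 1" using sn(1)[OF U] by simp
  qed
  finally have "card (\<Union>U\<in>syl (nor P) q. U - {\<one>}) = 2 ^ i * r ^ l * (q ^ s - 1)" using n by simp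
  moreover have "(\<Union>U\<in>syl (nor P) q. U - {\<one>}) \<subseteq> {x\<in>nor P. ord x = q}"
  proof
    fix x assume "x \<in> (\<Union>U\<in>syl (nor P) q. U - {\<one>})"
    then obtain U where "U \<in> syl (nor P) q" "x \<in> U" "x \<noteq> \<one>" by blast
    then show "x \<in> {x\<in>nor P. ord x = q}" using ord_q_subgroup(2)[OF sylD(1) sn(1)] sylD(2) by blast
  qed
  moreover have "finite {x\<in>nor P. ord x = q}" using fN by simp
  ultimately show ?thesis using card_mono by metis
qed

text \<open>If both \<open>q\<close> and \<open>r\<close> divided the order of the normalizer of \<open>P\<close>, its
  elements of orders \<open>q\<close> and \<open>r\<close> would outnumber it.\<close>

lemma normalizer_one_prime: "2 ^ i - 1 dvd q ^ j \<or> 2 ^ i - 1 dvd r ^ k"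
proof -
  interpret S: even_case G r q i k j by (rule swap)
  obtain P where P: "P \<in> syl (carrier G) 2" using Sp_ex by auto
  have "2 ^ i - 1 dvd q ^ j * r ^ k" using card_nor_2(1)[OF P] by (metis dvd_triv_right)
  then obtain b c where bc: "2 ^ i - 1 = b * c" "b dvd q ^ j" "c dvd r ^ k" using division_decomp by blast
  obtain s where s: "b = q ^ s" using bc(2) divides_primepow_nat[OF primes(2)] by blast
  obtain l where l: "c = r ^ l" using bc(3) divides_primepow_nat[OF primes(3)] by blast
  have N: "card (nor P) = 2 ^ i * (q ^ s * r ^ l)" using card_nor_2(2)[OF P] bc(1) s l by simp
  have N': "card (nor P) = 2 ^ i * (r ^ l * q ^ s)" using N by (simp only: ac_simps)
  show ?thesis
  proof (cases "s = 0 \<or> l = 0")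
    case True then show ?thesis using bc s l by auto
  next
    case False
    then have sl: "s > 0" "l > 0" by auto
    have sN: "subgroup (nor P) G" by (rule subgroup_nor[OF syl_carrier[OF P]])
    note fN = finite_sub[OF sN]
    let ?Q = "{x\<in>nor P. ord x = q}" and ?R = "{x\<in>nor P. ord x = r}"
    have o: "ord x = 1 \<or> ord x = 2" if x: "x \<in> P" for x
    proof (cases "x = \<one>")
      case False
      then have "x \<in> Ep" using p_subgroup_mem[OF sylD(1)[OF P] card_Sp[OF P] x] by simp
      then show ?thesis by (simp add: Ep_alt)
    qed simp
    have PQ: "P \<inter> ?Q = {}" "P \<inter> ?R = {}" "?Q \<inter> ?R = {}" using o ge3 distinct by fastforce+
    have fP: "finite P" using finite_sub sylD(1)[OF P] by blast
    have "card P + (card ?Q + card ?R) = card (P \<union> (?Q \<union> ?R))"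
      using PQ fN fP by (subst card_Un_disjoint, simp, simp, blast, subst card_Un_disjoint) auto
    also have "\<dots> \<le> card (nor P)" using subgroup_sub_nor[OF sylD(1)[OF P]] by (intro card_mono fN) blast
    finally have "2 ^ i + (2 ^ i * r ^ l * (q ^ s - 1) + 2 ^ i * q ^ s * (r ^ l - 1)) \<le> 2 ^ i * (q ^ s * r ^ l)"
      using card_Sp[OF P] count_q_in_normalizer[OF P N sl(1)] S.count_q_in_normalizer[OF P N' sl(2)] N by linarith
    moreover have "2 ^ i + (2 ^ i * r ^ l * (q ^ s - 1) + 2 ^ i * q ^ s * (r ^ l - 1)) =
       2 ^ i * (1 + (r ^ l * (q ^ s - 1) + q ^ s * (r ^ l - 1)))" by (simp add: algebra_simps)
    ultimately have "2 ^ i * (1 + (r ^ l * (q ^ s - 1) + q ^ s * (r ^ l - 1))) \<le> 2 ^ i * (q ^ s * r ^ l)" by (simp only:)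
    moreover have two: "0 < (2::nat) ^ i" by simp
    ultimately have le: "1 + (r ^ l * (q ^ s - 1) + q ^ s * (r ^ l - 1)) \<le> q ^ s * r ^ l"
      by (simp only: nat_mult_le_cancel1[OF two])
    have gt: "1 < q ^ s" "1 < r ^ l" using one_less_power prime_gt_1_nat primes sl by blast+
    obtain b where b: "q ^ s = Suc (Suc b)" using gt(1) by (metis less_imp_Suc_add add_Suc One_nat_def plus_1_eq_Suc)
    obtain c where c: "r ^ l = Suc (Suc c)" using gt(2) by (metis less_imp_Suc_add add_Suc One_nat_def plus_1_eq_Suc)
    show ?thesis using le unfolding b c by simp
  qed
qed

text \<open>The counting equation leaves only \<open>q ^ j = 2 ^ i - 1\<close> and \<open>r ^ k = 2 ^ i + 1\<close>. A
  Sylow \<open>q\<close>-subgroup of the normalizer of \<open>P\<close> has order \<open>q ^ j\<close> and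
  acts on \<open>P\<close> without fixed points, so its order is \<open>q\<close>.\<close>

lemma normalizer_divides_case:
  assumes d: "2 ^ i - 1 dvd q ^ j"
  shows "j = 1 \<and> q = 2 ^ i - 1 \<and> r ^ k = 2 ^ i + 1"
proof -
  obtain P where P: "P \<in> syl (carrier G) 2" using Sp_ex by auto
  obtain e where "q ^ j = (2 ^ i - 1) * e" using d by auto
  then have bc: "q ^ j = 2 ^ i - 1" "r ^ k = 2 ^ i + 1"
    using final_arith[OF counts(2) _ two_pow_ge_4 ge3(4,3)] by blast+
  have N: "card (nor P) = 2 ^ i * (q ^ j * r ^ 0)" using card_nor_2(2)[OF P] bc by simp
  have sN: "subgroup (nor P) G" by (rule subgroup_nor[OF syl_carrier[OF P]])
  obtain U where U: "U \<in> syl (nor P) q" using syl_nonempty[OF sN finite_sub[OF sN] primes(2)] by auto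
  note cU = selfnormal_in_normalizer(1)[OF P N pos(2) U]
  note oU = ord_q_subgroup[OF sylD(1)[OF U] cU]
  have "card U \<le> q"
  proof (rule elementary_abelian_fixed_point_free[OF primes(1,2) _ sylD(1)[OF P] card_Sp[OF P] syl_2_ne_one[OF P] sylD(1)[OF U]])
    show "q \<noteq> 2" using distinct by simp
    show "U \<subseteq> nor P" by (rule sylD[OF U])
    fix x assume x: "x \<in> U"
    show "x [^] q = \<one>" using oU[OF x] pow_ord_eq_1[of x] by (cases "x = \<one>") auto
    fix y
    show "x \<otimes> y = y \<otimes> x" if y: "y \<in> U"
    proof (cases "x = \<one>")
      case True then show ?thesis using subgroup.mem_carrier[OF sylD(1)[OF U] y] by simp
    next
      case False
      then have "y \<in> cen {x}" using selfnormal_in_normalizer(3)[OF P N pos(2) U x] y by blast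
      then show ?thesis unfolding cen_def by simp
    qed
    show "cj x y \<noteq> y" if y: "y \<in> P" "x \<noteq> \<one>" "y \<noteq> \<one>"
    proof
      assume f: "cj x y = y"
      have yE: "y \<in> Ep" using p_subgroup_mem[OF sylD(1)[OF P] card_Sp[OF P] y(1,3)] .
      have "x \<otimes> y = y \<otimes> x" using f cj_fix_iff[of x y] oU(1)[OF x y(2)] yE by (simp add: Ep_alt)
      then show False using not_commuting_2_q[of y x] oU[OF x y(2)] yE by (simp add: Ep_alt)
    qed
  qed
  then have "q ^ j \<le> q ^ 1" using cU by simp
  then have "j \<le> 1" using power_le_imp_le_exp prime_gt_1_nat[OF primes(2)] by blast
  then have "j = 1" using pos by linarith
  then show ?thesis using bc by simp
qed

text \<open>The nine Sylow 2-subgroups resemble the points of a sharply 3-transitive action: a nontrivial element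
  normalizes at most two of them. An element \<open>x\<close> of order 3 is then determined by the images of
  one point under \<open>x\<close> and under its square. But there are 224 such elements, and
  \<open>224 * 9\<close> exceeds \<open>9 ^ 3\<close>.\<close>

lemma order_504_False:
  assumes e: "i = 3" "q = 7" "j = 1" "r = 3" "k = 2" shows False
proof -
  interpret S: even_case G r q i k j by (rule swap)
  define \<Omega> where "\<Omega> = syl (carrier G) 2"
  have f\<Omega>: "finite \<Omega>" unfolding \<Omega>_def by (rule finite_syl[OF fin])
  obtain P0 where P0: "P0 \<in> \<Omega>" using Sp_ex by (auto simp: \<Omega>_def)
  have c\<Omega>: "card \<Omega> = 9" using card_nor_2(1)[of P0] P0 e by (simp add: \<Omega>_def)
  have cN: "card (nor P) = 56" if "P \<in> \<Omega>" for P using card_nor_2(2)[of P] that e by (simp add: \<Omega>_def)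
  have sN: "subgroup (nor P) G" if "P \<in> \<Omega>" for P using that subgroup_nor syl_carrier unfolding \<Omega>_def by blast
  have c3: "card {x\<in>carrier G. ord x = 3} = 224" using S.counts(3) e by simp
  have c7: "card {x\<in>carrier G. ord x = 7} = 216" using counts(3) e by simp
  have no3: "x \<notin> nor P" if "P \<in> \<Omega>" "ord x = 3" for P x
  proof
    assume "x \<in> nor P"
    then have "3 dvd (56::nat)" using ord_dvd_card[OF sN finite_sub[OF sN]] that cN by metis
    then show False by simp
  qed
  \<comment> \<open>A nontrivial element of order 7 fixing three of the nine points would fix all of them, and so would the other elements of order 7.\<close>
  have rigid: "g = \<one>" if g: "g \<in> carrier G" and Ps: "P1 \<in> \<Omega>" "P2 \<in> \<Omega>" "P3 \<in> \<Omega>" and ne: "P1 \<noteq> P2" "P1 \<noteq> P3" "P2 \<noteq> P3"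
    and n: "g \<in> nor P1" "g \<in> nor P2" "g \<in> nor P3" for g P1 P2 P3
  proof (rule ccontr)
    assume g1: "g \<noteq> \<one>"
    consider "ord g = 2" | "ord g = 3" | "ord g = 7" using ord_cases[OF g g1] e by auto
    then show False
    proof cases
      case 1
      then have "P1 = cen {g}" "P2 = cen {g}" using involution_normalizing syl_2_eq g1 Ps n unfolding \<Omega>_def by blast+
      then show False using ne by simp
    next
      case 2 then show False using no3 Ps n by blast
    next
      case 3
      note gs = generate_singleton[OF g]
      have aK: "acts (generate G {g}) (\<lambda>g A. cj g ` A) \<Omega>"
        unfolding \<Omega>_def by (rule acts_restrict[OF acts_syl[OF subgroup_self] gs(1) subgroup.subset[OF gs(1)]])
      let ?F = "{A\<in>\<Omega>. \<forall>h\<in>generate G {g}. cj h ` A = A}"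
      have "card \<Omega> mod 7 = card ?F mod 7"
        by (rule fixed_points_mod[OF aK f\<Omega>, of 7 1]) (use gs(3) 3 primes(2) e in auto)
      then have m: "card ?F mod 7 = 2" using c\<Omega> by simp
      have inF: "P \<in> ?F" if "P \<in> \<Omega>" "g \<in> nor P" for P
      proof -
        have "generate G {g} \<subseteq> nor P" using that(2) by (intro generate_subgroup_incl sN[OF that(1)]) auto
        then show ?thesis using that(1) unfolding nor_def by blast
      qed
      have "{P1, P2, P3} \<subseteq> ?F" using inF Ps n by blast
      then have "card {P1, P2, P3} \<le> card ?F" using f\<Omega> by (intro card_mono) auto
      moreover have "card ?F \<le> 9" using card_mono[OF f\<Omega>, of ?F] c\<Omega> by auto
      moreover have "card {P1, P2, P3} = 3" using ne by simp
      ultimately have "card ?F = 9" using m by presburger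
      then have F: "?F = \<Omega>" using c\<Omega> f\<Omega> by (intro card_subset_eq) auto
      have nall: "g \<in> nor P" if "P \<in> \<Omega>" for P
      proof -
        have "P \<in> ?F" using F that by simp
        then show ?thesis using gs(2) g unfolding nor_def by blast
      qed
      have "{x\<in>carrier G. ord x = 7} \<subseteq> nor P1"
      proof
        fix x assume x: "x \<in> {x\<in>carrier G. ord x = 7}"
        then have "aeq g x" using type g 3 by simp
        then obtain \<phi> where \<phi>: "\<phi> \<in> iso G G" "\<phi> g = x" unfolding aeq_def by blast
        obtain P where P: "P \<in> \<Omega>" "P1 = \<phi> ` P" using iso_syl_image(1)[OF \<phi>(1) fin, of 2] Ps(1) unfolding \<Omega>_def by blast
        have "nor P1 = \<phi> ` nor P" unfolding P(2) using P(1) by (intro iso_nor[OF \<phi>(1)]) (auto simp: \<Omega>_def dest: syl_carrier)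
        then show "x \<in> nor P1" using nall[OF P(1)] \<phi>(2) by blast
      qed
      then have "216 \<le> card (nor P1)" using c7 card_mono[OF finite_sub[OF sN[OF Ps(1)]]] by metis
      then show False using cN[OF Ps(1)] by simp
    qed
  qed
  \<comment> \<open>Two elements of order 3 with the same images differ by an element that fixes the three points of the cycle.\<close>
  define h where "h = (\<lambda>(x, P). (P, cj x ` P, cj x ` cj x ` P))"
  have cl: "cj x ` P \<in> \<Omega>" if "x \<in> carrier G" "P \<in> \<Omega>" for x P using syl_cj[OF _ that(1) subgroup_self] that(2) unfolding \<Omega>_def by blast
  have sub: "P \<subseteq> carrier G" if "P \<in> \<Omega>" for P using that syl_carrier unfolding \<Omega>_def by blast
  have "inj_on h ({x\<in>carrier G. ord x = 3} \<times> \<Omega>)"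
  proof (rule inj_onI)
    fix u v assume u: "u \<in> {x\<in>carrier G. ord x = 3} \<times> \<Omega>" and v: "v \<in> {x\<in>carrier G. ord x = 3} \<times> \<Omega>" and eq: "h u = h v"
    obtain x P where xP: "u = (x, P)" "x \<in> carrier G" "ord x = 3" "P \<in> \<Omega>" using u by auto
    obtain y where yP: "v = (y, P)" "y \<in> carrier G" "ord y = 3" "cj y ` P = cj x ` P" "cj y ` cj y ` P = cj x ` cj x ` P"
      using v eq xP(1) by (auto simp: h_def)
    note Pc = sub[OF xP(4)]
    have cube: "cj z ` cj z ` cj z ` P = P" if z: "z \<in> carrier G" "ord z = 3" for z
    proof -
      have "z [^] (3::nat) = \<one>" using pow_ord_eq_1[OF z(1)] z(2) by simp
      then have "z \<otimes> (z \<otimes> z) = \<one>" using z(1) by (simp add: numeral_3_eq_3 m_assoc)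
      then show ?thesis using z(1) Pc by (simp add: cj_image_image)
    qed
    define g where "g = inv y \<otimes> x"
    have gc: "g \<in> carrier G" using xP yP by (simp add: g_def)
    have bring: "cj g ` A = B" if "cj x ` A = cj y ` B" "A \<subseteq> carrier G" "B \<subseteq> carrier G" for A B
    proof -
      have "cj g ` A = cj (inv y) ` cj x ` A" unfolding g_def using xP yP that(2) by (intro cj_image_image[symmetric]) auto
      also have "\<dots> = cj (inv y \<otimes> y) ` B" unfolding that(1) using that yP by (subst cj_image_image) auto
      finally show ?thesis using that yP by simp
    qed
    have cls: "cj x ` P \<in> \<Omega>" "cj x ` cj x ` P \<in> \<Omega>" using cl xP by blast+
    have n: "g \<in> nor P" "g \<in> nor (cj x ` P)" "g \<in> nor (cj x ` cj x ` P)"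
    proof -
      have "cj g ` P = P" by (rule bring[OF yP(4)[symmetric] Pc Pc])
      moreover have "cj g ` cj x ` P = cj x ` P" by (rule bring) (use yP cls sub in simp_all)
      moreover have "cj g ` cj x ` cj x ` P = cj x ` cj x ` P"
      proof (rule bring)
        show "cj x ` cj x ` cj x ` P = cj y ` cj x ` cj x ` P"
          using cube[OF xP(2,3)] cube[OF yP(2,3)] yP(5) by simp
      qed (use cls sub in simp_all)
      ultimately show "g \<in> nor P" "g \<in> nor (cj x ` P)" "g \<in> nor (cj x ` cj x ` P)" using gc unfolding nor_def by blast+
    qed
    have ne1: "P \<noteq> cj x ` P" using no3[OF xP(4,3)] xP(2) unfolding nor_def by blast
    have ne2: "cj x ` P \<noteq> cj x ` cj x ` P" using no3[OF cls(1) xP(3)] xP(2) unfolding nor_def by blast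
    have ne3: "P \<noteq> cj x ` cj x ` P"
    proof
      assume "P = cj x ` cj x ` P"
      then have "cj x ` P = P" using cube[OF xP(2,3)] by metis
      then show False using ne1 by simp
    qed
    have "g = \<one>" by (rule rigid[OF gc xP(4) cls ne1 ne3 ne2 n])
    then have "x = y" using xP yP unfolding g_def by (metis inv_equality inv_inv inv_closed)
    then show "u = v" using xP yP by simp
  qed
  moreover have "h ` ({x\<in>carrier G. ord x = 3} \<times> \<Omega>) \<subseteq> \<Omega> \<times> \<Omega> \<times> \<Omega>" using cl by (auto simp: h_def)
  ultimately have "card ({x\<in>carrier G. ord x = 3} \<times> \<Omega>) \<le> card (\<Omega> \<times> \<Omega> \<times> \<Omega>)" using f\<Omega> by (intro card_inj_on_le) auto
  then show False using c3 c\<Omega> by (simp add: card_cartesian_product)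
qed

text \<open>One of the three consecutive numbers \<open>q\<close>, \<open>2 ^ i\<close>, \<open>r ^ k\<close> is
  divisible by 3, which leaves the group orders 60 and 504.\<close>

lemma orders_if_divides:
  assumes d: "2 ^ i - 1 dvd q ^ j" shows "q ^ j = 3 \<and> q = 3 \<and> r ^ k = 5 \<and> r = 5 \<and> (2::nat) ^ i = 4"
proof -
  note n = normalizer_divides_case[OF d]
  have i2: "i \<ge> 2"
  proof (rule ccontr)
    assume "\<not> i \<ge> 2"
    then have "i = 1" using i_pos by linarith
    then show False using two_pow_ge_4 by simp
  qed
  have three: "prime (3::nat)" by simp
  have "\<not> 3 dvd (2::nat) ^ i" using prime_dvd_power_nat[of 3 2 i] by auto
  then have "3 dvd q \<or> 3 dvd r ^ k" using n two_pow_ge_4 by presburger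
  then show ?thesis
  proof
    assume "3 dvd q"
    then have q: "q = 3" using primes_dvd_imp_eq[of 3 q] primes(2) three by blast
    then have a: "(2::nat) ^ i = 4" "r ^ k = 5" using n two_pow_ge_4 by linarith+
    have "r dvd r ^ k" using pos by (simp add: dvd_power)
    then have "r = 5" using a(2) primes(3) by (simp add: primes_dvd_imp_eq)
    then show ?thesis using q a n by simp
  next
    assume "3 dvd r ^ k"
    then have "3 dvd r" by (rule prime_dvd_power_nat[rotated]) simp
    then have r: "r = 3" using primes_dvd_imp_eq[of 3 r] primes(3) three by blast
    then have "i = 3 \<and> k = 2" using two_power_plus_one_eq_three_power[of i k] n i2 by simp
    then show ?thesis using order_504_False r n by simp
  qed
qed

theorem order_60:
  "order G = 60 \<and> (\<forall>x\<in>carrier G. ord x \<in> {1, 2, 3, 5}) \<and>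
   (\<forall>x\<in>carrier G. ord x \<in> {3, 5} \<longrightarrow> card (cen {x}) = ord x \<and> (\<exists>t\<in>carrier G. cj t x = inv x))"
proof -
  interpret S: even_case G r q i k j by (rule swap)
  have o: "(q ^ j = 3 \<and> q = 3 \<and> r ^ k = 5 \<and> r = 5 \<and> (2::nat) ^ i = 4) \<or> (r ^ k = 3 \<and> r = 3 \<and> q ^ j = 5 \<and> q = 5 \<and> (2::nat) ^ i = 4)"
    using normalizer_one_prime orders_if_divides S.orders_if_divides by blast
  have 1: "order G = 60" using order_eq o by auto
  have 2: "ord x \<in> {1, 2, 3, 5}" if "x \<in> carrier G" for x using ord_cases[OF that] o by (cases "x = \<one>") auto
  have 3: "card (cen {x}) = q ^ j \<and> (\<exists>t\<in>carrier G. cj t x = inv x)" if x: "x \<in> carrier G" "ord x = q" for x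
    using card_cen_q[OF x] ex_inverting[OF x] unfolding inverting_def I_iff by blast
  have 4: "card (cen {x}) = r ^ k \<and> (\<exists>t\<in>carrier G. cj t x = inv x)" if x: "x \<in> carrier G" "ord x = r" for x
    using S.card_cen_q[OF x] S.ex_inverting[OF x] unfolding S.inverting_def S.I_iff by blast
  show ?thesis using 1 2 3 4 o by auto
qed

end

section \<open>Finite perfect groups with at most four automorphism orbits\<close>

context group begin

lemma automorphism_orbits_eq: "automorphism_orbits G = (\<lambda>x. {y. aeq x y}) ` carrier G"
proof -
  have "orbit (AutoGroup G) (\<lambda>\<alpha>. \<alpha>) x = {y. aeq x y}" if x: "x \<in> carrier G" for x
  proof (intro equalityI subsetI)
    fix y assume "y \<in> orbit (AutoGroup G) (\<lambda>\<alpha>. \<alpha>) x"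
    then obtain \<alpha> where \<alpha>: "\<alpha> \<in> auto G" "y = \<alpha> x" by (auto simp: orbit_def AutoGroup_def)
    then have "\<alpha> \<in> iso G G" by (auto simp: auto_def Bij_def iso_def)
    then show "y \<in> {y. aeq x y}" using \<alpha>(2) unfolding aeq_def by blast
  next
    fix y assume "y \<in> {y. aeq x y}"
    then obtain \<phi> where \<phi>: "\<phi> \<in> iso G G" "\<phi> x = y" unfolding aeq_def by blast
    let ?\<alpha> = "restrict \<phi> (carrier G)"
    have "bij_betw ?\<alpha> (carrier G) (carrier G)" using iso_bij[OF \<phi>(1)] by (simp cong: bij_betw_cong)
    moreover have "?\<alpha> \<in> hom G G" using iso_closed[OF \<phi>(1)] iso_mult[OF \<phi>(1)] by (auto simp: hom_def)
    ultimately have "?\<alpha> \<in> auto G" by (simp add: auto_def Bij_def)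
    moreover have "y = ?\<alpha> x" using \<phi>(2) x by simp
    ultimately have "\<exists>g. y = g x \<and> g \<in> auto G" by blast
    then show "y \<in> orbit (AutoGroup G) (\<lambda>\<alpha>. \<alpha>) x" by (simp add: orbit_def AutoGroup_def)
  qed
  then show ?thesis unfolding automorphism_orbits_def orbits_def by (auto simp: image_iff)
qed

lemma aeq_class_eq: "x \<in> carrier G \<Longrightarrow> {z. aeq x z} = {z. aeq y z} \<longleftrightarrow> aeq x y"
  using aeq_refl aeq_trans aeq_sym by blast

text \<open>An invariant with many values forces many orbits; if it has as many values as there are orbits, equal values
  imply equal orbits.\<close>

lemma card_invariant_le:
  assumes "finite (automorphism_orbits G)" "\<And>x y. x \<in> carrier G \<Longrightarrow> aeq x y \<Longrightarrow> f x = f y"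
  shows "finite (f ` carrier G)" "card (f ` carrier G) \<le> card (automorphism_orbits G)"
    "card (automorphism_orbits G) \<le> card (f ` carrier G) \<Longrightarrow> x \<in> carrier G \<Longrightarrow> y \<in> carrier G \<Longrightarrow> f x = f y \<Longrightarrow> aeq x y"
proof -
  define g where "g A = f (SOME z. z \<in> A)" for A
  have g: "g {z. aeq x z} = f x" if "x \<in> carrier G" for x
  proof -
    have "aeq x (SOME z. z \<in> {z. aeq x z})" using someI_ex[of "\<lambda>z. z \<in> {z. aeq x z}"] aeq_refl[of x] by blast
    then show ?thesis unfolding g_def using assms(2)[OF that] by simp
  qed
  then have e: "f ` carrier G = g ` automorphism_orbits G" unfolding automorphism_orbits_eq by (force simp: image_iff)
  then show "finite (f ` carrier G)" using assms(1) by simp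
  show le: "card (f ` carrier G) \<le> card (automorphism_orbits G)" unfolding e by (rule card_image_le[OF assms(1)])
  assume "card (automorphism_orbits G) \<le> card (f ` carrier G)" and x: "x \<in> carrier G" and y: "y \<in> carrier G" and fxy: "f x = f y"
  then have "card (g ` automorphism_orbits G) = card (automorphism_orbits G)" using le e by simp
  then have "inj_on g (automorphism_orbits G)" by (rule eq_card_imp_inj_on[OF assms(1)])
  moreover have "{z. aeq x z} \<in> automorphism_orbits G" "{z. aeq y z} \<in> automorphism_orbits G"
    unfolding automorphism_orbits_eq using x y by blast+
  ultimately have "{z. aeq x z} = {z. aeq y z}" using g[OF x] g[OF y] fxy inj_onD by metis
  then show "aeq x y" using aeq_class_eq[OF x] by simp
qed

lemma five_elements_aeq:
  assumes "finite (automorphism_orbits G)" "card (automorphism_orbits G) \<le> 4"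
    "a \<in> carrier G" "b \<in> carrier G" "c \<in> carrier G" "d \<in> carrier G" "e \<in> carrier G"
  shows "aeq a b \<or> aeq a c \<or> aeq a d \<or> aeq a e \<or> aeq b c \<or> aeq b d \<or> aeq b e \<or> aeq c d \<or> aeq c e \<or> aeq d e"
proof (rule ccontr)
  assume n: "\<not> ?thesis"
  let ?f = "\<lambda>x. {z. aeq x z}"
  have "{?f a, ?f b, ?f c, ?f d, ?f e} \<subseteq> automorphism_orbits G" unfolding automorphism_orbits_eq using assms(3-7) by blast
  then have "card {?f a, ?f b, ?f c, ?f d, ?f e} \<le> card (automorphism_orbits G)" by (rule card_mono[OF assms(1)])
  moreover have "card {A, B, C, D, E} = 5" if "A \<notin> {B, C, D, E}" "B \<notin> {C, D, E}" "C \<notin> {D, E}" "D \<notin> {E}" for A B C D E :: "'a set"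
    using that by simp
  then have "card {?f a, ?f b, ?f c, ?f d, ?f e} = 5"
    by this (use n aeq_class_eq assms(3-7) in simp_all)
  ultimately show False using assms(2) by linarith
qed

lemma not_aeq_ord: "x \<in> carrier G \<Longrightarrow> ord x \<noteq> ord y \<Longrightarrow> \<not> aeq x y" using aeq_ord by force

lemma commuting_primes_order:
  assumes "prime p" "prime r" "p \<noteq> r" "x \<in> carrier G" "ord x = p" "y \<in> carrier G" "ord y = r" "x \<otimes> y = y \<otimes> x"
  shows "ord (x \<otimes> y) = p * r"
proof -
  have pw: "(x \<otimes> y) [^] n = x [^] n \<otimes> y [^] n" for n :: nat using assms by (intro pow_mult_distrib)
  have c: "x \<otimes> y \<in> carrier G" using assms by simp
  have "x [^] (p * r) = \<one>" "y [^] (p * r) = \<one>" using assms pow_eq_id by simp_all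
  then have "(x \<otimes> y) [^] (p * r) = \<one>" using pw[of "p * r"] by simp
  then have d: "ord (x \<otimes> y) dvd p * r" using pow_eq_id[OF c] by blast
  have n1: "\<not> ord (x \<otimes> y) dvd p"
  proof
    assume "ord (x \<otimes> y) dvd p"
    then have "x [^] p \<otimes> y [^] p = \<one>" using pow_eq_id[OF c] pw by simp
    then have "y [^] p = \<one>" using pow_ord_eq_1[of x] assms by simp
    then have "r dvd p" using pow_eq_id[of y p] assms by simp
    then show False using assms(1-3) primes_dvd_imp_eq by blast
  qed
  have n2: "\<not> ord (x \<otimes> y) dvd r"
  proof
    assume "ord (x \<otimes> y) dvd r"
    then have "x [^] r \<otimes> y [^] r = \<one>" using pow_eq_id[OF c] pw by simp
    then have "x [^] r = \<one>" using pow_ord_eq_1[of y] assms by simp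
    then have "p dvd r" using pow_eq_id[of x r] assms by simp
    then show False using assms(1-3) primes_dvd_imp_eq by blast
  qed
  obtain a b where ab: "ord (x \<otimes> y) = a * b" "a dvd p" "b dvd r" using division_decomp[OF d] by blast
  have "a = p" using ab n2 assms(1) by (cases "a = 1") (auto simp: prime_nat_iff)
  moreover have "b = r" using ab n1 assms(2) by (cases "b = 1") (auto simp: prime_nat_iff)
  ultimately show ?thesis using ab by simp
qed

context
  assumes finite_G: "finite (carrier G)" and perfect_G: "derived G (carrier G) = carrier G"
    and nontrivial_G: "carrier G \<noteq> {\<one>}"
    and orbits_G: "finite (automorphism_orbits G)" "card (automorphism_orbits G) \<le> 4"
begin

lemma prime_element: assumes "prime p" "p dvd order G" shows "\<exists>x\<in>carrier G. ord x = p"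
  using cauchy[OF subgroup_self finite_G assms(1)] assms(2) by (simp add: order_def)

lemma four_types:
  assumes "a \<in> carrier G" "b \<in> carrier G" "c \<in> carrier G" "d \<in> carrier G" "distinct [ord a, ord b, ord c, ord d]" "e \<in> carrier G"
  shows "aeq a e \<or> aeq b e \<or> aeq c e \<or> aeq d e"
  using five_elements_aeq[OF orbits_G assms(1-4,6)] not_aeq_ord assms by auto

lemma four_orders_determine:
  assumes "a \<in> carrier G" "b \<in> carrier G" "c \<in> carrier G" "d \<in> carrier G" "distinct [ord a, ord b, ord c, ord d]"
    and "x \<in> carrier G" "y \<in> carrier G" "ord x = ord y"
  shows "aeq x y"
proof -
  have "aeq a x \<or> aeq b x \<or> aeq c x \<or> aeq d x" "aeq a y \<or> aeq b y \<or> aeq c y \<or> aeq d y"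
    using four_types[OF assms(1-5)] assms(6,7) by blast+
  then obtain u v where u: "u \<in> {a, b, c, d}" "aeq u x" and v: "v \<in> {a, b, c, d}" "aeq v y" by blast
  have uv: "u \<in> carrier G" "v \<in> carrier G" using u v assms by auto
  then have "ord u = ord v" using aeq_ord u v assms(8) by metis
  then have "u = v" using u v assms(5) by auto
  then show ?thesis using u v uv aeq_trans aeq_sym by blast
qed

text \<open>If elements of orders \<open>p\<close> and \<open>r\<close> commute, their product has a fourth order, so
  the orbits are determined by the orders. Otherwise all elements have prime power order, there are at most
  three orbits of nontrivial elements, and for one of the primes there is only one.\<close>

lemma not_two_primes:
  assumes "prime p" "prime r" "p \<noteq> r" "order G = p ^ i * r ^ j" "i > 0" "j > 0" shows False
proof -
  obtain a where a: "a \<in> carrier G" "ord a = p" using prime_element[OF assms(1)] assms by (auto simp: dvd_power)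
  obtain b where b: "b \<in> carrier G" "ord b = r" using prime_element[OF assms(2)] assms by (auto simp: dvd_power)
  have gt: "1 < p" "1 < r" using prime_gt_1_nat assms(1,2) by blast+
  show False
  proof (cases "\<exists>x\<in>carrier G. \<exists>y\<in>carrier G. ord x = p \<and> ord y = r \<and> x \<otimes> y = y \<otimes> x")
    case True
    then obtain x y where xy: "x \<in> carrier G" "y \<in> carrier G" "ord x = p" "ord y = r" "x \<otimes> y = y \<otimes> x" by blast
    have w: "ord (x \<otimes> y) = p * r" by (rule commuting_primes_order[OF assms(1-3) xy(1,3,2,4,5)])
    have D: "distinct [ord \<one>, ord a, ord b, ord (x \<otimes> y)]" unfolding w a b using gt assms(3) by auto
    note dt = four_orders_determine[OF one_closed a(1) b(1) m_closed[OF xy(1,2)] D]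
    have ord4: "ord u \<in> {1, p, r, p * r}" if "u \<in> carrier G" for u
    proof -
      have "aeq \<one> u \<or> aeq a u \<or> aeq b u \<or> aeq (x \<otimes> y) u"
        using four_types[OF one_closed a(1) b(1) m_closed[OF xy(1,2)] D that] .
      then show ?thesis using aeq_ord[of _ u] a b xy w by auto
    qed
    have exp: "l \<le> 1" if "s = p \<and> t = r \<or> s = r \<and> t = p" "u \<in> carrier G" "ord u = s ^ l" for s t u l
    proof (rule ccontr)
      assume "\<not> l \<le> 1"
      then have "s ^ 2 dvd s ^ l" by (intro le_imp_power_dvd) simp
      then have "s ^ 2 dvd ord u" using that(3) by simp
      moreover have "ord u dvd s * t" using ord4[OF that(2)] that(1) by auto
      ultimately have "s * s dvd s * t" using dvd_trans by (metis power2_eq_square)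
      then have "s dvd t" using that(1) gt by auto
      then show False using that(1) assms(1-3) primes_dvd_imp_eq by blast
    qed
    interpret mixed_group G p r i j
    proof
      show "\<forall>x\<in>carrier G. \<forall>y\<in>carrier G. ord x = p \<longrightarrow> ord y = p \<longrightarrow> aeq x y" using dt by simp
      show "\<forall>x\<in>carrier G. \<forall>y\<in>carrier G. ord x = r \<longrightarrow> ord y = r \<longrightarrow> aeq x y" using dt by simp
      show "\<And>x k. x \<in> carrier G \<Longrightarrow> ord x = p ^ k \<Longrightarrow> k \<le> 1" "\<And>x k. x \<in> carrier G \<Longrightarrow> ord x = r ^ k \<Longrightarrow> k \<le> 1"
        using exp by blast+
    qed (use assms perfect_G in auto)
    show False using no_commuting xy by blast
  next
    case False
    interpret pr_group G p r i j
      by unfold_locales (use assms perfect_G nontrivial_G False in auto)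
    interpret S: pr_group G r p j i by (rule swap)
    have ES: "S.Ep = Er" by (rule Er_swap(1))
    have ne: "\<not> aeq \<one> x" if "x \<in> Ep \<union> Er" for x
      using that aeq_ord[of \<one> x] ord_eq_1[of x] by (auto simp: Ep_def Er_def)
    have pr: "\<not> aeq x y" if "x \<in> Ep" "y \<in> Er" for x y
    proof
      assume "aeq x y"
      then have "ord y = ord x" using aeq_ord that by (simp add: Ep_def)
      then have "y \<in> Ep" using that unfolding Ep_def Er_def by auto
      then show False using Ep_Er that(2) by blast
    qed
    have c: "x \<in> carrier G" if "x \<in> Ep \<union> Er" for x using that by (auto simp: Ep_def Er_def)
    have aE: "a \<in> Ep" using a gt unfolding Ep_def by (auto intro!: exI[of _ 1])
    have bE: "b \<in> Er" using b gt unfolding Er_def by (auto intro!: exI[of _ 1])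
    show False
    proof (cases "\<forall>x\<in>Er. \<forall>y\<in>Er. aeq x y")
      case True
      have "aeq x y \<or> aeq x z \<or> aeq y z" if "x \<in> Ep" "y \<in> Ep" "z \<in> Ep" for x y z
      proof -
        have "aeq \<one> x \<or> aeq \<one> y \<or> aeq \<one> z \<or> aeq \<one> b \<or> aeq x y \<or> aeq x z \<or> aeq x b \<or> aeq y z \<or> aeq y b \<or> aeq z b"
          using five_elements_aeq[OF orbits_G one_closed] c that bE by blast
        then show ?thesis using ne pr that bE by blast
      qed
      then show False using few_types_False[OF True] by blast
    next
      case nonsingle: False
      then obtain u v where uv: "u \<in> Er" "v \<in> Er" "\<not> aeq u v" by blast
      have s: "aeq x y" if "x \<in> Ep" "y \<in> Ep" for x y
      proof -
        have "aeq \<one> x \<or> aeq \<one> y \<or> aeq \<one> u \<or> aeq \<one> v \<or> aeq x y \<or> aeq x u \<or> aeq x v \<or> aeq y u \<or> aeq y v \<or> aeq u v"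
          using five_elements_aeq[OF orbits_G one_closed] c that uv by blast
        then show ?thesis using ne pr that uv by blast
      qed
      have "aeq x y \<or> aeq x z \<or> aeq y z" if "x \<in> Er" "y \<in> Er" "z \<in> Er" for x y z
      proof -
        have "aeq \<one> a \<or> aeq \<one> x \<or> aeq \<one> y \<or> aeq \<one> z \<or> aeq a x \<or> aeq a y \<or> aeq a z \<or> aeq x y \<or> aeq x z \<or> aeq y z"
          using five_elements_aeq[OF orbits_G one_closed] c that aE by blast
        then show ?thesis using ne pr that aE by blast
      qed
      then show False using S.few_types_False s unfolding Er_swap by blast
    qed
  qed
qed

text \<open>Each prime divisor of the order accounts for an orbit besides that of the identity, so there are at most
  three of them. A single one contradicts perfectness, two have been excluded, and with three of them the
  orbits are determined by the orders of the elements.\<close>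

theorem four_orbits_order_60:
  "order G = 60 \<and> (\<forall>x\<in>carrier G. ord x \<in> {1, 2, 3, 5}) \<and>
   (\<forall>x\<in>carrier G. ord x \<in> {3, 5} \<longrightarrow> card (cen {x}) = ord x \<and> (\<exists>t\<in>carrier G. cj t x = inv x))"
proof -
  let ?F = "prime_factors (order G)"
  define e where "e p = multiplicity p (order G)" for p
  have o0: "order G \<noteq> 0" using finite_G order_gt_0_iff_finite by auto
  have o1: "order G \<noteq> 1" using nontrivial_G unfolding order_def by (metis card_1_singletonE one_closed singletonD)
  have P: "prime p" "p dvd order G" "e p > 0" if "p \<in> ?F" for p
    using that o0 by (auto simp: e_def in_prime_factors_iff prime_multiplicity_gt_zero_iff)
  have prod: "order G = (\<Prod>p\<in>?F. p ^ e p)" unfolding e_def using o0 by (simp add: prime_factorization_nat)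
  have fF: "finite ?F" by simp
  define el where "el p = (SOME x. x \<in> carrier G \<and> ord x = p)" for p
  have el: "el p \<in> carrier G" "ord (el p) = p" if "p \<in> ?F" for p
    using someI_ex[of "\<lambda>x. x \<in> carrier G \<and> ord x = p"] prime_element[OF P(1,2)[OF that]] unfolding el_def by blast+
  have gt: "1 < p" if "p \<in> ?F" for p using prime_gt_1_nat[OF P(1)[OF that]] .
  have three: "p = q \<or> p = r \<or> p = s \<or> q = r \<or> q = s \<or> r = s" if "p \<in> ?F" "q \<in> ?F" "r \<in> ?F" "s \<in> ?F" for p q r s
  proof (rule ccontr)
    assume n: "\<not> ?thesis"
    have "distinct [ord \<one>, ord (el p), ord (el q), ord (el r)]" using n el(2)[OF that(1)] el(2)[OF that(2)] el(2)[OF that(3)] gt[OF that(1)] gt[OF that(2)] gt[OF that(3)] by auto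
    then have "aeq \<one> (el s) \<or> aeq (el p) (el s) \<or> aeq (el q) (el s) \<or> aeq (el r) (el s)"
      by (intro four_types el that one_closed)
    then have "ord (el s) \<in> {1, p, q, r}"
      using aeq_ord[of \<one> "el s"] aeq_ord[of "el p" "el s"] aeq_ord[of "el q" "el s"] aeq_ord[of "el r" "el s"]
        el[OF that(1)] el[OF that(2)] el[OF that(3)] by auto
    then show False using el(2)[OF that(4)] n gt[OF that(4)] by auto
  qed
  have "?F \<noteq> {}" using o0 o1 by (simp add: prime_factorization_empty_iff)
  then obtain p where p: "p \<in> ?F" by blast
  show ?thesis
  proof (cases "?F = {p}")
    case True
    then have "order G = p ^ e p" using prod by simp
    then show ?thesis using order_prime_power_not_perfect P[OF p] perfect_G by blast
  next
    case False
    then obtain q where q: "q \<in> ?F" "q \<noteq> p" using p by blast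
    show ?thesis
    proof (cases "?F = {p, q}")
      case True
      then have "order G = p ^ e p * q ^ e q" using prod q(2) by simp
      then show ?thesis using not_two_primes[of p q] P[OF p] P[OF q(1)] q(2) by blast
    next
      case False
      then obtain r where r: "r \<in> ?F" "r \<noteq> p" "r \<noteq> q" using p q by blast
      have F: "?F = {p, q, r}"
      proof -
        have "s \<in> {p, q, r}" if "s \<in> ?F" for s using three[OF p q(1) r(1) that] q(2) r(2,3) by blast
        then show ?thesis using p q(1) r(1) by blast
      qed
      have o: "order G = p ^ e p * q ^ e q * r ^ e r" using prod q(2) r(2,3) unfolding F by (simp add: mult.assoc)
      have D: "distinct [ord \<one>, ord (el p), ord (el q), ord (el r)]"
        using el(2)[OF p] el(2)[OF q(1)] el(2)[OF r(1)] q(2) r(2,3) gt[OF p] gt[OF q(1)] gt[OF r(1)] by auto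
      note dt = four_orders_determine[OF one_closed el(1)[OF p] el(1)[OF q(1)] el(1)[OF r(1)] D]
      interpret T: three_primes G p q r "e p" "e q" "e r"
      proof
        show "\<forall>x\<in>carrier G. x \<noteq> \<one> \<longrightarrow> prime (ord x)"
        proof (intro ballI impI)
          fix x assume x: "x \<in> carrier G" "x \<noteq> \<one>"
          have "aeq \<one> x \<or> aeq (el p) x \<or> aeq (el q) x \<or> aeq (el r) x"
            using four_types[OF one_closed el(1)[OF p] el(1)[OF q(1)] el(1)[OF r(1)] D x(1)] .
          then have "ord x \<in> {1, p, q, r}"
            using aeq_ord[of \<one> x] aeq_ord[of "el p" x] aeq_ord[of "el q" x] aeq_ord[of "el r" x] el[OF p] el[OF q(1)] el[OF r(1)] by auto
          moreover have "ord x \<noteq> 1" using x ord_eq_1 by blast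
          ultimately show "prime (ord x)" using P(1) p q r by blast
        qed
        show "\<forall>x\<in>carrier G. \<forall>y\<in>carrier G. ord x = ord y \<longrightarrow> aeq x y" using dt by blast
      qed (use perfect_G P p q r o in auto)
      interpret T2: three_primes G q p r "e q" "e p" "e r" by (rule T.rotate)
      interpret T0: three_primes G p r q "e p" "e r" "e q" by (rule T.swap_qr)
      interpret T3: three_primes G r p q "e r" "e p" "e q" by (rule T0.rotate)
      show ?thesis using T.two_is_one_of_the_primes
      proof (elim disjE)
        assume "p = 2"
        then interpret even_case G q r "e p" "e q" "e r" using T.three_primes_axioms by (simp add: even_case_def)
        show ?thesis by (rule order_60)
      next
        assume "q = 2"
        then interpret even_case G p r "e q" "e p" "e r" using T2.three_primes_axioms by (simp add: even_case_def)
        show ?thesis by (rule order_60)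
      next
        assume "r = 2"
        then interpret even_case G p q "e r" "e p" "e q" using T3.three_primes_axioms by (simp add: even_case_def)
        show ?thesis by (rule order_60)
      qed
    qed
  qed
qed

end

end

section \<open>Groups with finite conjugacy classes\<close>

context group begin

lemma coset_eq_iff:
  assumes H: "subgroup H G" and x: "x \<in> carrier G" and y: "y \<in> carrier G"
  shows "H #> x = H #> y \<longleftrightarrow> x \<otimes> inv y \<in> H"
proof
  assume "H #> x = H #> y"
  then have "x \<in> H #> y" using rcos_self[OF x H] by simp
  then obtain h where h: "h \<in> H" "x = h \<otimes> y" unfolding r_coset_def by blast
  then have "x \<otimes> inv y = h" using subgroup.mem_carrier[OF H h(1)] y by (simp add: m_assoc)
  then show "x \<otimes> inv y \<in> H" using h(1) by simp
next
  assume h: "x \<otimes> inv y \<in> H"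
  have "x = (x \<otimes> inv y) \<otimes> y" using x y by (simp add: m_assoc)
  then have "x \<in> H #> y" unfolding r_coset_def using h by blast
  then show "H #> x = H #> y" using repr_independence[OF _ y H] by simp
qed

lemma rcosets_eq_image: "(rcosets H) = (\<lambda>x. H #> x) ` carrier G" unfolding RCOSETS_def by blast

lemma finite_index_criterion:
  assumes H: "subgroup H G" and f: "finite (f ` carrier G)"
    and e: "\<And>x y. x \<in> carrier G \<Longrightarrow> y \<in> carrier G \<Longrightarrow> f x = f y \<Longrightarrow> x \<otimes> inv y \<in> H"
  shows "finite (rcosets H)"
proof -
  have "(rcosets H) \<subseteq> (\<lambda>v. H #> (SOME x. x \<in> carrier G \<and> f x = v)) ` (f ` carrier G)"
  proof
    fix c assume "c \<in> rcosets H"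
    then obtain x where x: "x \<in> carrier G" "c = H #> x" unfolding RCOSETS_def by blast
    let ?y = "SOME y. y \<in> carrier G \<and> f y = f x"
    have y: "?y \<in> carrier G \<and> f ?y = f x" by (rule someI[of _ x]) (use x in simp)
    then have "c = H #> ?y" using coset_eq_iff[OF H, of ?y x] e[of ?y x] x by simp
    then show "c \<in> (\<lambda>v. H #> (SOME x. x \<in> carrier G \<and> f x = v)) ` (f ` carrier G)" using x(1) by blast
  qed
  then show ?thesis by (rule finite_subset) (intro finite_imageI f)
qed

lemma finite_index_Int:
  assumes "subgroup H G" "subgroup K G" "finite (rcosets H)" "finite (rcosets K)" shows "finite (rcosets (H \<inter> K))"
proof (rule finite_index_criterion[where f = "\<lambda>x. (H #> x, K #> x)"])
  show "subgroup (H \<inter> K) G" using assms by (intro subgroup_Int)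
  have "(\<lambda>x. (H #> x, K #> x)) ` carrier G \<subseteq> (rcosets H) \<times> (rcosets K)" unfolding rcosets_eq_image by blast
  then show "finite ((\<lambda>x. (H #> x, K #> x)) ` carrier G)" by (rule finite_subset) (intro finite_cartesian_product assms)
  show "x \<otimes> inv y \<in> H \<inter> K" if "x \<in> carrier G" "y \<in> carrier G" "(H #> x, K #> x) = (H #> y, K #> y)" for x y
    using coset_eq_iff[OF assms(1) that(1,2)] coset_eq_iff[OF assms(2) that(1,2)] that(3) by simp
qed

lemma finite_index_mono:
  assumes "subgroup H G" "subgroup K G" "H \<subseteq> K" "finite (rcosets H)" shows "finite (rcosets K)"
proof (rule finite_index_criterion[where f = "\<lambda>x. H #> x"])
  show "finite ((\<lambda>x. H #> x) ` carrier G)" using assms(4) unfolding rcosets_eq_image .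
  show "x \<otimes> inv y \<in> K" if "x \<in> carrier G" "y \<in> carrier G" "H #> x = H #> y" for x y
    using coset_eq_iff[OF assms(1) that(1,2)] that(3) assms(3) by blast
qed (rule assms)

lemma finite_transversal:
  assumes H: "subgroup H G" and f: "finite (rcosets H)"
  shows "\<exists>D. finite D \<and> D \<subseteq> carrier G \<and> (\<forall>x\<in>carrier G. \<exists>h\<in>H. \<exists>d\<in>D. x = h \<otimes> d)"
proof -
  let ?s = "\<lambda>c. SOME y. y \<in> carrier G \<and> H #> y = c"
  have s: "?s (H #> x) \<in> carrier G \<and> H #> ?s (H #> x) = H #> x" if "x \<in> carrier G" for x
    by (rule someI[of "\<lambda>y. y \<in> carrier G \<and> H #> y = H #> x" x]) (use that in simp)
  let ?D = "?s ` (rcosets H)"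
  have "\<exists>h\<in>H. \<exists>d\<in>?D. x = h \<otimes> d" if x: "x \<in> carrier G" for x
  proof -
    have "x \<otimes> inv (?s (H #> x)) \<in> H" using coset_eq_iff[OF H x, of "?s (H #> x)"] s[OF x] by simp
    moreover have "x = (x \<otimes> inv (?s (H #> x))) \<otimes> ?s (H #> x)" using x s[OF x] by (simp add: m_assoc)
    moreover have "?s (H #> x) \<in> ?D" unfolding rcosets_eq_image using x by blast
    ultimately show ?thesis by blast
  qed
  moreover have "?D \<subseteq> carrier G" unfolding rcosets_eq_image using s by blast
  moreover have "finite ?D" using f by simp
  ultimately show ?thesis by blast
qed

lemma finite_subgroup_finite_index:
  assumes "subgroup H G" "finite (rcosets H)" "finite H" shows "finite (carrier G)"
proof -
  obtain D where D: "finite D" "\<forall>x\<in>carrier G. \<exists>h\<in>H. \<exists>d\<in>D. x = h \<otimes> d" using finite_transversal[OF assms(1,2)] by blast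
  then have "carrier G \<subseteq> (\<lambda>(h, d). h \<otimes> d) ` (H \<times> D)" by fast
  then show ?thesis by (rule finite_subset) (intro finite_imageI finite_cartesian_product assms D)
qed

definition fc :: bool where "fc \<longleftrightarrow> (\<forall>x\<in>carrier G. finite ((\<lambda>g. cj g x) ` carrier G))"

lemma fc_cen_finite_index:
  assumes fc "finite S" "S \<subseteq> carrier G" shows "finite (rcosets (cen S))"
proof (rule finite_index_criterion[where f = "\<lambda>x. restrict (\<lambda>s. cj (inv x) s) S"])
  show "subgroup (cen S) G" by (rule subgroup_cen[OF assms(3)])
  have "(\<lambda>x. restrict (\<lambda>s. cj (inv x) s) S) ` carrier G \<subseteq> PiE S (\<lambda>s. (\<lambda>g. cj g s) ` carrier G)" by auto
  moreover have "finite (PiE S (\<lambda>s. (\<lambda>g. cj g s) ` carrier G))"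
    using assms unfolding fc_def by (intro finite_PiE) auto
  ultimately show "finite ((\<lambda>x. restrict (\<lambda>s. cj (inv x) s) S) ` carrier G)" by (rule finite_subset)
next
  fix x y assume x: "x \<in> carrier G" and y: "y \<in> carrier G" and e: "restrict (\<lambda>s. cj (inv x) s) S = restrict (\<lambda>s. cj (inv y) s) S"
  have "cj (x \<otimes> inv y) s = s" if s: "s \<in> S" for s
  proof -
    have sc: "s \<in> carrier G" using s assms(3) by blast
    have "cj (inv x) s = cj (inv y) s" using fun_cong[OF e, of s] s by simp
    then have "cj (x \<otimes> inv y) s = cj x (cj (inv x) s)" using x y sc by (simp add: cj_cj)
    then show ?thesis using x sc by simp
  qed
  then show "x \<otimes> inv y \<in> cen S" using cen_iff[of "x \<otimes> inv y" S] x y assms(3) by simp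
qed

lemma iso_class_card:
  assumes "\<phi> \<in> iso G G" "x \<in> carrier G"
  shows "card ((\<lambda>g. cj g (\<phi> x)) ` carrier G) = card ((\<lambda>g. cj g x) ` carrier G)"
proof -
  have "(\<lambda>g. cj g (\<phi> x)) ` carrier G = \<phi> ` (\<lambda>g. cj g x) ` carrier G"
  proof (intro equalityI subsetI)
    fix y assume "y \<in> (\<lambda>g. cj g (\<phi> x)) ` carrier G"
    then obtain g where g: "g \<in> carrier G" "y = cj g (\<phi> x)" by blast
    then obtain h where h: "h \<in> carrier G" "g = \<phi> h" using iso_surj[OF assms(1)] by blast
    then have "y = \<phi> (cj h x)" using g iso_cj[OF assms(1) h(1) assms(2)] by simp
    then show "y \<in> \<phi> ` (\<lambda>g. cj g x) ` carrier G" using h by blast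
  next
    fix y assume "y \<in> \<phi> ` (\<lambda>g. cj g x) ` carrier G"
    then obtain h where h: "h \<in> carrier G" "y = \<phi> (cj h x)" by blast
    then have "y = cj (\<phi> h) (\<phi> x)" using iso_cj[OF assms(1) h(1) assms(2)] by simp
    then show "y \<in> (\<lambda>g. cj g (\<phi> x)) ` carrier G" using iso_closed[OF assms(1) h(1)] by blast
  qed
  moreover have "(\<lambda>g. cj g x) ` carrier G \<subseteq> carrier G" using assms(2) by auto
  ultimately show ?thesis using iso_card[OF assms(1)] by simp
qed

text \<open>Class sizes are constant on orbits, hence bounded. Let \<open>a\<close> have a class of largest size, let
  \<open>B\<close> be a finite set of elements that conjugate \<open>a\<close> to all its conjugates, and let
  \<open>c\<close> commute with \<open>B\<close>. Multiplication by \<open>c\<close> maps the class of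
  \<open>a\<close> into that of \<open>a \<otimes> c\<close>, hence onto it, which confines the commutators of
  \<open>c\<close> to a finite set. Finally the centralizer of \<open>B\<close> has finite index.\<close>

lemma finite_commutators:
  assumes fc: fc and orb: "finite (automorphism_orbits G)" shows "finite (derived_set G (carrier G))"
proof -
  define K where "K x = (\<lambda>g. cj g x) ` carrier G" for x
  have Kc: "K x \<subseteq> carrier G" if "x \<in> carrier G" for x using that unfolding K_def by auto
  have fK: "finite (K x)" if "x \<in> carrier G" for x using fc that unfolding fc_def K_def by blast
  have fin: "finite ((\<lambda>x. card (K x)) ` carrier G)"
  proof (rule card_invariant_le(1)[OF orb])
    fix x y assume "x \<in> carrier G" "aeq x y"
    then show "card (K x) = card (K y)" unfolding aeq_def K_def using iso_class_card by fastforce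
  qed
  obtain a where a: "a \<in> carrier G" "card (K a) = Max ((\<lambda>x. card (K x)) ` carrier G)"
    using Max_in[OF fin] one_closed by fastforce
  have max: "card (K x) \<le> card (K a)" if "x \<in> carrier G" for x unfolding a(2) using fin that by (intro Max_ge) auto
  obtain B where B: "B \<subseteq> carrier G" "finite B" "K a = (\<lambda>b. cj b a) ` B"
    using finite_subset_image[OF fK[OF a(1)], of "\<lambda>g. cj g a" "carrier G"] unfolding K_def by blast
  \<comment> \<open>The commutators of elements that commute with \<open>B\<close> will be found in \<open>S\<close>.\<close>
  define S where "S = (\<lambda>(u, v). inv u \<otimes> v) ` (K a \<times> K a)"
  have fS: "finite S" unfolding S_def using fK[OF a(1)] by simp
  have key: "cj g c \<otimes> inv c \<in> S" if g: "g \<in> carrier G" and c: "c \<in> cen B" for g c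
  proof -
    have cc: "c \<in> carrier G" using c cen_sub by blast
    have ac: "a \<otimes> c \<in> carrier G" using a cc by simp
    have sub: "(\<lambda>k. k \<otimes> c) ` K a \<subseteq> K (a \<otimes> c)"
    proof
      fix y assume "y \<in> (\<lambda>k. k \<otimes> c) ` K a"
      then obtain b where b: "b \<in> B" "y = cj b a \<otimes> c" unfolding B(3) by blast
      have bc: "b \<in> carrier G" using b B(1) by blast
      have "b \<otimes> c = c \<otimes> b" using c b(1) unfolding cen_def by simp
      then have "cj b c = c" using cj_fix_iff[OF bc cc] by simp
      then have "y = cj b (a \<otimes> c)" using b bc cc a by (simp add: cj_mult)
      then show "y \<in> K (a \<otimes> c)" unfolding K_def using bc by blast
    qed
    have "card ((\<lambda>k. k \<otimes> c) ` K a) = card (K a)"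
      using Kc[OF a(1)] cc by (intro card_image inj_onI) (metis right_cancel subsetD)
    then have eq: "(\<lambda>k. k \<otimes> c) ` K a = K (a \<otimes> c)" using card_seteq[OF fK[OF ac] sub] max[OF ac] by simp
    have "cj g (a \<otimes> c) \<in> K (a \<otimes> c)" unfolding K_def using g by blast
    then obtain k where k: "k \<in> K a" "cj g (a \<otimes> c) = k \<otimes> c" using eq by blast
    have kc: "k \<in> carrier G" using k Kc[OF a(1)] by blast
    have "inv (cj g a) \<otimes> (cj g a \<otimes> cj g c) \<otimes> inv c = inv (cj g a) \<otimes> (k \<otimes> c) \<otimes> inv c"
      using k(2) g a cc by (simp add: cj_mult)
    then have "cj g c \<otimes> inv c = inv (cj g a) \<otimes> k" using g a cc kc by (simp add: m_assoc)
    moreover have "cj g a \<in> K a" unfolding K_def using g by blast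
    ultimately show ?thesis unfolding S_def using k(1) by (intro image_eqI[of _ _ "(cj g a, k)"]) auto
  qed
  obtain D where D: "finite D" "D \<subseteq> carrier G" "\<forall>x\<in>carrier G. \<exists>h\<in>cen B. \<exists>d\<in>D. x = h \<otimes> d"
    using finite_transversal[OF subgroup_cen[OF B(1)] fc_cen_finite_index[OF fc B(2,1)]] by blast
  let ?T = "(\<lambda>(k, s, d). inv k \<otimes> s \<otimes> d) ` ((\<Union>d\<in>D. K d) \<times> S \<times> D)"
  have "derived_set G (carrier G) \<subseteq> ?T"
  proof
    fix z assume "z \<in> derived_set G (carrier G)"
    then obtain g x where gx: "g \<in> carrier G" "x \<in> carrier G" "z = g \<otimes> x \<otimes> inv g \<otimes> inv x" by blast
    obtain h d where hd: "h \<in> cen B" "d \<in> D" "inv x = h \<otimes> d" using D(3) gx(2) by blast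
    have c: "h \<in> carrier G" "d \<in> carrier G" using hd cen_sub D(2) by blast+
    have "x = inv (h \<otimes> d)" using hd(3) gx(2) by (metis inv_inv)
    then have x: "x = inv d \<otimes> inv h" using c by (simp add: inv_mult_group)
    have h': "inv h \<in> cen B" using hd(1) subgroup.m_inv_closed[OF subgroup_cen[OF B(1)]] by blast
    have "z = cj g x \<otimes> inv x" using gx by (simp add: cj_def)
    also have "\<dots> = inv (cj g d) \<otimes> (cj g (inv h) \<otimes> inv (inv h)) \<otimes> d"
      unfolding x using gx(1) c by (simp add: cj_mult cj_inv inv_mult_group m_assoc)
    finally have "z = inv (cj g d) \<otimes> (cj g (inv h) \<otimes> inv (inv h)) \<otimes> d" .
    moreover have "cj g d \<in> (\<Union>d\<in>D. K d)" using hd(2) gx(1) unfolding K_def by blast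
    ultimately show "z \<in> ?T" using key[OF gx(1) h'] hd(2) by force
  qed
  moreover have "finite ?T" using D(1,2) fK fS by (intro finite_imageI finite_cartesian_product finite_UN_I) auto
  ultimately show ?thesis by (rule finite_subset)
qed

lemma iso_derived_set:
  assumes "\<phi> \<in> iso G G" "x \<in> derived_set G (carrier G)" shows "\<phi> x \<in> derived_set G (carrier G)"
proof -
  interpret f: group_hom G G \<phi> by (rule iso_hom[OF assms(1)])
  obtain u v where uv: "u \<in> carrier G" "v \<in> carrier G" "x = u \<otimes> v \<otimes> inv u \<otimes> inv v" using assms(2) by blast
  then have "\<phi> x = \<phi> u \<otimes> \<phi> v \<otimes> inv (\<phi> u) \<otimes> inv (\<phi> v)" by simp
  moreover have "\<phi> u \<in> carrier G" "\<phi> v \<in> carrier G" using uv by simp_all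
  ultimately show ?thesis by blast
qed

lemma iso_derived_set_image: assumes "\<phi> \<in> iso G G" shows "\<phi> ` derived_set G (carrier G) = derived_set G (carrier G)"
proof (intro equalityI subsetI)
  show "y \<in> derived_set G (carrier G)" if "y \<in> \<phi> ` derived_set G (carrier G)" for y using that iso_derived_set[OF assms] by blast
next
  interpret f: group_hom G G \<phi> by (rule iso_hom[OF assms(1)])
  fix y assume "y \<in> derived_set G (carrier G)"
  then obtain u v where uv: "u \<in> carrier G" "v \<in> carrier G" "y = u \<otimes> v \<otimes> inv u \<otimes> inv v" by blast
  obtain a b where ab: "a \<in> carrier G" "b \<in> carrier G" "u = \<phi> a" "v = \<phi> b" using iso_surj[OF assms] uv by metis
  have "y = \<phi> (a \<otimes> b \<otimes> inv a \<otimes> inv b)" using uv ab by simp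
  then show "y \<in> \<phi> ` derived_set G (carrier G)" using ab by blast
qed

text \<open>The terms of the series are generated by decreasing sets of commutators, and these are finite.\<close>

lemma derived_series_stabilizes:
  assumes "finite (derived_set G (carrier G))"
  shows "\<exists>n. derived G ((derived G ^^ Suc n) (carrier G)) = (derived G ^^ Suc n) (carrier G)"
proof (rule ccontr)
  assume n: "\<not> ?thesis"
  define H where "H n = (derived G ^^ n) (carrier G)" for n
  define T where "T n = derived_set G (H n)" for n
  have sH: "subgroup (H n) G" for n unfolding H_def by (rule exp_of_derived_is_subgroup[OF subgroup_self])
  have H: "H (Suc n) = generate G (T n)" for n by (simp add: H_def T_def derived_def)
  have "H (Suc n) \<subseteq> H n" for n using derived_incl[OF subset_refl sH] by (simp add: H_def)
  then have mono: "T (Suc n) \<subseteq> T n" for n unfolding T_def by (rule mono_derived_set)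
  have fT: "finite (T n)" for n
  proof (induction n)
    case 0 show ?case using assms by (simp add: T_def H_def)
  next
    case (Suc n) show ?case using mono Suc.IH by (rule finite_subset)
  qed
  have "T (Suc n) \<noteq> T n" for n
  proof
    assume "T (Suc n) = T n"
    then have "H (Suc (Suc n)) = H (Suc n)" using H by simp
    then show False using n by (auto simp: H_def)
  qed
  then have "card (T (Suc n)) < card (T n)" for n using mono fT by (metis psubset_card_mono psubsetI)
  then have "card (T n) + n \<le> card (T 0)" for n
  proof (induction n)
    case (Suc n)
    then show ?case by (metis Suc_leI add_Suc_right add_Suc add_le_mono1 le_trans)
  qed simp
  from this[of "Suc (card (T 0))"] show False by simp
qed

text \<open>An element of \<open>C\<close> that commutes with a set of coset representatives is central.\<close>

lemma abelian_finite_index_center: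
  assumes fc "subgroup C G" "finite (rcosets C)" "\<And>x y. x \<in> C \<Longrightarrow> y \<in> C \<Longrightarrow> x \<otimes> y = y \<otimes> x"
  shows "finite (rcosets (center G))"
proof -
  obtain D where D: "finite D" "D \<subseteq> carrier G" "\<forall>x\<in>carrier G. \<exists>h\<in>C. \<exists>d\<in>D. x = h \<otimes> d"
    using finite_transversal[OF assms(2,3)] by blast
  show ?thesis
  proof (rule finite_index_mono)
    show s: "subgroup (C \<inter> cen D) G" by (intro subgroup_Int assms subgroup_cen D)
    show "subgroup (center G) G" by (rule center_is_subgroup)
    show "finite (rcosets (C \<inter> cen D))" by (intro finite_index_Int assms subgroup_cen D fc_cen_finite_index)
    show "C \<inter> cen D \<subseteq> center G"
    proof
      fix z assume z: "z \<in> C \<inter> cen D"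
      have zc: "z \<in> carrier G" using z subgroup.mem_carrier[OF s] by blast
      have "z \<otimes> g = g \<otimes> z" if g: "g \<in> carrier G" for g
      proof -
        obtain h d where hd: "h \<in> C" "d \<in> D" "g = h \<otimes> d" using D(3) g by blast
        have c: "h \<in> carrier G" "d \<in> carrier G" using subgroup.mem_carrier[OF assms(2) hd(1)] subsetD[OF D(2) hd(2)] by simp_all
        have "z \<otimes> h = h \<otimes> z" using assms(4) z hd(1) by blast
        moreover have "z \<otimes> d = d \<otimes> z" using z hd(2) unfolding cen_def by blast
        ultimately have "cj z h = h" "cj z d = d" using cj_fix_iff zc c by blast+
        then have "cj z g = g" using zc c hd(3) by (simp add: cj_mult)
        then show ?thesis using cj_fix_iff[OF zc g] by simp
      qed
      then show "z \<in> center G" using zc unfolding center_def by blast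
    qed
  qed
qed

end

section \<open>A perfect subgroup centralized by a subgroup of finite index\<close>

context group begin

lemma cenD: "g \<in> cen S \<Longrightarrow> s \<in> S \<Longrightarrow> g \<otimes> s = s \<otimes> g" by (simp add: cen_def)

lemma exponent_2_commute:
  assumes "x \<in> carrier G" "y \<in> carrier G" "x \<otimes> x = \<one>" "y \<otimes> y = \<one>" "(x \<otimes> y) \<otimes> (x \<otimes> y) = \<one>"
  shows "x \<otimes> y = y \<otimes> x"
proof -
  have "inv x = x" "inv y = y" "inv (x \<otimes> y) = x \<otimes> y" using assms inv_equality by blast+
  then show ?thesis using assms by (metis inv_mult_group)
qed

end

text \<open>The situation to be refuted: \<open>C\<close> is the centralizer of all commutators, and \<open>R\<close> is
  the last term of the derived series.\<close>

locale centralized_perfect = group G for G (structure) +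
  fixes R C :: "'a set"
  assumes sR: "subgroup R G" and sC: "subgroup C G" and perfect_R: "derived G R = R"
    and iso_R: "\<And>\<phi>. \<phi> \<in> iso G G \<Longrightarrow> \<phi> ` R = R" and iso_C: "\<And>\<phi>. \<phi> \<in> iso G G \<Longrightarrow> \<phi> ` C = C"
    and comm_RC: "\<And>r c. r \<in> R \<Longrightarrow> c \<in> C \<Longrightarrow> r \<otimes> c = c \<otimes> r"
    and not_sub: "\<not> R \<subseteq> C" and fin_index: "finite (rcosets C)"
    and fin_comm: "finite (derived_set G (carrier G))"
    and class_2: "\<And>x c. x \<in> derived_set G (carrier G) \<Longrightarrow> c \<in> C \<Longrightarrow> x \<otimes> c = c \<otimes> x"
    and nonabelian: "\<exists>u\<in>C. \<exists>v\<in>C. u \<otimes> v \<noteq> v \<otimes> u"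
    and has_fc: fc and infinite_G: "infinite (carrier G)"
    and orbits_finite: "finite (automorphism_orbits G)" and orbits_le: "card (automorphism_orbits G) \<le> 11"
begin

lemma Rc: "r \<in> R \<Longrightarrow> r \<in> carrier G" and Cc: "c \<in> C \<Longrightarrow> c \<in> carrier G"
  using subgroup.mem_carrier[OF sR] subgroup.mem_carrier[OF sC] by blast+

lemma normal_C: "C \<lhd> G"
  unfolding normal_inv_iff using sC iso_C[OF cj_iso] by (auto simp: cj_def)

text \<open>The group \<open>Q\<close> is the image of \<open>R\<close> in the quotient by \<open>C\<close>. In this
  form \<open>\<pi> x\<close> makes sense for every \<open>x\<close>, and it lies in \<open>Q\<close> if and
  only if \<open>x\<close> is in the product of \<open>R\<close> and \<open>C\<close>.\<close>

definition \<pi> where "\<pi> x = C #> x"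

definition Q where "Q = (G Mod C)\<lparr>carrier := \<pi> ` R\<rparr>"

lemma hom_\<pi>: "group_hom G (G Mod C) \<pi>"
  unfolding \<pi>_def group_hom_def group_hom_axioms_def
  using normal.factorgroup_is_group[OF normal_C] normal.r_coset_hom_Mod[OF normal_C] is_group by auto

lemma carrier_Q: "carrier Q = \<pi> ` R" by (simp add: Q_def)

lemma sub_Q: "subgroup (\<pi> ` R) (G Mod C)" by (rule group_hom.subgroup_img_is_subgroup[OF hom_\<pi> sR])

sublocale Q: group Q
  unfolding Q_def by (rule subgroup.subgroup_is_group[OF sub_Q normal.factorgroup_is_group[OF normal_C]])

lemma \<pi>_mult: "x \<in> carrier G \<Longrightarrow> y \<in> carrier G \<Longrightarrow> \<pi> x \<otimes>\<^bsub>Q\<^esub> \<pi> y = \<pi> (x \<otimes> y)"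
  using group_hom.hom_mult[OF hom_\<pi>] by (simp add: Q_def)

lemma \<pi>_one: "\<pi> \<one> = \<one>\<^bsub>Q\<^esub>"
  using coset_mult_one[OF subgroup.subset[OF sC]] by (simp add: Q_def \<pi>_def)

lemma \<pi>_eq_iff: "x \<in> carrier G \<Longrightarrow> y \<in> carrier G \<Longrightarrow> \<pi> x = \<pi> y \<longleftrightarrow> x \<otimes> inv y \<in> C"
  unfolding \<pi>_def by (rule coset_eq_iff[OF sC])

lemma \<pi>_in: "x \<in> R \<Longrightarrow> \<pi> x \<in> carrier Q" by (simp add: carrier_Q)

lemma \<pi>_eq_one: "x \<in> carrier G \<Longrightarrow> \<pi> x = \<one>\<^bsub>Q\<^esub> \<longleftrightarrow> x \<in> C"
  using \<pi>_eq_iff[of x \<one>] \<pi>_one by simp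

lemma \<pi>_mult_C: assumes "x \<in> carrier G" "c \<in> C" shows "\<pi> (x \<otimes> c) = \<pi> x"
proof -
  have "cj x c \<in> C" using iso_C[OF cj_iso[OF assms(1)]] assms(2) by blast
  then show ?thesis using \<pi>_eq_iff[of "x \<otimes> c" x] assms Cc by (simp add: cj_def)
qed

lemma \<pi>_pow: "x \<in> R \<Longrightarrow> \<pi> (x [^] n) = \<pi> x [^]\<^bsub>Q\<^esub> (n::nat)"
proof (induction n)
  case (Suc n)
  then show ?case using \<pi>_mult[of "x [^] n" x] Rc by simp
qed (simp add: \<pi>_one)

lemma \<pi>_inv: assumes "x \<in> R" shows "inv\<^bsub>Q\<^esub> (\<pi> x) = \<pi> (inv x)"
proof (rule Q.inv_equality)
  show "\<pi> (inv x) \<otimes>\<^bsub>Q\<^esub> \<pi> x = \<one>\<^bsub>Q\<^esub>" using \<pi>_mult[of "inv x" x] Rc[OF assms] by (simp add: \<pi>_one)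
qed (use assms subgroup.m_inv_closed[OF sR] in \<open>auto simp: \<pi>_in\<close>)

lemma \<pi>_cj: assumes "x \<in> R" "y \<in> R" shows "Q.cj (\<pi> x) (\<pi> y) = \<pi> (cj x y)"
  unfolding Q.cj_def cj_def using assms Rc by (simp add: \<pi>_inv \<pi>_mult)

lemma finite_Q: "finite (carrier Q)"
proof (rule finite_subset[OF _ fin_index])
  show "carrier Q \<subseteq> rcosets C" unfolding carrier_Q rcosets_eq_image \<pi>_def using Rc by blast
qed

lemma perfect_Q: "derived Q (carrier Q) = carrier Q"
proof -
  have "derived Q (\<pi> ` R) = derived (G Mod C) (\<pi> ` R)"
    unfolding Q_def by (rule group.derived_consistent[OF normal.factorgroup_is_group[OF normal_C] subset_refl sub_Q])
  also have "\<dots> = \<pi> ` R" using group_hom.derived_img[OF hom_\<pi> subgroup.subset[OF sR]] perfect_R by simp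
  finally show ?thesis unfolding carrier_Q .
qed

lemma nontrivial_Q: "carrier Q \<noteq> {\<one>\<^bsub>Q\<^esub>}"
proof
  assume e: "carrier Q = {\<one>\<^bsub>Q\<^esub>}"
  have "r \<in> C" if "r \<in> R" for r using \<pi>_in[OF that] e \<pi>_eq_one[OF Rc[OF that]] by simp
  then show False using not_sub by blast
qed

lemma orbits_Q_finite: "finite (automorphism_orbits Q)" unfolding Q.automorphism_orbits_eq using finite_Q by simp

lemma iso_\<pi>_eq_iff:
  assumes "\<phi> \<in> iso G G" "x \<in> carrier G" "y \<in> carrier G" shows "\<pi> (\<phi> x) = \<pi> (\<phi> y) \<longleftrightarrow> \<pi> x = \<pi> y"
proof -
  interpret f: group_hom G G \<phi> by (rule iso_hom[OF assms(1)])
  have "\<phi> x \<otimes> inv (\<phi> y) = \<phi> (x \<otimes> inv y)" using assms by simp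
  then have "\<pi> (\<phi> x) = \<pi> (\<phi> y) \<longleftrightarrow> \<phi> (x \<otimes> inv y) \<in> \<phi> ` C" using \<pi>_eq_iff[of "\<phi> x" "\<phi> y"] iso_C[OF assms(1)] assms by simp
  also have "\<dots> \<longleftrightarrow> x \<otimes> inv y \<in> C" by (rule iso_mem[OF assms(1) subgroup.subset[OF sC]]) (use assms in simp)
  finally show ?thesis using \<pi>_eq_iff[OF assms(2,3)] by simp
qed

lemma iso_mem_R: "\<phi> \<in> iso G G \<Longrightarrow> x \<in> carrier G \<Longrightarrow> \<phi> x \<in> R \<longleftrightarrow> x \<in> R"
  using iso_mem[OF _ subgroup.subset[OF sR], of \<phi> x] iso_R[of \<phi>] by simp

lemma iso_mem_cen_C: "\<phi> \<in> iso G G \<Longrightarrow> x \<in> carrier G \<Longrightarrow> \<phi> x \<in> cen C \<longleftrightarrow> x \<in> cen C"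
  using iso_mem[OF _ cen_sub, of \<phi> x C] iso_cen[OF _ subgroup.subset[OF sC], of \<phi>] iso_C[of \<phi>] by simp

lemma iso_Q: assumes \<phi>: "\<phi> \<in> iso G G" and x: "x \<in> R" shows "Q.aeq (\<pi> x) (\<pi> (\<phi> x))"
proof -
  define \<Phi> where "\<Phi> c = \<pi> (\<phi> (SOME r. r \<in> R \<and> \<pi> r = c))" for c
  have \<Phi>: "\<Phi> (\<pi> r) = \<pi> (\<phi> r)" if "r \<in> R" for r
  proof -
    have s: "(SOME s. s \<in> R \<and> \<pi> s = \<pi> r) \<in> R \<and> \<pi> (SOME s. s \<in> R \<and> \<pi> s = \<pi> r) = \<pi> r"
      by (rule someI[of "\<lambda>s. s \<in> R \<and> \<pi> s = \<pi> r" r]) (use that in simp)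
    then show ?thesis unfolding \<Phi>_def using iso_\<pi>_eq_iff[OF \<phi>] Rc that by blast
  qed
  have cl: "\<phi> r \<in> R" if "r \<in> R" for r using iso_R[OF \<phi>] that by blast
  have "\<Phi> \<in> iso Q Q"
  proof (rule isoI)
    show "\<Phi> \<in> hom Q Q"
    proof (rule homI)
      fix a assume "a \<in> carrier Q"
      then obtain r where r: "r \<in> R" "a = \<pi> r" unfolding carrier_Q by blast
      then show "\<Phi> a \<in> carrier Q" using \<Phi> cl \<pi>_in by simp
      fix b assume "b \<in> carrier Q"
      then obtain s where s: "s \<in> R" "b = \<pi> s" unfolding carrier_Q by blast
      have rs: "r \<otimes> s \<in> R" using r s subgroup.m_closed[OF sR] by blast
      show "\<Phi> (a \<otimes>\<^bsub>Q\<^esub> b) = \<Phi> a \<otimes>\<^bsub>Q\<^esub> \<Phi> b"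
        using r s \<pi>_mult[OF Rc Rc, OF r(1) s(1)] \<pi>_mult[OF Rc[OF cl] Rc[OF cl], OF r(1) s(1)] \<Phi>[OF rs] \<Phi>[OF r(1)] \<Phi>[OF s(1)]
          iso_mult[OF \<phi> Rc Rc, OF r(1) s(1)] by simp
    qed
    show "bij_betw \<Phi> (carrier Q) (carrier Q)"
    proof (rule bij_betw_imageI)
      show "inj_on \<Phi> (carrier Q)"
      proof (rule inj_onI)
        fix a b assume ab: "a \<in> carrier Q" "b \<in> carrier Q" "\<Phi> a = \<Phi> b"
        then obtain r s where "r \<in> R" "a = \<pi> r" "s \<in> R" "b = \<pi> s" unfolding carrier_Q by blast
        then show "a = b" using ab(3) \<Phi> iso_\<pi>_eq_iff[OF \<phi>] Rc by simp
      qed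
      have "\<Phi> ` \<pi> ` R = \<pi> ` \<phi> ` R" unfolding image_image using \<Phi> by (intro image_cong) auto
      then show "\<Phi> ` carrier Q = carrier Q" unfolding carrier_Q using iso_R[OF \<phi>] by simp
    qed
  qed
  then show ?thesis unfolding Q.aeq_def using \<Phi>[OF x] by blast
qed

lemma R_cen_C: "R \<subseteq> cen C" unfolding cen_def using comm_RC Rc by blast

text \<open>Orbits are nonempty, so the value for elements outside the product of \<open>R\<close> and \<open>C\<close>
  differs from all the other values.\<close>

definition label :: "('a \<Rightarrow> nat) \<Rightarrow> 'a \<Rightarrow> 'a set set \<times> nat" where
  "label s x = (if \<pi> x \<in> carrier Q then ({q. Q.aeq (\<pi> x) q}, s x) else ({}, 0))"

lemma label_invariant:
  assumes s: "\<And>\<phi> x. \<phi> \<in> iso G G \<Longrightarrow> x \<in> carrier G \<Longrightarrow> s (\<phi> x) = s x" and x: "x \<in> carrier G" and a: "aeq x y"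
  shows "label s x = label s y"
proof -
  obtain \<phi> where \<phi>: "\<phi> \<in> iso G G" "y = \<phi> x" using a unfolding aeq_def by blast
  have sxy: "s y = s x" using s \<phi> x by simp
  show ?thesis
  proof (cases "\<pi> x \<in> carrier Q")
    case True
    then obtain r where r: "r \<in> R" "\<pi> x = \<pi> r" unfolding carrier_Q by blast
    then have e: "\<pi> y = \<pi> (\<phi> r)" using iso_\<pi>_eq_iff[OF \<phi>(1) x Rc[OF r(1)]] \<phi>(2) by simp
    have "\<phi> r \<in> R" using iso_R[OF \<phi>(1)] r(1) by blast
    then have y: "\<pi> y \<in> carrier Q" using e \<pi>_in by simp
    have "{q. Q.aeq (\<pi> x) q} = {q. Q.aeq (\<pi> y) q}"
      using Q.aeq_class_eq[OF True] iso_Q[OF \<phi>(1) r(1)] r(2) e by simp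
    then show ?thesis using True y sxy by (simp add: label_def)
  next
    case False
    have "\<pi> y \<notin> carrier Q"
    proof
      assume "\<pi> y \<in> carrier Q"
      then obtain r where r: "r \<in> R" "\<pi> y = \<pi> r" unfolding carrier_Q by blast
      have "r \<in> \<phi> ` R" using iso_R[OF \<phi>(1)] r(1) by simp
      then obtain r' where r': "r' \<in> R" "\<pi> y = \<pi> (\<phi> r')" using r(2) by blast
      then have "\<pi> x = \<pi> r'" using iso_\<pi>_eq_iff[OF \<phi>(1) x Rc[OF r'(1)]] \<phi>(2) by simp
      then show False using False r'(1) \<pi>_in by simp
    qed
    then show ?thesis using False by (simp add: label_def)
  qed
qed

lemma label_count:
  assumes s: "\<forall>\<phi>\<in>iso G G. \<forall>x\<in>carrier G. s (\<phi> x) = s x"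
    and T: "\<forall>t\<in>T. \<exists>x\<in>carrier G. \<pi> x \<in> carrier Q \<and> t = ({q. Q.aeq (\<pi> x) q}, s x)"
  shows "card T \<le> 11"
    "11 \<le> card T \<Longrightarrow> x \<in> carrier G \<Longrightarrow> y \<in> carrier G \<Longrightarrow> label s x = label s y \<Longrightarrow> aeq x y"
proof -
  have li: "label s x = label s y" if "x \<in> carrier G" "aeq x y" for x y
    by (rule label_invariant[OF _ that]) (use s in blast)
  note inv = card_invariant_le[where f = "label s", OF orbits_finite li]
  have "T \<subseteq> label s ` carrier G"
  proof
    fix t assume "t \<in> T"
    then obtain x where x: "x \<in> carrier G" "\<pi> x \<in> carrier Q" "t = ({q. Q.aeq (\<pi> x) q}, s x)" using T by blast
    then have "t = label s x" by (simp add: label_def)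
    then show "t \<in> label s ` carrier G" using x(1) by blast
  qed
  then have le: "card T \<le> card (label s ` carrier G)" using inv(1) by (intro card_mono) auto
  also have "\<dots> \<le> card (automorphism_orbits G)" using inv(2) by simp
  finally show "card T \<le> 11" using orbits_le by linarith
  assume "11 \<le> card T" "x \<in> carrier G" "y \<in> carrier G" "label s x = label s y"
  then show "aeq x y" using inv(3) le orbits_le by (meson le_trans)
qed

lemma orbits_QE: assumes "U \<in> automorphism_orbits Q" obtains r where "r \<in> R" "U = {q. Q.aeq (\<pi> r) q}"
  using assms unfolding Q.automorphism_orbits_eq carrier_Q by blast

text \<open>All four statements rest on the classification of finite perfect groups with at most four orbits.\<close>

lemma few_orbits_Q:
  assumes "card (automorphism_orbits Q) \<le> 4"
  shows "order Q = 60" "\<And>q. q \<in> carrier Q \<Longrightarrow> Q.ord q \<in> {1, 2, 3, 5}"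
    "\<And>q. q \<in> carrier Q \<Longrightarrow> Q.ord q \<in> {3, 5} \<Longrightarrow> card (Q.cen {q}) = Q.ord q \<and> (\<exists>t\<in>carrier Q. Q.cj t q = inv\<^bsub>Q\<^esub> q)"
    "\<And>n. n \<in> {1, 2, 3, 5} \<Longrightarrow> \<exists>q\<in>carrier Q. Q.ord q = n"
proof -
  note T = Q.four_orbits_order_60[OF finite_Q perfect_Q nontrivial_Q orbits_Q_finite assms]
  show "order Q = 60" using T by blast
  show "\<And>q. q \<in> carrier Q \<Longrightarrow> Q.ord q \<in> {1, 2, 3, 5}" using T by blast
  show "\<And>q. q \<in> carrier Q \<Longrightarrow> Q.ord q \<in> {3, 5} \<Longrightarrow> card (Q.cen {q}) = Q.ord q \<and> (\<exists>t\<in>carrier Q. Q.cj t q = inv\<^bsub>Q\<^esub> q)"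
    using T by blast
  have c: "card (carrier Q) = 60" using T by (simp add: order_def)
  fix n :: nat assume n: "n \<in> {1, 2, 3, 5}"
  show "\<exists>q\<in>carrier Q. Q.ord q = n"
  proof (cases "n = 1")
    case True then show ?thesis by (intro bexI[of _ "\<one>\<^bsub>Q\<^esub>"]) auto
  next
    case False
    then have "prime n" "n dvd card (carrier Q)" using n c by auto
    then show ?thesis by (rule Q.cauchy[OF Q.subgroup_self finite_Q])
  qed
qed

lemma card_ord_classes:
  assumes "S \<subseteq> carrier Q" shows "card (Q.ord ` S) \<le> card ((\<lambda>q. {z. Q.aeq q z}) ` S)"
proof -
  have "Q.ord (SOME z. z \<in> {z. Q.aeq q z}) = Q.ord q" if "q \<in> S" for q
  proof -
    have "Q.aeq q (SOME z. z \<in> {z. Q.aeq q z})" using someI_ex[of "\<lambda>z. z \<in> {z. Q.aeq q z}"] Q.aeq_refl[of q] by blast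
    then show ?thesis using Q.aeq_ord that assms by blast
  qed
  then have "Q.ord ` S = (\<lambda>U. Q.ord (SOME z. z \<in> U)) ` (\<lambda>q. {z. Q.aeq q z}) ` S" by (force simp: image_image)
  then show ?thesis using card_image_le[of "(\<lambda>q. {z. Q.aeq q z}) ` S"] finite_subset[OF assms finite_Q] by simp
qed

lemma four_le_orbits_Q: "card (automorphism_orbits Q) \<ge> 4"
proof (rule ccontr)
  assume "\<not> ?thesis"
  then have "card (automorphism_orbits Q) \<le> 4" "card (automorphism_orbits Q) < 4" by auto
  have "{1, 2, 3, 5} \<subseteq> Q.ord ` carrier Q"
  proof
    fix n :: nat assume "n \<in> {1, 2, 3, 5}"
    then obtain q where "q \<in> carrier Q" "Q.ord q = n" using few_orbits_Q(4)[OF \<open>card (automorphism_orbits Q) \<le> 4\<close>, of n] by blast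
    then show "n \<in> Q.ord ` carrier Q" by blast
  qed
  then have "card {1, 2, 3, 5 :: nat} \<le> card (Q.ord ` carrier Q)" using finite_Q by (intro card_mono) auto
  also have "\<dots> \<le> card (automorphism_orbits Q)" unfolding Q.automorphism_orbits_eq by (rule card_ord_classes) simp
  finally show False using \<open>card (automorphism_orbits Q) < 4\<close> by simp
qed

text \<open>Otherwise an element of the center of \<open>C\<close> outside \<open>R\<close> and a noncentral element of
  \<open>C\<close> would provide each orbit on \<open>Q\<close> with three kinds of elements above it, which
  makes at least twelve orbits.\<close>

lemma center_in_R: "C \<inter> cen C \<subseteq> R"
proof (rule ccontr)
  assume "\<not> ?thesis"
  then obtain z where z: "z \<in> C" "z \<in> cen C" "z \<notin> R" by blast
  obtain c where c: "c \<in> C" "c \<notin> cen C" using nonabelian Cc unfolding cen_def by blast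
  define s where "s x = (if x \<in> R then 0 else if x \<in> cen C then 1 else 2 :: nat)" for x
  have "card (automorphism_orbits Q \<times> {0, 1, 2 :: nat}) \<le> 11"
  proof (rule label_count(1))
    show "\<forall>\<phi>\<in>iso G G. \<forall>x\<in>carrier G. s (\<phi> x) = s x"
      unfolding s_def using iso_mem_R iso_mem_cen_C by simp
    show "\<forall>t\<in>automorphism_orbits Q \<times> {0, 1, 2 :: nat}. \<exists>x\<in>carrier G. \<pi> x \<in> carrier Q \<and> t = ({q. Q.aeq (\<pi> x) q}, s x)"
    proof
    fix t assume "t \<in> automorphism_orbits Q \<times> {0, 1, 2 :: nat}"
    then obtain U n where t: "t = (U, n)" "U \<in> automorphism_orbits Q" "n \<in> {0, 1, 2}" by blast
    obtain r where r: "r \<in> R" "U = {q. Q.aeq (\<pi> r) q}" using orbits_QE[OF t(2)] .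
    have scen: "subgroup (cen C) G" by (rule subgroup_cen[OF subgroup.subset[OF sC]])
    have rcen: "r \<in> cen C" using r(1) R_cen_C by blast
    have back_R: "x \<in> R" if "r \<otimes> x \<in> R" "x \<in> C" for x
    proof -
      have "inv r \<otimes> (r \<otimes> x) \<in> R" using that(1) r(1) sR by (simp add: subgroup.m_closed subgroup.m_inv_closed)
      then show ?thesis using Rc[OF r(1)] Cc[OF that(2)] by simp
    qed
    have back_cen: "x \<in> cen C" if "r \<otimes> x \<in> cen C" "x \<in> C" for x
    proof -
      have "inv r \<otimes> (r \<otimes> x) \<in> cen C" using that(1) rcen scen by (simp add: subgroup.m_closed subgroup.m_inv_closed)
      then show ?thesis using Rc[OF r(1)] Cc[OF that(2)] by simp
    qed
    have s0: "s r = 0" using r(1) by (simp add: s_def)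
    have "r \<otimes> z \<in> cen C" using rcen z(2) subgroup.m_closed[OF scen] by blast
    then have s1: "s (r \<otimes> z) = 1" using back_R[OF _ z(1)] z(3) by (auto simp: s_def)
    have s2: "s (r \<otimes> c) = 2" using back_R[OF _ c(1)] back_cen[OF _ c(1)] c(2) R_cen_C by (auto simp: s_def)
    have "\<exists>x\<in>{r, r \<otimes> z, r \<otimes> c}. s x = n" using t(3) s0 s1 s2 by auto
    then obtain x where x: "x \<in> {r, r \<otimes> z, r \<otimes> c}" "s x = n" by blast
    then have "\<pi> x = \<pi> r" "x \<in> carrier G" using \<pi>_mult_C[OF Rc[OF r(1)]] z(1) c(1) Rc[OF r(1)] Cc by auto
    then show "\<exists>x\<in>carrier G. \<pi> x \<in> carrier Q \<and> t = ({q. Q.aeq (\<pi> x) q}, s x)"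
      using x(2) t(1) r \<pi>_in[OF r(1)] by (intro bexI[of _ x]) auto
    qed
  qed
  then show False using four_le_orbits_Q by (simp add: card_cartesian_product)
qed

lemma center_eq: "C \<inter> cen C = R \<inter> C" using center_in_R R_cen_C by blast

text \<open>The center of \<open>C\<close> is a central subgroup of finite index in the perfect group \<open>R\<close>,
  so the transfer applies.\<close>

lemma center_exponent: "\<exists>n>0. \<forall>a\<in>C \<inter> cen C. a [^] (n::nat) = \<one>"
proof -
  let ?A = "C \<inter> cen C" and ?GR = "G\<lparr>carrier := R\<rparr>"
  interpret GR: group ?GR by (rule subgroup.subgroup_is_group[OF sR is_group])
  have sA: "subgroup ?A G" by (intro subgroup_Int sC subgroup_cen subgroup.subset[OF sC])
  have sA': "subgroup ?A ?GR" by (rule subgroup_incl[OF sA sR center_in_R])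
  have f: "finite (rcosets\<^bsub>?GR\<^esub> ?A)"
  proof (rule GR.finite_index_criterion[OF sA', where f = \<pi>])
    show "finite (\<pi> ` carrier ?GR)" using finite_Q by (simp add: carrier_Q)
    fix x y assume xy: "x \<in> carrier ?GR" "y \<in> carrier ?GR" "\<pi> x = \<pi> y"
    then have c: "x \<in> R" "y \<in> R" by simp_all
    have "x \<otimes> inv y \<in> C" using \<pi>_eq_iff[OF Rc Rc, OF c] xy(3) by simp
    moreover have "x \<otimes> inv y \<in> R" using c sR by (simp add: subgroup.m_closed subgroup.m_inv_closed)
    ultimately show "x \<otimes>\<^bsub>?GR\<^esub> inv\<^bsub>?GR\<^esub> y \<in> ?A" unfolding center_eq using m_inv_consistent[OF sR c(2)] by simp
  qed
  have "a [^] card (rcosets\<^bsub>?GR\<^esub> ?A) = \<one>" if a: "a \<in> ?A" for a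
  proof -
    have "a [^]\<^bsub>?GR\<^esub> card (rcosets\<^bsub>?GR\<^esub> ?A) = \<one>\<^bsub>?GR\<^esub>"
    proof (rule GR.perfect_central_exponent[OF _ sA' f _ a])
      show "derived ?GR (carrier ?GR) = carrier ?GR" using derived_consistent[OF subset_refl sR] perfect_R by simp
      show "b \<otimes>\<^bsub>?GR\<^esub> g = g \<otimes>\<^bsub>?GR\<^esub> b" if "b \<in> ?A" "g \<in> carrier ?GR" for b g using comm_RC[of g b] that by simp
    qed
    then show ?thesis using nat_pow_consistent[of a _ R] by simp
  qed
  moreover have "card (rcosets\<^bsub>?GR\<^esub> ?A) > 0" using f GR.one_closed unfolding card_gt_0_iff GR.rcosets_eq_image by blast
  ultimately show ?thesis by blast
qed

lemma commutator_in_center: assumes "u \<in> C" "v \<in> C" shows "cj u v \<otimes> inv v \<in> C \<inter> cen C" "cj u v \<otimes> inv v \<in> derived_set G (carrier G)"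
proof -
  show d: "cj u v \<otimes> inv v \<in> derived_set G (carrier G)" unfolding cj_def using assms Cc by blast
  have "cj u v \<otimes> inv v \<in> C" unfolding cj_def using assms sC by (simp add: subgroup.m_closed subgroup.m_inv_closed)
  then show "cj u v \<otimes> inv v \<in> C \<inter> cen C" unfolding cen_def using class_2[OF d] Cc by blast
qed

lemma nontrivial_commutator: "\<exists>w\<in>C \<inter> cen C. w \<noteq> \<one> \<and> w \<in> derived_set G (carrier G)"
proof -
  obtain u v where uv: "u \<in> C" "v \<in> C" "u \<otimes> v \<noteq> v \<otimes> u" using nonabelian by blast
  have c: "u \<in> carrier G" "v \<in> carrier G" using uv Cc by blast+
  have "cj u v \<otimes> inv v \<noteq> \<one>"
  proof
    assume "cj u v \<otimes> inv v = \<one>"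
    then have "cj u v \<otimes> inv v = v \<otimes> inv v" using c by simp
    then have "cj u v = v" using right_cancel[of "inv v" "cj u v" v] c by simp
    then show False using cj_fix_iff c uv(3) by blast
  qed
  then show ?thesis using commutator_in_center[OF uv(1,2)] by blast
qed

lemma center_prime: "\<exists>p d. prime p \<and> d \<in> C \<inter> cen C \<and> ord d = p"
proof -
  obtain w where w: "w \<in> C" "w \<in> cen C" "w \<noteq> \<one>" using nontrivial_commutator by blast
  obtain n where n: "n > 0" "w [^] (n::nat) = \<one>" using center_exponent w by blast
  have wc: "w \<in> carrier G" using w Cc by blast
  have "ord w dvd n" using pow_eq_id[OF wc] n(2) by blast
  then have o: "ord w \<noteq> 0" using n(1) by (intro notI) simp
  have "ord w \<noteq> 1" using ord_eq_1[OF wc] w(3) by blast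
  then obtain p where p: "prime p" "p dvd ord w" using prime_factor_nat by blast
  have "ord (w [^] (ord w div p)) = p" by (rule prime_power_of_order[OF wc p o])
  moreover have "subgroup (C \<inter> cen C) G" by (intro subgroup_Int sC subgroup_cen subgroup.subset[OF sC])
  then have "w [^] (ord w div p) \<in> C \<inter> cen C" using w by (intro subgroup_pow) auto
  ultimately show ?thesis using p(1) by blast
qed

end

locale centralized_perfect_prime = centralized_perfect +
  fixes p :: nat and d
  assumes prime_p: "prime p" and d: "d \<in> C \<inter> cen C" and ord_d: "ord d = p"
begin

text \<open>An element is \<open>p\<close>-regular if its order is finite and prime to \<open>p\<close>.\<close>

definition regular where "regular x \<longleftrightarrow> (\<exists>k::nat. \<not> p dvd k \<and> x [^] k = \<one>)"

definition kind where "kind x = (if x \<notin> cen C then 2 else if regular x then 0 else 1 :: nat)"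

lemma dc: "d \<in> C" "d \<in> R" "d \<in> carrier G" "d \<noteq> \<one>"
  using d center_in_R Cc ord_d prime_gt_1_nat[OF prime_p] by auto

lemma regular_iso: assumes "\<phi> \<in> iso G G" "x \<in> carrier G" shows "regular (\<phi> x) \<longleftrightarrow> regular x"
proof -
  have "\<phi> x [^] k = \<one> \<longleftrightarrow> x [^] k = \<one>" for k :: nat
    using iso_pow[OF assms, of k] iso_inj[OF assms(1), of "x [^] k" \<one>] iso_one[OF assms(1)] assms(2) by simp
  then show ?thesis unfolding regular_def by simp
qed

lemma kind_iso: "\<forall>\<phi>\<in>iso G G. \<forall>x\<in>carrier G. kind (\<phi> x) = kind x"
  unfolding kind_def using regular_iso iso_mem_cen_C by simp

lemma R_finite_order: assumes "x \<in> R" shows "\<exists>N>0. x [^] (N::nat) = \<one> "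
proof -
  obtain n where n: "n > 0" "\<forall>a\<in>C \<inter> cen C. a [^] (n::nat) = \<one>" using center_exponent by blast
  define k where "k = card (carrier Q)"
  have k: "k > 0" unfolding k_def using finite_Q Q.one_closed by (auto simp: card_gt_0_iff)
  have "\<pi> (x [^] k) = \<one>\<^bsub>Q\<^esub>" unfolding \<pi>_pow[OF assms] k_def by (rule Q.pow_card_subgroup[OF Q.subgroup_self finite_Q \<pi>_in[OF assms]])
  then have "x [^] k \<in> C" using \<pi>_eq_one Rc[OF assms] by simp
  moreover have "x [^] k \<in> R" by (rule subgroup_pow[OF sR assms])
  ultimately have "(x [^] k) [^] n = \<one>" using n(2) center_eq by blast
  then have "x [^] (k * n) = \<one>" using Rc[OF assms] by (simp add: nat_pow_pow)
  then show ?thesis using k n(1) by (intro exI[of _ "k * n"]) simp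
qed

text \<open>A power of \<open>r\<close> whose exponent is divisible by the full power of \<open>p\<close> in the order
  of \<open>r\<close>, and congruent to 1 modulo the order of the image, is \<open>p\<close>-regular and has
  the same image.\<close>

lemma regular_representative:
  assumes r: "r \<in> R" and reg: "\<not> p dvd Q.ord (\<pi> r)" shows "\<exists>r'\<in>R. \<pi> r' = \<pi> r \<and> regular r'"
proof -
  obtain N where N: "N > 0" "r [^] (N::nat) = \<one>" using R_finite_order[OF r] by blast
  obtain m where m: "N = p ^ multiplicity p N * m" "\<not> p dvd m"
    using multiplicity_decompose'[of N p] N(1) prime_p by (metis not_prime_unit less_numeral_extra(3))
  define f where "f = multiplicity p N"
  define k where "k = Q.ord (\<pi> r)"
  have cop: "coprime (p ^ f) k" using prime_imp_coprime[OF prime_p] reg by (simp add: k_def)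
  have pk: "\<pi> r [^]\<^bsub>Q\<^esub> k = \<one>\<^bsub>Q\<^esub>" unfolding k_def using \<pi>_in[OF r] by simp
  have "\<exists>u. \<pi> r [^]\<^bsub>Q\<^esub> (p ^ f * u) = \<pi> r"
  proof (cases "k = 1")
    case True
    then have "\<pi> r = \<one>\<^bsub>Q\<^esub>" using pk \<pi>_in[OF r] by simp
    then show ?thesis by simp
  next
    case False
    then obtain u y where "p ^ f * u = k * y + 1" using coprime_bezout_strong[OF cop] by blast
    then have "\<pi> r [^]\<^bsub>Q\<^esub> (p ^ f * u) = (\<pi> r [^]\<^bsub>Q\<^esub> k) [^]\<^bsub>Q\<^esub> y \<otimes>\<^bsub>Q\<^esub> \<pi> r" using \<pi>_in[OF r] by (simp add: Q.nat_pow_pow)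
    then show ?thesis using pk \<pi>_in[OF r] by auto
  qed
  then obtain u where u: "\<pi> r [^]\<^bsub>Q\<^esub> (p ^ f * u) = \<pi> r" by blast
  let ?r = "r [^] (p ^ f * u)"
  have "?r [^] m = r [^] (p ^ f * u * m)" using Rc[OF r] by (simp add: nat_pow_pow)
  also have "p ^ f * u * m = N * u" using m(1) by (simp add: f_def)
  also have "r [^] (N * u) = (r [^] N) [^] u" using Rc[OF r] by (simp add: nat_pow_pow)
  finally have "regular ?r" unfolding regular_def using N(2) m(2) by auto
  moreover have "\<pi> ?r = \<pi> r" using \<pi>_pow[OF r] u by simp
  ultimately show ?thesis using subgroup_pow[OF sR r] by blast
qed

text \<open>If \<open>r\<close> is \<open>p\<close>-regular, then \<open>r \<otimes> d\<close> is not, since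
  \<open>d\<close> commutes with \<open>r\<close> and has order \<open>p\<close>.\<close>

lemma singular_representative: assumes r: "r \<in> R" shows "\<exists>r'\<in>R. \<pi> r' = \<pi> r \<and> \<not> regular r'"
proof (cases "regular r")
  case True
  have "\<not> regular (r \<otimes> d)"
  proof
    assume "regular (r \<otimes> d)"
    then obtain k l where k: "\<not> p dvd k" "r [^] (k::nat) = \<one>" and l: "\<not> p dvd l" "(r \<otimes> d) [^] (l::nat) = \<one>"
      using True unfolding regular_def by blast
    have "(r \<otimes> d) [^] (k * l) = r [^] (k * l) \<otimes> d [^] (k * l)"
      using Rc[OF r] dc comm_RC[OF r dc(1)] by (intro pow_mult_distrib) auto
    moreover have "r [^] (k * l) = (r [^] k) [^] l" using Rc[OF r] by (simp add: nat_pow_pow)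
    moreover have "(r \<otimes> d) [^] (k * l) = ((r \<otimes> d) [^] l) [^] k" using Rc[OF r] dc by (simp add: nat_pow_pow mult.commute)
    ultimately have "d [^] (k * l) = \<one>" using k(2) l(2) dc by simp
    then have "p dvd k * l" using pow_eq_id[OF dc(3)] ord_d by simp
    then show False using k(1) l(1) prime_dvd_mult_iff[OF prime_p] by blast
  qed
  moreover have "r \<otimes> d \<in> R" using r dc subgroup.m_closed[OF sR] by blast
  ultimately show ?thesis using \<pi>_mult_C[OF Rc[OF r] dc(1)] by blast
qed (use r in blast)

text \<open>The labels with respect to \<open>kind\<close> that certainly occur.\<close>

definition T where "T = automorphism_orbits Q \<times> {1, 2} \<union> (\<lambda>q. {z. Q.aeq q z}) ` {q\<in>carrier Q. \<not> p dvd Q.ord q} \<times> {0 :: nat}"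

lemma T_attained: "\<forall>t\<in>T. \<exists>x\<in>carrier G. \<pi> x \<in> carrier Q \<and> t = ({q. Q.aeq (\<pi> x) q}, kind x)"
proof
  fix t assume "t \<in> T"
  have *: "\<exists>x\<in>carrier G. \<pi> x \<in> carrier Q \<and> t = ({q. Q.aeq (\<pi> x) q}, kind x)"
    if "r \<in> R" "x \<in> carrier G" "\<pi> x = \<pi> r" "kind x = n" "t = ({q. Q.aeq (\<pi> r) q}, n)" for t r x n
    using that \<pi>_in[OF that(1)] by (intro bexI[of _ x]) auto
  consider U where "U \<in> automorphism_orbits Q" "t = (U, 1)" | U where "U \<in> automorphism_orbits Q" "t = (U, 2)"
    | q where "q \<in> carrier Q" "\<not> p dvd Q.ord q" "t = ({z. Q.aeq q z}, 0)"
    using \<open>t \<in> T\<close> unfolding T_def by blast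
  then show "\<exists>x\<in>carrier G. \<pi> x \<in> carrier Q \<and> t = ({q. Q.aeq (\<pi> x) q}, kind x)"
  proof cases
    case (1 U)
    obtain r where r: "r \<in> R" "U = {q. Q.aeq (\<pi> r) q}" using orbits_QE[OF 1(1)] .
    obtain r' where r': "r' \<in> R" "\<pi> r' = \<pi> r" "\<not> regular r'" using singular_representative[OF r(1)] by blast
    have "kind r' = 1" using r' R_cen_C by (auto simp: kind_def)
    then show ?thesis using *[OF r(1) Rc[OF r'(1)] r'(2)] 1 r by blast
  next
    case (2 U)
    obtain r where r: "r \<in> R" "U = {q. Q.aeq (\<pi> r) q}" using orbits_QE[OF 2(1)] .
    obtain c where c: "c \<in> C" "c \<notin> cen C" using nonabelian Cc unfolding cen_def by blast
    have scen: "subgroup (cen C) G" by (rule subgroup_cen[OF subgroup.subset[OF sC]])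
    have "r \<otimes> c \<notin> cen C"
    proof
      assume "r \<otimes> c \<in> cen C"
      moreover have "r \<in> cen C" using r(1) R_cen_C by blast
      ultimately have "inv r \<otimes> (r \<otimes> c) \<in> cen C" using scen by (simp add: subgroup.m_closed subgroup.m_inv_closed)
      then show False using c Rc[OF r(1)] Cc by simp
    qed
    then have "kind (r \<otimes> c) = 2" by (simp add: kind_def)
    then show ?thesis using *[OF r(1) _ \<pi>_mult_C[OF Rc[OF r(1)] c(1)]] Rc[OF r(1)] Cc[OF c(1)] 2 r by blast
  next
    case (3 q)
    obtain r where r: "r \<in> R" "q = \<pi> r" using 3(1) unfolding carrier_Q by blast
    obtain r' where r': "r' \<in> R" "\<pi> r' = \<pi> r" "regular r'" using regular_representative[OF r(1)] 3(2) r(2) by blast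
    have "kind r' = 0" using r' R_cen_C by (auto simp: kind_def)
    then show ?thesis using *[OF r(1) Rc[OF r'(1)] r'(2)] 3 r by blast
  qed
qed

lemma (in -) card_labels:
  assumes "finite U" "finite V" shows "card (U \<times> {1, 2} \<union> V \<times> {0 :: nat}) = 2 * card U + card V"
proof -
  have "card (U \<times> {1, 2} \<union> V \<times> {0 :: nat}) = card (U \<times> {1, 2 :: nat}) + card (V \<times> {0 :: nat})"
  proof (rule card_Un_disjoint)
    show "(U \<times> {1, 2}) \<inter> (V \<times> {0 :: nat}) = {}" unfolding Times_Int_Times by simp
  qed (simp_all add: assms)
  then show ?thesis by (simp add: card_cartesian_product)
qed

lemma card_T: "card T = 2 * card (automorphism_orbits Q) + card ((\<lambda>q. {z. Q.aeq q z}) ` {q\<in>carrier Q. \<not> p dvd Q.ord q})"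
  unfolding T_def by (rule card_labels[OF orbits_Q_finite finite_imageI]) (simp add: finite_Q)

lemma card_T_le: "card T \<le> 11" by (rule label_count(1)[OF kind_iso T_attained])

text \<open>With five or more orbits on \<open>Q\<close>, the identity would be the only \<open>p\<close>-regular
  element of \<open>Q\<close>, which would make \<open>Q\<close> a \<open>p\<close>-group.\<close>

lemma orbits_Q_le_4: "card (automorphism_orbits Q) \<le> 4"
proof (rule ccontr)
  assume n: "\<not> ?thesis"
  let ?S = "(\<lambda>q. {z. Q.aeq q z}) ` {q\<in>carrier Q. \<not> p dvd Q.ord q}"
  have le: "card ?S \<le> 1" using card_T card_T_le n by linarith
  have fS: "finite ?S" using finite_Q by simp
  have ndvd: "\<not> p dvd 1" using prime_p not_prime_unit by blast
  have one: "q = \<one>\<^bsub>Q\<^esub>" if q: "q \<in> carrier Q" "\<not> p dvd Q.ord q" for q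
  proof -
    have "{z. Q.aeq q z} \<in> ?S" "{z. Q.aeq \<one>\<^bsub>Q\<^esub> z} \<in> ?S" using q ndvd by auto
    moreover have "\<forall>a\<in>?S. \<forall>b\<in>?S. a = b" using le unfolding One_nat_def card_le_Suc0_iff_eq[OF fS] .
    ultimately have "{z. Q.aeq q z} = {z. Q.aeq \<one>\<^bsub>Q\<^esub> z}" by (meson bspec)
    then have "Q.aeq q \<one>\<^bsub>Q\<^esub>" using Q.aeq_class_eq[OF q(1)] by blast
    then have "Q.ord \<one>\<^bsub>Q\<^esub> = Q.ord q" using Q.aeq_ord q(1) by blast
    then have "Q.ord q = 1" by simp
    then show ?thesis using Q.ord_eq_1[OF q(1)] by blast
  qed
  have "\<exists>n. card (carrier Q) = p ^ n"
  proof (rule Q.pgroup_card[OF Q.subgroup_self finite_Q prime_p])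
    fix x q assume x: "x \<in> carrier Q" "prime q" "Q.ord x = q"
    show "q = p"
    proof (rule ccontr)
      assume "q \<noteq> p"
      then have "\<not> p dvd Q.ord x" using x prime_p primes_dvd_imp_eq by blast
      then have "x = \<one>\<^bsub>Q\<^esub>" by (rule one[OF x(1)])
      then have "q = 1" using x(3) by simp
      then show False using x(2) not_prime_1 by blast
    qed
  qed
  then obtain n where n: "order Q = p ^ n" unfolding order_def by blast
  have "n \<noteq> 0"
  proof
    assume "n = 0"
    then have "card (carrier Q) = 1" using n by (simp add: order_def)
    then show False using nontrivial_Q Q.one_closed by (metis card_1_singletonE singletonD)
  qed
  then show False using Q.order_prime_power_not_perfect[OF n _ prime_p] perfect_Q by simp
qed

lemmas Q60 = few_orbits_Q[OF orbits_Q_le_4]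

text \<open>The elements of orders 1, 2, 3, 5 other than \<open>p\<close> are \<open>p\<close>-regular, so at least
  three orbits are. Together with two labels for each of the four orbits they give eleven labels; a prime
  \<open>p\<close> other than 2, 3, 5 would give twelve.\<close>

lemma count_exact: "p \<in> {2, 3, 5}" "11 \<le> card T"
proof -
  let ?O = "{q\<in>carrier Q. \<not> p dvd Q.ord q}"
  have sub: "{1, 2, 3, 5} - {p} \<subseteq> Q.ord ` ?O"
  proof
    fix n assume n: "n \<in> {1, 2, 3, 5} - {p}"
    then obtain q where q: "q \<in> carrier Q" "Q.ord q = n" using Q60(4)[of n] by blast
    have "\<not> p dvd n"
    proof
      assume a: "p dvd n"
      have "n = 1 \<or> prime n" using n by auto
      then show False using a n prime_p primes_dvd_imp_eq by (metis DiffD2 insertI1 not_prime_1 nat_dvd_1_iff_1)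
    qed
    then show "n \<in> Q.ord ` ?O" using q by blast
  qed
  then have "card ({1, 2, 3, 5} - {p}) \<le> card (Q.ord ` ?O)" using finite_Q by (intro card_mono) auto
  also have "\<dots> \<le> card ((\<lambda>q. {z. Q.aeq q z}) ` ?O)" by (rule card_ord_classes) blast
  finally have ge: "8 + card ({1, 2, 3, 5} - {p}) \<le> card T" using card_T four_le_orbits_Q by linarith
  have "p \<noteq> 1" using prime_p not_prime_1 by blast
  show p: "p \<in> {2, 3, 5}"
  proof (rule ccontr)
    assume "p \<notin> {2, 3, 5}"
    then have "{1, 2, 3, 5} - {p} = {1, 2, 3, 5}" using \<open>p \<noteq> 1\<close> by blast
    then show False using ge card_T_le by simp
  qed
  have "card ({1, 2, 3, 5} - {p}) = card {1, 2, 3, 5 :: nat} - 1" using p by (intro card_Diff_singleton) auto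
  then show "11 \<le> card T" using ge by simp
qed

lemma same_label:
  assumes "x \<in> carrier G" "y \<in> carrier G" "\<pi> x \<in> carrier Q" "\<pi> x = \<pi> y" "kind x = kind y" shows "aeq x y"
proof (rule label_count(2)[OF kind_iso T_attained count_exact(2) assms(1,2)])
  show "label kind x = label kind y" using assms by (simp add: label_def)
qed

text \<open>An element of the center that is \<open>p\<close>-regular has the label of the identity, hence is the
  identity; the others share one label.\<close>

lemma center_one_orbit: assumes "x \<in> C \<inter> cen C" "x \<noteq> \<one>" "y \<in> C \<inter> cen C" "y \<noteq> \<one>" shows "aeq x y"
proof -
  have pi: "\<pi> z = \<pi> \<one>" if "z \<in> C" for z using \<pi>_eq_one[OF Cc[OF that]] that \<pi>_one by simp
  have oneQ: "\<pi> \<one> \<in> carrier Q" using \<pi>_one by simp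
  have k: "kind z = 1" if z: "z \<in> C \<inter> cen C" "z \<noteq> \<one>" for z
  proof (rule ccontr)
    assume "kind z \<noteq> 1"
    then have "kind z = 0" using z by (simp add: kind_def split: if_splits)
    moreover have "\<one> \<in> cen C" using subgroup.one_closed[OF subgroup_cen[OF subgroup.subset[OF sC]]] .
    moreover have "\<not> p dvd 1" using prime_p not_prime_unit by blast
    then have "regular \<one>" unfolding regular_def by (intro exI[of _ 1]) simp
    ultimately have "aeq \<one> z" using z Cc pi oneQ by (intro same_label) (auto simp: kind_def)
    then have "ord z = 1" using aeq_ord[of \<one> z] by simp
    then show False using z ord_eq_1[of z] Cc by auto
  qed
  show ?thesis using assms Cc pi oneQ k by (intro same_label) auto
qed

lemma center_pow_p: assumes "x \<in> C \<inter> cen C" shows "x [^] p = \<one>"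
proof (cases "x = \<one>")
  case False
  have "aeq d x" using center_one_orbit[OF d dc(4) assms False] .
  then have "ord x = p" using aeq_ord dc(3) ord_d by blast
  then show ?thesis using pow_ord_eq_1[of x] assms Cc by auto
qed simp

lemma sA: "subgroup (C \<inter> cen C) G" by (intro subgroup_Int sC subgroup_cen subgroup.subset[OF sC])

text \<open>The center of \<open>C\<close> has exponent 2, and it is finite because its nontrivial elements are
  commutators. The elements of \<open>C\<close> outside it form one orbit, so either all of them have square
  \<open>\<one>\<close>, and \<open>C\<close> is abelian, or none has. But the squares lie in the center, and
  there are more commuting elements in different cosets of the center than it has elements, so two of them, in
  different cosets, have the same square; their quotient has square \<open>\<one>\<close>.\<close>

lemma p_not_2: "p \<noteq> 2"
proof
  assume p2: "p = 2"
  let ?A = "C \<inter> cen C"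
  have sqA: "x \<otimes> x = \<one>" if "x \<in> ?A" for x using center_pow_p[OF that] p2 that Cc by (simp add: numeral_2_eq_2)
  obtain w where w: "w \<in> ?A" "w \<noteq> \<one>" "w \<in> derived_set G (carrier G)" using nontrivial_commutator by blast
  have "?A \<subseteq> insert \<one> (derived_set G (carrier G))"
  proof
    fix x assume x: "x \<in> ?A"
    show "x \<in> insert \<one> (derived_set G (carrier G))"
    proof (cases "x = \<one>")
      case False
      then obtain \<phi> where \<phi>: "\<phi> \<in> iso G G" "\<phi> w = x" using center_one_orbit[OF w(1,2) x] unfolding aeq_def by blast
      have "x \<in> derived_set G (carrier G)" using iso_derived_set[OF \<phi>(1) w(3)] unfolding \<phi>(2) .
      then show ?thesis by (rule insertI2)
    qed simp
  qed
  then have fA: "finite ?A" using fin_comm finite_subset by blast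
  have sq: "c \<otimes> c \<in> ?A" if c: "c \<in> C" for c
  proof -
    have cc: "c \<in> carrier G" by (rule Cc[OF c])
    have "c \<otimes> c \<in> cen C" unfolding cen_def
    proof (intro CollectI conjI ballI)
      show "c \<otimes> c \<in> carrier G" using cc by simp
      fix x assume x: "x \<in> C"
      have xc: "x \<in> carrier G" by (rule Cc[OF x])
      define k where "k = cj x c \<otimes> inv c"
      have k: "k \<in> ?A" unfolding k_def by (rule commutator_in_center[OF x c])
      have kc: "k \<in> carrier G" using k Cc by blast
      have kcc: "k \<otimes> c = c \<otimes> k" using k c unfolding cen_def by blast
      have cjk: "cj x c = k \<otimes> c" using xc cc by (simp add: k_def m_assoc)
      have "cj x (c \<otimes> c) = (k \<otimes> c) \<otimes> (k \<otimes> c)" using cj_mult[OF xc cc cc] cjk by simp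
      also have "\<dots> = k \<otimes> (c \<otimes> k) \<otimes> c" using kc cc by (simp add: m_assoc)
      also have "\<dots> = k \<otimes> (k \<otimes> c) \<otimes> c" by (simp only: kcc)
      also have "\<dots> = (k \<otimes> k) \<otimes> (c \<otimes> c)" using kc cc by (simp add: m_assoc)
      also have "\<dots> = c \<otimes> c" using sqA[OF k] cc by simp
      finally show "c \<otimes> c \<otimes> x = x \<otimes> (c \<otimes> c)" using cj_fix_iff[of x "c \<otimes> c"] xc cc by simp
    qed
    then show ?thesis using c subgroup.m_closed[OF sC] by blast
  qed
  have nsq: "c \<otimes> c \<noteq> \<one>" if c: "c \<in> C" "c \<notin> cen C" for c
  proof
    assume c1: "c \<otimes> c = \<one>"
    have all: "y \<otimes> y = \<one>" if y: "y \<in> C" for y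
    proof (cases "y \<in> cen C")
      case True then show ?thesis using sqA y by blast
    next
      case False
      have "aeq c y"
      proof (rule same_label)
        show "\<pi> c \<in> carrier Q" "\<pi> c = \<pi> y" using \<pi>_eq_one[OF Cc[OF c(1)]] \<pi>_eq_one[OF Cc[OF y]] c(1) y by simp_all
        show "kind c = kind y" using False c by (simp add: kind_def)
      qed (use c y Cc in auto)
      then obtain \<phi> where \<phi>: "\<phi> \<in> iso G G" "\<phi> c = y" unfolding aeq_def by blast
      then have "y \<otimes> y = \<phi> (c \<otimes> c)" using iso_mult[OF \<phi>(1) Cc[OF c(1)] Cc[OF c(1)]] by simp
      then show ?thesis using c1 iso_one[OF \<phi>(1)] by simp
    qed
    have "u \<otimes> v = v \<otimes> u" if "u \<in> C" "v \<in> C" for u v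
      using exponent_2_commute[of u v] all that Cc subgroup.m_closed[OF sC] by blast
    then show False using nonabelian by blast
  qed
  \<comment> \<open>Centralizers of finite sets have finite index and the center is finite, so arbitrarily many commuting elements can be picked in different cosets of the center.\<close>
  have commuting: "\<exists>S\<subseteq>C. finite S \<and> card S = n \<and> (\<forall>x\<in>S. \<forall>y\<in>S. x \<otimes> y = y \<otimes> x) \<and> (\<forall>x\<in>S. \<forall>y\<in>S. x \<noteq> y \<longrightarrow> x \<otimes> inv y \<notin> ?A)" for n
  proof (induction n)
    case 0 show ?case by (intro exI[of _ "{}"]) simp
  next
    case (Suc n)
    then obtain S where S: "S \<subseteq> C" "finite S" "card S = n" "\<forall>x\<in>S. \<forall>y\<in>S. x \<otimes> y = y \<otimes> x" "\<forall>x\<in>S. \<forall>y\<in>S. x \<noteq> y \<longrightarrow> x \<otimes> inv y \<notin> ?A"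
      by blast
    have Sc: "S \<subseteq> carrier G" using S(1) Cc by blast
    have sS: "subgroup (cen S) G" by (rule subgroup_cen[OF Sc])
    have si: "subgroup (C \<inter> cen S) G" by (intro subgroup_Int sC sS)
    have "finite (rcosets (C \<inter> cen S))" by (intro finite_index_Int sC sS fin_index fc_cen_finite_index has_fc S(2) Sc)
    then have inf: "infinite (C \<inter> cen S)" using finite_subgroup_finite_index[OF si] infinite_G by blast
    let ?B = "(\<lambda>(a, y). a \<otimes> y) ` (?A \<times> S)"
    have "finite ?B" using fA S(2) by simp
    then have "\<not> C \<inter> cen S \<subseteq> ?B" using inf finite_subset by blast
    then obtain x where x: "x \<in> C" "x \<in> cen S" "x \<notin> ?B" by blast
    have xc: "x \<in> carrier G" by (rule Cc[OF x(1)])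
    have new: "x \<otimes> inv y \<notin> ?A" if y: "y \<in> S" for y
    proof
      assume a: "x \<otimes> inv y \<in> ?A"
      have "x = (x \<otimes> inv y) \<otimes> y" using xc y Sc by (auto simp: m_assoc)
      then have "x \<in> ?B" using a y by force
      then show False using x(3) by simp
    qed
    have new': "y \<otimes> inv x \<notin> ?A" if y: "y \<in> S" for y
    proof
      assume a: "y \<otimes> inv x \<in> ?A"
      have yc: "y \<in> carrier G" using y Sc by blast
      have "inv (y \<otimes> inv x) \<in> ?A" using a subgroup.m_inv_closed[OF sA] by blast
      then show False using new[OF y] xc yc by (simp add: inv_mult_group)
    qed
    have xS: "x \<notin> S" using new[of x] subgroup.one_closed[OF sA] xc by auto
    have comm: "x \<otimes> y = y \<otimes> x" if "y \<in> S" for y using x(2) that unfolding cen_def by blast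
    show ?case
    proof (intro exI[of _ "insert x S"] conjI ballI impI)
      show "insert x S \<subseteq> C" "finite (insert x S)" "card (insert x S) = Suc n" using S(1-3) x(1) xS by auto
      fix y z assume yz: "y \<in> insert x S" "z \<in> insert x S"
      show "y \<otimes> z = z \<otimes> y" using yz comm S(4) by auto
      assume ne: "y \<noteq> z"
      show "y \<otimes> inv z \<notin> ?A"
      proof (cases "y = x")
        case True
        then have "z \<in> S" using yz ne by simp
        then show ?thesis using new True by simp
      next
        case False
        then have yS: "y \<in> S" using yz by simp
        show ?thesis
        proof (cases "z = x")
          case True then show ?thesis using new'[OF yS] by simp
        next
          case False
          then have "z \<in> S" using yz by simp
          then show ?thesis using S(5) yS ne by blast
        qed
      qed
    qed
  qed
  obtain S where S: "S \<subseteq> C" "finite S" "card S = Suc (card ?A)" "\<forall>x\<in>S. \<forall>y\<in>S. x \<otimes> y = y \<otimes> x"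
    "\<forall>x\<in>S. \<forall>y\<in>S. x \<noteq> y \<longrightarrow> x \<otimes> inv y \<notin> ?A" using commuting[of "Suc (card ?A)"] by (elim exE conjE) (rule that; assumption)
  have "\<not> inj_on (\<lambda>x. x \<otimes> x) S"
  proof
    assume "inj_on (\<lambda>x. x \<otimes> x) S"
    moreover have "(\<lambda>x. x \<otimes> x) ` S \<subseteq> ?A" using sq S(1) by blast
    ultimately have "card S \<le> card ?A" using fA by (rule card_inj_on_le)
    then show False using S(3) by simp
  qed
  then obtain x y where xy: "x \<in> S" "y \<in> S" "x \<otimes> x = y \<otimes> y" "x \<noteq> y" unfolding inj_on_def by blast
  have c: "x \<in> carrier G" "y \<in> carrier G" using xy S(1) Cc by blast+
  have e: "x \<otimes> inv y \<in> C" using xy S(1) sC by (auto intro!: subgroup.m_closed subgroup.m_inv_closed)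
  then have ne: "(x \<otimes> inv y) \<otimes> (x \<otimes> inv y) \<noteq> \<one>" using nsq S(5) xy by blast
  have com: "x \<otimes> y = y \<otimes> x" using S(4) xy by blast
  have "inv y \<otimes> x = x \<otimes> inv y"
  proof -
    have "inv y \<otimes> (x \<otimes> y) \<otimes> inv y = inv y \<otimes> (y \<otimes> x) \<otimes> inv y" by (simp only: com)
    then show ?thesis using c by (simp add: m_assoc)
  qed
  then have "(x \<otimes> inv y) \<otimes> (x \<otimes> inv y) = (x \<otimes> x) \<otimes> (inv y \<otimes> inv y)" using c by (metis inv_closed m_assoc m_closed)
  also have "\<dots> = \<one>" using xy(3) c by (simp add: m_assoc)
  finally show False using ne by simp
qed

text \<open>Let \<open>g\<close> in \<open>R\<close> have an image of order \<open>p\<close>. It can be chosen such that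
  some \<open>t\<close> in \<open>R\<close> conjugates it exactly to its inverse. The elements of
  \<open>R\<close> inverting the image of \<open>g\<close> then all conjugate \<open>g\<close> to its inverse,
  because the centralizer of the image is generated by the image. But \<open>g\<close> and
  \<open>g \<otimes> d\<close> have the same label, and an automorphism moving \<open>g\<close> to
  \<open>g \<otimes> d\<close> moves \<open>t\<close> to an element \<open>v\<close> that inverts
  \<open>g\<close> as well as \<open>g \<otimes> d\<close>. So \<open>v\<close> inverts \<open>d\<close>; but
  \<open>v\<close> commutes with \<open>d\<close>, whose order is odd.\<close>

theorem contradiction: False
proof -
  have p35: "p \<in> {3, 5}" using count_exact(1) p_not_2 by blast
  let ?A = "C \<inter> cen C"
  obtain q where q: "q \<in> carrier Q" "Q.ord q = p" using Q60(4)[of p] p35 by blast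
  then have cq: "card (Q.cen {q}) = p" "\<exists>t\<in>carrier Q. Q.cj t q = inv\<^bsub>Q\<^esub> q" using Q60(3)[of q] p35 by auto
  obtain g0 where g0: "g0 \<in> R" "q = \<pi> g0" using q unfolding carrier_Q by blast
  obtain t where t: "t \<in> R" "Q.cj (\<pi> t) q = inv\<^bsub>Q\<^esub> q" using cq(2) unfolding carrier_Q by blast
  have tc: "t \<in> carrier G" and g0c: "g0 \<in> carrier G" using t(1) g0(1) Rc by blast+
  have Acomm: "r \<otimes> a = a \<otimes> r" if "r \<in> R" "a \<in> ?A" for r a using comm_RC that by blast
  have Ac: "a \<in> carrier G" if "a \<in> ?A" for a using that Cc by blast
  have cjR: "cj x y \<in> R" if "x \<in> R" "y \<in> R" for x y
    unfolding cj_def using that sR by (simp add: subgroup.m_closed subgroup.m_inv_closed)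
  have cjA: "cj r a = a" if "r \<in> R" "a \<in> ?A" for r a using cj_fix_iff[OF Rc Ac] Acomm that by blast
  define a where "a = g0 \<otimes> cj t g0"
  have "\<pi> (cj t g0) = \<pi> (inv g0)" using t(2) \<pi>_cj[OF t(1) g0(1)] \<pi>_inv[OF g0(1)] g0(2) by simp
  then have "\<pi> a = \<one>\<^bsub>Q\<^esub>" unfolding a_def using \<pi>_mult[OF g0c, of "cj t g0"] \<pi>_mult[OF g0c, of "inv g0"] tc g0c by (simp add: \<pi>_one)
  then have "a \<in> C" using \<pi>_eq_one[of a] tc g0c by (simp add: a_def)
  moreover have "a \<in> R" unfolding a_def using g0(1) cjR[OF t(1) g0(1)] subgroup.m_closed[OF sR] by blast
  ultimately have a: "a \<in> ?A" using center_eq by blast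
  have cja: "cj t g0 = inv g0 \<otimes> a" unfolding a_def using tc g0c by simp
  \<comment> \<open>Multiplying \<open>g0\<close> by a square root of \<open>inv a\<close> makes \<open>t\<close> invert it exactly.\<close>
  define b where "b = a [^] ((p - 1) div 2)"
  have b: "b \<in> ?A" unfolding b_def by (rule subgroup_pow[OF sA a])
  have bc: "b \<in> carrier G" and ac: "a \<in> carrier G" using a b Ac by blast+
  have "b \<otimes> b \<otimes> a = a [^] ((p - 1) div 2 + (p - 1) div 2 + 1)" unfolding b_def using ac by (simp add: nat_pow_mult)
  also have "(p - 1) div 2 + (p - 1) div 2 + 1 = p" using p35 by auto
  finally have bba: "b \<otimes> b \<otimes> a = \<one>" using center_pow_p[OF a] by simp
  define g where "g = g0 \<otimes> b"
  have gR: "g \<in> R" unfolding g_def using g0(1) b center_in_R subgroup.m_closed[OF sR] by blast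
  have gc: "g \<in> carrier G" by (rule Rc[OF gR])
  have \<pi>g: "\<pi> g = q" unfolding g_def using \<pi>_mult_C[OF g0c] b g0(2) by simp
  have cjtg: "cj t g = inv g"
  proof -
    have "cj t g = inv g0 \<otimes> a \<otimes> b" unfolding g_def using cj_mult[OF tc g0c bc] cja cjA[OF t(1) b] by simp
    moreover have "a \<otimes> b = inv b"
    proof -
      have "a \<otimes> b \<otimes> b = \<one>" using bba ac bc Acomm[OF _ a, of "b \<otimes> b"] b center_in_R subgroup.m_closed[OF sR] by (metis m_assoc m_closed subsetD)
      then show ?thesis using inv_equality[of "a \<otimes> b" b] ac bc by simp
    qed
    moreover have "inv g = inv g0 \<otimes> inv b"
    proof -
      have "g = b \<otimes> g0" unfolding g_def using Acomm[OF g0(1) b] by simp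
      then show ?thesis using g0c bc by (simp add: inv_mult_group)
    qed
    ultimately show ?thesis using g0c ac bc by (simp add: m_assoc)
  qed
  \<comment> \<open>The centralizer of the image of \<open>g\<close> is generated by that image, so it lifts to elements commuting with \<open>g\<close>.\<close>
  have lift: "cj u g = g" if u: "u \<in> R" "\<pi> u \<in> Q.cen {q}" for u
  proof -
    note gs = Q.generate_singleton[OF q(1)]
    have scq: "subgroup (Q.cen {q}) Q" by (rule Q.subgroup_cen) (use q in simp)
    have "q \<in> Q.cen {q}" unfolding Q.cen_def using q by simp
    then have sub: "generate Q {q} \<subseteq> Q.cen {q}" by (intro Q.generate_subgroup_incl scq) simp
    have "finite (Q.cen {q})" using finite_Q Q.cen_sub finite_subset by metis
    then have gen: "generate Q {q} = Q.cen {q}" using sub gs(3) q(2) cq(1) by (intro card_subset_eq) auto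
    let ?L = "R \<inter> cen {g}"
    have sL: "subgroup ?L G" by (intro subgroup_Int sR subgroup_cen) (use gc in simp)
    have "subgroup (\<pi> ` ?L) Q"
    proof (rule Q.subgroupI)
      show "\<pi> ` ?L \<subseteq> carrier Q" using \<pi>_in by blast
      show "\<pi> ` ?L \<noteq> {}" using subgroup.one_closed[OF sL] by blast
      fix x assume "x \<in> \<pi> ` ?L"
      then obtain x' where x': "x' \<in> ?L" "x = \<pi> x'" by blast
      then show "inv\<^bsub>Q\<^esub> x \<in> \<pi> ` ?L" using \<pi>_inv[of x'] subgroup.m_inv_closed[OF sL] by auto
      fix y assume "y \<in> \<pi> ` ?L"
      then obtain y' where y': "y' \<in> ?L" "y = \<pi> y'" by blast
      then have "x \<otimes>\<^bsub>Q\<^esub> y = \<pi> (x' \<otimes> y')" using \<pi>_mult[of x' y'] x' Rc by auto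
      then show "x \<otimes>\<^bsub>Q\<^esub> y \<in> \<pi> ` ?L" using subgroup.m_closed[OF sL] x' y' by blast
    qed
    moreover have "q \<in> \<pi> ` ?L"
    proof -
      have "g \<in> ?L" using gR gc unfolding cen_def by simp
      then show ?thesis using \<pi>g by blast
    qed
    ultimately have "generate Q {q} \<subseteq> \<pi> ` ?L" by (intro Q.generate_subgroup_incl) auto
    then obtain l where l: "l \<in> R" "l \<in> cen {g}" "\<pi> u = \<pi> l" using u(2) gen by blast
    have uc: "u \<in> carrier G" and lc: "l \<in> carrier G" using u l Rc by blast+
    have "u \<otimes> inv l \<in> C" using \<pi>_eq_iff[OF uc lc] l(3) by simp
    moreover have "u \<otimes> inv l \<in> R" using u(1) l(1) sR by (simp add: subgroup.m_closed subgroup.m_inv_closed)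
    ultimately have z: "u \<otimes> inv l \<in> ?A" using center_eq by blast
    have "cj l g = g" using l(2) cj_fix_iff[OF lc gc] unfolding cen_def by blast
    moreover have "cj (u \<otimes> inv l) g = g" using cj_fix_iff[OF Ac[OF z] gc] Acomm[OF gR z] by simp
    moreover have "cj u g = cj (u \<otimes> inv l) (cj l g)" using uc lc gc by (simp add: cj_cj m_assoc)
    ultimately show ?thesis by simp
  qed
  have sing: "kind x = 1" if x: "x \<in> R" "\<pi> x = q" for x
  proof -
    have "\<not> regular x"
    proof
      assume "regular x"
      then obtain k where k: "\<not> p dvd k" "x [^] (k::nat) = \<one>" unfolding regular_def by blast
      have "q [^]\<^bsub>Q\<^esub> k = \<one>\<^bsub>Q\<^esub>" using \<pi>_pow[OF x(1), of k] k(2) x(2) \<pi>_one by simp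
      then show False using Q.pow_eq_id[OF q(1)] q(2) k(1) by blast
    qed
    then show ?thesis using x(1) R_cen_C by (auto simp: kind_def)
  qed
  have gdR: "g \<otimes> d \<in> R" using gR dc subgroup.m_closed[OF sR] by blast
  have \<pi>gd: "\<pi> (g \<otimes> d) = q" using \<pi>_mult_C[OF gc dc(1)] \<pi>g by simp
  have "aeq g (g \<otimes> d)" using gc Rc[OF gdR] q(1) \<pi>g \<pi>gd sing gR gdR by (intro same_label) auto
  then obtain \<alpha> where \<alpha>: "\<alpha> \<in> iso G G" "\<alpha> g = g \<otimes> d" unfolding aeq_def by blast
  define v where "v = \<alpha> t"
  have vR: "v \<in> R" unfolding v_def using iso_R[OF \<alpha>(1)] t(1) by blast
  have vc: "v \<in> carrier G" by (rule Rc[OF vR])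
  interpret f: group_hom G G \<alpha> by (rule iso_hom[OF \<alpha>(1)])
  have cv: "cj v (g \<otimes> d) = inv (g \<otimes> d)"
  proof -
    have "cj v (g \<otimes> d) = \<alpha> (cj t g)" using iso_cj[OF \<alpha>(1) tc gc] \<alpha>(2) by (simp add: v_def)
    then show ?thesis using cjtg gc \<alpha>(2) by simp
  qed
  have dA: "d \<in> ?A" by (rule d)
  have invd: "inv (g \<otimes> d) = inv g \<otimes> inv d"
    using Acomm[OF gR dA] gc dc(3) by (metis inv_mult_group)
  have "cj v (g \<otimes> d) = cj v g \<otimes> d" using cj_mult[OF vc gc dc(3)] cjA[OF vR dA] by simp
  then have cvg: "cj v g \<otimes> d = inv g \<otimes> inv d" using cv invd by simp
  have "cj v g = inv g"
  proof -
    let ?u = "inv t \<otimes> v"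
    have uR: "?u \<in> R" using t(1) vR sR by (simp add: subgroup.m_closed subgroup.m_inv_closed)
    have uc: "?u \<in> carrier G" by (rule Rc[OF uR])
    have "\<pi> (cj v g) = \<pi> (inv g)"
    proof -
      have "\<pi> (cj v g \<otimes> d) = \<pi> (cj v g)" using \<pi>_mult_C[OF _ dc(1)] vc gc by simp
      moreover have "inv d \<in> C" using dc(1) subgroup.m_inv_closed[OF sC] by blast
      then have "\<pi> (inv g \<otimes> inv d) = \<pi> (inv g)" using \<pi>_mult_C gc by simp
      ultimately show ?thesis using cvg by simp
    qed
    then have "\<pi> (cj v g) = \<pi> (cj t g)" using cjtg by simp
    then have e: "Q.cj (\<pi> v) q = Q.cj (\<pi> t) q" using \<pi>_cj[OF vR gR] \<pi>_cj[OF t(1) gR] \<pi>g by simp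
    have it: "\<pi> (inv t) \<in> carrier Q" using \<pi>_in subgroup.m_inv_closed[OF sR t(1)] by blast
    have "Q.cj (\<pi> ?u) q = Q.cj (\<pi> (inv t) \<otimes>\<^bsub>Q\<^esub> \<pi> v) q" using \<pi>_mult[of "inv t" v] tc vc by simp
    also have "\<dots> = Q.cj (\<pi> (inv t)) (Q.cj (\<pi> v) q)" by (rule Q.cj_cj[symmetric, OF it \<pi>_in[OF vR] q(1)])
    also have "\<dots> = Q.cj (inv\<^bsub>Q\<^esub> (\<pi> t)) (Q.cj (\<pi> v) q)" using \<pi>_inv[OF t(1)] by simp
    also have "\<dots> = q" unfolding e using \<pi>_in[OF t(1)] q(1) by simp
    finally have "\<pi> ?u \<in> Q.cen {q}" using Q.cen_iff[of "\<pi> ?u" "{q}"] \<pi>_in[OF uR] q(1) by simp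
    then have "cj ?u g = g" by (rule lift[OF uR])
    then have "cj t (cj ?u g) = inv g" using cjtg by simp
    then show ?thesis using tc uc vc gc by (simp add: cj_cj)
  qed
  then have "inv g \<otimes> d = inv g \<otimes> inv d" using cvg by simp
  then have "d = inv d" using gc dc(3) by simp
  then have "d \<otimes> d = \<one>" using dc(3) by (metis r_inv)
  then have "d [^] (2::nat) = \<one>" using dc(3) by (simp add: numeral_2_eq_2)
  then have "p dvd 2" using pow_eq_id[OF dc(3), of 2] ord_d by simp
  then have "p \<le> 2" by (rule dvd_imp_le) simp
  then show False using p35 by auto
qed

end

context centralized_perfect begin

theorem contradiction: False
proof -
  obtain p d where "prime p" "d \<in> C \<inter> cen C" "ord d = p" using center_prime by blast
  then interpret centralized_perfect_prime G R C p d by unfold_locales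
  show False by (rule contradiction)
qed

end

text \<open>It remains to verify the hypotheses on the centralizer of the commutators and on the last term of the
  derived series.\<close>

theorem (in group) FC_few_orbits_central_by_finite:
  assumes "FC_group G" "infinite (carrier G)" "\<not> solvable G"
    and "finite (automorphism_orbits G)" "card (automorphism_orbits G) \<le> 11"
  shows "central_by_finite G"
proof (rule ccontr)
  assume not_cbf: "\<not> central_by_finite G"
  have fc: fc
    unfolding fc_def
  proof
    fix x assume "x \<in> carrier G"
    moreover have "conjugates G x = (\<lambda>g. cj g x) ` carrier G" unfolding conjugates_def cj_def by blast
    ultimately show "finite ((\<lambda>g. cj g x) ` carrier G)" using assms(1) unfolding FC_group_def by metis
  qed
  let ?K = "derived_set G (carrier G)"
  have fK: "finite ?K" by (rule finite_commutators[OF fc assms(4)])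
  have Kc: "?K \<subseteq> carrier G" by (rule derived_set_in_carrier) simp
  define C where "C = cen ?K"
  have sC: "subgroup C G" unfolding C_def by (rule subgroup_cen[OF Kc])
  have fC: "finite (rcosets C)" unfolding C_def by (rule fc_cen_finite_index[OF fc fK Kc])
  obtain n where n: "derived G ((derived G ^^ Suc n) (carrier G)) = (derived G ^^ Suc n) (carrier G)"
    using derived_series_stabilizes[OF fK] by blast
  define R where "R = (derived G ^^ Suc n) (carrier G)"
  have sR: "subgroup R G" unfolding R_def by (rule exp_of_derived_is_subgroup[OF subgroup_self])
  have pR: "derived G R = R" using n by (simp add: R_def)
  have comm: "x \<otimes> c = c \<otimes> x" if "x \<in> ?K" "c \<in> C" for x c
    by (rule cenD[OF that(2)[unfolded C_def] that(1), symmetric])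
  have "R = derived G ((derived G ^^ n) (carrier G))" by (simp add: R_def)
  then have "R \<subseteq> generate G ?K"
    using mono_derived[OF exp_of_derived_in_carrier[OF subset_refl], of n] by (simp add: derived_def)
  also have "\<dots> \<subseteq> cen C" using comm Kc by (intro generate_subgroup_incl subgroup_cen subgroup.subset[OF sC]) (auto simp: cen_def)
  finally have RC: "R \<subseteq> cen C" .
  have comm_RC: "r \<otimes> c = c \<otimes> r" if "r \<in> R" "c \<in> C" for r c
  proof -
    have "r \<in> cen C" using that RC by blast
    then show ?thesis using that(2) unfolding cen_def by blast
  qed
  have not_sub: "\<not> R \<subseteq> C"
  proof
    assume "R \<subseteq> C"
    then have ab: "u \<otimes> v = v \<otimes> u" if "u \<in> R" "v \<in> R" for u v using comm_RC that by blast
    have "derived_set G R \<subseteq> {\<one>}"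
    proof
      fix x assume "x \<in> derived_set G R"
      then obtain u v where uv: "u \<in> R" "v \<in> R" "x = u \<otimes> v \<otimes> inv u \<otimes> inv v" by blast
      have c: "u \<in> carrier G" "v \<in> carrier G" using uv subgroup.mem_carrier[OF sR] by blast+
      have "x = v \<otimes> u \<otimes> inv u \<otimes> inv v" using uv(3) ab[OF uv(1,2)] by simp
      then show "x \<in> {\<one>}" using c by (simp add: m_assoc)
    qed
    then have "derived G R \<subseteq> {\<one>}" unfolding derived_def using triv_subgroup generate_subgroup_incl by blast
    then have "R = {\<one>}" using pR subgroup.one_closed[OF sR] by blast
    then have "(derived G ^^ Suc n) (carrier G) = {\<one>}" by (simp only: R_def)
    then have "solvable_seq G (carrier G)" by (rule trivial_derived_seq_imp_solvable[OF subgroup_self])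
    then show False using assms(3) unfolding solvable_def by simp
  qed
  have nonab: "\<exists>u\<in>C. \<exists>v\<in>C. u \<otimes> v \<noteq> v \<otimes> u"
  proof (rule ccontr)
    assume "\<not> ?thesis"
    then have "finite (rcosets (center G))" by (intro abelian_finite_index_center[OF fc sC fC]) blast
    then show False using not_cbf is_group by (simp add: central_by_finite_def)
  qed
  interpret centralized_perfect G R C
  proof (intro centralized_perfect.intro centralized_perfect_axioms.intro)
    fix \<phi> assume \<phi>: "\<phi> \<in> iso G G"
    interpret f: group_hom G G \<phi> by (rule iso_hom[OF \<phi>])
    have "\<phi> ` carrier G = carrier G" using iso_bij[OF \<phi>] by (simp add: bij_betw_def)
    then show "\<phi> ` R = R" unfolding R_def using f.exp_of_derived_img[OF subset_refl, of "Suc n"] by simp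
    show "\<phi> ` C = C" unfolding C_def using iso_cen[OF \<phi> Kc] iso_derived_set_image[OF \<phi>] by simp
  qed (fact is_group sR sC pR comm_RC not_sub fC fK comm nonab fc assms(2,4,5))+
  show False by (rule contradiction)
qed

theorem theoremC:
  fixes G :: "('a, 'b) monoid_scheme"
  assumes "FC_group G"
    and "infinite (carrier G)"
    and "\<not> solvable G"
    and "finite (automorphism_orbits G)"
    and "card (automorphism_orbits G) \<le> 11"
  shows "central_by_finite G"
proof -
  interpret group G using assms(1) by (simp add: FC_group_def)
  show ?thesis by (rule FC_few_orbits_central_by_finite[OF assms])
qed

end
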